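(* There is an equivalence of fibrations over $\mathbf{CompCat}$ $$\int^{\mathcal C\in\mathbf{CompCat}}\mathbf{Lax}(\mathcal C,\mathbf{Set})\;\simeq\;\mathbf{CompCat}^{\mathrm{bo}}$$ and an equivalence of fibrations over $\mathbf{TrCat}$ $$\int^{\mathcal T\in\mathbf{TrCat}}\mathbf{Lax}(\mathrm{Int}(\mathcal T),\mathbf{Set})\;\simeq\;\mathbf{TrCat}^{\mathrm{bo}},$$ where the left-hand sides are Grothendieck constructions with their canonical projections, and the right-hand sides are fibered by the domain functors $\mathrm{dom}\colon\mathbf{CompCat}^{\mathrm{bo}}\to\mathbf{CompCat}$ and $\mathrm{dom}\colon\mathbf{TrCat}^{\mathrm{bo}}\to\mathbf{TrCat}$.
   Context: Conventions: "monoidal category" means strict symmetric monoidal category, and all monoidal functors (strict, strong, lax) are symmetric; $\mathbf{Set}$ is cartesian monoidal. $\mathbf{Lax}(\mathcal M,\mathbf{Set})$ is the category of lax monoidal functors and monoidal natural transformations. A compact category is a monoidal category in which every object has a dual; $\mathbf{CompCat}$ is the category of compact categories and strict monoidal functors. A traced category is a monoidal category with a trace $\mathrm{Tr}^U_{X,Y}\colon\mathrm{Hom}(U\otimes X,U\otimes Y)\to\mathrm{Hom}(X,Y)$ in the sense of Joyal–Street–Verity; $\mathbf{TrCat}$ is the category of traced categories and strict monoidal functors commuting with the trace. $\mathrm{Int}(\mathcal T)$ is the Joyal–Street–Verity compact category with objects pairs $(X^-,X^+)$ of objects of $\mathcal T$, componentwise tensor, and $$\mathrm{Hom}((X^-,X^+),(Y^-,Y^+))=\mathrm{Hom}_{\mathcal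 T}(X^-\otimes Y^+,X^+\otimes Y^-).$$ The composite of $f\colon X^-\otimes Y^+\to X^+\otimes Y^-$ and $g\colon Y^-\otimes Z^+\to Y^+\otimes Z^-$ is the trace over $Y^+$ of the evident composite (up to symmetries) $X^-\otimes Y^+\otimes Z^+\to X^+\otimes Y^-\otimes Z^+\to X^+\otimes Y^+\otimes Z^-$. $\mathrm{Int}$ is a functor $\mathbf{TrCat}\to\mathbf{CompCat}$, acting componentwise on objects. The Grothendieck construction $\int^{\mathcal C}\mathbf{Lax}(\mathcal C,\mathbf{Set})$ has objects $(\mathcal C,P)$ with $P\colon\mathcal C\to\mathbf{Set}$ lax monoidal. A morphism $(\mathcal C,P)\to(\mathcal C',P')$ is a strict monoidal functor $G\colon\mathcal C\to\mathcal C'$ with a monoidal transformation $P\to P'\circ G$. The traced case is analogous, with $\mathrm{Int}(\mathcal T)$ and $\mathrm{Int}(G)$ in place of $\mathcal C$ and $G$. $\mathbf{CompCat}^{\mathrm{bo}}$ (resp. $\mathbf{TrCat}^{\mathrm{bo}}$) is the full subcategory of the arrow category of $\mathbf{CompCat}$ (resp. $\mathbf{TrCat}$) on the bijective-on-objects functors; $\mathrm{dom}$ sends an arrow to its domain. An equivalence of fibrations is an equivalence of categories commuting with the projections to the base and preserving cartesian morphisms. *)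

theory Defs
  imports "HOL-Library.FuncSet"
begin

section \<open>Categories, functors, natural isomorphisms\<close>

text \<open>
  Structure maps are extensional (they equal \<open>undefined\<close> off their carriers), so that equality of
  categories and of functors is equality of HOL terms. The composite \<open>g \<cdot> f\<close> is "\<open>f\<close>, then \<open>g\<close>".
\<close>

record ('o, 'a) cat =
  Obj :: "'o set"
  Arr :: "'a set"
  Dom :: "'a \<Rightarrow> 'o"
  Cod :: "'a \<Rightarrow> 'o"
  ide :: "'o \<Rightarrow> 'a"
  Comp :: "'a \<Rightarrow> 'a \<Rightarrow> 'a" (infixr "\<cdot>\<index>" 65)

definition hom :: "('o, 'a, 'm) cat_scheme \<Rightarrow> 'o \<Rightarrow> 'o \<Rightarrow> 'a set" where
  "hom C X Y = {f \<in> Arr C. Dom C f = X \<and> Cod C f = Y}"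

locale category =
  fixes C :: "('o, 'a, 'm) cat_scheme" (structure)
  assumes Dom_closed: "Dom C \<in> Arr C \<rightarrow>\<^sub>E Obj C"
    and Cod_closed: "Cod C \<in> Arr C \<rightarrow>\<^sub>E Obj C"
    and ide_closed: "ide C \<in> (\<Pi>\<^sub>E X\<in>Obj C. hom C X X)"
    and Comp_closed:
      "Comp C \<in> (\<Pi>\<^sub>E g\<in>Arr C. \<Pi>\<^sub>E f\<in>{f \<in> Arr C. Cod C f = Dom C g}. hom C (Dom C f) (Cod C g))"
    and Comp_ide_left: "f \<in> hom C X Y \<Longrightarrow> ide C Y \<cdot> f = f"
    and Comp_ide_right: "f \<in> hom C X Y \<Longrightarrow> f \<cdot> ide C X = f"
    and Comp_assoc: "\<lbrakk>f \<in> hom C W X; g \<in> hom C X Y; h \<in> hom C Y Z\<rbrakk> \<Longrightarrow> h \<cdot> (g \<cdot> f) = (h \<cdot> g) \<cdot> f"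

text \<open>
  The category with objects \<open>Ob\<close>, hom-sets \<open>H X Y\<close>, identities \<open>i X\<close> and composition
  \<open>c X Y Z g f\<close>. Arrows are tagged with source and target, because the sets \<open>H X Y\<close> may overlap.
\<close>

definition cat_of_homs ::
  "'o set \<Rightarrow> ('o \<Rightarrow> 'o \<Rightarrow> 'h set) \<Rightarrow> ('o \<Rightarrow> 'h) \<Rightarrow> ('o \<Rightarrow> 'o \<Rightarrow> 'o \<Rightarrow> 'h \<Rightarrow> 'h \<Rightarrow> 'h)
    \<Rightarrow> ('o, 'o \<times> 'h \<times> 'o) cat" where
  "cat_of_homs Ob H i c =
    (let A = {(X, f, Y). X \<in> Ob \<and> Y \<in> Ob \<and> f \<in> H X Y} in
     \<lparr> Obj = Ob,
       Arr = A,
       Dom = (\<lambda>(X, f, Y)\<in>A. X),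
       Cod = (\<lambda>(X, f, Y)\<in>A. Y),
       ide = (\<lambda>X\<in>Ob. (X, i X, X)),
       Comp = (\<lambda>u\<in>A. \<lambda>v\<in>{v \<in> A. snd (snd v) = fst u}.
                 (case (u, v) of ((Y, g, Z), (X, f, _)) \<Rightarrow> (X, c X Y Z g f, Z))) \<rparr>)"

record ('o, 'a, 'p, 'b) func =
  omap :: "'o \<Rightarrow> 'p"
  amap :: "'a \<Rightarrow> 'b"

definition is_functor ::
  "('o, 'a, 'm) cat_scheme \<Rightarrow> ('p, 'b, 'n) cat_scheme \<Rightarrow> ('o, 'a, 'p, 'b) func \<Rightarrow> bool" where
  "is_functor C D F \<longleftrightarrow>
     omap F \<in> Obj C \<rightarrow>\<^sub>E Obj D \<and>
     amap F \<in> Arr C \<rightarrow>\<^sub>E Arr D \<and>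
     (\<forall>X\<in>Obj C. \<forall>Y\<in>Obj C. \<forall>f\<in>hom C X Y. amap F f \<in> hom D (omap F X) (omap F Y)) \<and>
     (\<forall>X\<in>Obj C. amap F (ide C X) = ide D (omap F X)) \<and>
     (\<forall>g\<in>Arr C. \<forall>f\<in>Arr C. Cod C f = Dom C g \<longrightarrow>
        amap F (g \<cdot>\<^bsub>C\<^esub> f) = amap F g \<cdot>\<^bsub>D\<^esub> amap F f)"

definition func_id :: "('o, 'a, 'm) cat_scheme \<Rightarrow> ('o, 'a, 'o, 'a) func" where
  "func_id C = \<lparr> omap = (\<lambda>X\<in>Obj C. X), amap = (\<lambda>f\<in>Arr C. f) \<rparr>"

text \<open>\<open>C\<close> is the domain of the functor \<open>F\<close> that is applied first.\<close>

definition func_comp ::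
  "('o, 'a, 'm) cat_scheme \<Rightarrow> ('p, 'b, 'q, 'c) func \<Rightarrow> ('o, 'a, 'p, 'b) func
    \<Rightarrow> ('o, 'a, 'q, 'c) func" where
  "func_comp C G F =
    \<lparr> omap = compose (Obj C) (omap G) (omap F), amap = compose (Arr C) (amap G) (amap F) \<rparr>"

definition iso_arrow :: "('o, 'a, 'm) cat_scheme \<Rightarrow> 'a \<Rightarrow> bool" where
  "iso_arrow C f \<longleftrightarrow> f \<in> Arr C \<and>
     (\<exists>g\<in>hom C (Cod C f) (Dom C f).
        g \<cdot>\<^bsub>C\<^esub> f = ide C (Dom C f) \<and> f \<cdot>\<^bsub>C\<^esub> g = ide C (Cod C f))"

definition naturally_isomorphic ::
  "('o, 'a, 'm) cat_scheme \<Rightarrow> ('p, 'b, 'n) cat_scheme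
    \<Rightarrow> ('o, 'a, 'p, 'b) func \<Rightarrow> ('o, 'a, 'p, 'b) func \<Rightarrow> bool" where
  "naturally_isomorphic C D F G \<longleftrightarrow>
     (\<exists>\<tau>. (\<forall>X\<in>Obj C. \<tau> X \<in> hom D (omap F X) (omap G X) \<and> iso_arrow D (\<tau> X)) \<and>
          (\<forall>f\<in>Arr C. amap G f \<cdot>\<^bsub>D\<^esub> \<tau> (Dom C f) = \<tau> (Cod C f) \<cdot>\<^bsub>D\<^esub> amap F f))"

definition is_equivalence ::
  "('o, 'a, 'm) cat_scheme \<Rightarrow> ('p, 'b, 'n) cat_scheme \<Rightarrow> ('o, 'a, 'p, 'b) func \<Rightarrow> bool" where
  "is_equivalence C D F \<longleftrightarrow>
     is_functor C D F \<and>
     (\<exists>G. is_functor D C G \<and>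
          naturally_isomorphic C C (func_comp C G F) (func_id C) \<and>
          naturally_isomorphic D D (func_comp D F G) (func_id D))"


section \<open>Fibrations\<close>

definition cartesian ::
  "('o, 'a, 'm) cat_scheme \<Rightarrow> ('p, 'b, 'n) cat_scheme \<Rightarrow> ('o, 'a, 'p, 'b) func \<Rightarrow> 'a \<Rightarrow> bool" where
  "cartesian E B p f \<longleftrightarrow>
     f \<in> Arr E \<and>
     (\<forall>g\<in>Arr E. \<forall>w\<in>hom B (omap p (Dom E g)) (omap p (Dom E f)).
        Cod E g = Cod E f \<and> amap p f \<cdot>\<^bsub>B\<^esub> w = amap p g \<longrightarrow>
        (\<exists>!k. k \<in> hom E (Dom E g) (Dom E f) \<and> amap p k = w \<and> f \<cdot>\<^bsub>E\<^esub> k = g))"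

definition fibration ::
  "('o, 'a, 'm) cat_scheme \<Rightarrow> ('p, 'b, 'n) cat_scheme \<Rightarrow> ('o, 'a, 'p, 'b) func \<Rightarrow> bool" where
  "fibration E B p \<longleftrightarrow>
     category E \<and> category B \<and> is_functor E B p \<and>
     (\<forall>e\<in>Obj E. \<forall>u\<in>Arr B. Cod B u = omap p e \<longrightarrow>
        (\<exists>f. cartesian E B p f \<and> Cod E f = e \<and> amap p f = u))"

definition equivalence_of_fibrations ::
  "('p, 'b, 'n) cat_scheme
    \<Rightarrow> ('o, 'a, 'm) cat_scheme \<Rightarrow> ('o, 'a, 'p, 'b) func
    \<Rightarrow> ('o', 'a', 'm') cat_scheme \<Rightarrow> ('o', 'a', 'p, 'b) func
    \<Rightarrow> ('o, 'a, 'o', 'a') func \<Rightarrow> bool" where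
  "equivalence_of_fibrations B E p E' p' \<Phi> \<longleftrightarrow>
     fibration E B p \<and> fibration E' B p' \<and>
     is_equivalence E E' \<Phi> \<and>
     func_comp E p' \<Phi> = p \<and>
     (\<forall>f. cartesian E B p f \<longrightarrow> cartesian E' B p' (amap \<Phi> f))"


section \<open>Grothendieck constructions and arrow categories\<close>

text \<open>
  An indexed category over \<open>B\<close>: a category \<open>fibre b\<close> for every object \<open>b\<close>, and for every arrow
  \<open>g\<close> from \<open>b\<close> to \<open>b'\<close> a reindexing functor \<open>reindex g\<close> from \<open>fibre b'\<close> to \<open>fibre b\<close>.
\<close>

record ('b, 'g, 'x, 't) indexed =
  fibre :: "'b \<Rightarrow> ('x, 't) cat"
  reindex :: "'g \<Rightarrow> ('x, 't, 'x, 't) func"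

type_synonym ('b, 'g, 'x, 't) total_arrow = "('b \<times> 'x) \<times> ('g \<times> 't) \<times> ('b \<times> 'x)"

definition grothendieck ::
  "('b, 'g) cat \<Rightarrow> ('b, 'g, 'x, 't) indexed \<Rightarrow> ('b \<times> 'x, ('b, 'g, 'x, 't) total_arrow) cat" where
  "grothendieck B I = cat_of_homs
     {(b, x). b \<in> Obj B \<and> x \<in> Obj (fibre I b)}
     (\<lambda>(b, x) (b', x'). {(g, t). g \<in> hom B b b' \<and> t \<in> hom (fibre I b) x (omap (reindex I g) x')})
     (\<lambda>(b, x). (ide B b, ide (fibre I b) x))
     (\<lambda>(b, x) _ _ (h, u) (g, t). (h \<cdot>\<^bsub>B\<^esub> g, amap (reindex I g) u \<cdot>\<^bsub>fibre I b\<^esub> t))"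

definition grothendieck_proj ::
  "('b, 'g) cat \<Rightarrow> ('b, 'g, 'x, 't) indexed
    \<Rightarrow> ('b \<times> 'x, ('b, 'g, 'x, 't) total_arrow, 'b, 'g) func" where
  "grothendieck_proj B I =
    \<lparr> omap = (\<lambda>(b, x)\<in>Obj (grothendieck B I). b),
      amap = (\<lambda>(bx, (g, t), bx')\<in>Arr (grothendieck B I). g) \<rparr>"

definition full_subcat :: "('o, 'a) cat \<Rightarrow> 'o set \<Rightarrow> ('o, 'a) cat" where
  "full_subcat C S =
    (let A = {f \<in> Arr C. Dom C f \<in> S \<and> Cod C f \<in> S} in
     \<lparr> Obj = Obj C \<inter> S,
       Arr = A,
       Dom = restrict (Dom C) A,
       Cod = restrict (Cod C) A,
       ide = restrict (ide C) (Obj C \<inter> S),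
       Comp = (\<lambda>g\<in>A. \<lambda>f\<in>{f \<in> A. Cod C f = Dom C g}. g \<cdot>\<^bsub>C\<^esub> f) \<rparr>)"

definition arrow_cat :: "('b, 'g) cat \<Rightarrow> ('g, 'g \<times> ('g \<times> 'g) \<times> 'g) cat" where
  "arrow_cat B = cat_of_homs
     (Arr B)
     (\<lambda>f f'. {(g, h). g \<in> hom B (Dom B f) (Dom B f') \<and> h \<in> hom B (Cod B f) (Cod B f') \<and>
                      h \<cdot>\<^bsub>B\<^esub> f = f' \<cdot>\<^bsub>B\<^esub> g})
     (\<lambda>f. (ide B (Dom B f), ide B (Cod B f)))
     (\<lambda>_ _ _ (g', h') (g, h). (g' \<cdot>\<^bsub>B\<^esub> g, h' \<cdot>\<^bsub>B\<^esub> h))"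

text \<open>The domain functor, on the full subcategory of the arrow category on \<open>S\<close>.\<close>

definition dom_functor ::
  "('b, 'g) cat \<Rightarrow> 'g set \<Rightarrow> ('g, 'g \<times> ('g \<times> 'g) \<times> 'g, 'b, 'g) func" where
  "dom_functor B S =
    \<lparr> omap = (\<lambda>f\<in>Obj (full_subcat (arrow_cat B) S). Dom B f),
      amap = (\<lambda>(f, (g, h), f')\<in>Arr (full_subcat (arrow_cat B) S). g) \<rparr>"


section \<open>Strict symmetric monoidal, compact and traced categories\<close>

record ('o, 'a) smc = "('o, 'a) cat" +
  unit_obj :: 'o ("\<one>\<index>")
  tobj :: "'o \<Rightarrow> 'o \<Rightarrow> 'o" (infixr "\<otimes>\<index>" 72)
  tarr :: "'a \<Rightarrow> 'a \<Rightarrow> 'a" (infixr "\<boxtimes>\<index>" 70)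
  symm :: "'o \<Rightarrow> 'o \<Rightarrow> 'a" ("\<sigma>\<index>")

record ('o, 'a) tracedcat = "('o, 'a) smc" +
  trace :: "'o \<Rightarrow> 'o \<Rightarrow> 'o \<Rightarrow> 'a \<Rightarrow> 'a" ("Tr\<index>")

locale symmetric_monoidal = category C for C :: "('o, 'a, 'm) smc_scheme" (structure) +
  assumes unit_closed: "\<one> \<in> Obj C"
    and tobj_closed: "tobj C \<in> Obj C \<rightarrow>\<^sub>E Obj C \<rightarrow>\<^sub>E Obj C"
    and tarr_ext: "tarr C \<in> Arr C \<rightarrow>\<^sub>E Arr C \<rightarrow>\<^sub>E Arr C"
    and tarr_closed:
      "\<lbrakk>f \<in> hom C X Y; f' \<in> hom C X' Y'\<rbrakk> \<Longrightarrow> f \<boxtimes> f' \<in> hom C (X \<otimes> X') (Y \<otimes> Y')"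
    and tarr_ide: "\<lbrakk>X \<in> Obj C; Y \<in> Obj C\<rbrakk> \<Longrightarrow> ide C X \<boxtimes> ide C Y = ide C (X \<otimes> Y)"
    and tarr_Comp:
      "\<lbrakk>f \<in> hom C X Y; g \<in> hom C Y Z; f' \<in> hom C X' Y'; g' \<in> hom C Y' Z'\<rbrakk>
        \<Longrightarrow> (g \<cdot> f) \<boxtimes> (g' \<cdot> f') = (g \<boxtimes> g') \<cdot> (f \<boxtimes> f')"
    and tobj_assoc: "\<lbrakk>X \<in> Obj C; Y \<in> Obj C; Z \<in> Obj C\<rbrakk> \<Longrightarrow> (X \<otimes> Y) \<otimes> Z = X \<otimes> (Y \<otimes> Z)"
    and tobj_unit_left: "X \<in> Obj C \<Longrightarrow> \<one> \<otimes> X = X"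
    and tobj_unit_right: "X \<in> Obj C \<Longrightarrow> X \<otimes> \<one> = X"
    and tarr_assoc: "\<lbrakk>f \<in> Arr C; g \<in> Arr C; h \<in> Arr C\<rbrakk> \<Longrightarrow> (f \<boxtimes> g) \<boxtimes> h = f \<boxtimes> (g \<boxtimes> h)"
    and tarr_unit_left: "f \<in> Arr C \<Longrightarrow> ide C \<one> \<boxtimes> f = f"
    and tarr_unit_right: "f \<in> Arr C \<Longrightarrow> f \<boxtimes> ide C \<one> = f"
    and symm_closed: "symm C \<in> (\<Pi>\<^sub>E X\<in>Obj C. \<Pi>\<^sub>E Y\<in>Obj C. hom C (X \<otimes> Y) (Y \<otimes> X))"
    and symm_natural:
      "\<lbrakk>f \<in> hom C X X'; g \<in> hom C Y Y'\<rbrakk> \<Longrightarrow> \<sigma> X' Y' \<cdot> (f \<boxtimes> g) = (g \<boxtimes> f) \<cdot> \<sigma> X Y"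
    and symm_involutive: "\<lbrakk>X \<in> Obj C; Y \<in> Obj C\<rbrakk> \<Longrightarrow> \<sigma> Y X \<cdot> \<sigma> X Y = ide C (X \<otimes> Y)"
    and symm_hexagon:
      "\<lbrakk>X \<in> Obj C; Y \<in> Obj C; Z \<in> Obj C\<rbrakk>
        \<Longrightarrow> \<sigma> X (Y \<otimes> Z) = (ide C Y \<boxtimes> \<sigma> X Z) \<cdot> (\<sigma> X Y \<boxtimes> ide C Z)"

definition is_dual ::
  "('o, 'a, 'm) smc_scheme \<Rightarrow> 'o \<Rightarrow> 'o \<Rightarrow> 'a \<Rightarrow> 'a \<Rightarrow> bool" where
  "is_dual C X Y \<eta> \<epsilon> \<longleftrightarrow>
     Y \<in> Obj C \<and>
     \<eta> \<in> hom C \<one>\<^bsub>C\<^esub> (X \<otimes>\<^bsub>C\<^esub> Y) \<and>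
     \<epsilon> \<in> hom C (Y \<otimes>\<^bsub>C\<^esub> X) \<one>\<^bsub>C\<^esub> \<and>
     (ide C X \<boxtimes>\<^bsub>C\<^esub> \<epsilon>) \<cdot>\<^bsub>C\<^esub> (\<eta> \<boxtimes>\<^bsub>C\<^esub> ide C X) = ide C X \<and>
     (\<epsilon> \<boxtimes>\<^bsub>C\<^esub> ide C Y) \<cdot>\<^bsub>C\<^esub> (ide C Y \<boxtimes>\<^bsub>C\<^esub> \<eta>) = ide C Y"

locale compact_category = symmetric_monoidal +
  assumes dual_exists: "X \<in> Obj C \<Longrightarrow> \<exists>Y \<eta> \<epsilon>. is_dual C X Y \<eta> \<epsilon>"

locale traced_category = symmetric_monoidal C
    for C :: "('o, 'a, 'm) tracedcat_scheme" (structure) +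
  assumes trace_closed:
      "trace C \<in> (\<Pi>\<^sub>E U\<in>Obj C. \<Pi>\<^sub>E X\<in>Obj C. \<Pi>\<^sub>E Y\<in>Obj C. hom C (U \<otimes> X) (U \<otimes> Y) \<rightarrow>\<^sub>E hom C X Y)"
    and trace_natural_dom:
      "\<lbrakk>U \<in> Obj C; X \<in> Obj C; Y \<in> Obj C; f \<in> hom C (U \<otimes> X) (U \<otimes> Y); g \<in> hom C X' X\<rbrakk>
        \<Longrightarrow> Tr U X' Y (f \<cdot> (ide C U \<boxtimes> g)) = Tr U X Y f \<cdot> g"
    and trace_natural_cod:
      "\<lbrakk>U \<in> Obj C; X \<in> Obj C; Y \<in> Obj C; f \<in> hom C (U \<otimes> X) (U \<otimes> Y); h \<in> hom C Y Y'\<rbrakk>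
        \<Longrightarrow> Tr U X Y' ((ide C U \<boxtimes> h) \<cdot> f) = h \<cdot> Tr U X Y f"
    and trace_dinatural:
      "\<lbrakk>U \<in> Obj C; V \<in> Obj C; X \<in> Obj C; Y \<in> Obj C; f \<in> hom C (U \<otimes> X) (V \<otimes> Y); g \<in> hom C V U\<rbrakk>
        \<Longrightarrow> Tr U X Y ((g \<boxtimes> ide C Y) \<cdot> f) = Tr V X Y (f \<cdot> (g \<boxtimes> ide C X))"
    and trace_vanishing_unit:
      "\<lbrakk>X \<in> Obj C; Y \<in> Obj C; f \<in> hom C X Y\<rbrakk> \<Longrightarrow> Tr \<one> X Y f = f"
    and trace_vanishing_tensor:
      "\<lbrakk>U \<in> Obj C; V \<in> Obj C; X \<in> Obj C; Y \<in> Obj C; f \<in> hom C (U \<otimes> V \<otimes> X) (U \<otimes> V \<otimes> Y)\<rbrakk>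
        \<Longrightarrow> Tr (U \<otimes> V) X Y f = Tr V X Y (Tr U (V \<otimes> X) (V \<otimes> Y) f)"
    and trace_superposing:
      "\<lbrakk>U \<in> Obj C; X \<in> Obj C; Y \<in> Obj C; f \<in> hom C (U \<otimes> X) (U \<otimes> Y); g \<in> hom C X' Y'\<rbrakk>
        \<Longrightarrow> Tr U (X \<otimes> X') (Y \<otimes> Y') (f \<boxtimes> g) = Tr U X Y f \<boxtimes> g"
    and trace_yanking: "U \<in> Obj C \<Longrightarrow> Tr U U U (\<sigma> U U) = ide C U"

definition strict_monoidal_functor ::
  "('o, 'a, 'm) smc_scheme \<Rightarrow> ('p, 'b, 'n) smc_scheme \<Rightarrow> ('o, 'a, 'p, 'b) func \<Rightarrow> bool" where
  "strict_monoidal_functor C D F \<longleftrightarrow>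
     is_functor C D F \<and>
     omap F \<one>\<^bsub>C\<^esub> = \<one>\<^bsub>D\<^esub> \<and>
     (\<forall>X\<in>Obj C. \<forall>Y\<in>Obj C. omap F (X \<otimes>\<^bsub>C\<^esub> Y) = omap F X \<otimes>\<^bsub>D\<^esub> omap F Y) \<and>
     (\<forall>f\<in>Arr C. \<forall>g\<in>Arr C. amap F (f \<boxtimes>\<^bsub>C\<^esub> g) = amap F f \<boxtimes>\<^bsub>D\<^esub> amap F g) \<and>
     (\<forall>X\<in>Obj C. \<forall>Y\<in>Obj C. amap F (\<sigma>\<^bsub>C\<^esub> X Y) = \<sigma>\<^bsub>D\<^esub> (omap F X) (omap F Y))"

definition traced_functor ::
  "('o, 'a, 'm) tracedcat_scheme \<Rightarrow> ('p, 'b, 'n) tracedcat_scheme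
    \<Rightarrow> ('o, 'a, 'p, 'b) func \<Rightarrow> bool" where
  "traced_functor C D F \<longleftrightarrow>
     strict_monoidal_functor C D F \<and>
     (\<forall>U\<in>Obj C. \<forall>X\<in>Obj C. \<forall>Y\<in>Obj C. \<forall>f\<in>hom C (U \<otimes>\<^bsub>C\<^esub> X) (U \<otimes>\<^bsub>C\<^esub> Y).
        amap F (Tr\<^bsub>C\<^esub> U X Y f) = Tr\<^bsub>D\<^esub> (omap F U) (omap F X) (omap F Y) (amap F f))"

text \<open>
  Smallness is relative to a universe type \<open>'u\<close>. The objects and arrows of a small category, and
  the elements of a small set, are drawn from \<open>'u\<close>.
\<close>

type_synonym 'u small_func = "('u, 'u, 'u, 'u) func"
type_synonym 'u compcat_arrow = "('u, 'u) smc \<times> 'u small_func \<times> ('u, 'u) smc"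
type_synonym 'u trcat_arrow = "('u, 'u) tracedcat \<times> 'u small_func \<times> ('u, 'u) tracedcat"
type_synonym 'u compcat = "(('u, 'u) smc, 'u compcat_arrow) cat"
type_synonym 'u trcat = "(('u, 'u) tracedcat, 'u trcat_arrow) cat"

definition CompCat :: "'u compcat" where
  "CompCat = cat_of_homs {C. compact_category C} (\<lambda>C D. {F. strict_monoidal_functor C D F})
     func_id (\<lambda>C _ _. func_comp C)"

definition TrCat :: "'u trcat" where
  "TrCat = cat_of_homs {T. traced_category T} (\<lambda>T S. {F. traced_functor T S F})
     func_id (\<lambda>T _ _. func_comp T)"

definition compcat_bo :: "'u compcat_arrow set" where
  "compcat_bo = {(C, F, D) \<in> Arr CompCat. bij_betw (omap F) (Obj C) (Obj D)}"

definition trcat_bo :: "'u trcat_arrow set" where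
  "trcat_bo = {(T, F, S) \<in> Arr TrCat. bij_betw (omap F) (Obj T) (Obj S)}"

abbreviation CompCat_bo :: "('u compcat_arrow, _) cat" where
  "CompCat_bo \<equiv> full_subcat (arrow_cat CompCat) compcat_bo"

abbreviation TrCat_bo :: "('u trcat_arrow, _) cat" where
  "TrCat_bo \<equiv> full_subcat (arrow_cat TrCat) trcat_bo"


section \<open>The Int construction\<close>

text \<open>
  An object \<open>(X\<^sup>-, X\<^sup>+)\<close> is written \<open>(X, X')\<close>, so an arrow from \<open>(X, X')\<close> to \<open>(Y, Y')\<close> is an arrow
  \<open>X \<otimes> Y' \<rightarrow> X' \<otimes> Y\<close> of \<open>T\<close>. The symmetries in the composite put the traced object \<open>Y'\<close> in the
  leftmost position. The unspecified parts are the standard ones: the identity of \<open>(X, X')\<close> is the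
  symmetry of \<open>T\<close>, the tensor product of arrows is that of \<open>T\<close> up to exchange of the middle factors,
  and the symmetry of \<open>(X, X')\<close> and \<open>(Y, Y')\<close> is the permutation
  \<open>X \<otimes> Y \<otimes> Y' \<otimes> X' \<rightarrow> X' \<otimes> Y' \<otimes> Y \<otimes> X\<close>.
\<close>

definition Int_cat ::
  "('o, 'a, 'm) tracedcat_scheme \<Rightarrow> ('o \<times> 'o, ('o \<times> 'o) \<times> 'a \<times> ('o \<times> 'o)) cat" where
  "Int_cat T = cat_of_homs
     (Obj T \<times> Obj T)
     (\<lambda>(X, X') (Y, Y'). hom T (X \<otimes>\<^bsub>T\<^esub> Y') (X' \<otimes>\<^bsub>T\<^esub> Y))
     (\<lambda>(X, X'). \<sigma>\<^bsub>T\<^esub> X X')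
     (\<lambda>(X, X') (Y, Y') (Z, Z') g f.
        Tr\<^bsub>T\<^esub> Y' (X \<otimes>\<^bsub>T\<^esub> Z') (X' \<otimes>\<^bsub>T\<^esub> Z)
          ((\<sigma>\<^bsub>T\<^esub> X' Y' \<boxtimes>\<^bsub>T\<^esub> ide T Z) \<cdot>\<^bsub>T\<^esub> (ide T X' \<boxtimes>\<^bsub>T\<^esub> g) \<cdot>\<^bsub>T\<^esub>
           (f \<boxtimes>\<^bsub>T\<^esub> ide T Z') \<cdot>\<^bsub>T\<^esub> (\<sigma>\<^bsub>T\<^esub> Y' X \<boxtimes>\<^bsub>T\<^esub> ide T Z')))"

definition Int_smc ::
  "('o, 'a, 'm) tracedcat_scheme \<Rightarrow> ('o \<times> 'o, ('o \<times> 'o) \<times> 'a \<times> ('o \<times> 'o)) smc" where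
  "Int_smc T =
    (let Ob = Obj T \<times> Obj T; A = Arr (Int_cat T);
         tens = (\<lambda>(X, X') (Y, Y'). (X \<otimes>\<^bsub>T\<^esub> Y, X' \<otimes>\<^bsub>T\<^esub> Y')) in
     cat.extend (Int_cat T)
      (smc.fields
        (\<one>\<^bsub>T\<^esub>, \<one>\<^bsub>T\<^esub>)
        (\<lambda>XX\<in>Ob. \<lambda>YY\<in>Ob. tens XX YY)
        (\<lambda>u\<in>A. \<lambda>v\<in>A.
           (case (u, v) of (((X, X'), f, (Y, Y')), ((W, W'), g, (Z, Z'))) \<Rightarrow>
             (tens (X, X') (W, W'),
              (ide T X' \<boxtimes>\<^bsub>T\<^esub> \<sigma>\<^bsub>T\<^esub> Y W' \<boxtimes>\<^bsub>T\<^esub> ide T Z) \<cdot>\<^bsub>T\<^esub> (f \<boxtimes>\<^bsub>T\<^esub> g) \<cdot>\<^bsub>T\<^esub>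
                (ide T X \<boxtimes>\<^bsub>T\<^esub> \<sigma>\<^bsub>T\<^esub> W Y' \<boxtimes>\<^bsub>T\<^esub> ide T Z'),
              tens (Y, Y') (Z, Z'))))
        (\<lambda>(X, X')\<in>Ob. \<lambda>(Y, Y')\<in>Ob.
           (tens (X, X') (Y, Y'),
            (\<sigma>\<^bsub>T\<^esub> Y' X' \<boxtimes>\<^bsub>T\<^esub> \<sigma>\<^bsub>T\<^esub> X Y) \<cdot>\<^bsub>T\<^esub> \<sigma>\<^bsub>T\<^esub> (X \<otimes>\<^bsub>T\<^esub> Y) (Y' \<otimes>\<^bsub>T\<^esub> X'),
            tens (Y, Y') (X, X')))))"

definition Int_map ::
  "('o, 'a, 'm) tracedcat_scheme \<Rightarrow> ('o, 'a, 'p, 'b) func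
    \<Rightarrow> ('o \<times> 'o, ('o \<times> 'o) \<times> 'a \<times> ('o \<times> 'o), 'p \<times> 'p, ('p \<times> 'p) \<times> 'b \<times> ('p \<times> 'p)) func" where
  "Int_map T G =
    \<lparr> omap = (\<lambda>XX\<in>Obj (Int_cat T). map_prod (omap G) (omap G) XX),
      amap = (\<lambda>(XX, f, YY)\<in>Arr (Int_cat T).
                (map_prod (omap G) (omap G) XX, amap G f, map_prod (omap G) (omap G) YY)) \<rparr>"


section \<open>Lax monoidal functors to sets\<close>

type_synonym 's set_arrow = "'s set \<times> ('s \<Rightarrow> 's) \<times> 's set"

definition set_cat :: "('s set, 's set_arrow) cat" where
  "set_cat = cat_of_homs UNIV (\<lambda>A B. A \<rightarrow>\<^sub>E B) (\<lambda>A. \<lambda>x\<in>A. x) (\<lambda>A _ _. compose A)"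

text \<open>
  The structure maps \<open>1 \<rightarrow> P I\<close> and \<open>P X \<times> P Y \<rightarrow> P (X \<otimes> Y)\<close> of a lax monoidal functor to the
  cartesian monoidal category of sets are given as an element and as curried functions. The
  coherence diagrams are stated elementwise; only the associator and unitors of sets occur in
  them, since \<open>M\<close> is strict.
\<close>

record ('o, 'a, 's) lax =
  under :: "('o, 'a, 's set, 's set_arrow) func"
  lunit :: 's
  lmult :: "'o \<Rightarrow> 'o \<Rightarrow> 's \<Rightarrow> 's \<Rightarrow> 's"

definition lset :: "('o, 'a, 's) lax \<Rightarrow> 'o \<Rightarrow> 's set" where
  "lset P X = omap (under P) X"

definition lact :: "('o, 'a, 's) lax \<Rightarrow> 'a \<Rightarrow> 's \<Rightarrow> 's" where
  "lact P f = fst (snd (amap (under P) f))"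

definition lax_monoidal :: "('o, 'a, 'm) smc_scheme \<Rightarrow> ('o, 'a, 's) lax \<Rightarrow> bool" where
  "lax_monoidal M P \<longleftrightarrow>
     is_functor M set_cat (under P) \<and>
     lunit P \<in> lset P \<one>\<^bsub>M\<^esub> \<and>
     lmult P \<in> (\<Pi>\<^sub>E X\<in>Obj M. \<Pi>\<^sub>E Y\<in>Obj M. lset P X \<rightarrow>\<^sub>E lset P Y \<rightarrow>\<^sub>E lset P (X \<otimes>\<^bsub>M\<^esub> Y)) \<and>
     (\<forall>f\<in>Arr M. \<forall>g\<in>Arr M. \<forall>x\<in>lset P (Dom M f). \<forall>y\<in>lset P (Dom M g).
        lact P (f \<boxtimes>\<^bsub>M\<^esub> g) (lmult P (Dom M f) (Dom M g) x y)
          = lmult P (Cod M f) (Cod M g) (lact P f x) (lact P g y)) \<and>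
     (\<forall>X\<in>Obj M. \<forall>Y\<in>Obj M. \<forall>Z\<in>Obj M. \<forall>x\<in>lset P X. \<forall>y\<in>lset P Y. \<forall>z\<in>lset P Z.
        lmult P (X \<otimes>\<^bsub>M\<^esub> Y) Z (lmult P X Y x y) z
          = lmult P X (Y \<otimes>\<^bsub>M\<^esub> Z) x (lmult P Y Z y z)) \<and>
     (\<forall>X\<in>Obj M. \<forall>x\<in>lset P X. lmult P \<one>\<^bsub>M\<^esub> X (lunit P) x = x) \<and>
     (\<forall>X\<in>Obj M. \<forall>x\<in>lset P X. lmult P X \<one>\<^bsub>M\<^esub> x (lunit P) = x) \<and>
     (\<forall>X\<in>Obj M. \<forall>Y\<in>Obj M. \<forall>x\<in>lset P X. \<forall>y\<in>lset P Y.
        lact P (\<sigma>\<^bsub>M\<^esub> X Y) (lmult P X Y x y) = lmult P Y X y x)"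

definition monoidal_transformation ::
  "('o, 'a, 'm) smc_scheme \<Rightarrow> ('o, 'a, 's) lax \<Rightarrow> ('o, 'a, 's) lax \<Rightarrow> ('o \<Rightarrow> 's \<Rightarrow> 's) \<Rightarrow> bool" where
  "monoidal_transformation M P Q \<theta> \<longleftrightarrow>
     \<theta> \<in> (\<Pi>\<^sub>E X\<in>Obj M. lset P X \<rightarrow>\<^sub>E lset Q X) \<and>
     (\<forall>f\<in>Arr M. \<forall>x\<in>lset P (Dom M f).
        \<theta> (Cod M f) (lact P f x) = lact Q f (\<theta> (Dom M f) x)) \<and>
     \<theta> \<one>\<^bsub>M\<^esub> (lunit P) = lunit Q \<and>
     (\<forall>X\<in>Obj M. \<forall>Y\<in>Obj M. \<forall>x\<in>lset P X. \<forall>y\<in>lset P Y.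
        \<theta> (X \<otimes>\<^bsub>M\<^esub> Y) (lmult P X Y x y) = lmult Q X Y (\<theta> X x) (\<theta> Y y))"

type_synonym ('o, 'a, 's) lax_arrow = "('o, 'a, 's) lax \<times> ('o \<Rightarrow> 's \<Rightarrow> 's) \<times> ('o, 'a, 's) lax"

definition Lax ::
  "('o, 'a, 'm) smc_scheme \<Rightarrow> (('o, 'a, 's) lax, ('o, 'a, 's) lax_arrow) cat" where
  "Lax M = cat_of_homs
     {P. lax_monoidal M P}
     (\<lambda>P Q. {\<theta>. monoidal_transformation M P Q \<theta>})
     (\<lambda>P. \<lambda>X\<in>Obj M. \<lambda>x\<in>lset P X. x)
     (\<lambda>P _ _ \<phi> \<theta>. \<lambda>X\<in>Obj M. compose (lset P X) (\<phi> X) (\<theta> X))"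

definition lax_precomp ::
  "('o, 'a, 'm) smc_scheme \<Rightarrow> ('o, 'a, 'p, 'b) func \<Rightarrow> ('p, 'b, 's) lax \<Rightarrow> ('o, 'a, 's) lax" where
  "lax_precomp M G P =
    \<lparr> under = func_comp M (under P) G,
      lunit = lunit P,
      lmult = (\<lambda>X\<in>Obj M. \<lambda>Y\<in>Obj M. lmult P (omap G X) (omap G Y)) \<rparr>"

text \<open>Precomposition with a strict monoidal functor \<open>G\<close> from \<open>M\<close> to \<open>N\<close>.\<close>

definition Lax_reindex ::
  "('o, 'a, 'm) smc_scheme \<Rightarrow> ('p, 'b, 'n) smc_scheme \<Rightarrow> ('o, 'a, 'p, 'b) func
    \<Rightarrow> (('p, 'b, 's) lax, ('p, 'b, 's) lax_arrow, ('o, 'a, 's) lax, ('o, 'a, 's) lax_arrow) func" where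
  "Lax_reindex M N G =
    \<lparr> omap = (\<lambda>P\<in>Obj (Lax N). lax_precomp M G P),
      amap = (\<lambda>(P, \<theta>, Q)\<in>Arr (Lax N).
                (lax_precomp M G P, \<lambda>X\<in>Obj M. \<theta> (omap G X), lax_precomp M G Q)) \<rparr>"

definition Lax_CompCat ::
  "(('u, 'u) smc, 'u compcat_arrow, ('u, 'u, 'u) lax, ('u, 'u, 'u) lax_arrow) indexed" where
  "Lax_CompCat = \<lparr> fibre = Lax, reindex = (\<lambda>(C, G, D). Lax_reindex C D G) \<rparr>"

type_synonym 'u int_arrow = "('u \<times> 'u) \<times> 'u \<times> ('u \<times> 'u)"

definition Lax_Int_TrCat ::
  "(('u, 'u) tracedcat, 'u trcat_arrow,
    ('u \<times> 'u, 'u int_arrow, 'u) lax, ('u \<times> 'u, 'u int_arrow, 'u) lax_arrow) indexed" where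
  "Lax_Int_TrCat =
    \<lparr> fibre = (\<lambda>T. Lax (Int_smc T)),
      reindex = (\<lambda>(T, G, S). Lax_reindex (Int_smc T) (Int_smc S) (Int_map T G)) \<rparr>"

end

theory Submission
  imports Defs
begin

text \<open>
  A bijective-on-objects functor \<open>F\<close> from \<open>C\<close> to \<open>D\<close> yields the lax functor \<open>D(1, F-)\<close> on \<open>C\<close>; in the traced
  case one takes \<open>Int(S)(1, Int(F)-)\<close> on \<open>Int(T)\<close>, which sends \<open>(Y, X)\<close> to \<open>S(F X, F Y)\<close>. This assignment
  lies over the base, is fully faithful, and hits every object of the Grothendieck construction up to a
  vertical isomorphism, so cartesian lifts transfer and it is an equivalence of fibrations.

  In the traced case \<open>P\<close> on \<open>Int(T)\<close> determines \<open>S\<close> by \<open>S(X, Y) = P(Y, X)\<close>, where tensor is the lax structure,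
  and composition and trace are the actions of arrows of \<open>Int(T)\<close> made of symmetries. The axioms
  become equations between diagrams in \<open>T\<close>, decided by comparing normal forms.

  In the compact case \<open>X\<close> is dualisable, so every arrow \<open>F X \<rightarrow> F Y\<close> of \<open>D\<close> is \<open>F f \<cdot> (p \<boxtimes> F X)\<close> for some
  \<open>p : 1 \<rightarrow> F A\<close> and \<open>f : A \<otimes> X \<rightarrow> Y\<close>. Hence \<open>D(X, Y)\<close> is the coend over \<open>A\<close> of \<open>P A \<times> C(A \<otimes> X, Y)\<close>,
  which is \<open>P (Y \<otimes> X\<^sup>*)\<close>.
\<close>

section \<open>Categories\<close>

text \<open>The comparison functor runs from arrows to lax functors, the direction that involves no
  choice; the equivalence claimed is a quasi-inverse of it. It loses no information because of
  names: over a bijective-on-objects functor every arrow of the codomain corresponds to an arrow out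
  of the unit, so that a transformation between functors of points determines a functor on all
  arrows.

  Two obstacles shape the formal proof. Equality of categories is strict and hom-sets are disjoint,
  whereas the sets of a lax functor may overlap. The category made from a lax functor must store
  source and target in each arrow and still live in the same universe, which takes an injection of
  triples into the universe; this is where its infinity enters. Conversely, arrows of
  \<open>Int(T)\<close> carry tags that must be stripped before they can be elements of a set in the
  universe.

  The second obstacle is coherence. Equations with traces and many symmetries are proved by
  reflection: diagrams become data, and evaluating a sound comparison replaces the
  calculation.\<close>

lemma hom_iff: "f \<in> hom C X Y \<longleftrightarrow> f \<in> Arr C \<and> Dom C f = X \<and> Cod C f = Y"
  by (simp add: hom_def)

context category
begin

lemma Dom_Obj [simp]: "f \<in> Arr C \<Longrightarrow> Dom C f \<in> Obj C"
  using Dom_closed by (auto dest: PiE_mem)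

lemma Cod_Obj [simp]: "f \<in> Arr C \<Longrightarrow> Cod C f \<in> Obj C"
  using Cod_closed by (auto dest: PiE_mem)

lemma ide_hom: "X \<in> Obj C \<Longrightarrow> ide C X \<in> hom C X X"
  using ide_closed by (auto dest: PiE_mem)

lemma ide_arr [simp]:
  assumes "X \<in> Obj C"
  shows "ide C X \<in> Arr C" "Dom C (ide C X) = X" "Cod C (ide C X) = X"
  using ide_hom[OF assms] by (auto simp: hom_iff)

lemma homD:
  assumes "f \<in> hom C X Y"
  shows "f \<in> Arr C" "Dom C f = X" "Cod C f = Y" "X \<in> Obj C" "Y \<in> Obj C"
  using assms by (auto simp: hom_iff)

lemma arr_hom: "f \<in> Arr C \<Longrightarrow> f \<in> hom C (Dom C f) (Cod C f)"
  by (simp add: hom_iff)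

lemma comp_hom: "\<lbrakk>g \<in> hom C Y Z; f \<in> hom C X Y\<rbrakk> \<Longrightarrow> g \<cdot> f \<in> hom C X Z"
  using PiE_mem[OF PiE_mem[OF Comp_closed, of g], of f] by (auto simp: hom_iff)

lemma comp_arr [simp]:
  assumes "g \<in> Arr C" "f \<in> Arr C" "Cod C f = Dom C g"
  shows "g \<cdot> f \<in> Arr C" "Dom C (g \<cdot> f) = Dom C f" "Cod C (g \<cdot> f) = Cod C g"
  using comp_hom[of g "Dom C g" "Cod C g" f "Dom C f"] assms by (auto simp: hom_iff)

lemma comp_ide [simp]:
  "\<lbrakk>f \<in> Arr C; Cod C f = Y\<rbrakk> \<Longrightarrow> ide C Y \<cdot> f = f"
  "\<lbrakk>f \<in> Arr C; Dom C f = X\<rbrakk> \<Longrightarrow> f \<cdot> ide C X = f"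
  using Comp_ide_left Comp_ide_right by (auto simp: hom_iff)

lemma comp_assoc:
  "\<lbrakk>f \<in> Arr C; g \<in> Arr C; h \<in> Arr C; Cod C f = Dom C g; Cod C g = Dom C h\<rbrakk>
    \<Longrightarrow> (h \<cdot> g) \<cdot> f = h \<cdot> (g \<cdot> f)"
  using Comp_assoc[of f _ _ g _ h] by (auto simp: hom_iff)

end

lemma functor_hom:
  assumes "category C" "is_functor C D F" "f \<in> hom C X Y"
  shows "amap F f \<in> hom D (omap F X) (omap F Y)"
  using assms category.homD[OF assms(1,3)] by (auto simp: is_functor_def)

lemma functor_obj: "is_functor C D F \<Longrightarrow> X \<in> Obj C \<Longrightarrow> omap F X \<in> Obj D"
  by (auto simp: is_functor_def dest: PiE_mem)

lemma functor_ide: "is_functor C D F \<Longrightarrow> X \<in> Obj C \<Longrightarrow> amap F (ide C X) = ide D (omap F X)"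
  by (auto simp: is_functor_def)

lemma functor_comp:
  "\<lbrakk>is_functor C D F; g \<in> hom C Y Z; f \<in> hom C X Y\<rbrakk>
    \<Longrightarrow> amap F (g \<cdot>\<^bsub>C\<^esub> f) = amap F g \<cdot>\<^bsub>D\<^esub> amap F f"
  by (auto simp: is_functor_def hom_iff)

lemma functor_arr:
  assumes "category C" "is_functor C D F" "f \<in> Arr C"
  shows "amap F f \<in> Arr D" "Dom D (amap F f) = omap F (Dom C f)" "Cod D (amap F f) = omap F (Cod C f)"
  using functor_hom[OF assms(1,2) category.arr_hom[OF assms(1,3)]] by (auto simp: hom_iff)

lemma is_functorI:
  assumes "category C"
    and "omap F \<in> extensional (Obj C)" "amap F \<in> extensional (Arr C)"
    and "\<And>X. X \<in> Obj C \<Longrightarrow> omap F X \<in> Obj D"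
    and "\<And>X Y f. f \<in> hom C X Y \<Longrightarrow> amap F f \<in> hom D (omap F X) (omap F Y)"
    and "\<And>X. X \<in> Obj C \<Longrightarrow> amap F (ide C X) = ide D (omap F X)"
    and "\<And>X Y Z g f. \<lbrakk>g \<in> hom C Y Z; f \<in> hom C X Y\<rbrakk>
           \<Longrightarrow> amap F (g \<cdot>\<^bsub>C\<^esub> f) = amap F g \<cdot>\<^bsub>D\<^esub> amap F f"
  shows "is_functor C D F"
proof -
  have "amap F \<in> Arr C \<rightarrow>\<^sub>E Arr D"
    using assms(3) assms(5)[OF category.arr_hom[OF assms(1)]] by (simp add: PiE_iff hom_iff)
  moreover have "omap F \<in> Obj C \<rightarrow>\<^sub>E Obj D"
    using assms(2,4) by (auto simp: PiE_iff)
  ultimately show ?thesis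
    unfolding is_functor_def using assms category.arr_hom[OF assms(1)] by (fastforce simp: hom_iff)
qed

lemma func_eqI:
  fixes F G :: "('o, 'a, 'p, 'b) func"
  assumes "omap F \<in> extensional A" "omap G \<in> extensional A" "\<And>X. X \<in> A \<Longrightarrow> omap F X = omap G X"
    and "amap F \<in> extensional B" "amap G \<in> extensional B" "\<And>f. f \<in> B \<Longrightarrow> amap F f = amap G f"
  shows "F = G"
  using extensionalityI[OF assms(1,2)] extensionalityI[OF assms(4,5)] assms(3,6)
  by (intro func.equality) auto

lemma functor_ext:
  "is_functor C D F \<Longrightarrow> omap F \<in> extensional (Obj C)"
  "is_functor C D F \<Longrightarrow> amap F \<in> extensional (Arr C)"
  by (auto simp: is_functor_def PiE_iff)

lemma functor_eqI:
  assumes "is_functor C D F" "is_functor C D' G"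
    and "\<And>X. X \<in> Obj C \<Longrightarrow> omap F X = omap G X" "\<And>f. f \<in> Arr C \<Longrightarrow> amap F f = amap G f"
  shows "F = G"
  by (rule func_eqI[OF functor_ext(1)[OF assms(1)] functor_ext(1)[OF assms(2)] assms(3)
        functor_ext(2)[OF assms(1)] functor_ext(2)[OF assms(2)] assms(4)])

lemma func_id_simps [simp]:
  "omap (func_id C) = (\<lambda>X\<in>Obj C. X)" "amap (func_id C) = (\<lambda>f\<in>Arr C. f)"
  by (simp_all add: func_id_def)

lemma func_comp_simps [simp]:
  "omap (func_comp C G F) = compose (Obj C) (omap G) (omap F)"
  "amap (func_comp C G F) = compose (Arr C) (amap G) (amap F)"
  by (simp_all add: func_comp_def)

lemma is_functor_id: assumes "category C" shows "is_functor C C (func_id C)"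
proof -
  interpret category C by fact
  show ?thesis by (rule is_functorI[OF assms]) (auto simp: hom_iff)
qed

lemma is_functor_comp:
  assumes "category C" "category D" "is_functor C D F" "is_functor D E G"
  shows "is_functor C E (func_comp C G F)"
proof -
  interpret C: category C by fact
  interpret D: category D by fact
  note F = functor_obj[OF assms(3)] functor_arr[OF assms(1,3)]
  note G = functor_obj[OF assms(4)] functor_arr[OF assms(2,4)]
  show ?thesis
  proof (rule is_functorI[OF assms(1)])
    fix X assume X: "X \<in> Obj C"
    then show "amap (func_comp C G F) (ide C X) = ide E (omap (func_comp C G F) X)"
      using functor_ide[OF assms(3) X] functor_ide[OF assms(4) F(1)[OF X]] by (simp add: compose_def)
  next
    fix X Y Z g f assume h: "g \<in> hom C Y Z" "f \<in> hom C X Y"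
    from functor_comp[OF assms(3) h] functor_comp[OF assms(4) functor_hom[OF assms(1,3) h(1)]
        functor_hom[OF assms(1,3) h(2)]]
    show "amap (func_comp C G F) (g \<cdot>\<^bsub>C\<^esub> f) = amap (func_comp C G F) g \<cdot>\<^bsub>E\<^esub> amap (func_comp C G F) f"
      using C.comp_hom[OF h] h by (simp add: compose_def hom_iff)
  qed (auto simp: compose_def F G hom_iff)
qed

lemma func_comp_id:
  assumes "category C" "category D" "is_functor C D F"
  shows "func_comp C F (func_id C) = F" "func_comp C (func_id D) F = F"
  using functor_obj[OF assms(3)] functor_arr[OF assms(1,3)]
  by (auto intro!: functor_eqI[OF is_functor_comp[OF assms(1,1) is_functor_id[OF assms(1)] assms(3)] assms(3)]
      functor_eqI[OF is_functor_comp[OF assms(1,2,3) is_functor_id[OF assms(2)]] assms(3)] simp: compose_def)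

lemma func_comp_assoc:
  assumes "category C" "category D" "is_functor C D F"
  shows "func_comp C (func_comp D H G) F = func_comp C H (func_comp C G F)"
  using functor_obj[OF assms(3)] functor_arr[OF assms(1,3)]
  by (simp add: func_comp_def compose_def fun_eq_iff restrict_def)

section \<open>Categories from families of hom-sets, full subcategories, arrow categories\<close>

lemma cat_of_homs_simps [simp]:
  "Obj (cat_of_homs Ob H i c) = Ob"
  "Arr (cat_of_homs Ob H i c) = {(X, f, Y). X \<in> Ob \<and> Y \<in> Ob \<and> f \<in> H X Y}"
  "\<lbrakk>X \<in> Ob; Y \<in> Ob; f \<in> H X Y\<rbrakk> \<Longrightarrow> Dom (cat_of_homs Ob H i c) (X, f, Y) = X"
  "\<lbrakk>X \<in> Ob; Y \<in> Ob; f \<in> H X Y\<rbrakk> \<Longrightarrow> Cod (cat_of_homs Ob H i c) (X, f, Y) = Y"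
  "X \<in> Ob \<Longrightarrow> ide (cat_of_homs Ob H i c) X = (X, i X, X)"
  "\<lbrakk>X \<in> Ob; Y \<in> Ob; Z \<in> Ob; f \<in> H X Y; g \<in> H Y Z\<rbrakk>
    \<Longrightarrow> Comp (cat_of_homs Ob H i c) (Y, g, Z) (X, f, Y) = (X, c X Y Z g f, Z)"
  by (auto simp: cat_of_homs_def Let_def)

lemma hom_cat_of_homs:
  "u \<in> hom (cat_of_homs Ob H i c) X Y \<longleftrightarrow> (\<exists>f. u = (X, f, Y) \<and> X \<in> Ob \<and> Y \<in> Ob \<and> f \<in> H X Y)"
  by (auto simp: hom_def)

lemma category_cat_of_homs:
  assumes i: "\<And>X. X \<in> Ob \<Longrightarrow> i X \<in> H X X"
    and c: "\<And>X Y Z f g. \<lbrakk>X \<in> Ob; Y \<in> Ob; Z \<in> Ob; f \<in> H X Y; g \<in> H Y Z\<rbrakk> \<Longrightarrow> c X Y Z g f \<in> H X Z"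
    and l: "\<And>X Y f. \<lbrakk>X \<in> Ob; Y \<in> Ob; f \<in> H X Y\<rbrakk> \<Longrightarrow> c X Y Y (i Y) f = f"
    and r: "\<And>X Y f. \<lbrakk>X \<in> Ob; Y \<in> Ob; f \<in> H X Y\<rbrakk> \<Longrightarrow> c X X Y f (i X) = f"
    and a: "\<And>W X Y Z f g h. \<lbrakk>W \<in> Ob; X \<in> Ob; Y \<in> Ob; Z \<in> Ob; f \<in> H W X; g \<in> H X Y; h \<in> H Y Z\<rbrakk>
        \<Longrightarrow> c W Y Z h (c W X Y g f) = c W X Z (c X Y Z h g) f"
  shows "category (cat_of_homs Ob H i c)" (is "category ?C")
proof
  \<comment> \<open>Typing follows from the rewrite rules for arrows. What remains is
    extensionality, and that needs the definition itself, because the rules say nothing off the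
    carriers.\<close>
  show "Dom ?C \<in> Arr ?C \<rightarrow>\<^sub>E Obj ?C" "Cod ?C \<in> Arr ?C \<rightarrow>\<^sub>E Obj ?C"
    by (auto simp: PiE_iff, auto simp: cat_of_homs_def Let_def)
  show "ide ?C \<in> (\<Pi>\<^sub>E X\<in>Obj ?C. hom ?C X X)"
    by (auto simp: PiE_iff hom_cat_of_homs i, auto simp: cat_of_homs_def Let_def)
  show "Comp ?C \<in> (\<Pi>\<^sub>E g\<in>Arr ?C. \<Pi>\<^sub>E f\<in>{f \<in> Arr ?C. Cod ?C f = Dom ?C g}. hom ?C (Dom ?C f) (Cod ?C g))"
  proof (intro PiE_I)
    fix u v assume "u \<in> Arr ?C" "v \<in> {f \<in> Arr ?C. Cod ?C f = Dom ?C u}"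
    then show "Comp ?C u v \<in> hom ?C (Dom ?C v) (Cod ?C u)"
      by (auto simp: hom_cat_of_homs c)
  next
    fix u v assume u: "u \<in> Arr ?C" "v \<notin> {f \<in> Arr ?C. Cod ?C f = Dom ?C u}"
    \<comment> \<open>The definition restricts composition by comparing tags, the axiom by comparing
      \<open>Cod\<close> and \<open>Dom\<close>. The two guards agree because \<open>u\<close> is an
      arrow.\<close>
    have "(v \<in> Arr ?C \<and> snd (snd v) = fst u) = (v \<in> Arr ?C \<and> Cod ?C v = Dom ?C u)"
      using u(1) by auto
    then show "Comp ?C u v = undefined"
      using u by (simp add: cat_of_homs_def Let_def split_beta split del: if_split) auto
  next
    fix u assume "u \<notin> Arr ?C"
    then show "Comp ?C u = undefined"
      by (auto simp: cat_of_homs_def Let_def)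
  qed
qed (auto simp: hom_cat_of_homs i c l r a)

lemma full_subcat_simps [simp]:
  "Obj (full_subcat C S) = Obj C \<inter> S"
  "Arr (full_subcat C S) = {f \<in> Arr C. Dom C f \<in> S \<and> Cod C f \<in> S}"
  "f \<in> Arr (full_subcat C S) \<Longrightarrow> Dom (full_subcat C S) f = Dom C f"
  "f \<in> Arr (full_subcat C S) \<Longrightarrow> Cod (full_subcat C S) f = Cod C f"
  "X \<in> Obj C \<inter> S \<Longrightarrow> ide (full_subcat C S) X = ide C X"
  "\<lbrakk>g \<in> Arr (full_subcat C S); f \<in> Arr (full_subcat C S); Cod C f = Dom C g\<rbrakk>
    \<Longrightarrow> Comp (full_subcat C S) g f = g \<cdot>\<^bsub>C\<^esub> f"
  by (auto simp: full_subcat_def Let_def)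

lemma hom_full_subcat: "u \<in> hom (full_subcat C S) X Y \<longleftrightarrow> u \<in> hom C X Y \<and> X \<in> S \<and> Y \<in> S"
  by (auto simp: hom_def full_subcat_def Let_def)

lemma category_full_subcat:
  assumes "category C" shows "category (full_subcat C S)" (is "category ?D")
proof -
  interpret category C by fact
  show ?thesis
  proof
    show "Dom ?D \<in> Arr ?D \<rightarrow>\<^sub>E Obj ?D" "Cod ?D \<in> Arr ?D \<rightarrow>\<^sub>E Obj ?D"
      "ide ?D \<in> (\<Pi>\<^sub>E X\<in>Obj ?D. hom ?D X X)"
      by (auto simp: PiE_iff hom_full_subcat ide_hom, auto simp: full_subcat_def Let_def)
    show "Comp ?D \<in> (\<Pi>\<^sub>E g\<in>Arr ?D. \<Pi>\<^sub>E f\<in>{f \<in> Arr ?D. Cod ?D f = Dom ?D g}. hom ?D (Dom ?D f) (Cod ?D g))"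
    proof (intro PiE_I)
      fix u v assume "u \<in> Arr ?D" "v \<in> {f \<in> Arr ?D. Cod ?D f = Dom ?D u}"
      then have "u \<in> Arr ?D" "v \<in> Arr ?D" "Cod C v = Dom C u"
        by (auto simp: full_subcat_def Let_def)
      then show "Comp ?D u v \<in> hom ?D (Dom ?D v) (Cod ?D u)"
        by (auto simp: hom_full_subcat hom_iff)
    qed (auto simp: full_subcat_def Let_def)
  qed (auto simp: hom_full_subcat hom_iff comp_assoc)
qed

lemma category_arrow_cat:
  assumes "category B" shows "category (arrow_cat B)"
proof -
  interpret category B by fact
  show ?thesis
    unfolding arrow_cat_def
  proof (rule category_cat_of_homs; clarsimp simp: hom_iff comp_assoc)
    fix X Y Z a b a' b'
    assume *: "X \<in> Arr B" "Y \<in> Arr B" "Z \<in> Arr B" "a \<in> Arr B" "b \<in> Arr B" "a' \<in> Arr B" "b' \<in> Arr B"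
      "b \<cdot>\<^bsub>B\<^esub> X = Y \<cdot>\<^bsub>B\<^esub> a" "b' \<cdot>\<^bsub>B\<^esub> Y = Z \<cdot>\<^bsub>B\<^esub> a'"
      "Dom B a = Dom B X" "Cod B a = Dom B Y" "Dom B b = Cod B X" "Cod B b = Cod B Y"
      "Dom B a' = Dom B Y" "Cod B a' = Dom B Z" "Dom B b' = Cod B Y" "Cod B b' = Cod B Z"
    have "b' \<cdot>\<^bsub>B\<^esub> Y \<cdot>\<^bsub>B\<^esub> a = (b' \<cdot>\<^bsub>B\<^esub> Y) \<cdot>\<^bsub>B\<^esub> a"
      using * by (intro comp_assoc[symmetric]) simp_all
    also have "\<dots> = Z \<cdot>\<^bsub>B\<^esub> a' \<cdot>\<^bsub>B\<^esub> a"
      unfolding *(9) using * by (intro comp_assoc) simp_all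
    finally show "b' \<cdot>\<^bsub>B\<^esub> Y \<cdot>\<^bsub>B\<^esub> a = Z \<cdot>\<^bsub>B\<^esub> a' \<cdot>\<^bsub>B\<^esub> a" .
  qed
qed

section \<open>Fully faithful functors over the base of a fibration\<close>

text \<open>The hypotheses concern \<open>K\<close> from \<open>E'\<close> to \<open>E\<close>,
  while \<open>\<Phi>\<close> goes from \<open>E\<close> to \<open>E'\<close> and is the
  quasi-inverse of \<open>K\<close> made from the chosen isomorphisms. Since these lie over
  identities, \<open>\<Phi>\<close> commutes with the projections on the nose. Only \<open>E\<close>
  is assumed to be a fibration: a lift in \<open>E'\<close> is obtained by transporting a lift in
  \<open>E\<close> back along the fully faithful \<open>K\<close>.\<close>

lemma ff_equivalence:
  assumes fib: "fibration E B p" and cE': "category E'" and fp': "is_functor E' B p'"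
    and fK: "is_functor E' E K" and tri: "func_comp E' p K = p'"
    and ff: "\<And>x y h. \<lbrakk>x \<in> Obj E'; y \<in> Obj E'; h \<in> hom E (omap K x) (omap K y)\<rbrakk>
        \<Longrightarrow> \<exists>!k. k \<in> hom E' x y \<and> amap K k = h"
    and ess: "\<And>e. e \<in> Obj E \<Longrightarrow> \<exists>e' i j. e' \<in> Obj E' \<and> i \<in> hom E e (omap K e') \<and> j \<in> hom E (omap K e') e \<and>
        j \<cdot>\<^bsub>E\<^esub> i = ide E e \<and> i \<cdot>\<^bsub>E\<^esub> j = ide E (omap K e') \<and> amap p i = ide B (omap p e)"
  shows "\<exists>\<Phi>. equivalence_of_fibrations B E p E' p' \<Phi>"
proof -
  from fib have cE: "category E" and cB: "category B" and fp: "is_functor E B p"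
    and lift: "\<And>e u. \<lbrakk>e \<in> Obj E; u \<in> Arr B; Cod B u = omap p e\<rbrakk> \<Longrightarrow> \<exists>f. cartesian E B p f \<and> Cod E f = e \<and> amap p f = u"
    by (auto simp: fibration_def)
  interpret E: category E by fact
  interpret E': category E' by fact
  interpret B: category B by fact
  \<comment> \<open>The object and the two mutually inverse arrows are chosen as one triple, so that
    they belong together.\<close>
  have "\<forall>e. \<exists>r. e \<in> Obj E \<longrightarrow> (case r of (e', i, j) \<Rightarrow> e' \<in> Obj E' \<and> i \<in> hom E e (omap K e') \<and> j \<in> hom E (omap K e') e \<and>
        j \<cdot>\<^bsub>E\<^esub> i = ide E e \<and> i \<cdot>\<^bsub>E\<^esub> j = ide E (omap K e') \<and> amap p i = ide B (omap p e))"
    using ess by fastforce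
  from choice[OF this] obtain r where r: "\<And>e. e \<in> Obj E \<Longrightarrow> (case r e of (e', i, j) \<Rightarrow> e' \<in> Obj E' \<and> i \<in> hom E e (omap K e') \<and> j \<in> hom E (omap K e') e \<and>
        j \<cdot>\<^bsub>E\<^esub> i = ide E e \<and> i \<cdot>\<^bsub>E\<^esub> j = ide E (omap K e') \<and> amap p i = ide B (omap p e))"
    by auto
  define L where "L e = fst (r e)" for e
  define i where "i e = fst (snd (r e))" for e
  define j where "j e = snd (snd (r e))" for e
  have L: "L e \<in> Obj E'" "i e \<in> hom E e (omap K (L e))" "j e \<in> hom E (omap K (L e)) e"
    "j e \<cdot>\<^bsub>E\<^esub> i e = ide E e" "i e \<cdot>\<^bsub>E\<^esub> j e = ide E (omap K (L e))" "amap p (i e) = ide B (omap p e)"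
    if "e \<in> Obj E" for e
    using r[OF that] by (auto simp: L_def i_def j_def split: prod.splits)
  have pK: "omap p (omap K x) = omap p' x" if "x \<in> Obj E'" for x
    using tri that by (metis compose_eq func_comp_simps(1))
  have pKa: "amap p (amap K f) = amap p' f" if "f \<in> Arr E'" for f
    using tri that by (metis compose_eq func_comp_simps(2))
  note Kh = functor_hom[OF cE' fK] and ph = functor_hom[OF cE fp] and Ko = functor_obj[OF fK]
    and po = functor_obj[OF fp]
  \<comment> \<open>The image of \<open>i e\<close> in the base is an identity, so its source and
    target agree there; the image of \<open>j e\<close> is inverse to an identity.\<close>
  have pL: "omap p' (L e) = omap p e" "amap p (j e) = ide B (omap p e)" if e: "e \<in> Obj E" for e
  proof -
    have h: "amap p (i e) \<in> hom B (omap p e) (omap p (omap K (L e)))" by (rule ph[OF L(2)[OF e]])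
    then have 1: "omap p (omap K (L e)) = omap p e"
      using L(6)[OF e] po[OF e] by (simp add: hom_iff)
    then show "omap p' (L e) = omap p e" using pK L(1)[OF e] by simp
    have "amap p (j e) \<cdot>\<^bsub>B\<^esub> amap p (i e) = ide B (omap p e)"
      using functor_comp[OF fp L(3)[OF e] L(2)[OF e]] L(4)[OF e] functor_ide[OF fp e] by simp
    moreover have "amap p (j e) \<in> hom B (omap p e) (omap p e)"
      using ph[OF L(3)[OF e]] 1 by simp
    ultimately show "amap p (j e) = ide B (omap p e)"
      using L(6)[OF e] by (simp add: hom_iff)
  qed
  have Kinj: "k = k'" if "k \<in> hom E' x y" "k' \<in> hom E' x y" "amap K k = amap K k'" for k k' x y
    using ff[of x y "amap K k"] that Kh[OF that(1)] E'.homD[OF that(1)] by metis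
  \<comment> \<open>\<open>K\<close> reflects cartesian arrows up to vertical isomorphisms
    \<open>s\<close> and \<open>t\<close> at the two ends. The general form serves twice: for
    \<open>\<Phi>\<close> with the chosen isomorphisms at both ends, and for lifts with an identity
    at the codomain.\<close>
  have Kcart: "cartesian E' B p' k \<and> amap p' k = amap p f"
    if k: "k \<in> hom E' x y" and f: "cartesian E B p f" and fh: "f \<in> hom E a b"
      and s: "s \<in> hom E a (omap K x)" "s' \<in> hom E (omap K x) a" "s' \<cdot>\<^bsub>E\<^esub> s = ide E a" "s \<cdot>\<^bsub>E\<^esub> s' = ide E (omap K x)"
        "amap p s = ide B (omap p a)" "amap p s' = ide B (omap p a)"
      and t: "t \<in> hom E b (omap K y)" "t' \<in> hom E (omap K y) b" "t' \<cdot>\<^bsub>E\<^esub> t = ide E b" "t \<cdot>\<^bsub>E\<^esub> t' = ide E (omap K y)"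
        "amap p t = ide B (omap p b)" "amap p t' = ide B (omap p b)"
      and eq: "amap K k = t \<cdot>\<^bsub>E\<^esub> f \<cdot>\<^bsub>E\<^esub> s'" for k x y f a b s s' t t'
  proof -
    note H = E.homD[OF fh] E.homD[OF s(1)] E.homD[OF s(2)] E.homD[OF t(1)] E.homD[OF t(2)] E'.homD[OF k]
    have px: "omap p' x = omap p a" 
      using ph[OF s(1)] s(5) pK[OF H(29)] po[OF H(4)] by (auto simp: hom_iff)
    have py: "omap p' y = omap p b"
      using ph[OF t(1)] t(5) pK[OF H(30)] po[OF H(5)] by (auto simp: hom_iff)
    have pf: "amap p f \<in> hom B (omap p a) (omap p b)" by (rule ph[OF fh])
    have pk: "amap p' k = amap p f"
      using pKa[OF H(26)] eq functor_comp[OF fp t(1) E.comp_hom[OF fh s(2)]] functor_comp[OF fp fh s(2)] s(6) t(5)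
        B.homD[OF pf] by simp
    have "cartesian E' B p' k"
      unfolding cartesian_def
    proof (intro conjI ballI impI)
      show "k \<in> Arr E'" by (rule H)
      fix g w assume g: "g \<in> Arr E'" and w: "w \<in> hom B (omap p' (Dom E' g)) (omap p' (Dom E' k))"
        and gw: "Cod E' g = Cod E' k \<and> amap p' k \<cdot>\<^bsub>B\<^esub> w = amap p' g"
      define z where "z = Dom E' g"
      have gh: "g \<in> hom E' z y" using g gw H z_def by (simp add: hom_iff)
      have zO: "z \<in> Obj E'" using g z_def by simp
      note Kg = Kh[OF gh]
      \<comment> \<open>The test arrow \<open>K g\<close> is moved by \<open>t'\<close> to the
        codomain of \<open>f\<close>. There it factors through \<open>f\<close> by some
        \<open>m\<close>; then \<open>s\<close> brings \<open>m\<close> into the image of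
        \<open>K\<close>, and fullness gives the factorisation of \<open>g\<close>. Uniqueness runs
        the same way back.\<close>
      have th: "t' \<cdot>\<^bsub>E\<^esub> amap K g \<in> hom E (omap K z) b" by (rule E.comp_hom[OF t(2) Kg])
      have w': "w \<in> hom B (omap p (omap K z)) (omap p a)"
        using w H px pK[OF zO] z_def by simp
      have "amap p (t' \<cdot>\<^bsub>E\<^esub> amap K g) = amap p' g"
        using functor_comp[OF fp t(2) Kg] t(6) pKa[OF g] ph[OF Kg] pK[OF H(30)] py by (simp add: hom_iff)
      then have "\<exists>!m. m \<in> hom E (Dom E (t' \<cdot>\<^bsub>E\<^esub> amap K g)) (Dom E f) \<and> amap p m = w \<and> f \<cdot>\<^bsub>E\<^esub> m = t' \<cdot>\<^bsub>E\<^esub> amap K g"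
        using w' gw pk E.homD[OF th] E.homD[OF fh]
        by (intro conjunct2[OF f[unfolded cartesian_def], rule_format, of "t' \<cdot>\<^bsub>E\<^esub> amap K g" w]) simp_all
      then have ex: "\<exists>!m. m \<in> hom E (omap K z) a \<and> amap p m = w \<and> f \<cdot>\<^bsub>E\<^esub> m = t' \<cdot>\<^bsub>E\<^esub> amap K g"
        using th fh by (simp add: hom_iff)
      then obtain m where m: "m \<in> hom E (omap K z) a" "amap p m = w" "f \<cdot>\<^bsub>E\<^esub> m = t' \<cdot>\<^bsub>E\<^esub> amap K g" by auto
      obtain n where n: "n \<in> hom E' z x" "amap K n = s \<cdot>\<^bsub>E\<^esub> m"
        using ff[OF zO H(29) E.comp_hom[OF s(1) m(1)]] by auto
      note Hm = E.homD[OF m(1)] E.homD[OF Kg]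
      have a1: "amap p' n = w"
        using pKa[of n] n functor_comp[OF fp s(1) m(1)] s(5) m(2) w' by (simp add: hom_iff)
      have a2: "k \<cdot>\<^bsub>E'\<^esub> n = g"
      proof (rule Kinj[OF E'.comp_hom[OF k n(1)] gh])
        have "amap K (k \<cdot>\<^bsub>E'\<^esub> n) = (t \<cdot>\<^bsub>E\<^esub> f \<cdot>\<^bsub>E\<^esub> s') \<cdot>\<^bsub>E\<^esub> (s \<cdot>\<^bsub>E\<^esub> m)"
          using functor_comp[OF fK k n(1)] eq n(2) by simp
        also have "\<dots> = t \<cdot>\<^bsub>E\<^esub> f \<cdot>\<^bsub>E\<^esub> (s' \<cdot>\<^bsub>E\<^esub> s) \<cdot>\<^bsub>E\<^esub> m"
          using H Hm by (simp add: E.comp_assoc del: s(3))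
        also have "\<dots> = t \<cdot>\<^bsub>E\<^esub> (t' \<cdot>\<^bsub>E\<^esub> amap K g)"
          using s(3) m H Hm by simp
        also have "\<dots> = (t \<cdot>\<^bsub>E\<^esub> t') \<cdot>\<^bsub>E\<^esub> amap K g"
          using H Hm by (subst E.comp_assoc) auto
        also have "\<dots> = amap K g" using t(4) Hm by simp
        finally show "amap K (k \<cdot>\<^bsub>E'\<^esub> n) = amap K g" .
      qed
      show "\<exists>!n. n \<in> hom E' (Dom E' g) (Dom E' k) \<and> amap p' n = w \<and> k \<cdot>\<^bsub>E'\<^esub> n = g"
      proof (rule ex1I[of _ n])
        show "n \<in> hom E' (Dom E' g) (Dom E' k) \<and> amap p' n = w \<and> k \<cdot>\<^bsub>E'\<^esub> n = g"
          using n a1 a2 z_def H by simp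
        fix n' assume "n' \<in> hom E' (Dom E' g) (Dom E' k) \<and> amap p' n' = w \<and> k \<cdot>\<^bsub>E'\<^esub> n' = g"
        then have n': "n' \<in> hom E' z x" "amap p' n' = w" "k \<cdot>\<^bsub>E'\<^esub> n' = g" using z_def H by auto
        note Kn' = Kh[OF n'(1)]
        have q1: "s' \<cdot>\<^bsub>E\<^esub> amap K n' \<in> hom E (omap K z) a" by (rule E.comp_hom[OF s(2) Kn'])
        have q2: "amap p (s' \<cdot>\<^bsub>E\<^esub> amap K n') = w"
          using functor_comp[OF fp s(2) Kn'] s(6) pKa[of n'] n' w' by (simp add: hom_iff)
        have "amap K g = (t \<cdot>\<^bsub>E\<^esub> f \<cdot>\<^bsub>E\<^esub> s') \<cdot>\<^bsub>E\<^esub> amap K n'"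
          using functor_comp[OF fK k n'(1)] eq n'(3) by simp
        then have "t' \<cdot>\<^bsub>E\<^esub> amap K g = (t' \<cdot>\<^bsub>E\<^esub> t) \<cdot>\<^bsub>E\<^esub> f \<cdot>\<^bsub>E\<^esub> s' \<cdot>\<^bsub>E\<^esub> amap K n'"
          using H E.homD[OF Kn'] by (simp add: E.comp_assoc del: t(3))
        then have q3: "f \<cdot>\<^bsub>E\<^esub> (s' \<cdot>\<^bsub>E\<^esub> amap K n') = t' \<cdot>\<^bsub>E\<^esub> amap K g"
          using t(3) H E.homD[OF Kn'] by simp
        have "s' \<cdot>\<^bsub>E\<^esub> amap K n' = m" using ex q1 q2 q3 m by blast
        then have "amap K n = (s \<cdot>\<^bsub>E\<^esub> s') \<cdot>\<^bsub>E\<^esub> amap K n'"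
          using n(2) H E.homD[OF Kn'] by (simp add: E.comp_assoc del: s(4))
        then have "amap K n = amap K n'" using s(4) E.homD[OF Kn'] by simp
        then show "n' = n" using Kinj[OF n(1) n'(1)] by simp
      qed
    qed
    then show ?thesis using pk by simp
  qed
  \<comment> \<open>The preimage under \<open>K\<close> of \<open>f\<close> conjugated by the chosen
    isomorphisms; full faithfulness makes the description definite.\<close>
  define \<Phi> where "\<Phi> = \<lparr>omap = (\<lambda>e\<in>Obj E. L e),
     amap = (\<lambda>f\<in>Arr E. THE k. k \<in> hom E' (L (Dom E f)) (L (Cod E f)) \<and> amap K k = i (Cod E f) \<cdot>\<^bsub>E\<^esub> f \<cdot>\<^bsub>E\<^esub> j (Dom E f))\<rparr>"
  have \<Phi>o: "omap \<Phi> e = L e" if "e \<in> Obj E" for e using that by (simp add: \<Phi>_def)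
  have \<Phi>a: "amap \<Phi> f \<in> hom E' (L a) (L b) \<and> amap K (amap \<Phi> f) = i b \<cdot>\<^bsub>E\<^esub> f \<cdot>\<^bsub>E\<^esub> j a" if f: "f \<in> hom E a b" for f a b
  proof -
    note H = E.homD[OF f]
    have "i b \<cdot>\<^bsub>E\<^esub> f \<cdot>\<^bsub>E\<^esub> j a \<in> hom E (omap K (L a)) (omap K (L b))"
      by (rule E.comp_hom[OF L(2)[OF H(5)] E.comp_hom[OF f L(3)[OF H(4)]]])
    from theI'[OF ff[OF L(1)[OF H(4)] L(1)[OF H(5)] this]] show ?thesis
      using H by (simp add: \<Phi>_def)
  qed
  note \<Phi>h = \<Phi>a[THEN conjunct1] and K\<Phi> = \<Phi>a[THEN conjunct2]
  have f\<Phi>: "is_functor E E' \<Phi>"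
  proof (rule is_functorI[OF cE])
    fix x assume x: "x \<in> Obj E"
    have xi: "ide E x \<in> hom E x x" using x by (rule E.ide_hom)
    show "amap \<Phi> (ide E x) = ide E' (omap \<Phi> x)"
    proof (rule Kinj[OF \<Phi>h[OF xi]])
      show "ide E' (omap \<Phi> x) \<in> hom E' (L x) (L x)" using x L(1) \<Phi>o by (simp add: E'.ide_hom)
      show "amap K (amap \<Phi> (ide E x)) = amap K (ide E' (omap \<Phi> x))"
        using K\<Phi>[OF xi] functor_ide[OF fK L(1)[OF x]] E.homD[OF L(3)[OF x]] L(5)[OF x] x \<Phi>o by simp
    qed
  next
    fix X Y Z g f assume g: "g \<in> hom E Y Z" and f: "f \<in> hom E X Y"
    note H = E.homD[OF g] E.homD[OF f] 
    note I = E.homD[OF L(2)[OF H(4)]] E.homD[OF L(2)[OF H(5)]] E.homD[OF L(3)[OF H(4)]] E.homD[OF L(3)[OF H(9)]]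
    show "amap \<Phi> (g \<cdot>\<^bsub>E\<^esub> f) = amap \<Phi> g \<cdot>\<^bsub>E'\<^esub> amap \<Phi> f"
    proof (rule Kinj[OF \<Phi>h[OF E.comp_hom[OF g f]] E'.comp_hom[OF \<Phi>h[OF g] \<Phi>h[OF f]]])
      have "amap K (amap \<Phi> g \<cdot>\<^bsub>E'\<^esub> amap \<Phi> f) = (i Z \<cdot>\<^bsub>E\<^esub> g \<cdot>\<^bsub>E\<^esub> j Y) \<cdot>\<^bsub>E\<^esub> (i Y \<cdot>\<^bsub>E\<^esub> f \<cdot>\<^bsub>E\<^esub> j X)"
        using functor_comp[OF fK \<Phi>h[OF g] \<Phi>h[OF f]] K\<Phi>[OF g] K\<Phi>[OF f] by simp
      also have "\<dots> = i Z \<cdot>\<^bsub>E\<^esub> g \<cdot>\<^bsub>E\<^esub> (j Y \<cdot>\<^bsub>E\<^esub> i Y) \<cdot>\<^bsub>E\<^esub> f \<cdot>\<^bsub>E\<^esub> j X"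
        using H I by (simp add: E.comp_assoc)
      also have "\<dots> = i Z \<cdot>\<^bsub>E\<^esub> (g \<cdot>\<^bsub>E\<^esub> f) \<cdot>\<^bsub>E\<^esub> j X"
        using L(4)[OF H(4)] H I by (simp add: E.comp_assoc)
      finally show "amap K (amap \<Phi> (g \<cdot>\<^bsub>E\<^esub> f)) = amap K (amap \<Phi> g \<cdot>\<^bsub>E'\<^esub> amap \<Phi> f)"
        using K\<Phi>[OF E.comp_hom[OF g f]] by simp
    qed
  next
    fix X Y f assume f: "f \<in> hom E X Y"
    show "amap \<Phi> f \<in> hom E' (omap \<Phi> X) (omap \<Phi> Y)"
      using \<Phi>h[OF f] E.homD[OF f] \<Phi>o by simp
  qed (auto simp: \<Phi>_def L)
  have p\<Phi>: "amap p' (amap \<Phi> f) = amap p f" if f: "f \<in> hom E a b" for f a b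
  proof -
    note H = E.homD[OF f]
    show ?thesis
      using pKa[of "amap \<Phi> f"] \<Phi>h[OF f] K\<Phi>[OF f] functor_comp[OF fp L(2)[OF H(5)] E.comp_hom[OF f L(3)[OF H(4)]]]
        functor_comp[OF fp f L(3)[OF H(4)]] L(6)[OF H(5)] pL(2)[OF H(4)] ph[OF f] by (simp add: hom_iff)
  qed
  have tri\<Phi>: "func_comp E p' \<Phi> = p"
    by (rule functor_eqI[OF is_functor_comp[OF cE cE' f\<Phi> fp'] fp])
      (auto simp: compose_def \<Phi>o pL p\<Phi>[OF E.arr_hom])
  have cart: "cartesian E' B p' (amap \<Phi> f)" if f: "cartesian E B p f" for f
  proof -
    have fA: "f \<in> Arr E" using f by (simp add: cartesian_def)
    define a b where "a = Dom E f" "b = Cod E f"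
    have fh: "f \<in> hom E a b" and ab: "a \<in> Obj E" "b \<in> Obj E" using fA by (simp_all add: a_b_def hom_iff)
    show ?thesis
      using Kcart[OF \<Phi>h[OF fh] f fh L(2)[OF ab(1)] L(3)[OF ab(1)] L(4)[OF ab(1)] L(5)[OF ab(1)] L(6)[OF ab(1)] pL(2)[OF ab(1)]
          L(2)[OF ab(2)] L(3)[OF ab(2)] L(4)[OF ab(2)] L(5)[OF ab(2)] L(6)[OF ab(2)] pL(2)[OF ab(2)] K\<Phi>[OF fh]] by simp
  qed
  have fib': "fibration E' B p'"
    unfolding fibration_def
  proof (intro conjI ballI impI cE' cB fp')
    fix y u assume y: "y \<in> Obj E'" and u: "u \<in> Arr B" "Cod B u = omap p' y"
    \<comment> \<open>The lift is taken at \<open>K y\<close> itself, so the vertical isomorphism at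
      the codomain can be the identity and the transported lift ends exactly at
      \<open>y\<close>.\<close>
    obtain f where f: "cartesian E B p f" "Cod E f = omap K y" "amap p f = u"
      using lift[of "omap K y" u] Ko[OF y] u pK[OF y] by auto
    define a where "a = Dom E f"
    have fh: "f \<in> hom E a (omap K y)" using f by (simp add: a_def hom_iff cartesian_def)
    note H = E.homD[OF fh]
    obtain k where k: "k \<in> hom E' (L a) y" "amap K k = f \<cdot>\<^bsub>E\<^esub> j a"
      using ff[OF L(1)[OF H(4)] y E.comp_hom[OF fh L(3)[OF H(4)]]] by auto
    have t: "ide E (omap K y) \<in> hom E (omap K y) (omap K y)" using Ko[OF y] by (rule E.ide_hom)
    have "cartesian E' B p' k \<and> amap p' k = amap p f"
      using H E.homD[OF L(3)[OF H(4)]] k(2) functor_ide[OF fp Ko[OF y]]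
      by (intro Kcart[OF k(1) f(1) fh L(2)[OF H(4)] L(3)[OF H(4)] L(4)[OF H(4)] L(5)[OF H(4)] L(6)[OF H(4)] pL(2)[OF H(4)] t t]) simp_all
    then show "\<exists>f. cartesian E' B p' f \<and> Cod E' f = y \<and> amap p' f = u"
      using k f E'.homD[OF k(1)] by auto
  qed
  have isoE: "iso_arrow E (j e)" if "e \<in> Obj E" for e
    unfolding iso_arrow_def using L[OF that] by (auto simp: hom_iff intro!: bexI[of _ "i e"])
  have nat1: "naturally_isomorphic E E (func_comp E K \<Phi>) (func_id E)"
    unfolding naturally_isomorphic_def
  proof (intro exI[of _ j] conjI ballI)
    fix f assume f: "f \<in> Arr E"
    note F = E.arr_hom[OF f] and O = E.Dom_Obj[OF f] E.Cod_Obj[OF f]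
    note I = E.homD[OF L(2)[OF O(1)]] E.homD[OF L(3)[OF O(1)]] E.homD[OF L(2)[OF O(2)]] E.homD[OF L(3)[OF O(2)]]
    have "j (Cod E f) \<cdot>\<^bsub>E\<^esub> (i (Cod E f) \<cdot>\<^bsub>E\<^esub> f \<cdot>\<^bsub>E\<^esub> j (Dom E f)) = (j (Cod E f) \<cdot>\<^bsub>E\<^esub> i (Cod E f)) \<cdot>\<^bsub>E\<^esub> f \<cdot>\<^bsub>E\<^esub> j (Dom E f)"
      using f I by (simp add: E.comp_assoc)
    then show "amap (func_id E) f \<cdot>\<^bsub>E\<^esub> j (Dom E f) = j (Cod E f) \<cdot>\<^bsub>E\<^esub> amap (func_comp E K \<Phi>) f"
      using f K\<Phi>[OF F] L(4)[OF O(2)] I by (simp add: compose_def)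
  qed (auto simp: compose_def \<Phi>o isoE L)
  have nat2: "naturally_isomorphic E' E' (func_comp E' \<Phi> K) (func_id E')"
  proof -
    \<comment> \<open>The second natural isomorphism is the preimage under \<open>K\<close> of the
      first one, and its inverse is the preimage of \<open>i\<close>.\<close>
    have "\<forall>x\<in>Obj E'. \<exists>k. k \<in> hom E' (L (omap K x)) x \<and> amap K k = j (omap K x)"
      using ff L(1,3) Ko by blast
    from bchoice[OF this] obtain k where k: "\<And>x. x \<in> Obj E' \<Longrightarrow> k x \<in> hom E' (L (omap K x)) x \<and> amap K (k x) = j (omap K x)" by auto
    have "\<forall>x\<in>Obj E'. \<exists>k. k \<in> hom E' x (L (omap K x)) \<and> amap K k = i (omap K x)"
      using ff L(1,2) Ko by blast
    from bchoice[OF this] obtain l where l: "\<And>x. x \<in> Obj E' \<Longrightarrow> l x \<in> hom E' x (L (omap K x)) \<and> amap K (l x) = i (omap K x)" by auto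
    have kl: "k x \<cdot>\<^bsub>E'\<^esub> l x = ide E' x" "l x \<cdot>\<^bsub>E'\<^esub> k x = ide E' (L (omap K x))" if x: "x \<in> Obj E'" for x
    proof -
      note kx = k[OF x, THEN conjunct1] and lx = l[OF x, THEN conjunct1]
      show "k x \<cdot>\<^bsub>E'\<^esub> l x = ide E' x"
        by (rule Kinj[OF E'.comp_hom[OF kx lx] E'.ide_hom[OF x]])
          (simp add: functor_comp[OF fK kx lx] k[OF x] l[OF x] L(4)[OF Ko[OF x]] functor_ide[OF fK x])
      show "l x \<cdot>\<^bsub>E'\<^esub> k x = ide E' (L (omap K x))"
        using L(1)[OF Ko[OF x]]
        by (intro Kinj[OF E'.comp_hom[OF lx kx] E'.ide_hom])
          (simp_all add: functor_comp[OF fK lx kx] k[OF x] l[OF x] L(5)[OF Ko[OF x]] functor_ide[OF fK])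
    qed
    show ?thesis
      unfolding naturally_isomorphic_def
    proof (intro exI[of _ k] conjI ballI)
      fix x assume x: "x \<in> Obj E'"
      show "k x \<in> hom E' (omap (func_comp E' \<Phi> K) x) (omap (func_id E') x)"
        using k[OF x] x Ko[OF x] by (simp add: compose_def \<Phi>o)
      show "iso_arrow E' (k x)"
        unfolding iso_arrow_def using k[OF x] l[OF x] kl[OF x] by (auto simp: hom_iff intro!: bexI[of _ "l x"])
    next
      fix f assume f: "f \<in> Arr E'"
      define a b where "a = Dom E' f" "b = Cod E' f"
      have fh: "f \<in> hom E' a b" and ab: "a \<in> Obj E'" "b \<in> Obj E'" using f by (simp_all add: a_b_def hom_iff)
      note ka = k[OF ab(1), THEN conjunct1] and kb = k[OF ab(2), THEN conjunct1]
      note Kf = Kh[OF fh] and oa = Ko[OF ab(1)] and ob = Ko[OF ab(2)]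
      note I = E.homD[OF L(2)[OF ob]] E.homD[OF L(3)[OF ob]] E.homD[OF L(3)[OF oa]] E.homD[OF Kf]
      have "f \<cdot>\<^bsub>E'\<^esub> k a = k b \<cdot>\<^bsub>E'\<^esub> amap \<Phi> (amap K f)"
      proof (rule Kinj[OF E'.comp_hom[OF fh ka] E'.comp_hom[OF kb \<Phi>h[OF Kf]]])
        have "j (omap K b) \<cdot>\<^bsub>E\<^esub> (i (omap K b) \<cdot>\<^bsub>E\<^esub> amap K f \<cdot>\<^bsub>E\<^esub> j (omap K a)) = (j (omap K b) \<cdot>\<^bsub>E\<^esub> i (omap K b)) \<cdot>\<^bsub>E\<^esub> amap K f \<cdot>\<^bsub>E\<^esub> j (omap K a)"
          using I by (simp add: E.comp_assoc)
        then show "amap K (f \<cdot>\<^bsub>E'\<^esub> k a) = amap K (k b \<cdot>\<^bsub>E'\<^esub> amap \<Phi> (amap K f))"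
          using functor_comp[OF fK fh ka] functor_comp[OF fK kb \<Phi>h[OF Kf]] k[OF ab(1)] k[OF ab(2)] K\<Phi>[OF Kf] L(4)[OF ob] I
          by simp
      qed
      then show "amap (func_id E') f \<cdot>\<^bsub>E'\<^esub> k (Dom E' f) = k (Cod E' f) \<cdot>\<^bsub>E'\<^esub> amap (func_comp E' \<Phi> K) f"
        using f by (simp add: compose_def a_b_def)
    qed
  qed
  have "is_equivalence E E' \<Phi>"
    unfolding is_equivalence_def using f\<Phi> fK nat1 nat2 by auto
  then show ?thesis
    unfolding equivalence_of_fibrations_def using fib fib' tri\<Phi> cart by auto
qed

section \<open>The Grothendieck construction\<close>

text \<open>Reindexing is functorial as an equation between functors, not up to isomorphism. This is
  what makes composition in the total category associative and unital without coherence
  data.\<close>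

locale indexed_category =
  fixes B :: "('b, 'g) cat" and I :: "('b, 'g, 'x, 't) indexed"
  assumes base: "category B"
    and fibre_category: "b \<in> Obj B \<Longrightarrow> category (fibre I b)"
    and reindex_functor: "g \<in> hom B b b' \<Longrightarrow> is_functor (fibre I b') (fibre I b) (reindex I g)"
    and reindex_ide: "b \<in> Obj B \<Longrightarrow> reindex I (ide B b) = func_id (fibre I b)"
    and reindex_comp: "\<lbrakk>g \<in> hom B b b'; h \<in> hom B b' b''\<rbrakk>
      \<Longrightarrow> reindex I (h \<cdot>\<^bsub>B\<^esub> g) = func_comp (fibre I b'') (reindex I g) (reindex I h)"
begin

interpretation B: category B by (rule base)

lemma reindex_comp_obj:
  assumes "g \<in> hom B b b'" "h \<in> hom B b' b''" "x \<in> Obj (fibre I b'')"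
  shows "omap (reindex I (h \<cdot>\<^bsub>B\<^esub> g)) x = omap (reindex I g) (omap (reindex I h) x)"
  using assms by (simp add: reindex_comp compose_def)

lemma reindex_comp_arr:
  assumes "g \<in> hom B b b'" "h \<in> hom B b' b''" "t \<in> Arr (fibre I b'')"
  shows "amap (reindex I (h \<cdot>\<^bsub>B\<^esub> g)) t = amap (reindex I g) (amap (reindex I h) t)"
  using assms by (simp add: reindex_comp compose_def)

lemma reindex_hom:
  assumes "g \<in> hom B b b'" "t \<in> hom (fibre I b') x y"
  shows "amap (reindex I g) t \<in> hom (fibre I b) (omap (reindex I g) x) (omap (reindex I g) y)"
  using functor_hom[OF fibre_category reindex_functor[OF assms(1)] assms(2)] B.homD[OF assms(1)] by simp

lemma reindex_obj:
  assumes "g \<in> hom B b b'" "x \<in> Obj (fibre I b')"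
  shows "omap (reindex I g) x \<in> Obj (fibre I b)"
  using functor_obj[OF reindex_functor[OF assms(1)] assms(2)] .

lemma category_grothendieck: "category (grothendieck B I)"
  unfolding grothendieck_def
proof (rule category_cat_of_homs; clarify)
  fix b x assume "b \<in> Obj B" "x \<in> Obj (fibre I b)"
  then show "ide B b \<in> hom B b b \<and> ide (fibre I b) x \<in> hom (fibre I b) x (omap (reindex I (ide B b)) x)"
    using B.ide_hom category.ide_hom[OF fibre_category] by (simp add: reindex_ide)
next
  fix b x b' x' b'' x'' g t h u
  assume o: "x'' \<in> Obj (fibre I b'')"
    and g: "g \<in> hom B b b'" "t \<in> hom (fibre I b) x (omap (reindex I g) x')"
    and h: "h \<in> hom B b' b''" "u \<in> hom (fibre I b') x' (omap (reindex I h) x'')"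
  note H = B.homD[OF g(1)]
  interpret F: category "fibre I b" by (rule fibre_category) (rule H)
  show "h \<cdot>\<^bsub>B\<^esub> g \<in> hom B b b'' \<and> amap (reindex I g) u \<cdot>\<^bsub>fibre I b\<^esub> t \<in> hom (fibre I b) x (omap (reindex I (h \<cdot>\<^bsub>B\<^esub> g)) x'')"
    unfolding reindex_comp_obj[OF g(1) h(1) o]
    using B.comp_hom[OF h(1) g(1)] F.comp_hom[OF reindex_hom[OF g(1) h(2)] g(2)] by simp
next
  fix b x b' x' g t
  assume o: "x' \<in> Obj (fibre I b')" and g: "g \<in> hom B b b'" "t \<in> hom (fibre I b) x (omap (reindex I g) x')"
  note H = B.homD[OF g(1)]
  interpret F: category "fibre I b" by (rule fibre_category) (rule H)
  show "ide B b' \<cdot>\<^bsub>B\<^esub> g = g \<and> amap (reindex I g) (ide (fibre I b') x') \<cdot>\<^bsub>fibre I b\<^esub> t = t"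
    using functor_ide[OF reindex_functor[OF g(1)] o] F.homD[OF g(2)] H by simp
next
  fix b x b' x' g t
  assume o: "x \<in> Obj (fibre I b)" and g: "g \<in> hom B b b'" "t \<in> hom (fibre I b) x (omap (reindex I g) x')"
  note H = B.homD[OF g(1)]
  interpret F: category "fibre I b" by (rule fibre_category) (rule H)
  show "g \<cdot>\<^bsub>B\<^esub> ide B b = g \<and> amap (reindex I (ide B b)) t \<cdot>\<^bsub>fibre I b\<^esub> ide (fibre I b) x = t"
    using F.homD[OF g(2)] H by (simp add: reindex_ide)
next
  fix b x b' x' b'' x'' b''' x''' g t h u k v
  assume g: "g \<in> hom B b b'" "t \<in> hom (fibre I b) x (omap (reindex I g) x')"
    and h: "h \<in> hom B b' b''" "u \<in> hom (fibre I b') x' (omap (reindex I h) x'')"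
    and k: "k \<in> hom B b'' b'''" "v \<in> hom (fibre I b'') x'' (omap (reindex I k) x''')"
  note H = B.homD[OF g(1)] B.homD[OF h(1)] B.homD[OF k(1)]
  interpret F: category "fibre I b" by (rule fibre_category) (rule H)
  interpret F': category "fibre I b'" by (rule fibre_category) (rule H)
  interpret F'': category "fibre I b''" by (rule fibre_category) (rule H)
  note kv = reindex_hom[OF h(1) k(2)]
  note 1 = functor_comp[OF reindex_functor[OF g(1)] kv h(2)]
  note 2 = F.homD[OF g(2)] F.homD[OF reindex_hom[OF g(1) h(2)]] F.homD[OF reindex_hom[OF g(1) kv]]
  show "k \<cdot>\<^bsub>B\<^esub> h \<cdot>\<^bsub>B\<^esub> g = (k \<cdot>\<^bsub>B\<^esub> h) \<cdot>\<^bsub>B\<^esub> g \<and>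
       amap (reindex I (h \<cdot>\<^bsub>B\<^esub> g)) v \<cdot>\<^bsub>fibre I b\<^esub> amap (reindex I g) u \<cdot>\<^bsub>fibre I b\<^esub> t =
       amap (reindex I g) (amap (reindex I h) v \<cdot>\<^bsub>fibre I b'\<^esub> u) \<cdot>\<^bsub>fibre I b\<^esub> t"
    unfolding 1 reindex_comp_arr[OF g(1) h(1) F''.homD(1)[OF k(2)]]
    using H 2 by (simp add: B.comp_assoc F.comp_assoc)
qed

text \<open>The lift of \<open>u\<close> at \<open>(b', x')\<close> has an identity as its fibre
  component. Composing with it changes only the base component, so a factorisation through it is
  forced in both components.\<close>

lemma fibration_grothendieck: "fibration (grothendieck B I) B (grothendieck_proj B I)"
proof -
  let ?E = "grothendieck B I" and ?p = "grothendieck_proj B I"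
  note E = category_grothendieck
  interpret E: category ?E by (rule E)
  have pf: "is_functor ?E B ?p"
  proof (rule is_functorI[OF E])
    show "omap ?p \<in> extensional (Obj ?E)" "amap ?p \<in> extensional (Arr ?E)"
      by (simp_all add: grothendieck_proj_def)
  next
    fix X assume X: "X \<in> Obj ?E"
    then show "omap ?p X \<in> Obj B" by (auto simp: grothendieck_proj_def) (auto simp: grothendieck_def)
    have "ide ?E X = (X, (ide B (fst X), ide (fibre I (fst X)) (snd X)), X)"
      using X by (auto simp: grothendieck_def)
    with E.ide_arr(1)[OF X] X show "amap ?p (ide ?E X) = ide B (omap ?p X)"
      by (auto simp: grothendieck_proj_def split_beta)
  next
    fix X Y f assume f: "f \<in> hom ?E X Y"
    note H = E.homD[OF f]
    from f obtain g t where "f = (X, (g, t), Y)" "g \<in> hom B (fst X) (fst Y)"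
      by (auto simp: grothendieck_def hom_cat_of_homs)
    with H show "amap ?p f \<in> hom B (omap ?p X) (omap ?p Y)"
      by (auto simp: grothendieck_proj_def split_beta)
  next
    fix X Y Z g f assume g: "g \<in> hom ?E Y Z" and f: "f \<in> hom ?E X Y"
    note H = E.homD[OF E.comp_hom[OF g f]] E.homD[OF g] E.homD[OF f]
    from g f obtain g1 g2 f1 f2 where *: "g = (Y, (g1, g2), Z)" "f = (X, (f1, f2), Y)"
      by (auto simp: hom_cat_of_homs grothendieck_def)
    with g f have "fst (fst (snd (g \<cdot>\<^bsub>?E\<^esub> f))) = g1 \<cdot>\<^bsub>B\<^esub> f1"
      by (auto simp: hom_cat_of_homs grothendieck_def)
    then show "amap ?p (g \<cdot>\<^bsub>?E\<^esub> f) = amap ?p g \<cdot>\<^bsub>B\<^esub> amap ?p f"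
      using H by (simp add: grothendieck_proj_def split_beta *)
  qed
  show ?thesis
    unfolding fibration_def
  proof (intro conjI ballI impI E base pf)
    fix e u assume e: "e \<in> Obj ?E" and u: "u \<in> Arr B" "Cod B u = omap ?p e"
    obtain b' x' where ex: "e = (b', x')" by (cases e)
    then have b': "b' \<in> Obj B" "x' \<in> Obj (fibre I b')" "Cod B u = b'"
      using e u by (auto simp: grothendieck_def grothendieck_proj_def)
    define b where "b = Dom B u"
    have uh: "u \<in> hom B b b'" and b: "b \<in> Obj B" using u b' by (auto simp: b_def hom_iff)
    define y where "y = omap (reindex I u) x'"
    have y: "y \<in> Obj (fibre I b)" unfolding y_def by (rule reindex_obj[OF uh b'(2)])
    define f where "f = ((b, y), (u, ide (fibre I b) y), (b', x'))"
    have fh: "f \<in> hom ?E (b, y) (b', x')"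
      using b b' uh y category.ide_hom[OF fibre_category[OF b] y]
      by (auto simp: f_def grothendieck_def hom_cat_of_homs y_def)
    have pu: "amap ?p f = u"
      using E.homD(1)[OF fh] by (simp add: grothendieck_proj_def f_def)
    have "cartesian ?E B ?p f"
      unfolding cartesian_def
    proof (intro conjI ballI impI)
      show "f \<in> Arr ?E" using fh by (simp add: hom_iff)
      fix g w assume g: "g \<in> Arr ?E" and w: "w \<in> hom B (omap ?p (Dom ?E g)) (omap ?p (Dom ?E f))"
        and gw: "Cod ?E g = Cod ?E f \<and> amap ?p f \<cdot>\<^bsub>B\<^esub> w = amap ?p g"
      obtain c z g1 t where gg: "g = ((c, z), (g1, t), (b', x'))" and c: "c \<in> Obj B" "z \<in> Obj (fibre I c)"
        and g1: "g1 \<in> hom B c b'" and t: "t \<in> hom (fibre I c) z (omap (reindex I g1) x')"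
        using g gw fh by (auto simp: hom_iff grothendieck_def)
      have Dg: "Dom ?E g = (c, z)"
        using g by (simp add: gg grothendieck_def)
      have wh: "w \<in> hom B c b"
        using w fh c b y unfolding Dg by (simp add: hom_iff grothendieck_proj_def restrict_def grothendieck_def)
      have uw: "u \<cdot>\<^bsub>B\<^esub> w = g1" using gw pu g by (simp add: gg grothendieck_proj_def)
      interpret F: category "fibre I c" by (rule fibre_category) (rule c)
      have t': "t \<in> hom (fibre I c) z (omap (reindex I w) y)"
        using t reindex_comp_obj[OF wh uh b'(2)] uw y_def by simp
      \<comment> \<open>The fibre component \<open>s\<close> survives unchanged because reindexing
        along \<open>w'\<close> preserves the identity that sits in the lift.\<close>
      have cmp: "f \<cdot>\<^bsub>?E\<^esub> ((c, z), (w', s), (b, y)) = ((c, z), (u \<cdot>\<^bsub>B\<^esub> w', s), (b', x'))"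
        if w': "w' \<in> hom B c b" and s: "s \<in> hom (fibre I c) z (omap (reindex I w') y)" for w' s
        using c b b' y uh w' s category.ide_hom[OF fibre_category[OF b] y] functor_ide[OF reindex_functor[OF w'] y] F.homD[OF s]
        by (simp add: f_def grothendieck_def) (simp add: y_def)
      have pk: "amap ?p ((c, z), (w', s), (b, y)) = w'"
        if "((c, z), (w', s), (b, y)) \<in> Arr ?E" for w' s
        using that by (simp add: grothendieck_proj_def)
      show "\<exists>!k. k \<in> hom ?E (Dom ?E g) (Dom ?E f) \<and> amap ?p k = w \<and> f \<cdot>\<^bsub>?E\<^esub> k = g"
      proof (rule ex1I[of _ "((c, z), (w, t), (b, y))"])
        have kh: "((c, z), (w, t), (b, y)) \<in> hom ?E (c, z) (b, y)"
          using c b y wh t' by (simp add: grothendieck_def hom_cat_of_homs)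
        then show "((c, z), (w, t), (b, y)) \<in> hom ?E (Dom ?E g) (Dom ?E f) \<and> amap ?p ((c, z), (w, t), (b, y)) = w \<and>
          f \<cdot>\<^bsub>?E\<^esub> ((c, z), (w, t), (b, y)) = g"
          using fh Dg pk[OF E.homD(1)[OF kh]] cmp[OF wh t'] uw by (simp add: hom_iff gg)
        fix k assume k: "k \<in> hom ?E (Dom ?E g) (Dom ?E f) \<and> amap ?p k = w \<and> f \<cdot>\<^bsub>?E\<^esub> k = g"
        then have kh: "k \<in> hom ?E (c, z) (b, y)" using fh Dg by (simp add: hom_iff)
        then obtain w' s where k': "k = ((c, z), (w', s), (b, y))" "w' \<in> hom B c b" "s \<in> hom (fibre I c) z (omap (reindex I w') y)"
          by (auto simp: grothendieck_def hom_cat_of_homs)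
        have "w' = w"
          using k pk[of w' s] E.homD(1)[OF kh] unfolding k'(1) by simp
        moreover have "s = t"
          using k cmp[OF k'(2,3)] unfolding k'(1) gg by simp
        ultimately show "k = ((c, z), (w, t), (b, y))" by (simp add: k'(1))
      qed
    qed
    then show "\<exists>f. cartesian ?E B ?p f \<and> Cod ?E f = e \<and> amap ?p f = u"
      using E.homD(3)[OF fh] pu unfolding ex by blast
  qed
qed

end

section \<open>The domain functor of an arrow category\<close>

lemma is_functor_dom_functor:
  assumes "category B"
  shows "is_functor (full_subcat (arrow_cat B) S) B (dom_functor B S)"
proof -
  let ?E = "full_subcat (arrow_cat B) S"
  interpret B: category B by fact
  note A = category_arrow_cat[OF assms]
  note E = category_full_subcat[OF A, of S]
  show ?thesis
  proof (rule is_functorI[OF E])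
    fix X assume X: "X \<in> Obj ?E"
    then have "X \<in> Arr B" "X \<in> S" by (auto simp: arrow_cat_def)
    then show "amap (dom_functor B S) (ide ?E X) = ide B (omap (dom_functor B S) X)"
      using category.ide_arr[OF E X] X
      by (simp add: dom_functor_def arrow_cat_def)
  next
    fix X Y Z g f assume g: "g \<in> hom ?E Y Z" and f: "f \<in> hom ?E X Y"
    have gf: "g \<cdot>\<^bsub>?E\<^esub> f \<in> hom ?E X Z" by (rule category.comp_hom[OF E g f])
    have "g \<cdot>\<^bsub>?E\<^esub> f = g \<cdot>\<^bsub>arrow_cat B\<^esub> f"
      using g f category.homD[OF E g] category.homD[OF E f]
      by (intro full_subcat_simps(6)) (auto simp: hom_full_subcat hom_iff)
    moreover from g f obtain g1 g2 f1 f2 where "g = (Y, (g1, g2), Z)" "f = (X, (f1, f2), Y)"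
      by (auto simp: hom_full_subcat hom_cat_of_homs arrow_cat_def)
    ultimately show "amap (dom_functor B S) (g \<cdot>\<^bsub>?E\<^esub> f) = amap (dom_functor B S) g \<cdot>\<^bsub>B\<^esub> amap (dom_functor B S) f"
      using gf g f by (auto simp: dom_functor_def hom_iff arrow_cat_def)
  next
    show "omap (dom_functor B S) \<in> extensional (Obj ?E)" "amap (dom_functor B S) \<in> extensional (Arr ?E)"
      by (simp_all add: dom_functor_def)
  next
    fix X assume "X \<in> Obj ?E" then show "omap (dom_functor B S) X \<in> Obj B"
      by (auto simp: dom_functor_def) (auto simp: arrow_cat_def)
  next
    fix X Y f assume f: "f \<in> hom ?E X Y"
    note H = category.homD[OF E f]
    from f obtain g h where "f = (X, (g, h), Y)" "g \<in> hom B (Dom B X) (Dom B Y)"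
      by (auto simp: arrow_cat_def hom_cat_of_homs hom_full_subcat)
    with H show "amap (dom_functor B S) f \<in> hom B (omap (dom_functor B S) X) (omap (dom_functor B S) Y)"
      by (auto simp: dom_functor_def split_beta)
  qed
qed

section \<open>Lax monoidal functors to sets\<close>

lemma category_set_cat: "category set_cat"
  unfolding set_cat_def by (rule category_cat_of_homs) (auto simp: compose_def restrict_def PiE_iff extensional_def fun_eq_iff)

context
  fixes M :: "('o, 'a, 'm) smc_scheme" and P :: "('o, 'a, 's) lax"
  assumes M: "category M" and P: "is_functor M set_cat (under P)"
begin

interpretation category M by (rule M)

lemma amap_under:
  assumes "f \<in> hom M X Y"
  shows "amap (under P) f = (lset P X, lact P f, lset P Y)" "lact P f \<in> lset P X \<rightarrow>\<^sub>E lset P Y"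
  using functor_hom[OF M P assms]
  by (auto simp: set_cat_def hom_cat_of_homs lset_def lact_def)

lemma lact_closed: "\<lbrakk>f \<in> hom M X Y; x \<in> lset P X\<rbrakk> \<Longrightarrow> lact P f x \<in> lset P Y"
  using amap_under(2) by fast

lemma lact_ide: "\<lbrakk>X \<in> Obj M; x \<in> lset P X\<rbrakk> \<Longrightarrow> lact P (ide M X) x = x"
  using functor_ide[OF P, of X] amap_under(1)[OF ide_hom, of X] by (simp add: set_cat_def lset_def)

lemma lact_comp:
  assumes "g \<in> hom M Y Z" "f \<in> hom M X Y" "x \<in> lset P X"
  shows "lact P (g \<cdot>\<^bsub>M\<^esub> f) x = lact P g (lact P f x)"
  using functor_comp[OF P assms(1,2)] amap_under[OF assms(1)] amap_under[OF assms(2)] amap_under[OF comp_hom[OF assms(1,2)]] assms(3)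
  by (simp add: set_cat_def compose_def)

end

locale lax_functor = symmetric_monoidal M for M :: "('o, 'a, 'm) smc_scheme" (structure) +
  fixes P :: "('o, 'a, 's) lax"
  assumes lax: "lax_monoidal M P"
begin

lemma under_functor: "is_functor M set_cat (under P)"
  using lax by (simp add: lax_monoidal_def)

lemmas act_closed = lact_closed[OF category_axioms under_functor]
lemmas act_ide = lact_ide[OF category_axioms under_functor]
lemmas act_comp = lact_comp[OF category_axioms under_functor]

lemma lunit_closed: "lunit P \<in> lset P \<one>"
  using lax by (simp add: lax_monoidal_def)

lemma lmult_ext: "lmult P \<in> (\<Pi>\<^sub>E X\<in>Obj M. \<Pi>\<^sub>E Y\<in>Obj M. lset P X \<rightarrow>\<^sub>E lset P Y \<rightarrow>\<^sub>E lset P (X \<otimes> Y))"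
  using lax by (simp add: lax_monoidal_def)

lemma lmult_closed: "\<lbrakk>X \<in> Obj M; Y \<in> Obj M; x \<in> lset P X; y \<in> lset P Y\<rbrakk> \<Longrightarrow> lmult P X Y x y \<in> lset P (X \<otimes> Y)"
  using lmult_ext by (blast dest: PiE_mem)

lemma lmult_natural:
  "\<lbrakk>f \<in> hom M X X'; g \<in> hom M Y Y'; x \<in> lset P X; y \<in> lset P Y\<rbrakk>
    \<Longrightarrow> lact P (f \<boxtimes> g) (lmult P X Y x y) = lmult P X' Y' (lact P f x) (lact P g y)"
  using lax by (auto simp: lax_monoidal_def hom_iff)

lemma lmult_assoc:
  "\<lbrakk>X \<in> Obj M; Y \<in> Obj M; Z \<in> Obj M; x \<in> lset P X; y \<in> lset P Y; z \<in> lset P Z\<rbrakk>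
    \<Longrightarrow> lmult P (X \<otimes> Y) Z (lmult P X Y x y) z = lmult P X (Y \<otimes> Z) x (lmult P Y Z y z)"
  using lax by (auto simp: lax_monoidal_def)

lemma lmult_unit:
  "\<lbrakk>X \<in> Obj M; x \<in> lset P X\<rbrakk> \<Longrightarrow> lmult P \<one> X (lunit P) x = x"
  "\<lbrakk>X \<in> Obj M; x \<in> lset P X\<rbrakk> \<Longrightarrow> lmult P X \<one> x (lunit P) = x"
  using lax by (auto simp: lax_monoidal_def)

lemma lmult_symm:
  "\<lbrakk>X \<in> Obj M; Y \<in> Obj M; x \<in> lset P X; y \<in> lset P Y\<rbrakk>
    \<Longrightarrow> lact P (\<sigma> X Y) (lmult P X Y x y) = lmult P Y X y x"
  using lax by (auto simp: lax_monoidal_def)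

end

context symmetric_monoidal
begin

lemma unit_obj [simp]: "\<one> \<in> Obj C" by (rule unit_closed)

lemma tobj_obj [simp]: "\<lbrakk>X \<in> Obj C; Y \<in> Obj C\<rbrakk> \<Longrightarrow> X \<otimes> Y \<in> Obj C"
  using tobj_closed by (blast dest: PiE_mem)

lemma tarr_arr [simp]:
  assumes "f \<in> Arr C" "g \<in> Arr C"
  shows "f \<boxtimes> g \<in> Arr C" "Dom C (f \<boxtimes> g) = Dom C f \<otimes> Dom C g" "Cod C (f \<boxtimes> g) = Cod C f \<otimes> Cod C g"
  using tarr_closed[OF arr_hom[OF assms(1)] arr_hom[OF assms(2)]] by (auto simp: hom_iff)

lemma symm_arr [simp]:
  assumes "X \<in> Obj C" "Y \<in> Obj C"
  shows "\<sigma> X Y \<in> Arr C" "Dom C (\<sigma> X Y) = X \<otimes> Y" "Cod C (\<sigma> X Y) = Y \<otimes> X"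
  using PiE_mem[OF PiE_mem[OF symm_closed assms(1)] assms(2)] by (auto simp: hom_iff)

lemma symm_hom: "\<lbrakk>X \<in> Obj C; Y \<in> Obj C\<rbrakk> \<Longrightarrow> \<sigma> X Y \<in> hom C (X \<otimes> Y) (Y \<otimes> X)"
  by (simp add: hom_iff)

lemmas tobj_simps [simp] = tobj_assoc tobj_unit_left tobj_unit_right
lemmas tarr_simps [simp] = tarr_assoc tarr_unit_left tarr_unit_right tarr_ide

lemma tarr_comp:
  "\<lbrakk>f \<in> Arr C; g \<in> Arr C; f' \<in> Arr C; g' \<in> Arr C; Cod C f = Dom C g; Cod C f' = Dom C g'\<rbrakk>
    \<Longrightarrow> (g \<boxtimes> g') \<cdot> (f \<boxtimes> f') = (g \<cdot> f) \<boxtimes> (g' \<cdot> f')"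
  using tarr_Comp[of f _ _ g _ f' _ _ g'] by (simp add: hom_iff)

end

text \<open>Takes plain functions and cuts them down to the carriers. The axioms can then be checked
  on unrestricted data, with extensionality settled once.\<close>

definition mk_lax :: "('o, 'a, 'm) smc_scheme \<Rightarrow> ('o \<Rightarrow> 's set) \<Rightarrow> ('a \<Rightarrow> 's \<Rightarrow> 's) \<Rightarrow> 's \<Rightarrow> ('o \<Rightarrow> 'o \<Rightarrow> 's \<Rightarrow> 's \<Rightarrow> 's) \<Rightarrow> ('o, 'a, 's) lax" where
  "mk_lax M S a u m = \<lparr> under = \<lparr> omap = (\<lambda>X\<in>Obj M. S X), amap = (\<lambda>f\<in>Arr M. (S (Dom M f), (\<lambda>x\<in>S (Dom M f). a f x), S (Cod M f))) \<rparr>,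
     lunit = u, lmult = (\<lambda>X\<in>Obj M. \<lambda>Y\<in>Obj M. \<lambda>x\<in>S X. \<lambda>y\<in>S Y. m X Y x y) \<rparr>"

lemma mk_lax_simps [simp]:
  "X \<in> Obj M \<Longrightarrow> lset (mk_lax M S a u m) X = S X"
  "\<lbrakk>f \<in> Arr M; x \<in> S (Dom M f)\<rbrakk> \<Longrightarrow> lact (mk_lax M S a u m) f x = a f x"
  "lunit (mk_lax M S a u m) = u"
  "\<lbrakk>X \<in> Obj M; Y \<in> Obj M; x \<in> S X; y \<in> S Y\<rbrakk> \<Longrightarrow> lmult (mk_lax M S a u m) X Y x y = m X Y x y"
  by (simp_all add: mk_lax_def lset_def lact_def)

lemma lax_monoidal_mk_lax:
  assumes "symmetric_monoidal M"
    and a: "\<And>f X Y x. \<lbrakk>f \<in> hom M X Y; x \<in> S X\<rbrakk> \<Longrightarrow> a f x \<in> S Y"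
    and aid: "\<And>X x. \<lbrakk>X \<in> Obj M; x \<in> S X\<rbrakk> \<Longrightarrow> a (ide M X) x = x"
    and acomp: "\<And>X Y Z f g x. \<lbrakk>g \<in> hom M Y Z; f \<in> hom M X Y; x \<in> S X\<rbrakk> \<Longrightarrow> a (g \<cdot>\<^bsub>M\<^esub> f) x = a g (a f x)"
    and u: "u \<in> S \<one>\<^bsub>M\<^esub>"
    and m: "\<And>X Y x y. \<lbrakk>X \<in> Obj M; Y \<in> Obj M; x \<in> S X; y \<in> S Y\<rbrakk> \<Longrightarrow> m X Y x y \<in> S (X \<otimes>\<^bsub>M\<^esub> Y)"
    and mn: "\<And>X Y X' Y' f g x y. \<lbrakk>f \<in> hom M X X'; g \<in> hom M Y Y'; x \<in> S X; y \<in> S Y\<rbrakk>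
      \<Longrightarrow> a (f \<boxtimes>\<^bsub>M\<^esub> g) (m X Y x y) = m X' Y' (a f x) (a g y)"
    and ma: "\<And>X Y Z x y z. \<lbrakk>X \<in> Obj M; Y \<in> Obj M; Z \<in> Obj M; x \<in> S X; y \<in> S Y; z \<in> S Z\<rbrakk>
      \<Longrightarrow> m (X \<otimes>\<^bsub>M\<^esub> Y) Z (m X Y x y) z = m X (Y \<otimes>\<^bsub>M\<^esub> Z) x (m Y Z y z)"
    and mu: "\<And>X x. \<lbrakk>X \<in> Obj M; x \<in> S X\<rbrakk> \<Longrightarrow> m \<one>\<^bsub>M\<^esub> X u x = x" "\<And>X x. \<lbrakk>X \<in> Obj M; x \<in> S X\<rbrakk> \<Longrightarrow> m X \<one>\<^bsub>M\<^esub> x u = x"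
    and ms: "\<And>X Y x y. \<lbrakk>X \<in> Obj M; Y \<in> Obj M; x \<in> S X; y \<in> S Y\<rbrakk> \<Longrightarrow> a (\<sigma>\<^bsub>M\<^esub> X Y) (m X Y x y) = m Y X y x"
  shows "lax_monoidal M (mk_lax M S a u m)" (is "lax_monoidal M ?P")
proof -
  interpret symmetric_monoidal M by fact
  note a' = a[OF arr_hom]
  have "is_functor M set_cat (under ?P)"
  proof (rule is_functorI[OF category_axioms])
    fix X Y Z g f assume g: "g \<in> hom M Y Z" and f: "f \<in> hom M X Y"
    have "amap (under ?P) h = (S V, \<lambda>x\<in>S V. a h x, S W)" "(\<lambda>x\<in>S V. a h x) \<in> S V \<rightarrow>\<^sub>E S W" if "h \<in> hom M V W" for h V W
      using that a[OF that] by (auto simp: mk_lax_def hom_iff)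
    note * = this[OF g] this[OF f] this(1)[OF comp_hom[OF g f]]
    have "amap (under ?P) g \<cdot>\<^bsub>set_cat\<^esub> amap (under ?P) f = (S X, compose (S X) (\<lambda>x\<in>S Y. a g x) (\<lambda>x\<in>S X. a f x), S Z)"
      using * by (simp add: set_cat_def)
    also have "compose (S X) (\<lambda>x\<in>S Y. a g x) (\<lambda>x\<in>S X. a f x) = (\<lambda>x\<in>S X. a (g \<cdot>\<^bsub>M\<^esub> f) x)"
      using a[OF f] acomp[OF g f] by (auto simp: compose_def fun_eq_iff restrict_def)
    finally show "amap (under ?P) (g \<cdot>\<^bsub>M\<^esub> f) = amap (under ?P) g \<cdot>\<^bsub>set_cat\<^esub> amap (under ?P) f"
      using *(5) by (simp only:)
  next
    fix X Y f assume f: "f \<in> hom M X Y"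
    note H = homD[OF f]
    then show "amap (under ?P) f \<in> hom set_cat (omap (under ?P) X) (omap (under ?P) Y)"
      using a[OF f] by (auto simp: mk_lax_def set_cat_def hom_cat_of_homs)
  next
    fix X assume "X \<in> Obj M"
    then show "amap (under ?P) (ide M X) = ide set_cat (omap (under ?P) X)"
      by (auto simp: mk_lax_def set_cat_def aid)
  next
    fix X show "omap (under ?P) X \<in> Obj set_cat" by (simp add: set_cat_def)
  qed (auto simp: mk_lax_def)
  then show ?thesis
    unfolding lax_monoidal_def
    using m u mn[OF arr_hom arr_hom] ma mu ms a'
    by (auto simp: PiE_iff extensional_def mk_lax_def lset_def lact_def restrict_def)
qed

context
  fixes M :: "('o, 'a, 'm) smc_scheme"
  assumes M: "symmetric_monoidal M"
begin

interpretation symmetric_monoidal M by (rule M)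

lemma monoidal_transformation_natural:
  "\<lbrakk>monoidal_transformation M P Q \<theta>; f \<in> hom M X Y; x \<in> lset P X\<rbrakk> \<Longrightarrow> \<theta> Y (lact P f x) = lact Q f (\<theta> X x)"
  by (auto simp: monoidal_transformation_def hom_iff)

lemma monoidal_transformation_closed:
  "\<lbrakk>monoidal_transformation M P Q \<theta>; X \<in> Obj M; x \<in> lset P X\<rbrakk> \<Longrightarrow> \<theta> X x \<in> lset Q X"
  by (auto simp: monoidal_transformation_def dest: PiE_mem)

lemma monoidal_transformation_id:
  assumes "lax_monoidal M P" shows "monoidal_transformation M P P (\<lambda>X\<in>Obj M. \<lambda>x\<in>lset P X. x)"
proof -
  interpret lax_functor M P by standard fact
  show ?thesis
    using act_closed[OF arr_hom] lunit_closed lmult_closed by (auto simp: monoidal_transformation_def)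
qed

lemma monoidal_transformation_comp:
  assumes "lax_monoidal M P" "monoidal_transformation M P Q \<theta>" "monoidal_transformation M Q R \<phi>"
  shows "monoidal_transformation M P R (\<lambda>X\<in>Obj M. compose (lset P X) (\<phi> X) (\<theta> X))"
proof -
  interpret lax_functor M P by standard fact
  show ?thesis
    using act_closed[OF arr_hom] lunit_closed lmult_closed
      monoidal_transformation_closed[OF assms(2)] monoidal_transformation_closed[OF assms(3)] assms(2,3)
    by (auto simp: monoidal_transformation_def compose_def)
qed

lemma monoidal_transformation_ext:
  assumes "monoidal_transformation M P Q \<theta>" "monoidal_transformation M P Q' \<phi>"
    "\<And>X x. \<lbrakk>X \<in> Obj M; x \<in> lset P X\<rbrakk> \<Longrightarrow> \<theta> X x = \<phi> X x"
  shows "\<theta> = \<phi>"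
proof -
  have 1: "\<theta> \<in> (\<Pi>\<^sub>E X\<in>Obj M. lset P X \<rightarrow>\<^sub>E lset Q X)" "\<phi> \<in> (\<Pi>\<^sub>E X\<in>Obj M. lset P X \<rightarrow>\<^sub>E lset Q' X)"
    using assms(1,2) by (auto simp: monoidal_transformation_def)
  show ?thesis
  proof (rule extensionalityI[of _ "Obj M"])
    fix X assume X: "X \<in> Obj M"
    show "\<theta> X = \<phi> X"
      by (rule extensionalityI[of _ "lset P X"]) (use PiE_mem[OF 1(1) X] PiE_mem[OF 1(2) X] assms(3) X in \<open>auto simp: PiE_iff\<close>)
  qed (use 1 in \<open>auto simp: PiE_iff\<close>)
qed

lemma category_Lax: "category (Lax M :: (('o, 'a, 's) lax, _) cat)"
  unfolding Lax_def
proof (rule category_cat_of_homs, unfold mem_Collect_eq)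
  fix P :: "('o, 'a, 's) lax" assume "lax_monoidal M P"
  then show "monoidal_transformation M P P (\<lambda>X\<in>Obj M. \<lambda>x\<in>lset P X. x)"
    by (rule monoidal_transformation_id)
next
  fix P Q R :: "('o, 'a, 's) lax" and \<theta> \<phi>
  assume "lax_monoidal M P" "monoidal_transformation M P Q \<theta>" "monoidal_transformation M Q R \<phi>"
  then show "monoidal_transformation M P R (\<lambda>X\<in>Obj M. compose (lset P X) (\<phi> X) (\<theta> X))"
    by (rule monoidal_transformation_comp)
next
  fix P Q :: "('o, 'a, 's) lax" and \<theta> assume *: "lax_monoidal M P" "lax_monoidal M Q" "monoidal_transformation M P Q \<theta>"
  show "(\<lambda>X\<in>Obj M. compose (lset P X) ((\<lambda>X\<in>Obj M. \<lambda>x\<in>lset Q X. x) X) (\<theta> X)) = \<theta>"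
    by (rule monoidal_transformation_ext[OF monoidal_transformation_comp[OF *(1,3) monoidal_transformation_id[OF *(2)]] *(3)])
      (use monoidal_transformation_closed[OF *(3)] in \<open>auto simp: compose_def\<close>)
  show "(\<lambda>X\<in>Obj M. compose (lset P X) (\<theta> X) ((\<lambda>X\<in>Obj M. \<lambda>x\<in>lset P X. x) X)) = \<theta>"
    by (rule monoidal_transformation_ext[OF monoidal_transformation_comp[OF *(1) monoidal_transformation_id[OF *(1)] *(3)] *(3)])
      (auto simp: compose_def)
next
  fix P Q R T :: "('o, 'a, 's) lax" and f g h
  assume "monoidal_transformation M P Q f"
  then show "(\<lambda>X\<in>Obj M. compose (lset P X) (h X) ((\<lambda>X\<in>Obj M. compose (lset P X) (g X) (f X)) X)) =
    (\<lambda>X\<in>Obj M. compose (lset P X) ((\<lambda>X\<in>Obj M. compose (lset Q X) (h X) (g X)) X) (f X))"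
    using monoidal_transformation_closed[of P Q f] by (auto simp: compose_def restrict_def fun_eq_iff)
qed

end

lemma hom_Lax: "u \<in> hom (Lax M) P Q \<longleftrightarrow> (\<exists>\<theta>. u = (P, \<theta>, Q) \<and> lax_monoidal M P \<and> lax_monoidal M Q \<and> monoidal_transformation M P Q \<theta>)"
  by (auto simp: Lax_def hom_cat_of_homs)

lemma Obj_Lax: "Obj (Lax M) = {P. lax_monoidal M P}"
  by (simp add: Lax_def)

section \<open>Reindexing of lax functors along strict monoidal functors\<close>

lemma strict_functor: "strict_monoidal_functor M N G \<Longrightarrow> is_functor M N G"
  by (simp add: strict_monoidal_functor_def)

lemma lax_precomp_simps [simp]:
  "X \<in> Obj M \<Longrightarrow> lset (lax_precomp M G P) X = lset P (omap G X)"
  "f \<in> Arr M \<Longrightarrow> lact (lax_precomp M G P) f = lact P (amap G f)"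
  "lunit (lax_precomp M G P) = lunit P"
  "\<lbrakk>X \<in> Obj M; Y \<in> Obj M\<rbrakk> \<Longrightarrow> lmult (lax_precomp M G P) X Y = lmult P (omap G X) (omap G Y)"
  by (simp_all add: lax_precomp_def lset_def lact_def compose_def)

lemma lax_monoidal_precomp:
  assumes "symmetric_monoidal M" "symmetric_monoidal N" "strict_monoidal_functor M N G" "lax_monoidal N P"
  shows "lax_monoidal M (lax_precomp M G P)"
proof -
  interpret M: symmetric_monoidal M by fact
  interpret N: symmetric_monoidal N by fact
  interpret lax_functor N P by standard fact
  note Gf = strict_functor[OF assms(3)]
  note G = functor_arr[OF M.category_axioms Gf] functor_obj[OF Gf]
  have "is_functor M set_cat (under (lax_precomp M G P))"
    using is_functor_comp[OF M.category_axioms N.category_axioms Gf under_functor]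
    by (simp add: lax_precomp_def)
  moreover have "lmult (lax_precomp M G P) \<in> (\<Pi>\<^sub>E X\<in>Obj M. \<Pi>\<^sub>E Y\<in>Obj M. lset (lax_precomp M G P) X \<rightarrow>\<^sub>E lset (lax_precomp M G P) Y \<rightarrow>\<^sub>E lset (lax_precomp M G P) (X \<otimes>\<^bsub>M\<^esub> Y))"
    using assms(3) PiE_mem[OF PiE_mem[OF lmult_ext G(4)] G(4)]
    by (auto simp: strict_monoidal_functor_def PiE_iff extensional_def, simp_all add: lax_precomp_def)
  ultimately show ?thesis
    using assms(3) lmult_natural[OF N.arr_hom[OF G(1)] N.arr_hom[OF G(1)]] lmult_assoc[OF G(4) G(4) G(4)]
      lmult_unit[OF G(4)] lmult_symm[OF G(4) G(4)] lunit_closed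
    unfolding lax_monoidal_def by (auto simp: strict_monoidal_functor_def G)
qed

lemma lax_eqI:
  fixes P Q :: "('o, 'a, 's) lax"
  assumes "under P = under Q" "lunit P = lunit Q" "lmult P \<in> extensional A" "lmult Q \<in> extensional A"
    "\<And>X. X \<in> A \<Longrightarrow> lmult P X \<in> extensional A'" "\<And>X. X \<in> A \<Longrightarrow> lmult Q X \<in> extensional A'"
    "\<And>X Y. X \<in> A \<Longrightarrow> Y \<in> A' \<Longrightarrow> lmult P X Y = lmult Q X Y"
  shows "P = Q"
proof -
  have "lmult P = lmult Q"
    by (rule extensionalityI[OF assms(3,4)], rule extensionalityI[of _ A'], insert assms, auto)
  with assms(1,2) show ?thesis by (intro lax.equality) auto
qed

lemma lax_precomp_id:
  assumes "symmetric_monoidal M" "lax_monoidal M P"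
  shows "lax_precomp M (func_id M) P = P"
proof -
  interpret symmetric_monoidal M by fact
  interpret lax_functor M P by standard fact
  show ?thesis
    using func_comp_id(1)[OF category_axioms category_set_cat under_functor] lmult_ext
    by (intro lax_eqI[of _ _ "Obj M" "Obj M"]) (auto simp: lax_precomp_def PiE_iff)
qed

lemma lax_precomp_comp:
  assumes "symmetric_monoidal M" "symmetric_monoidal N" "strict_monoidal_functor M N G"
  shows "lax_precomp M (func_comp M H G) P = lax_precomp M G (lax_precomp N H P)"
  using func_comp_assoc[OF symmetric_monoidal.axioms(1)[OF assms(1)] symmetric_monoidal.axioms(1)[OF assms(2)] strict_functor[OF assms(3)],
      of "under P" H]
    functor_obj[OF strict_functor[OF assms(3)]]
  by (intro lax_eqI[of _ _ "Obj M" "Obj M"]) (auto simp: lax_precomp_def compose_def)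

lemma monoidal_transformation_precomp:
  assumes "symmetric_monoidal M" "symmetric_monoidal N" "strict_monoidal_functor M N G" "monoidal_transformation N P Q \<theta>"
  shows "monoidal_transformation M (lax_precomp M G P) (lax_precomp M G Q) (\<lambda>X\<in>Obj M. \<theta> (omap G X))"
proof -
  interpret M: symmetric_monoidal M by fact
  interpret N: symmetric_monoidal N by fact
  note Gf = strict_functor[OF assms(3)]
  note G = functor_arr[OF M.category_axioms Gf] functor_obj[OF Gf]
  show ?thesis
    using assms(3) assms(4)
    unfolding monoidal_transformation_def strict_monoidal_functor_def
    by (auto simp: G PiE_iff extensional_def dest: bspec[OF _ G(1)])
qed

lemma Lax_reindex_simps:
  "P \<in> Obj (Lax N) \<Longrightarrow> omap (Lax_reindex M N G) P = lax_precomp M G P"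
  "(P, \<theta>, Q) \<in> Arr (Lax N) \<Longrightarrow> amap (Lax_reindex M N G) (P, \<theta>, Q) = (lax_precomp M G P, \<lambda>X\<in>Obj M. \<theta> (omap G X), lax_precomp M G Q)"
  by (simp_all add: Lax_reindex_def)

lemma is_functor_Lax_reindex:
  assumes M: "symmetric_monoidal M" and N: "symmetric_monoidal N" and G: "strict_monoidal_functor M N G"
  shows "is_functor (Lax N) (Lax M) (Lax_reindex M N G)"
proof -
  interpret N: symmetric_monoidal N by fact
  note LN = category_Lax[OF N] and pre = lax_monoidal_precomp[OF assms]
  note mtp = monoidal_transformation_precomp[OF assms]
  note Go = functor_obj[OF strict_functor[OF G]]
  show ?thesis
  proof (rule is_functorI[OF LN])
    fix X assume X: "X \<in> Obj (Lax N)"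
    then have 1: "ide (Lax N) X \<in> Arr (Lax N)" by (rule category.ide_arr[OF LN])
    have 2: "ide (Lax K) Y = (Y, \<lambda>X\<in>Obj K. \<lambda>x\<in>lset Y X. x, Y)" if "lax_monoidal K Y" for Y and K :: "('x, 'y, 'z) smc_scheme"
      using that by (simp add: Lax_def)
    have 3: "lax_monoidal N X" using X by (simp add: Obj_Lax)
    have "(\<lambda>Y\<in>Obj M. (\<lambda>X'\<in>Obj N. \<lambda>x\<in>lset X X'. x) (omap G Y)) = (\<lambda>Y\<in>Obj M. \<lambda>x\<in>lset (lax_precomp M G X) Y. x)"
      by (auto simp: Go restrict_def fun_eq_iff)
    then show "amap (Lax_reindex M N G) (ide (Lax N) X) = ide (Lax M) (omap (Lax_reindex M N G) X)"
      using 1 X by (simp add: 2[OF 3] 2[OF pre[OF 3]] Lax_reindex_simps)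
  next
    fix X Y Z g f assume g: "g \<in> hom (Lax N) Y Z" and f: "f \<in> hom (Lax N) X Y"
    have gf: "g \<cdot>\<^bsub>Lax N\<^esub> f \<in> Arr (Lax N)" using category.comp_hom[OF LN g f] by (simp add: hom_iff)
    obtain \<theta> \<phi> where *: "f = (X, \<theta>, Y)" "g = (Y, \<phi>, Z)" "lax_monoidal N X" "lax_monoidal N Y" "lax_monoidal N Z"
      "monoidal_transformation N X Y \<theta>" "monoidal_transformation N Y Z \<phi>"
      using g f by (auto simp: hom_Lax)
    have 2: "(R, \<phi>', T) \<cdot>\<^bsub>Lax K\<^esub> (Q, \<theta>', R) = (Q, \<lambda>X\<in>Obj K. compose (lset Q X) (\<phi>' X) (\<theta>' X), T)"
      if "lax_monoidal K Q" "lax_monoidal K R" "lax_monoidal K T" "monoidal_transformation K Q R \<theta>'" "monoidal_transformation K R T \<phi>'"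
      for Q R T \<theta>' \<phi>' and K :: "('x, 'y, 'z) smc_scheme"
      using that by (simp add: Lax_def)
    have fg: "f \<in> Arr (Lax N)" "g \<in> Arr (Lax N)" using f g by (auto simp: hom_iff)
    have "(\<lambda>X'\<in>Obj M. (\<lambda>X'\<in>Obj N. compose (lset X X') (\<phi> X') (\<theta> X')) (omap G X')) =
      (\<lambda>X'\<in>Obj M. compose (lset (lax_precomp M G X) X') ((\<lambda>X\<in>Obj M. \<phi> (omap G X)) X') ((\<lambda>X\<in>Obj M. \<theta> (omap G X)) X'))"
      by (auto simp: Go restrict_def fun_eq_iff)
    then show "amap (Lax_reindex M N G) (g \<cdot>\<^bsub>Lax N\<^esub> f) = amap (Lax_reindex M N G) g \<cdot>\<^bsub>Lax M\<^esub> amap (Lax_reindex M N G) f"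
      using gf fg unfolding *(1,2) 2[OF *(3-7)]
      by (simp add: Lax_reindex_simps 2[OF pre[OF *(3)] pre[OF *(4)] pre[OF *(5)] mtp[OF *(6)] mtp[OF *(7)]])
  next
    fix X Y f assume "f \<in> hom (Lax N) X Y"
    then show "amap (Lax_reindex M N G) f \<in> hom (Lax M) (omap (Lax_reindex M N G) X) (omap (Lax_reindex M N G) Y)"
      using pre mtp by (auto simp: hom_Lax Obj_Lax Lax_reindex_def) (auto simp: Lax_def)
  qed (auto simp: Lax_reindex_def Obj_Lax pre)
qed

text \<open>Extensional structure maps turn precomposition with an identity, and likewise with a
  composite, into an equality of lax functors. This supplies the strict functoriality required of an
  indexed category.\<close>

lemma Lax_reindex_id:
  assumes M: "symmetric_monoidal M"
  shows "Lax_reindex M M (func_id M) = func_id (Lax M)"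
proof (rule func_eqI[where A = "Obj (Lax M)" and B = "Arr (Lax M)"])
  fix f assume f: "f \<in> Arr (Lax M)"
  then obtain P Q \<theta> where *: "f = (P, \<theta>, Q)" "lax_monoidal M P" "lax_monoidal M Q" "monoidal_transformation M P Q \<theta>"
    by (auto simp: Lax_def)
  have "(\<lambda>X\<in>Obj M. \<theta> (omap (func_id M) X)) = \<theta>"
    using *(4) by (auto simp: monoidal_transformation_def PiE_iff restrict_def extensional_def)
  then show "amap (Lax_reindex M M (func_id M)) f = amap (func_id (Lax M)) f"
    using f * by (simp add: Lax_reindex_def lax_precomp_id[OF M])
qed (auto simp: Lax_reindex_def Obj_Lax lax_precomp_id[OF M])

lemma Lax_reindex_comp:
  assumes M: "symmetric_monoidal M" and N: "symmetric_monoidal N" and K: "symmetric_monoidal K"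
    and G: "strict_monoidal_functor M N G" and H: "strict_monoidal_functor N K H"
  shows "Lax_reindex M K (func_comp M H G) = func_comp (Lax K) (Lax_reindex M N G) (Lax_reindex N K H)"
proof (rule func_eqI[where A = "Obj (Lax K)" and B = "Arr (Lax K)"])
  fix f assume f: "f \<in> Arr (Lax K)"
  then obtain P Q \<theta> where *: "f = (P, \<theta>, Q)" "lax_monoidal K P" "lax_monoidal K Q" "monoidal_transformation K P Q \<theta>"
    by (auto simp: Lax_def)
  note Go = functor_obj[OF strict_functor[OF G]]
  have 1: "amap (Lax_reindex N K H) f \<in> Arr (Lax N)"
    using functor_arr[OF category_Lax[OF K] is_functor_Lax_reindex[OF N K H] f] by simp
  show "amap (Lax_reindex M K (func_comp M H G)) f = amap (func_comp (Lax K) (Lax_reindex M N G) (Lax_reindex N K H)) f"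
    using f 1 *(1) by (simp add: compose_def Lax_reindex_simps lax_precomp_comp[OF M N G])
      (auto simp: restrict_def Go fun_eq_iff)
qed (auto simp: Lax_reindex_def lax_precomp_comp[OF M N G] compose_def Obj_Lax lax_monoidal_precomp[OF N K H])

context symmetric_monoidal
begin

text \<open>The hexagon at two unit objects makes \<open>\<sigma> X \<one>\<close> idempotent, and
  an invertible idempotent is an identity.\<close>

lemma symm_unit_right [simp]: assumes X: "X \<in> Obj C" shows "\<sigma> X \<one> = ide C X"
proof -
  have "\<sigma> X \<one> = \<sigma> X \<one> \<cdot> \<sigma> X \<one>" using symm_hexagon[OF X unit_obj unit_obj] X by simp
  moreover have "\<sigma> \<one> X \<cdot> \<sigma> X \<one> = ide C X" using symm_involutive[OF X unit_obj] X by simp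
  moreover have "(\<sigma> \<one> X \<cdot> \<sigma> X \<one>) \<cdot> \<sigma> X \<one> = \<sigma> \<one> X \<cdot> (\<sigma> X \<one> \<cdot> \<sigma> X \<one>)"
    using X by (intro comp_assoc) simp_all
  ultimately show ?thesis using X by simp
qed

lemma symm_unit_left [simp]: assumes X: "X \<in> Obj C" shows "\<sigma> \<one> X = ide C X"
  using symm_involutive[OF unit_obj X] X by simp

end

section \<open>The lax functor of points of a strict monoidal functor\<close>

lemma strict_functor_simps:
  assumes "strict_monoidal_functor M N J"
  shows "omap J \<one>\<^bsub>M\<^esub> = \<one>\<^bsub>N\<^esub>"
    "\<lbrakk>X \<in> Obj M; Y \<in> Obj M\<rbrakk> \<Longrightarrow> omap J (X \<otimes>\<^bsub>M\<^esub> Y) = omap J X \<otimes>\<^bsub>N\<^esub> omap J Y"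
    "\<lbrakk>f \<in> Arr M; g \<in> Arr M\<rbrakk> \<Longrightarrow> amap J (f \<boxtimes>\<^bsub>M\<^esub> g) = amap J f \<boxtimes>\<^bsub>N\<^esub> amap J g"
    "\<lbrakk>X \<in> Obj M; Y \<in> Obj M\<rbrakk> \<Longrightarrow> amap J (\<sigma>\<^bsub>M\<^esub> X Y) = \<sigma>\<^bsub>N\<^esub> (omap J X) (omap J Y)"
  using assms by (auto simp: strict_monoidal_functor_def)

text \<open>The lax functor \<open>N(1, J-)\<close> with its elements renamed by \<open>e\<close>.
  The renaming brings them into the universe of sets: it is \<open>id\<close> in the compact case
  and strips the tags of arrows of \<open>Int\<close> in the traced case. Decoding is done on one
  hom-set at a time, since injectivity of \<open>e\<close> is available only there.\<close>

definition rep_lax :: "('o, 'a, 'm) smc_scheme \<Rightarrow> ('p, 'b, 'n) smc_scheme \<Rightarrow> ('o, 'a, 'p, 'b) func \<Rightarrow> ('b \<Rightarrow> 's) \<Rightarrow> ('o, 'a, 's) lax" where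
  "rep_lax M N J e =
    (let d = \<lambda>X. inv_into (hom N \<one>\<^bsub>N\<^esub> (omap J X)) e in
     mk_lax M (\<lambda>X. e ` hom N \<one>\<^bsub>N\<^esub> (omap J X)) (\<lambda>f s. e (amap J f \<cdot>\<^bsub>N\<^esub> d (Dom M f) s)) (e (ide N \<one>\<^bsub>N\<^esub>))
       (\<lambda>X Y s t. e (d X s \<boxtimes>\<^bsub>N\<^esub> d Y t)))"

context
  fixes M :: "('o, 'a, 'm) smc_scheme" and N :: "('p, 'b, 'n) smc_scheme" and J :: "('o, 'a, 'p, 'b) func" and e :: "'b \<Rightarrow> 's"
  assumes M: "symmetric_monoidal M" and N: "symmetric_monoidal N" and J: "strict_monoidal_functor M N J"
    and e: "\<And>X. inj_on e (hom N \<one>\<^bsub>N\<^esub> X)"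
begin

interpretation M: symmetric_monoidal M by (rule M)
interpretation N: symmetric_monoidal N by (rule N)

lemma rep_lax_simps:
  shows "X \<in> Obj M \<Longrightarrow> lset (rep_lax M N J e) X = e ` hom N \<one>\<^bsub>N\<^esub> (omap J X)"
    and "\<lbrakk>f \<in> hom M X Y; p \<in> hom N \<one>\<^bsub>N\<^esub> (omap J X)\<rbrakk> \<Longrightarrow> lact (rep_lax M N J e) f (e p) = e (amap J f \<cdot>\<^bsub>N\<^esub> p)"
    and "lunit (rep_lax M N J e) = e (ide N \<one>\<^bsub>N\<^esub>)"
    and "\<lbrakk>X \<in> Obj M; Y \<in> Obj M; p \<in> hom N \<one>\<^bsub>N\<^esub> (omap J X); q \<in> hom N \<one>\<^bsub>N\<^esub> (omap J Y)\<rbrakk>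
      \<Longrightarrow> lmult (rep_lax M N J e) X Y (e p) (e q) = e (p \<boxtimes>\<^bsub>N\<^esub> q)"
  by (auto simp: rep_lax_def Let_def inv_into_f_f[OF e] hom_iff)

lemma lax_monoidal_rep: "lax_monoidal M (rep_lax M N J e)"
proof -
  note Jf = strict_functor[OF J]
  note Js = strict_functor_simps[OF J] functor_arr[OF M.category_axioms Jf] functor_obj[OF Jf] functor_ide[OF Jf]
  have inv: "inv_into (hom N \<one>\<^bsub>N\<^esub> X) e (e p) = p" if "p \<in> Arr N" "Dom N p = \<one>\<^bsub>N\<^esub>" "Cod N p = X" for X p
    using that by (intro inv_into_f_f[OF e]) (simp add: hom_iff)
  show ?thesis
    unfolding rep_lax_def Let_def
  proof (rule lax_monoidal_mk_lax[OF M]; clarsimp simp: inv Js hom_iff N.tarr_comp)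
    fix f g x assume "g \<in> Arr M" "f \<in> Arr M" "x \<in> Arr N" "Dom N x = \<one>\<^bsub>N\<^esub>" "Cod N x = omap J (Dom M f)" "Cod M f = Dom M g"
    then show "e (amap J (g \<cdot>\<^bsub>M\<^esub> f) \<cdot>\<^bsub>N\<^esub> x) = e (amap J g \<cdot>\<^bsub>N\<^esub> amap J f \<cdot>\<^bsub>N\<^esub> x)"
      using functor_comp[OF Jf M.arr_hom, of g f "Dom M f"] by (simp add: Js hom_iff N.comp_assoc)
  next
    fix X Y x y assume "X \<in> Obj M" "Y \<in> Obj M" "x \<in> Arr N" "y \<in> Arr N" "Dom N x = \<one>\<^bsub>N\<^esub>" "Cod N x = omap J X"
      "Dom N y = \<one>\<^bsub>N\<^esub>" "Cod N y = omap J Y"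
    \<comment> \<open>Naturality leaves a symmetry of the unit with itself, which is the
      identity.\<close>
    then show "e (\<sigma>\<^bsub>N\<^esub> (omap J X) (omap J Y) \<cdot>\<^bsub>N\<^esub> (x \<boxtimes>\<^bsub>N\<^esub> y)) = e (y \<boxtimes>\<^bsub>N\<^esub> x)"
      using N.symm_natural[OF N.arr_hom N.arr_hom, of x y] by simp
  qed
qed

end

text \<open>Common frame of both equivalences: each object \<open>b\<close> of the base carries a
  symmetric monoidal category \<open>Mo b\<close>, which is \<open>b\<close> itself in the compact
  case and \<open>Int\<close> of \<open>b\<close> in the traced case. \<open>FF\<close> says that a
  transformation between functors of points over \<open>g\<close> is induced by exactly one arrow
  \<open>h\<close> completing the square. \<open>ES\<close> says that every lax functor is a functor
  of points up to a transformation with bijective components; that the inverse is monoidal as well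
  is proved below.\<close>

locale smc_indexing =
  fixes Ob :: "'b set" and H :: "'b \<Rightarrow> 'b \<Rightarrow> 'g set" and i :: "'b \<Rightarrow> 'g" and c :: "'b \<Rightarrow> 'b \<Rightarrow> 'b \<Rightarrow> 'g \<Rightarrow> 'g \<Rightarrow> 'g"
    and Mo :: "'b \<Rightarrow> ('o, 'a) smc" and Mm :: "'b \<Rightarrow> 'g \<Rightarrow> ('o, 'a, 'o, 'a) func" and e :: "'a \<Rightarrow> 's"
    and S :: "('b \<times> 'g \<times> 'b) set"
  assumes base: "category (cat_of_homs Ob H i c)"
    and Mo: "b \<in> Ob \<Longrightarrow> symmetric_monoidal (Mo b)"
    and Mm: "\<lbrakk>b \<in> Ob; b' \<in> Ob; g \<in> H b b'\<rbrakk> \<Longrightarrow> strict_monoidal_functor (Mo b) (Mo b') (Mm b g)"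
    and Mm_id: "b \<in> Ob \<Longrightarrow> Mm b (i b) = func_id (Mo b)"
    and Mm_comp: "\<lbrakk>b \<in> Ob; b' \<in> Ob; b'' \<in> Ob; g \<in> H b b'; h \<in> H b' b''\<rbrakk>
      \<Longrightarrow> Mm b (c b b' b'' h g) = func_comp (Mo b) (Mm b' h) (Mm b g)"
    and e: "b \<in> Ob \<Longrightarrow> inj_on e (hom (Mo b) \<one>\<^bsub>Mo b\<^esub> x)"
    and S: "S \<subseteq> Arr (cat_of_homs Ob H i c)"
    and FF: "\<lbrakk>(b, F, d) \<in> S; (b', F', d') \<in> S; g \<in> H b b';
        monoidal_transformation (Mo b) (rep_lax (Mo b) (Mo d) (Mm b F) e)
          (lax_precomp (Mo b) (Mm b g) (rep_lax (Mo b') (Mo d') (Mm b' F') e)) \<theta>\<rbrakk>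
      \<Longrightarrow> \<exists>!h. h \<in> H d d' \<and> c b d d' h F = c b b' d' F' g \<and>
        (\<forall>x\<in>Obj (Mo b). \<forall>p\<in>hom (Mo d) \<one>\<^bsub>Mo d\<^esub> (omap (Mm b F) x). e (amap (Mm d h) p) = \<theta> x (e p))"
    and ES: "\<lbrakk>b \<in> Ob; lax_monoidal (Mo b) P\<rbrakk> \<Longrightarrow> \<exists>d F \<alpha>. (b, F, d) \<in> S \<and>
        monoidal_transformation (Mo b) P (rep_lax (Mo b) (Mo d) (Mm b F) e) \<alpha> \<and>
        (\<forall>x\<in>Obj (Mo b). bij_betw (\<alpha> x) (lset P x) (lset (rep_lax (Mo b) (Mo d) (Mm b F) e) x))"
begin

abbreviation "B \<equiv> cat_of_homs Ob H i c"
definition "I = \<lparr> fibre = (\<lambda>b. Lax (Mo b) :: (('o, 'a, 's) lax, _) cat), reindex = (\<lambda>(b, g, b'). Lax_reindex (Mo b) (Mo b') (Mm b g)) \<rparr>"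
abbreviation "E \<equiv> grothendieck B I"
abbreviation "E' \<equiv> full_subcat (arrow_cat B) S"

interpretation B: category B by (rule base)

lemma I_simps [simp]: "fibre I b = Lax (Mo b)" "reindex I (b, g, b') = Lax_reindex (Mo b) (Mo b') (Mm b g)"
  by (simp_all add: I_def)

sublocale indexed_category B I
  by (rule indexed_category.intro) (auto simp: base hom_cat_of_homs category_Lax[OF Mo] is_functor_Lax_reindex[OF Mo Mo Mm] Mm_id Lax_reindex_id[OF Mo]
    Mm_comp Lax_reindex_comp[OF Mo Mo Mo Mm Mm])

lemma SD:
  assumes "(b, F, d) \<in> S" shows "b \<in> Ob" "d \<in> Ob" "F \<in> H b d"
  using assms S by auto

definition "rep a = rep_lax (Mo (fst a)) (Mo (snd (snd a))) (Mm (fst a) (fst (snd a))) e"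

lemma rep_eq: "rep (b, F, d) = rep_lax (Mo b) (Mo d) (Mm b F) e"
  by (simp add: rep_def)

lemma rep_simps:
  assumes "(b, F, d) \<in> S"
  shows "x \<in> Obj (Mo b) \<Longrightarrow> lset (rep (b, F, d)) x = e ` hom (Mo d) \<one>\<^bsub>Mo d\<^esub> (omap (Mm b F) x)"
    and "\<lbrakk>f \<in> hom (Mo b) x y; p \<in> hom (Mo d) \<one>\<^bsub>Mo d\<^esub> (omap (Mm b F) x)\<rbrakk> \<Longrightarrow> lact (rep (b, F, d)) f (e p) = e (amap (Mm b F) f \<cdot>\<^bsub>Mo d\<^esub> p)"
    and "lunit (rep (b, F, d)) = e (ide (Mo d) \<one>\<^bsub>Mo d\<^esub>)"
    and "\<lbrakk>x \<in> Obj (Mo b); y \<in> Obj (Mo b); p \<in> hom (Mo d) \<one>\<^bsub>Mo d\<^esub> (omap (Mm b F) x); q \<in> hom (Mo d) \<one>\<^bsub>Mo d\<^esub> (omap (Mm b F) y)\<rbrakk>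
      \<Longrightarrow> lmult (rep (b, F, d)) x y (e p) (e q) = e (p \<boxtimes>\<^bsub>Mo d\<^esub> q)"
    and "lax_monoidal (Mo b) (rep (b, F, d))"
  using rep_lax_simps[OF Mo Mo Mm e] lax_monoidal_rep[OF Mo Mo Mm e] SD[OF assms] unfolding rep_eq by auto

text \<open>The transformation \<open>d(1, F-) \<rightarrow> d'(1, F'g-)\<close> induced by a commutative square \<open>(g, h)\<close> from \<open>F\<close> to \<open>F'\<close>.\<close>

definition "sqtrans a h = (\<lambda>x\<in>Obj (Mo (fst a)). \<lambda>s\<in>lset (rep a) x.
   e (amap (Mm (snd (snd a)) h) (inv_into (hom (Mo (snd (snd a))) \<one>\<^bsub>Mo (snd (snd a))\<^esub> (omap (Mm (fst a) (fst (snd a))) x)) e s)))"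

lemma sqtrans_eq:
  assumes "(b, F, d) \<in> S" "x \<in> Obj (Mo b)" "p \<in> hom (Mo d) \<one>\<^bsub>Mo d\<^esub> (omap (Mm b F) x)"
  shows "sqtrans (b, F, d) h x (e p) = e (amap (Mm d h) p)"
  using assms SD[OF assms(1)] by (simp add: sqtrans_def rep_simps inv_into_f_f[OF e])

lemma sqtrans_unique:
  assumes "(b, F, d) \<in> S" "monoidal_transformation (Mo b) (rep (b, F, d)) Q \<theta>" "monoidal_transformation (Mo b) (rep (b, F, d)) Q' (sqtrans (b, F, d) h)"
    and "\<And>x p. \<lbrakk>x \<in> Obj (Mo b); p \<in> hom (Mo d) \<one>\<^bsub>Mo d\<^esub> (omap (Mm b F) x)\<rbrakk> \<Longrightarrow> \<theta> x (e p) = e (amap (Mm d h) p)"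
  shows "\<theta> = sqtrans (b, F, d) h"
  by (rule monoidal_transformation_ext[OF Mo[OF SD(1)[OF assms(1)]] assms(2,3)])
    (auto simp: rep_simps[OF assms(1)] sqtrans_eq[OF assms(1)] assms(4))

lemma square:
  assumes s: "(b, F, d) \<in> S" "(b', F', d') \<in> S" and g: "g \<in> H b b'" and h: "h \<in> H d d'" and sq: "c b d d' h F = c b b' d' F' g"
  shows "x \<in> Obj (Mo b) \<Longrightarrow> omap (Mm d h) (omap (Mm b F) x) = omap (Mm b' F') (omap (Mm b g) x)"
    and "f \<in> Arr (Mo b) \<Longrightarrow> amap (Mm d h) (amap (Mm b F) f) = amap (Mm b' F') (amap (Mm b g) f)"
proof -
  have "func_comp (Mo b) (Mm d h) (Mm b F) = func_comp (Mo b) (Mm b' F') (Mm b g)"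
    using Mm_comp[of b d d' F h] Mm_comp[of b b' d' g F'] SD[OF s(1)] SD[OF s(2)] g h sq by simp
  note * = this[THEN arg_cong, of omap, THEN fun_cong] this[THEN arg_cong, of amap, THEN fun_cong]
  show "x \<in> Obj (Mo b) \<Longrightarrow> omap (Mm d h) (omap (Mm b F) x) = omap (Mm b' F') (omap (Mm b g) x)"
    using *(1)[of x] by (simp add: compose_def)
  show "f \<in> Arr (Mo b) \<Longrightarrow> amap (Mm d h) (amap (Mm b F) f) = amap (Mm b' F') (amap (Mm b g) f)"
    using *(2)[of f] by (simp add: compose_def)
qed

text \<open>The transformation applies \<open>h\<close> to points. Commutativity of the square puts
  the results into the right sets and gives naturality; strictness of \<open>h\<close> gives
  compatibility with unit and products.\<close>

lemma sqtrans_monoidal: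
  assumes s: "(b, F, d) \<in> S" "(b', F', d') \<in> S" and g: "g \<in> H b b'" and h: "h \<in> H d d'" and sq: "c b d d' h F = c b b' d' F' g"
  shows "monoidal_transformation (Mo b) (rep (b, F, d)) (lax_precomp (Mo b) (Mm b g) (rep (b', F', d'))) (sqtrans (b, F, d) h)"
proof -
  note O = SD[OF s(1)] SD[OF s(2)]
  interpret b: symmetric_monoidal "Mo b" by (rule Mo) (rule O)
  interpret d: symmetric_monoidal "Mo d" by (rule Mo) (rule O)
  interpret b': symmetric_monoidal "Mo b'" by (rule Mo) (rule O)
  interpret d': symmetric_monoidal "Mo d'" by (rule Mo) (rule O)
  note h' = Mm[OF O(2,5) h] and g' = Mm[OF O(1,4) g] and F = Mm[OF O(1-3)] and F' = Mm[OF O(4-6)]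
  note hf = strict_functor[OF h'] and gf = strict_functor[OF g'] and Ff = strict_functor[OF F] and F'f = strict_functor[OF F']
  note sqq = square[OF s g h sq]
  have cl: "amap (Mm d h) p \<in> hom (Mo d') \<one>\<^bsub>Mo d'\<^esub> (omap (Mm b' F') (omap (Mm b g) x))"
    if "x \<in> Obj (Mo b)" "p \<in> hom (Mo d) \<one>\<^bsub>Mo d\<^esub> (omap (Mm b F) x)" for x p
    using functor_hom[OF d.category_axioms hf that(2)] that(1) sqq(1) strict_functor_simps(1)[OF h'] by simp
  note gO = functor_obj[OF gf]
  have cl2: "p \<boxtimes>\<^bsub>Mo d\<^esub> q \<in> hom (Mo d) \<one>\<^bsub>Mo d\<^esub> (omap (Mm b F) (x \<otimes>\<^bsub>Mo b\<^esub> y))"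
    if "x \<in> Obj (Mo b)" "p \<in> hom (Mo d) \<one>\<^bsub>Mo d\<^esub> (omap (Mm b F) x)" "y \<in> Obj (Mo b)" "q \<in> hom (Mo d) \<one>\<^bsub>Mo d\<^esub> (omap (Mm b F) y)" for x y p q
    using d.tarr_closed[OF that(2,4)] that(1,3) strict_functor_simps(2)[OF F] by simp
  have "sqtrans (b, F, d) h \<in> (\<Pi>\<^sub>E x\<in>Obj (Mo b). lset (rep (b, F, d)) x \<rightarrow>\<^sub>E lset (lax_precomp (Mo b) (Mm b g) (rep (b', F', d'))) x)"
  proof (intro PiE_I)
    fix x t assume x: "x \<in> Obj (Mo b)" and "t \<in> lset (rep (b, F, d)) x"
    then obtain p where "p \<in> hom (Mo d) \<one>\<^bsub>Mo d\<^esub> (omap (Mm b F) x)" "t = e p" by (auto simp: rep_simps[OF s(1)])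
    then show "sqtrans (b, F, d) h x t \<in> lset (lax_precomp (Mo b) (Mm b g) (rep (b', F', d'))) x"
      using x cl[OF x] by (simp add: sqtrans_eq[OF s(1)] rep_simps[OF s(2)] gO)
  qed (auto simp: sqtrans_def)
  moreover have "sqtrans (b, F, d) h y (lact (rep (b, F, d)) f (e p)) = lact (rep (b', F', d')) (amap (Mm b g) f) (sqtrans (b, F, d) h x (e p))"
    if f: "f \<in> hom (Mo b) x y" and p: "p \<in> hom (Mo d) \<one>\<^bsub>Mo d\<^esub> (omap (Mm b F) x)" for x y f p
  proof -
    note o = b.homD[OF f]
    have Fp: "amap (Mm b F) f \<cdot>\<^bsub>Mo d\<^esub> p \<in> hom (Mo d) \<one>\<^bsub>Mo d\<^esub> (omap (Mm b F) y)"
      by (rule d.comp_hom[OF functor_hom[OF b.category_axioms Ff f] p])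
    show ?thesis
      using functor_comp[OF hf functor_hom[OF b.category_axioms Ff f] p] sqq(2)[OF o(1)] o
      by (simp add: rep_simps(2)[OF s(1) f p] sqtrans_eq[OF s(1) _ Fp] sqtrans_eq[OF s(1) _ p]
          rep_simps(2)[OF s(2) functor_hom[OF b.category_axioms gf f] cl[OF _ p]])
  qed
  moreover have "sqtrans (b, F, d) h \<one>\<^bsub>Mo b\<^esub> (lunit (rep (b, F, d))) = lunit (rep (b', F', d'))"
    using strict_functor_simps(1)[OF F] strict_functor_simps(1)[OF h'] functor_ide[OF hf d.unit_obj] d.ide_hom[OF d.unit_obj]
    by (simp add: rep_simps(3)[OF s(1)] rep_simps(3)[OF s(2)] sqtrans_eq[OF s(1)])
  moreover have "sqtrans (b, F, d) h (x \<otimes>\<^bsub>Mo b\<^esub> y) (lmult (rep (b, F, d)) x y (e p) (e q)) =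
      lmult (rep (b', F', d')) (omap (Mm b g) x) (omap (Mm b g) y) (sqtrans (b, F, d) h x (e p)) (sqtrans (b, F, d) h y (e q))"
    if "x \<in> Obj (Mo b)" "p \<in> hom (Mo d) \<one>\<^bsub>Mo d\<^esub> (omap (Mm b F) x)" "y \<in> Obj (Mo b)" "q \<in> hom (Mo d) \<one>\<^bsub>Mo d\<^esub> (omap (Mm b F) y)" for x y p q
    using that strict_functor_simps(3)[OF h', of p q]
    by (simp add: rep_simps(4)[OF s(1)] sqtrans_eq[OF s(1)] sqtrans_eq[OF s(1) _ cl2[OF that]] rep_simps(4)[OF s(2)] gO cl) (simp add: hom_iff)
  ultimately show ?thesis
    unfolding monoidal_transformation_def by (auto simp: rep_simps(1)[OF s(1)] b.arr_hom gO)
qed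

text \<open>The comparison sends an arrow to its domain with the functor of points, and a square to
  its top side with the induced transformation. It runs opposite to the equivalence, as
  \<open>ff_equivalence\<close> expects.\<close>

definition "K = \<lparr> omap = (\<lambda>a\<in>Obj E'. (fst a, rep a)),
  amap = (\<lambda>(a, (g, h), a')\<in>Arr E'. ((fst a, rep a), (g, (rep a, sqtrans a (fst (snd h)), lax_precomp (Mo (fst a)) (Mm (fst a) (fst (snd g))) (rep a'))), (fst a', rep a'))) \<rparr>"

lemma ObjE': "Obj E' = S" using S by (auto simp: arrow_cat_def)

text \<open>Arrows of the base are tagged triples already, so an arrow of the arrow category carries
  two layers of tags. The case distinction removes both.\<close>

lemma homE': "u \<in> hom E' a a' \<longleftrightarrow> a \<in> S \<and> a' \<in> S \<and>
   (case (a, a') of ((b, F, d), (b', F', d')) \<Rightarrow> \<exists>g h. u = (a, ((b, g, b'), (d, h, d')), a') \<and> g \<in> H b b' \<and> h \<in> H d d' \<and> c b d d' h F = c b b' d' F' g)"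
  using S by (auto simp: hom_full_subcat arrow_cat_def hom_cat_of_homs) (auto simp: hom_cat_of_homs subset_iff)

lemma homE'E:
  assumes "u \<in> hom E' a a'"
  obtains b F d b' F' d' g h where "a = (b, F, d)" "a' = (b', F', d')" "(b, F, d) \<in> S" "(b', F', d') \<in> S"
    "u = (a, ((b, g, b'), (d, h, d')), a')" "g \<in> H b b'" "h \<in> H d d'" "c b d d' h F = c b b' d' F' g"
  using assms by (cases a; cases a') (auto simp: homE')

lemma amap_K:
  assumes "(a, ((b, g, b'), (d, h, d')), a') \<in> Arr E'"
  shows "amap K (a, ((b, g, b'), (d, h, d')), a') = ((fst a, rep a), ((b, g, b'), (rep a, sqtrans a h, lax_precomp (Mo (fst a)) (Mm (fst a) g) (rep a'))), (fst a', rep a'))"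
  using assms by (simp add: K_def)

lemma catE': "category E'" by (rule category_full_subcat[OF category_arrow_cat[OF base]])

lemma K_hom:
  assumes s: "(b, F, d) \<in> S" "(b', F', d') \<in> S" and g: "g \<in> H b b'"
    and t: "monoidal_transformation (Mo b) (rep (b, F, d)) (lax_precomp (Mo b) (Mm b g) (rep (b', F', d'))) \<theta>"
  shows "((b, rep (b, F, d)), ((b, g, b'), (rep (b, F, d), \<theta>, lax_precomp (Mo b) (Mm b g) (rep (b', F', d')))), (b', rep (b', F', d')))
    \<in> hom E (b, rep (b, F, d)) (b', rep (b', F', d'))"
  using SD[OF s(1)] SD[OF s(2)] g t rep_simps(5)[OF s(1)] rep_simps(5)[OF s(2)]
    lax_monoidal_precomp[OF Mo[OF SD(1)[OF s(1)]] Mo[OF SD(1)[OF s(2)]] Mm[OF SD(1)[OF s(1)] SD(1)[OF s(2)] g] rep_simps(5)[OF s(2)]]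
  by (simp add: grothendieck_def hom_cat_of_homs hom_Lax Obj_Lax Lax_reindex_simps)

lemma is_functor_K: "is_functor E' E K"
proof (rule is_functorI[OF catE'])
  show "omap K \<in> extensional (Obj E')" "amap K \<in> extensional (Arr E')" by (simp_all add: K_def)
next
  fix a assume "a \<in> Obj E'"
  then show "omap K a \<in> Obj E"
    by (cases a) (auto simp: ObjE' K_def grothendieck_def Obj_Lax SD rep_simps)
next
  fix a a' u assume u: "u \<in> hom E' a a'"
  note H = category.homD[OF catE' u]
  show "amap K u \<in> hom E (omap K a) (omap K a')"
    using u
  proof (rule homE'E)
    fix b F d b' F' d' g h
    assume *: "a = (b, F, d)" "a' = (b', F', d')" "(b, F, d) \<in> S" "(b', F', d') \<in> S"
    "u = (a, ((b, g, b'), (d, h, d')), a')" "g \<in> H b b'" "h \<in> H d d'" "c b d d' h F = c b b' d' F' g"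
    have "omap K a = (b, rep (b, F, d))" "omap K a' = (b', rep (b', F', d'))"
      using H * by (simp_all add: K_def del: full_subcat_simps)
    then show ?thesis
      using H(1) K_hom[OF *(3,4,6) sqtrans_monoidal[OF *(3,4,6-8)]]
      unfolding *(5) by (simp add: amap_K *(1,2) del: full_subcat_simps)
  qed
next
  fix a assume a: "a \<in> Obj E'"
  obtain b F d where a': "a = (b, F, d)" "(b, F, d) \<in> S" using a by (cases a) (simp add: ObjE')
  note O = SD[OF a'(2)]
  interpret d: symmetric_monoidal "Mo d" by (rule Mo) (rule O)
  have F: "(b, F, d) \<in> Arr B" using a' S by auto
  have 1: "ide E' a = (a, ((b, i b, b), (d, i d, d)), a)"
    using a O F by (simp add: a' arrow_cat_def)
  then have 2: "(a, ((b, i b, b), (d, i d, d)), a) \<in> hom E' a a"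
    using category.ide_hom[OF catE' a] by simp
  then have sq: "i b \<in> H b b" "i d \<in> H d d" "c b d d (i d) F = c b b d F (i b)"
    by (auto simp: homE' a')
  have pre: "lax_precomp (Mo b) (func_id (Mo b)) (rep (b, F, d)) = rep (b, F, d)"
    by (rule lax_precomp_id[OF Mo[OF O(1)] rep_simps(5)[OF a'(2)]])
  \<comment> \<open>Both transformations fix every encoded point, and a transformation out of a
    functor of points is determined by its values there.\<close>
  have "sqtrans (b, F, d) (i d) = (\<lambda>x\<in>Obj (Mo b). \<lambda>s\<in>lset (rep (b, F, d)) x. s)"
  proof (rule sqtrans_unique[symmetric, OF a'(2) _ sqtrans_monoidal[OF a'(2) a'(2) sq]])
    show "monoidal_transformation (Mo b) (rep (b, F, d)) (rep (b, F, d)) (\<lambda>x\<in>Obj (Mo b). \<lambda>s\<in>lset (rep (b, F, d)) x. s)"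
      by (rule monoidal_transformation_id[OF Mo[OF O(1)] rep_simps(5)[OF a'(2)]])
    fix x p assume "x \<in> Obj (Mo b)" and p: "p \<in> hom (Mo d) \<one>\<^bsub>Mo d\<^esub> (omap (Mm b F) x)"
    then show "(\<lambda>x\<in>Obj (Mo b). \<lambda>s\<in>lset (rep (b, F, d)) x. s) x (e p) = e (amap (Mm d (i d)) p)"
      using d.homD[OF p] by (simp add: Mm_id[OF O(2)] rep_simps(1)[OF a'(2)])
  qed
  then show "amap K (ide E' a) = ide E (omap K a)"
    using category.homD(1)[OF catE' 2] a O unfolding 1
    by (simp add: amap_K del: full_subcat_simps)
      (simp add: K_def ObjE' a' grothendieck_def Obj_Lax rep_simps Mm_id pre del: full_subcat_simps,
          simp add: Lax_def rep_simps(5)[OF a'(2)])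
next
  fix a1 a2 a3 v u assume v: "v \<in> hom E' a2 a3" and u: "u \<in> hom E' a1 a2"
  obtain b1 F1 d1 b2 F2 d2 g h where 1: "a1 = (b1, F1, d1)" "a2 = (b2, F2, d2)" "(b1, F1, d1) \<in> S" "(b2, F2, d2) \<in> S"
    "u = (a1, ((b1, g, b2), (d1, h, d2)), a2)" "g \<in> H b1 b2" "h \<in> H d1 d2" "c b1 d1 d2 h F1 = c b1 b2 d2 F2 g"
    by (rule homE'E[OF u])
  obtain b3 F3 d3 g' h' where 2: "a3 = (b3, F3, d3)" "(b3, F3, d3) \<in> S"
    "v = (a2, ((b2, g', b3), (d2, h', d3)), a3)" "g' \<in> H b2 b3" "h' \<in> H d2 d3" "c b2 d2 d3 h' F2 = c b2 b3 d3 F3 g'"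
    using v 1(2) by (cases a3) (auto simp: homE')
  note O = SD[OF 1(3)] SD[OF 1(4)] SD[OF 2(2)]
  note vu = category.comp_hom[OF catE' v u]
  interpret M1: symmetric_monoidal "Mo b1" by (rule Mo) (rule O)
  interpret d1: symmetric_monoidal "Mo d1" by (rule Mo) (rule O)
  interpret d2: symmetric_monoidal "Mo d2" by (rule Mo) (rule O)
  note gm = Mm[OF O(1,4) 1(6)] and g'm = Mm[OF O(4,7) 2(4)] and hm = Mm[OF O(2,5) 1(7)] and h'm = Mm[OF O(5,8) 2(5)]
  have "v \<cdot>\<^bsub>E'\<^esub> u = v \<cdot>\<^bsub>arrow_cat B\<^esub> u"
    using v u category.homD[OF catE' v] category.homD[OF catE' u]
    by (intro full_subcat_simps(6)) (auto simp: hom_full_subcat hom_iff)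
  also have "\<dots> = (a1, ((b1, c b1 b2 b3 g' g, b3), (d1, c d1 d2 d3 h' h, d3)), a3)"
    unfolding 1(5) 2(3) arrow_cat_def using u v
    by (subst cat_of_homs_simps(6)) (auto simp: 1 2 O hom_cat_of_homs)
  finally have cmp: "v \<cdot>\<^bsub>E'\<^esub> u = (a1, ((b1, c b1 b2 b3 g' g, b3), (d1, c d1 d2 d3 h' h, d3)), a3)" .
  with vu have sq: "c b1 b2 b3 g' g \<in> H b1 b3" "c d1 d2 d3 h' h \<in> H d1 d3" 
    "c b1 d1 d3 (c d1 d2 d3 h' h) F1 = c b1 b3 d3 F3 (c b1 b2 b3 g' g)"
    by (auto simp: homE' 1 2)
  note t1 = sqtrans_monoidal[OF 1(3,4,6-8)] and t2 = sqtrans_monoidal[OF 1(4) 2(2,4-6)] 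
  note t2' = monoidal_transformation_precomp[OF Mo[OF O(1)] Mo[OF O(4)] gm t2]
  note r = rep_simps(5)[OF 1(3)] rep_simps(5)[OF 1(4)] rep_simps(5)[OF 2(2)]
  have pre: "lax_precomp (Mo b1) (Mm b1 (c b1 b2 b3 g' g)) P = lax_precomp (Mo b1) (Mm b1 g) (lax_precomp (Mo b2) (Mm b2 g') P)" for P :: "('o, 'a, 's) lax"
    using lax_precomp_comp[OF Mo[OF O(1)] Mo[OF O(4)] gm] Mm_comp[OF O(1,4,7) 1(6) 2(4)] by simp
  \<comment> \<open>On a point the left side applies \<open>h\<close> and then \<open>h'\<close>,
    the right side their composite.\<close>
  have tr: "(\<lambda>X\<in>Obj (Mo b1). compose (lset (rep (b1, F1, d1)) X) ((\<lambda>X\<in>Obj (Mo b1). sqtrans (b2, F2, d2) h' (omap (Mm b1 g) X)) X) (sqtrans (b1, F1, d1) h X))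
    = sqtrans (b1, F1, d1) (c d1 d2 d3 h' h)" (is "?\<tau> = _")
  proof (rule sqtrans_unique[OF 1(3) _ sqtrans_monoidal[OF 1(3) 2(2) sq]])
    show "monoidal_transformation (Mo b1) (rep (b1, F1, d1)) (lax_precomp (Mo b1) (Mm b1 g) (lax_precomp (Mo b2) (Mm b2 g') (rep (b3, F3, d3)))) ?\<tau>"
      by (rule monoidal_transformation_comp[OF Mo[OF O(1)] r(1) t1 t2'])
    fix x p assume x: "x \<in> Obj (Mo b1)" and p: "p \<in> hom (Mo d1) \<one>\<^bsub>Mo d1\<^esub> (omap (Mm b1 F1) x)"
    have "amap (Mm d1 h) p \<in> hom (Mo d2) \<one>\<^bsub>Mo d2\<^esub> (omap (Mm b2 F2) (omap (Mm b1 g) x))"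
      using functor_hom[OF d1.category_axioms strict_functor[OF hm] p] square(1)[OF 1(3,4,6-8)] x strict_functor_simps(1)[OF hm] by simp
    then show "?\<tau> x (e p) = e (amap (Mm d1 (c d1 d2 d3 h' h)) p)"
      using x p d1.homD[OF p] functor_obj[OF strict_functor[OF gm]]
      by (simp add: sqtrans_eq 1(3,4) rep_simps(1)[OF 1(3)] compose_def Mm_comp[OF O(2,5,8) 1(7) 2(5)])
  qed
  have 3: "((rep (b2, F2, d2), sqtrans (b2, F2, d2) h', lax_precomp (Mo b2) (Mm b2 g') (rep (b3, F3, d3)))) \<in> Arr (Lax (Mo b2))"
    using t2 r lax_monoidal_precomp[OF Mo[OF O(4)] Mo[OF O(7)] g'm] by (simp add: Lax_def)
  have 4: "amap (Lax_reindex (Mo b1) (Mo b2) (Mm b1 g)) (rep (b2, F2, d2), sqtrans (b2, F2, d2) h', lax_precomp (Mo b2) (Mm b2 g') (rep (b3, F3, d3)))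
      \<cdot>\<^bsub>Lax (Mo b1)\<^esub> (rep (b1, F1, d1), sqtrans (b1, F1, d1) h, lax_precomp (Mo b1) (Mm b1 g) (rep (b2, F2, d2)))
     = (rep (b1, F1, d1), sqtrans (b1, F1, d1) (c d1 d2 d3 h' h), lax_precomp (Mo b1) (Mm b1 (c b1 b2 b3 g' g)) (rep (b3, F3, d3)))"
    unfolding Lax_reindex_simps(2)[OF 3] pre tr[symmetric] using t1 t2' r
    by (simp add: Lax_def lax_monoidal_precomp[OF Mo[OF O(1)] Mo[OF O(4)] gm] lax_monoidal_precomp[OF Mo[OF O(4)] Mo[OF O(7)] g'm])
  have A: "(a2, ((b2, g', b3), (d2, h', d3)), a3) \<in> Arr E'" "(a1, ((b1, g, b2), (d1, h, d2)), a2) \<in> Arr E'"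
    "(a1, ((b1, c b1 b2 b3 g' g, b3), (d1, c d1 d2 d3 h' h, d3)), a3) \<in> Arr E'"
    using u v vu unfolding cmp unfolding 1(5) 2(3) by (simp_all only: hom_iff)
  show "amap K (v \<cdot>\<^bsub>E'\<^esub> u) = amap K v \<cdot>\<^bsub>E\<^esub> amap K u"
    using K_hom[OF 1(3,4,6) t1] K_hom[OF 1(4) 2(2,4) t2] 4 O 1(6) 2(4)
    unfolding cmp unfolding 1(5) 2(3) amap_K[OF A(1)] amap_K[OF A(2)] amap_K[OF A(3)]
    by (auto simp: grothendieck_def hom_cat_of_homs 1(1,2) 2(1))
qed

theorem equivalence: "\<exists>\<Phi>. equivalence_of_fibrations B E (grothendieck_proj B I) E' (dom_functor B S) \<Phi>"
proof (rule ff_equivalence[OF fibration_grothendieck catE' is_functor_dom_functor[OF base] is_functor_K])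
  have pf: "is_functor E B (grothendieck_proj B I)" using fibration_grothendieck by (simp add: fibration_def)
  show "func_comp E' (grothendieck_proj B I) K = dom_functor B S"
  proof (rule functor_eqI[OF is_functor_comp[OF catE' category_grothendieck is_functor_K pf] is_functor_dom_functor[OF base]])
    fix a assume a: "a \<in> Obj E'"
    then show "omap (func_comp E' (grothendieck_proj B I) K) a = omap (dom_functor B S) a"
      using functor_obj[OF is_functor_K a] SD
      by (cases a) (auto simp: compose_def grothendieck_proj_def dom_functor_def K_def ObjE')
  next
    fix u assume u: "u \<in> Arr E'"
    from category.arr_hom[OF catE' u] show "amap (func_comp E' (grothendieck_proj B I) K) u = amap (dom_functor B S) u"
    proof (rule homE'E)
      fix b F d b' F' d' g h assume "u = (Dom E' u, ((b, g, b'), (d, h, d')), Cod E' u)"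
      then obtain a a' where uu: "u = (a, ((b, g, b'), (d, h, d')), a')" by blast
      show ?thesis
        using functor_arr(1)[OF catE' is_functor_K u] u unfolding uu
        by (simp add: compose_def grothendieck_proj_def dom_functor_def amap_K del: full_subcat_simps cat_of_homs_simps)
    qed
  qed
next
  fix a a' k assume a: "a \<in> Obj E'" "a' \<in> Obj E'" and k: "k \<in> hom E (omap K a) (omap K a')"
  obtain b F d b' F' d' where aa: "a = (b, F, d)" "a' = (b', F', d')" by (cases a, cases a') auto
  have s: "(b, F, d) \<in> S" "(b', F', d') \<in> S" using a by (simp_all add: ObjE' aa)
  note O = SD[OF s(1)] SD[OF s(2)]
  have Ka: "omap K a = (b, rep a)" "omap K a' = (b', rep a')" using a by (simp_all add: K_def aa del: full_subcat_simps)
  obtain g \<theta> where k': "k = ((b, rep a), ((b, g, b'), (rep a, \<theta>, lax_precomp (Mo b) (Mm b g) (rep a'))), (b', rep a'))" "g \<in> H b b'"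
    and th: "monoidal_transformation (Mo b) (rep a) (lax_precomp (Mo b) (Mm b g) (rep a')) \<theta>"
    using k rep_simps(5)[OF s(2)] unfolding Ka
    by (auto simp: grothendieck_def hom_cat_of_homs hom_Lax Obj_Lax Lax_reindex_simps aa)
  have ex: "\<exists>!h. h \<in> H d d' \<and> c b d d' h F = c b b' d' F' g \<and>
        (\<forall>x\<in>Obj (Mo b). \<forall>p\<in>hom (Mo d) \<one>\<^bsub>Mo d\<^esub> (omap (Mm b F) x). e (amap (Mm d h) p) = \<theta> x (e p))"
    by (rule FF[OF s k'(2)]) (use th in \<open>simp add: aa rep_eq\<close>)
  \<comment> \<open>Being sent to \<open>k\<close> means lying over \<open>g\<close> and inducing
    \<open>\<theta>\<close>. This turns \<open>FF\<close> into unique existence of a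
    preimage.\<close>
  have eq: "amap K u = k \<longleftrightarrow> (\<forall>x\<in>Obj (Mo b). \<forall>p\<in>hom (Mo d) \<one>\<^bsub>Mo d\<^esub> (omap (Mm b F) x). e (amap (Mm d h) p) = \<theta> x (e p)) \<and> g' = g"
    if u: "u = (a, ((b, g', b'), (d, h, d')), a')" "g' \<in> H b b'" "h \<in> H d d'" "c b d d' h F = c b b' d' F' g'" for h g' u
  proof -
    have "u \<in> hom E' a a'" using u s by (simp add: homE' aa)
    then have uA: "u \<in> Arr E'" by (simp only: hom_iff)
    note t = sqtrans_monoidal[OF s u(2-4)]
    have "\<theta> = sqtrans a h \<longleftrightarrow> (\<forall>x\<in>Obj (Mo b). \<forall>p\<in>hom (Mo d) \<one>\<^bsub>Mo d\<^esub> (omap (Mm b F) x). e (amap (Mm d h) p) = \<theta> x (e p))"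
      using sqtrans_eq[OF s(1)] sqtrans_unique[OF s(1) th[unfolded aa] t] unfolding aa by metis
    then show ?thesis
      using amap_K[OF uA[unfolded u(1)]] unfolding u(1) k'(1) by (auto simp: aa)
  qed
  from ex obtain h where h: "h \<in> H d d'" "c b d d' h F = c b b' d' F' g"
    "\<forall>x\<in>Obj (Mo b). \<forall>p\<in>hom (Mo d) \<one>\<^bsub>Mo d\<^esub> (omap (Mm b F) x). e (amap (Mm d h) p) = \<theta> x (e p)" by blast
  show "\<exists>!u. u \<in> hom E' a a' \<and> amap K u = k"
  proof (rule ex1I[of _ "(a, ((b, g, b'), (d, h, d')), a')"])
    show "(a, ((b, g, b'), (d, h, d')), a') \<in> hom E' a a' \<and> amap K (a, ((b, g, b'), (d, h, d')), a') = k"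
      using eq[OF refl k'(2) h(1,2)] h(3) s k'(2) h(1,2) by (simp add: homE' aa)
    fix u assume u: "u \<in> hom E' a a' \<and> amap K u = k"
    then obtain g' h' where u': "u = (a, ((b, g', b'), (d, h', d')), a')" "g' \<in> H b b'" "h' \<in> H d d'" "c b d d' h' F = c b b' d' F' g'"
      by (auto simp: homE' aa)
    with eq[OF u'] u have "g' = g" "\<forall>x\<in>Obj (Mo b). \<forall>p\<in>hom (Mo d) \<one>\<^bsub>Mo d\<^esub> (omap (Mm b F) x). e (amap (Mm d h') p) = \<theta> x (e p)" by auto
    with ex h u' have "h' = h" by blast
    then show "u = (a, ((b, g, b'), (d, h, d')), a')" using u' \<open>g' = g\<close> by simp
  qed
next
  fix x assume "x \<in> Obj E"
  then obtain b P where x: "x = (b, P)" "b \<in> Ob" "lax_monoidal (Mo b) P" by (auto simp: grothendieck_def Obj_Lax)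
  obtain d F \<alpha> where s: "(b, F, d) \<in> S" and \<alpha>: "monoidal_transformation (Mo b) P (rep (b, F, d)) \<alpha>"
    and bij: "\<And>y. y \<in> Obj (Mo b) \<Longrightarrow> bij_betw (\<alpha> y) (lset P y) (lset (rep (b, F, d)) y)"
    using ES[OF x(2,3)] unfolding rep_eq by blast
  note M = Mo[OF x(2)] and r = rep_simps(5)[OF s]
  interpret M: symmetric_monoidal "Mo b" by (rule M)
  interpret P: lax_functor "Mo b" P by standard (rule x)
  interpret R: lax_functor "Mo b" "rep (b, F, d)" by standard (rule r)
  define \<beta> where "\<beta> = (\<lambda>y\<in>Obj (Mo b). \<lambda>q\<in>lset (rep (b, F, d)) y. inv_into (lset P y) (\<alpha> y) q)"
  have \<beta>\<alpha>: "\<beta> y (\<alpha> y q) = q" if "y \<in> Obj (Mo b)" "q \<in> lset P y" for y q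
    using that bij[OF that(1)] by (auto simp: \<beta>_def bij_betw_def)
  have \<alpha>\<beta>: "\<alpha> y (\<beta> y q) = q" "\<beta> y q \<in> lset P y" if "y \<in> Obj (Mo b)" "q \<in> lset (rep (b, F, d)) y" for y q
    using that bij[OF that(1)] by (auto simp: \<beta>_def bij_betw_def f_inv_into_f inv_into_into)
  note \<alpha>c = monoidal_transformation_closed[OF M \<alpha>]
  \<comment> \<open>Each law for the inverse is checked after applying \<open>\<alpha>\<close>,
    where it becomes the law for \<open>\<alpha>\<close>; then \<open>\<beta>\<close> cancels
    it.\<close>
  have \<beta>: "monoidal_transformation (Mo b) (rep (b, F, d)) P \<beta>"
    unfolding monoidal_transformation_def
  proof (intro conjI ballI)
    show "\<beta> \<in> (\<Pi>\<^sub>E y\<in>Obj (Mo b). lset (rep (b, F, d)) y \<rightarrow>\<^sub>E lset P y)"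
      using \<alpha>\<beta>(2) by (auto simp: PiE_iff) (auto simp: \<beta>_def)
    fix f q assume f: "f \<in> Arr (Mo b)" and q: "q \<in> lset (rep (b, F, d)) (Dom (Mo b) f)"
    have "\<alpha> (Cod (Mo b) f) (lact P f (\<beta> (Dom (Mo b) f) q)) = lact (rep (b, F, d)) f q"
      using monoidal_transformation_natural[OF M \<alpha> M.arr_hom[OF f] \<alpha>\<beta>(2)[OF _ q]] f q \<alpha>\<beta>(1) by simp
    then show "\<beta> (Cod (Mo b) f) (lact (rep (b, F, d)) f q) = lact P f (\<beta> (Dom (Mo b) f) q)"
      using \<beta>\<alpha>[OF _ P.act_closed[OF M.arr_hom[OF f] \<alpha>\<beta>(2)[OF _ q]]] f by simp
  next
    show "\<beta> \<one>\<^bsub>Mo b\<^esub> (lunit (rep (b, F, d))) = lunit P"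
      using \<beta>\<alpha>[OF M.unit_obj P.lunit_closed] \<alpha> by (simp add: monoidal_transformation_def)
  next
    fix X Y p q assume *: "X \<in> Obj (Mo b)" "Y \<in> Obj (Mo b)" "p \<in> lset (rep (b, F, d)) X" "q \<in> lset (rep (b, F, d)) Y"
    have "\<alpha> (X \<otimes>\<^bsub>Mo b\<^esub> Y) (lmult P X Y (\<beta> X p) (\<beta> Y q)) = lmult (rep (b, F, d)) X Y p q"
      using \<alpha> * \<alpha>\<beta> by (simp add: monoidal_transformation_def)
    then show "\<beta> (X \<otimes>\<^bsub>Mo b\<^esub> Y) (lmult (rep (b, F, d)) X Y p q) = lmult P X Y (\<beta> X p) (\<beta> Y q)"
      using \<beta>\<alpha>[OF _ P.lmult_closed[OF *(1,2) \<alpha>\<beta>(2)[OF *(1,3)] \<alpha>\<beta>(2)[OF *(2,4)]]] * by simp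
  qed
  have id: "(b, i b, b) \<in> hom B b b" using B.ide_hom[of b] x(2) by simp
  then have ib: "i b \<in> H b b" by (simp add: hom_cat_of_homs)
  have pre: "lax_precomp (Mo b) (Mm b (i b)) Q = Q" if "lax_monoidal (Mo b) Q" for Q :: "('o, 'a, 's) lax"
    using that by (simp add: Mm_id[OF x(2)] lax_precomp_id[OF M])
  have ar: "((b, Q), ((b, i b, b), (Q, \<gamma>, Q')), (b, Q')) \<in> hom E (b, Q) (b, Q')"
    if "lax_monoidal (Mo b) Q" "lax_monoidal (Mo b) Q'" "monoidal_transformation (Mo b) Q Q' \<gamma>" for Q Q' \<gamma>
    using that x(2) id by (auto simp: grothendieck_def hom_cat_of_homs Obj_Lax hom_Lax Lax_reindex_simps pre)
  \<comment> \<open>Both composites of the isomorphism with its inverse are instances, with the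
    roles of \<open>P\<close> and the functor of points exchanged.\<close>
  have cm: "((b, Q'), ((b, i b, b), (Q', \<delta>, Q)), (b, Q)) \<cdot>\<^bsub>E\<^esub> ((b, Q), ((b, i b, b), (Q, \<gamma>, Q')), (b, Q')) = ide E (b, Q)"
    if q: "lax_monoidal (Mo b) Q" "lax_monoidal (Mo b) Q'" "monoidal_transformation (Mo b) Q Q' \<gamma>" "monoidal_transformation (Mo b) Q' Q \<delta>"
      and inv: "\<And>y q. \<lbrakk>y \<in> Obj (Mo b); q \<in> lset Q y\<rbrakk> \<Longrightarrow> \<delta> y (\<gamma> y q) = q" for Q Q' \<gamma> \<delta>
  proof -
    have "(\<lambda>X\<in>Obj (Mo b). \<delta> (omap (Mm b (i b)) X)) = \<delta>"
      using q(4) by (auto simp: Mm_id[OF x(2)] monoidal_transformation_def PiE_iff extensional_def restrict_def)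
    then have 1: "amap (Lax_reindex (Mo b) (Mo b) (Mm b (i b))) (Q', \<delta>, Q) = (Q', \<delta>, Q)"
      using q by (subst Lax_reindex_simps(2)) (auto simp: pre, simp add: Lax_def)
    have "(\<lambda>X\<in>Obj (Mo b). compose (lset Q X) (\<delta> X) (\<gamma> X)) = (\<lambda>X\<in>Obj (Mo b). \<lambda>x\<in>lset Q X. x)"
      using inv by (auto simp: fun_eq_iff compose_def restrict_def)
    then have 2: "(Q', \<delta>, Q) \<cdot>\<^bsub>Lax (Mo b)\<^esub> (Q, \<gamma>, Q') = ide (Lax (Mo b)) Q"
      using q by (simp add: Lax_def)
    have 3: "c b b b (i b) (i b) = i b" using B.comp_ide(1)[of "(b, i b, b)" b] id x(2) ib by (simp add: hom_iff)
    show ?thesis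
      using ar[OF q(1-3)] ar[OF q(2,1,4)] x(2) 1 2 3 q(1)
      by (simp add: grothendieck_def hom_cat_of_homs ib Obj_Lax)
  qed
  let ?i = "((b, P), ((b, i b, b), (P, \<alpha>, rep (b, F, d))), (b, rep (b, F, d)))"
  let ?j = "((b, rep (b, F, d)), ((b, i b, b), (rep (b, F, d), \<beta>, P)), (b, P))"
  have Kb: "omap K (b, F, d) = (b, rep (b, F, d))" using s by (simp add: K_def ObjE' del: full_subcat_simps)
  have "amap (grothendieck_proj B I) ?i = ide B (omap (grothendieck_proj B I) x)"
    using ar[OF x(3) r \<alpha>] x \<open>x \<in> Obj E\<close> by (simp add: grothendieck_proj_def hom_iff)
  then show "\<exists>a i j. a \<in> Obj E' \<and> i \<in> hom E x (omap K a) \<and> j \<in> hom E (omap K a) x \<and> j \<cdot>\<^bsub>E\<^esub> i = ide E x \<and> i \<cdot>\<^bsub>E\<^esub> j = ide E (omap K a) \<and>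
      amap (grothendieck_proj B I) i = ide B (omap (grothendieck_proj B I) x)"
    using s ar[OF x(3) r \<alpha>] ar[OF r x(3) \<beta>] cm[OF x(3) r \<alpha> \<beta> \<beta>\<alpha>] cm[OF r x(3) \<beta> \<alpha> \<alpha>\<beta>(1)]
    by (intro exI[of _ "(b, F, d)"] exI[of _ ?i] exI[of _ ?j]) (simp add: ObjE' Kb x(1) del: full_subcat_simps)
qed

end

section \<open>Coherence for permutations of labelled tensor products\<close>

context symmetric_monoidal
begin

lemma ide_tarr [simp]: "\<lbrakk>X \<in> Obj C; Y \<in> Obj C; f \<in> Arr C\<rbrakk> \<Longrightarrow> ide C X \<boxtimes> (ide C Y \<boxtimes> f) = ide C (X \<otimes> Y) \<boxtimes> f"
  using tarr_assoc[of "ide C X" "ide C Y" f] by (simp del: tarr_assoc)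

lemma whisker:
  assumes "f \<in> Arr C" "g \<in> Arr C"
  shows "Cod C f = Y \<Longrightarrow> Dom C g = Z \<Longrightarrow> (ide C Y \<boxtimes> g) \<cdot> (f \<boxtimes> ide C Z) = f \<boxtimes> g"
    "Cod C g = Z \<Longrightarrow> Dom C f = Y \<Longrightarrow> (f \<boxtimes> ide C Z) \<cdot> (ide C Y \<boxtimes> g) = f \<boxtimes> g"
  using assms by (auto simp: tarr_comp)

lemma symm_nat:
  "\<lbrakk>f \<in> Arr C; g \<in> Arr C; Cod C f = X; Cod C g = Y\<rbrakk> \<Longrightarrow> \<sigma> X Y \<cdot> (f \<boxtimes> g) = (g \<boxtimes> f) \<cdot> \<sigma> (Dom C f) (Dom C g)"
  using symm_natural[OF arr_hom arr_hom] by auto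

primrec tens :: "'o list \<Rightarrow> 'o" where
  "tens [] = \<one>"
| "tens (X # Xs) = X \<otimes> tens Xs"

lemma tens_obj [simp]: "set Xs \<subseteq> Obj C \<Longrightarrow> tens Xs \<in> Obj C"
  by (induction Xs) auto

lemma tens_append [simp]: "\<lbrakk>set Xs \<subseteq> Obj C; set Ys \<subseteq> Obj C\<rbrakk> \<Longrightarrow> tens (Xs @ Ys) = tens Xs \<otimes> tens Ys"
  by (induction Xs) auto

end

definition rearr :: "'l list \<Rightarrow> 'l list \<Rightarrow> bool" where
  "rearr L L' \<longleftrightarrow> distinct L \<and> distinct L' \<and> set L = set L'"

lemma rearr_Cons:
  assumes "rearr (x # L) M"
  obtains pre post where "M = pre @ x # post" "x \<notin> set pre" "rearr L (pre @ post)"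
proof -
  have "x \<in> set M" using assms by (auto simp: rearr_def)
  then obtain pre post where "M = pre @ x # post" by (metis split_list)
  moreover from this have "x \<notin> set pre" "rearr L (pre @ post)"
    using assms by (auto simp: rearr_def)
  ultimately show thesis by (rule that)
qed

text \<open>Labels keep equal tensor factors apart. A permutation of factors is then determined by
  its source and target lists, even when an object occurs several times.\<close>

locale labelled_smc = symmetric_monoidal C for C :: "('o, 'a, 'm) smc_scheme" (structure) +
  fixes ty :: "'l \<Rightarrow> 'o"
  assumes ty [simp]: "ty l \<in> Obj C"
begin

definition T :: "'l list \<Rightarrow> 'o" where "T L = tens (map ty L)"

lemma T_simps [simp]: "T [] = \<one>" "T (x # L) = ty x \<otimes> T L" "T (L @ M) = T L \<otimes> T M" "T L \<in> Obj C"
proof -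
  have "set (map ty L) \<subseteq> Obj C" for L by auto
  then show "T (L @ M) = T L \<otimes> T M" "T L \<in> Obj C" by (simp_all add: T_def)
qed (simp_all add: T_def)

text \<open>Insertion: the tail is permuted first, then the head is moved past the factors
  \<open>pre\<close> that precede it in the target.\<close>

fun perm :: "'l list \<Rightarrow> 'l list \<Rightarrow> 'a" where
  "perm [] L' = ide C \<one>"
| "perm (x # L) L' =
    (let pre = takeWhile (\<lambda>y. y \<noteq> x) L'; post = tl (dropWhile (\<lambda>y. y \<noteq> x) L') in
     (\<sigma> (ty x) (T pre) \<boxtimes> ide C (T post)) \<cdot> (ide C (ty x) \<boxtimes> perm L (pre @ post)))"

lemma perm_Cons: "x \<notin> set pre \<Longrightarrow> perm (x # L) (pre @ x # post) =
    (\<sigma> (ty x) (T pre) \<boxtimes> ide C (T post)) \<cdot> (ide C (ty x) \<boxtimes> perm L (pre @ post))"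
proof -
  assume x: "x \<notin> set pre"
  then have *: "\<And>y. y \<in> set pre \<Longrightarrow> y \<noteq> x" by auto
  have "takeWhile (\<lambda>y. y \<noteq> x) (pre @ x # post) = pre" "dropWhile (\<lambda>y. y \<noteq> x) (pre @ x # post) = x # post"
    using takeWhile_append2[of pre "\<lambda>y. y \<noteq> x", OF *] dropWhile_append2[of pre "\<lambda>y. y \<noteq> x", OF *] by simp_all
  then show ?thesis by (simp only: perm.simps Let_def list.sel)
qed

declare perm.simps(2) [simp del]

lemma perm_arr [simp]:
  assumes "rearr L M"
  shows "perm L M \<in> Arr C" "Dom C (perm L M) = T L" "Cod C (perm L M) = T M"
proof -
  have "perm L M \<in> hom C (T L) (T M)"
    using assms
  proof (induction L arbitrary: M)
    case Nil then show ?case using ide_hom by (simp add: rearr_def)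
  next
    case (Cons x L)
    from Cons.prems show ?case
    proof (rule rearr_Cons)
      fix pre post assume *: "M = pre @ x # post" "x \<notin> set pre" "rearr L (pre @ post)"
      from Cons.IH[OF this(3)] show ?case using * by (simp add: perm_Cons hom_iff)
    qed
  qed
  then show "perm L M \<in> Arr C" "Dom C (perm L M) = T L" "Cod C (perm L M) = T M" by (auto simp: hom_iff)
qed

lemma perm_id [simp]: "distinct L \<Longrightarrow> perm L L = ide C (T L)"
  by (induction L) (simp_all add: perm_Cons[of _ "[]", simplified])

text \<open>Induction on the source, by the position of its head in the target. If it lies to the
  left, its symmetry and the swap act on disjoint factors. If it lies to the right, naturality
  slides the swap through its symmetry. If it is one of the two exchanged factors, the hexagon
  absorbs the swap, in the last case after cancelling a symmetry against its inverse.\<close>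

lemma perm_swap:
  assumes "rearr L (A @ x # y # B)"
  shows "(ide C (T A) \<boxtimes> \<sigma> (ty x) (ty y) \<boxtimes> ide C (T B)) \<cdot> perm L (A @ x # y # B) = perm L (A @ y # x # B)"
  using assms
proof (induction L arbitrary: A B)
  case Nil then show ?case by (simp add: rearr_def)
next
  case (Cons z L)
  have z: "z \<in> set A \<or> z \<in> set B \<or> z = x \<or> z = y" using Cons.prems by (auto simp: rearr_def)
  have d: "z \<notin> set L" "distinct (A @ x # y # B)" using Cons.prems by (auto simp: rearr_def)
  consider A1 A2 where "A = A1 @ z # A2" | B1 B2 where "B = B1 @ z # B2" | "z = x" | "z = y"
    using z by (metis split_list)
  then show ?case
  proof cases
    case (1 A1 A2)
    let ?W = "ide C (T A2) \<boxtimes> \<sigma> (ty x) (ty y) \<boxtimes> ide C (T B)"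
    have p: "rearr L (A1 @ A2 @ x # y # B)" "rearr L (A1 @ A2 @ y # x # B)" using Cons.prems 1 by (auto simp: rearr_def)
    define p where "p = perm L (A1 @ A2 @ x # y # B)"
    have pa: "p \<in> Arr C" "Cod C p = T A1 \<otimes> T A2 \<otimes> ty x \<otimes> ty y \<otimes> T B" "Dom C p = T L" using p by (simp_all add: p_def)
    have IH: "(ide C (T A1) \<boxtimes> ?W) \<cdot> p = perm L (A1 @ A2 @ y # x # B)"
      using Cons.IH[of "A1 @ A2" B] p by (simp add: p_def)
    have "(ide C (T A1 \<otimes> ty z) \<boxtimes> ?W) \<cdot> ((\<sigma> (ty z) (T A1) \<boxtimes> ide C (T A2 \<otimes> ty x \<otimes> ty y \<otimes> T B)) \<cdot> (ide C (ty z) \<boxtimes> p))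
        = (\<sigma> (ty z) (T A1) \<boxtimes> ?W) \<cdot> (ide C (ty z) \<boxtimes> p)"
      using pa by (subst comp_assoc[symmetric]) (simp_all add: whisker del: ide_tarr)
    also have "\<dots> = ((\<sigma> (ty z) (T A1) \<boxtimes> ide C (T A2 \<otimes> ty y \<otimes> ty x \<otimes> T B)) \<cdot> (ide C (ty z) \<boxtimes> ide C (T A1) \<boxtimes> ?W)) \<cdot> (ide C (ty z) \<boxtimes> p)"
      using pa whisker(2)[OF _ _ refl refl, of "\<sigma> (ty z) (T A1)" ?W] by simp
    also have "\<dots> = (\<sigma> (ty z) (T A1) \<boxtimes> ide C (T A2 \<otimes> ty y \<otimes> ty x \<otimes> T B)) \<cdot> ((ide C (ty z) \<boxtimes> (ide C (T A1) \<boxtimes> ?W)) \<cdot> (ide C (ty z) \<boxtimes> p))"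
      using pa by (intro comp_assoc) simp_all
    also have "(ide C (ty z) \<boxtimes> (ide C (T A1) \<boxtimes> ?W)) \<cdot> (ide C (ty z) \<boxtimes> p) = ide C (ty z) \<boxtimes> perm L (A1 @ A2 @ y # x # B)"
      using pa unfolding IH[symmetric] by (subst tarr_comp) simp_all
    finally show ?thesis
      using d 1 by (simp add: perm_Cons p_def)
  next
    case (2 B1 B2)
    let ?V = "ide C (T A) \<boxtimes> \<sigma> (ty x) (ty y) \<boxtimes> ide C (T B1)"
    let ?X = "T A \<otimes> ty x \<otimes> ty y \<otimes> T B1" and ?Y = "T A \<otimes> ty y \<otimes> ty x \<otimes> T B1"
    have p: "rearr L (A @ x # y # B1 @ B2)" "rearr L (A @ y # x # B1 @ B2)" using Cons.prems 2 by (auto simp: rearr_def)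
    define p where "p = perm L (A @ x # y # B1 @ B2)"
    have pa: "p \<in> Arr C" "Cod C p = ?X \<otimes> T B2" "Dom C p = T L" using p by (simp_all add: p_def)
    have IH: "(?V \<boxtimes> ide C (T B2)) \<cdot> p = perm L (A @ y # x # B1 @ B2)"
      using Cons.IH[of A "B1 @ B2"] p by (simp add: p_def)
    have d': "z \<noteq> x" "z \<noteq> y" using d 2 by auto
    have "(ide C (T A) \<boxtimes> \<sigma> (ty x) (ty y) \<boxtimes> ide C (T B)) \<cdot> perm (z # L) (A @ x # y # B) =
        ((?V \<boxtimes> ide C (ty z)) \<boxtimes> ide C (T B2)) \<cdot> ((\<sigma> (ty z) ?X \<boxtimes> ide C (T B2)) \<cdot> (ide C (ty z) \<boxtimes> p))"
      using d d' 2 perm_Cons[of z "A @ x # y # B1"] by (simp add: p_def)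
    also have "\<dots> = (((?V \<boxtimes> ide C (ty z)) \<cdot> \<sigma> (ty z) ?X) \<boxtimes> ide C (T B2)) \<cdot> (ide C (ty z) \<boxtimes> p)"
      using pa by (subst comp_assoc[symmetric]) (simp_all add: tarr_comp del: tarr_simps)
    also have "(?V \<boxtimes> ide C (ty z)) \<cdot> \<sigma> (ty z) ?X = \<sigma> (ty z) ?Y \<cdot> (ide C (ty z) \<boxtimes> ?V)"
      using symm_nat[OF _ _ refl refl, of "ide C (ty z)" ?V] by simp
    also have "((\<sigma> (ty z) ?Y \<cdot> (ide C (ty z) \<boxtimes> ?V)) \<boxtimes> ide C (T B2)) = (\<sigma> (ty z) ?Y \<boxtimes> ide C (T B2)) \<cdot> (ide C (ty z) \<boxtimes> (?V \<boxtimes> ide C (T B2)))"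
      using tarr_comp[of "ide C (ty z) \<boxtimes> ?V" "\<sigma> (ty z) ?Y" "ide C (T B2)" "ide C (T B2)"] by simp
    also have "((\<sigma> (ty z) ?Y \<boxtimes> ide C (T B2)) \<cdot> (ide C (ty z) \<boxtimes> (?V \<boxtimes> ide C (T B2)))) \<cdot> (ide C (ty z) \<boxtimes> p)
        = (\<sigma> (ty z) ?Y \<boxtimes> ide C (T B2)) \<cdot> ((ide C (ty z) \<boxtimes> (?V \<boxtimes> ide C (T B2))) \<cdot> (ide C (ty z) \<boxtimes> p))"
      using pa by (intro comp_assoc) simp_all
    also have "(ide C (ty z) \<boxtimes> (?V \<boxtimes> ide C (T B2))) \<cdot> (ide C (ty z) \<boxtimes> p) = ide C (ty z) \<boxtimes> perm L (A @ y # x # B1 @ B2)"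
      using pa unfolding IH[symmetric] by (subst tarr_comp) simp_all
    finally show ?thesis
      using d d' 2 perm_Cons[of z "A @ y # x # B1"] by simp
  next
    case 3
    have p: "rearr L (A @ y # B)" using Cons.prems 3 by (auto simp: rearr_def)
    have "\<sigma> (ty x) (T A \<otimes> ty y) \<boxtimes> ide C (T B) = (ide C (T A) \<boxtimes> \<sigma> (ty x) (ty y) \<boxtimes> ide C (T B)) \<cdot> (\<sigma> (ty x) (T A) \<boxtimes> ide C (ty y \<otimes> T B))"
      using tarr_comp[of "\<sigma> (ty x) (T A) \<boxtimes> ide C (ty y)" "ide C (T A) \<boxtimes> \<sigma> (ty x) (ty y)" "ide C (T B)" "ide C (T B)"] by (simp add: symm_hexagon)
    then show ?thesis
      using d 3 p perm_Cons[of x "A @ [y]"] perm_Cons[of x A] by (simp add: comp_assoc)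
  next
    case 4
    have p: "rearr L (A @ x # B)" "y \<noteq> x" using Cons.prems 4 by (auto simp: rearr_def)
    have "\<sigma> (ty y) (T A \<otimes> ty x) \<boxtimes> ide C (T B) = (ide C (T A) \<boxtimes> \<sigma> (ty y) (ty x) \<boxtimes> ide C (T B)) \<cdot> (\<sigma> (ty y) (T A) \<boxtimes> ide C (ty x \<otimes> T B))"
      using tarr_comp[of "\<sigma> (ty y) (T A) \<boxtimes> ide C (ty x)" "ide C (T A) \<boxtimes> \<sigma> (ty y) (ty x)" "ide C (T B)" "ide C (T B)"] by (simp add: symm_hexagon)
    moreover have "(ide C (T A) \<boxtimes> \<sigma> (ty x) (ty y) \<boxtimes> ide C (T B)) \<cdot> ((ide C (T A) \<boxtimes> \<sigma> (ty y) (ty x) \<boxtimes> ide C (T B)) \<cdot> q) = q"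
      if "q \<in> Arr C" "Cod C q = T A \<otimes> ty y \<otimes> ty x \<otimes> T B" for q
      using that by (subst comp_assoc[symmetric]) (simp_all add: tarr_comp symm_involutive)
    ultimately show ?thesis
      using d 4 p perm_Cons[of y "A @ [x]"] perm_Cons[of y A] by (simp add: comp_assoc)
  qed
qed

lemma perm_move:
  assumes "rearr L (A @ x # P @ B)"
  shows "(ide C (T A) \<boxtimes> \<sigma> (ty x) (T P) \<boxtimes> ide C (T B)) \<cdot> perm L (A @ x # P @ B) = perm L (A @ P @ x # B)"
  using assms
proof (induction P arbitrary: A)
  case Nil then show ?case by simp
next
  case (Cons y P)
  have p: "rearr L (A @ y # x # P @ B)" using Cons.prems by (auto simp: rearr_def)
  have "ide C (T A) \<boxtimes> \<sigma> (ty x) (T (y # P)) \<boxtimes> ide C (T B) = 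
     (ide C (T (A @ [y])) \<boxtimes> \<sigma> (ty x) (T P) \<boxtimes> ide C (T B)) \<cdot> (ide C (T A) \<boxtimes> \<sigma> (ty x) (ty y) \<boxtimes> ide C (T (P @ B)))"
  proof -
    have "(ide C (T A) \<boxtimes> ((ide C (ty y) \<boxtimes> \<sigma> (ty x) (T P)) \<boxtimes> ide C (T B))) \<cdot> (ide C (T A) \<boxtimes> ((\<sigma> (ty x) (ty y) \<boxtimes> ide C (T P)) \<boxtimes> ide C (T B)))
        = ide C (T A) \<boxtimes> \<sigma> (ty x) (T (y # P)) \<boxtimes> ide C (T B)"
      by (simp add: tarr_comp symm_hexagon del: tarr_simps)
    then show ?thesis by simp
  qed
  then show ?case
    using Cons.IH[of "A @ [y]"] perm_swap[of L A x y "P @ B"] Cons.prems p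
    by (simp add: comp_assoc)
qed

text \<open>Each insertion step of \<open>perm M N\<close> is a block move, which is a chain of
  adjacent swaps. The fixed prefix \<open>K\<close> is there for the induction: peeling off the head
  of \<open>M\<close> adds it to the prefix.\<close>

lemma perm_comp_ctx:
  assumes "rearr L (K @ M)" "rearr M N"
  shows "(ide C (T K) \<boxtimes> perm M N) \<cdot> perm L (K @ M) = perm L (K @ N)"
  using assms
proof (induction M arbitrary: K N)
  case Nil then show ?case by (simp add: rearr_def)
next
  case (Cons x M)
  from Cons.prems(2) show ?case
  proof (rule rearr_Cons)
    fix pre post assume N: "N = pre @ x # post" "x \<notin> set pre" "rearr M (pre @ post)"
    have r: "rearr L ((K @ [x]) @ M)" "rearr L (K @ x # pre @ post)" using Cons.prems N by (auto simp: rearr_def)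
    have "(ide C (T K) \<boxtimes> perm (x # M) N) \<cdot> perm L (K @ x # M) =
      ((ide C (T K) \<boxtimes> (\<sigma> (ty x) (T pre) \<boxtimes> ide C (T post))) \<cdot> (ide C (T K) \<boxtimes> (ide C (ty x) \<boxtimes> perm M (pre @ post)))) \<cdot> perm L (K @ x # M)"
      using N by (subst tarr_comp) (simp_all add: perm_Cons)
    also have "\<dots> = (ide C (T K) \<boxtimes> \<sigma> (ty x) (T pre) \<boxtimes> ide C (T post)) \<cdot> ((ide C (T (K @ [x])) \<boxtimes> perm M (pre @ post)) \<cdot> perm L ((K @ [x]) @ M))"
      using N Cons.prems by (subst comp_assoc) simp_all
    also have "\<dots> = perm L (K @ N)"
      using Cons.IH[OF r(1) N(3)] perm_move[of L K x pre post] r N by simp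
    finally show ?thesis .
  qed
qed

text \<open>This functoriality is the coherence used throughout: composites of permutations agree as
  soon as their source and target lists agree.\<close>

lemma perm_comp: "\<lbrakk>rearr L M; rearr M N\<rbrakk> \<Longrightarrow> perm M N \<cdot> perm L M = perm L N"
  using perm_comp_ctx[of L "[]" M N] by simp

text \<open>The case of \<open>perm_comp_ctx\<close> in which the permutation performed first is an
  identity.\<close>

lemma perm_left: "rearr (K @ M) (K @ N) \<Longrightarrow> ide C (T K) \<boxtimes> perm M N = perm (K @ M) (K @ N)"
  using perm_comp_ctx[of "K @ M" K M N] by (auto simp: rearr_def)

lemma perm_right: "rearr (M @ K) (N @ K) \<Longrightarrow> perm M N \<boxtimes> ide C (T K) = perm (M @ K) (N @ K)"
proof (induction M arbitrary: N)
  case Nil then have "N = []" by (cases N) (auto simp: rearr_def)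
  then show ?case using Nil by (simp add: rearr_def)
next
  case (Cons x M)
  have "rearr (x # M) N" using Cons.prems by (auto simp: rearr_def)
  then show ?case
  proof (rule rearr_Cons)
    fix pre post assume N: "N = pre @ x # post" "x \<notin> set pre" "rearr M (pre @ post)"
    then have "rearr (M @ K) ((pre @ post) @ K)" using Cons.prems by (auto simp: rearr_def)
    from Cons.IH[OF this] have IH: "perm M (pre @ post) \<boxtimes> ide C (T K) = perm (M @ K) (pre @ post @ K)" by simp
    have "perm (x # M) N \<boxtimes> ide C (T K) = ((\<sigma> (ty x) (T pre) \<boxtimes> ide C (T post)) \<boxtimes> ide C (T K)) \<cdot> ((ide C (ty x) \<boxtimes> perm M (pre @ post)) \<boxtimes> ide C (T K))"
      using N by (subst tarr_comp) (simp_all add: perm_Cons)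
    then show ?thesis using N IH by (simp add: perm_Cons)
  qed
qed

text \<open>Both sides are compared after composing with the symmetry in the other direction. There
  the hexagon splits off the head of \<open>L\<close> and the remaining symmetries cancel.\<close>

lemma perm_symm: "distinct (L @ M) \<Longrightarrow> perm (L @ M) (M @ L) = \<sigma> (T L) (T M)"
proof (induction L)
  case Nil then show ?case by simp
next
  case (Cons x L)
  have r: "rearr (L @ M) (M @ L)" "x \<notin> set M" using Cons.prems by (auto simp: rearr_def)
  have 1: "perm ((x # L) @ M) (M @ x # L) = (\<sigma> (ty x) (T M) \<boxtimes> ide C (T L)) \<cdot> (ide C (ty x) \<boxtimes> \<sigma> (T L) (T M))"
    using Cons r by (simp add: perm_Cons)
  have 2: "\<sigma> (T M) (ty x \<otimes> T L) = (ide C (ty x) \<boxtimes> \<sigma> (T M) (T L)) \<cdot> (\<sigma> (T M) (ty x) \<boxtimes> ide C (T L))"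
    by (simp add: symm_hexagon)
  have "\<sigma> (T M) (T (x # L)) \<cdot> perm ((x # L) @ M) (M @ x # L) =
     (ide C (ty x) \<boxtimes> \<sigma> (T M) (T L)) \<cdot> (((\<sigma> (T M) (ty x) \<boxtimes> ide C (T L)) \<cdot> (\<sigma> (ty x) (T M) \<boxtimes> ide C (T L))) \<cdot> (ide C (ty x) \<boxtimes> \<sigma> (T L) (T M)))"
    unfolding 1 T_simps(2) 2 by (simp add: comp_assoc)
  also have "\<dots> = ide C (T (x # L) \<otimes> T M)"
    by (simp add: tarr_comp symm_involutive)
  finally have "\<sigma> (T (x # L)) (T M) \<cdot> \<sigma> (T M) (T (x # L)) \<cdot> perm ((x # L) @ M) (M @ x # L) = \<sigma> (T (x # L)) (T M)"
    by simp
  moreover have "rearr ((x # L) @ M) (M @ x # L)" using Cons.prems by (auto simp: rearr_def)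
  ultimately show ?case
    using symm_involutive[of "T M" "T (x # L)"] by (subst (asm) comp_assoc[symmetric]) simp_all
qed

end

section \<open>Normal forms of traced diagrams\<close>

context symmetric_monoidal
begin

text \<open>Both sides are inverse to \<open>\<sigma> Z (X \<otimes> Y)\<close>, by the first
  hexagon and involutivity.\<close>

lemma symm_hexagon2:
  assumes "X \<in> Obj C" "Y \<in> Obj C" "Z \<in> Obj C"
  shows "\<sigma> (X \<otimes> Y) Z = (\<sigma> X Z \<boxtimes> ide C Y) \<cdot> (ide C X \<boxtimes> \<sigma> Y Z)"
proof -
  have "\<sigma> Z (X \<otimes> Y) \<cdot> ((\<sigma> X Z \<boxtimes> ide C Y) \<cdot> (ide C X \<boxtimes> \<sigma> Y Z)) =
    (ide C X \<boxtimes> \<sigma> Z Y) \<cdot> (((\<sigma> Z X \<boxtimes> ide C Y) \<cdot> (\<sigma> X Z \<boxtimes> ide C Y)) \<cdot> (ide C X \<boxtimes> \<sigma> Y Z))"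
    using assms by (simp add: symm_hexagon comp_assoc)
  also have "\<dots> = ide C (X \<otimes> Y \<otimes> Z)"
    using assms by (simp add: tarr_comp symm_involutive)
  finally have "\<sigma> (X \<otimes> Y) Z \<cdot> \<sigma> Z (X \<otimes> Y) \<cdot> ((\<sigma> X Z \<boxtimes> ide C Y) \<cdot> (ide C X \<boxtimes> \<sigma> Y Z)) = \<sigma> (X \<otimes> Y) Z"
    using assms by simp
  then show ?thesis
    using assms symm_involutive[of Z "X \<otimes> Y"] by (subst (asm) comp_assoc[symmetric]) simp_all
qed

end

context traced_category
begin

lemma trace_hom: "\<lbrakk>U \<in> Obj C; X \<in> Obj C; Y \<in> Obj C; f \<in> hom C (U \<otimes> X) (U \<otimes> Y)\<rbrakk> \<Longrightarrow> Tr U X Y f \<in> hom C X Y"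
  using PiE_mem[OF PiE_mem[OF PiE_mem[OF PiE_mem[OF trace_closed]]]] by blast

lemma trace_arr [simp]:
  assumes "U \<in> Obj C" "X \<in> Obj C" "Y \<in> Obj C" "f \<in> Arr C" "Dom C f = U \<otimes> X" "Cod C f = U \<otimes> Y"
  shows "Tr U X Y f \<in> Arr C" "Dom C (Tr U X Y f) = X" "Cod C (Tr U X Y f) = Y"
  using trace_hom[of U X Y f] assms by (auto simp: hom_iff)

text \<open>A wire that runs once around the loop is a straight wire. Naturality takes
  \<open>h\<close> and \<open>k\<close> out of the trace, superposing removes \<open>Z\<close>, and
  the yanking axiom does the rest.\<close>

lemma trace_yank:
  assumes U: "U \<in> Obj C" and k: "k \<in> Arr C" "Dom C k = X" "Cod C k = U \<otimes> Z" and Z: "Z \<in> Obj C"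
    and h: "h \<in> Arr C" "Dom C h = U \<otimes> Z" "Cod C h = Y"
  shows "Tr U X Y ((ide C U \<boxtimes> h) \<cdot> (\<sigma> U U \<boxtimes> ide C Z) \<cdot> (ide C U \<boxtimes> k)) = h \<cdot> k"
proof -
  have o: "X \<in> Obj C" "Y \<in> Obj C" using h k by auto
  then have "Tr U X Y ((ide C U \<boxtimes> h) \<cdot> (\<sigma> U U \<boxtimes> ide C Z) \<cdot> (ide C U \<boxtimes> k)) = h \<cdot> Tr U X (U \<otimes> Z) ((\<sigma> U U \<boxtimes> ide C Z) \<cdot> (ide C U \<boxtimes> k))"
    using U k Z h by (intro trace_natural_cod) (simp_all add: hom_iff)
  also have "Tr U X (U \<otimes> Z) ((\<sigma> U U \<boxtimes> ide C Z) \<cdot> (ide C U \<boxtimes> k)) = Tr U (U \<otimes> Z) (U \<otimes> Z) (\<sigma> U U \<boxtimes> ide C Z) \<cdot> k"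
    using o U k Z by (intro trace_natural_dom) (simp_all add: hom_iff)
  also have "Tr U (U \<otimes> Z) (U \<otimes> Z) (\<sigma> U U \<boxtimes> ide C Z) = Tr U U U (\<sigma> U U) \<boxtimes> ide C Z"
    using U Z by (intro trace_superposing) (simp_all add: hom_iff)
  finally show ?thesis using U k Z by (simp add: trace_yanking)
qed

text \<open>The axiom lets an arrow stand only to the right of a trace. Conjugating with symmetries
  outside the trace moves it to the left, and the hexagons turn these into symmetries with the
  traced object.\<close>

lemma trace_superposing_left:
  assumes o: "U \<in> Obj C" "X \<in> Obj C" "Y \<in> Obj C" "W \<in> Obj C" and f: "f \<in> Arr C" "Dom C f = U \<otimes> X" "Cod C f = U \<otimes> Y"
  shows "ide C W \<boxtimes> Tr U X Y f = Tr U (W \<otimes> X) (W \<otimes> Y) ((\<sigma> W U \<boxtimes> ide C Y) \<cdot> (ide C W \<boxtimes> f) \<cdot> (\<sigma> U W \<boxtimes> ide C X))"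
proof -
  have "ide C W \<boxtimes> Tr U X Y f = ((ide C W \<boxtimes> Tr U X Y f) \<cdot> \<sigma> X W) \<cdot> \<sigma> W X"
    using o f by (simp add: comp_assoc symm_involutive)
  also have "\<dots> = (\<sigma> Y W \<cdot> (Tr U X Y f \<boxtimes> ide C W)) \<cdot> \<sigma> W X"
    using o f symm_nat[OF _ _ refl refl, of "Tr U X Y f" "ide C W"] by simp
  also have "\<dots> = \<sigma> Y W \<cdot> (Tr U X Y f \<boxtimes> ide C W) \<cdot> \<sigma> W X"
    using o f by (intro comp_assoc) simp_all
  also have "Tr U X Y f \<boxtimes> ide C W = Tr U (X \<otimes> W) (Y \<otimes> W) (f \<boxtimes> ide C W)"
    using o f by (intro trace_superposing[symmetric]) (simp_all add: hom_iff)
  also have "\<dots> \<cdot> \<sigma> W X = Tr U (W \<otimes> X) (Y \<otimes> W) ((f \<boxtimes> ide C W) \<cdot> (ide C U \<boxtimes> \<sigma> W X))"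
    using o f by (intro trace_natural_dom[symmetric]) (simp_all add: hom_iff)
  also have "\<sigma> Y W \<cdot> \<dots> = Tr U (W \<otimes> X) (W \<otimes> Y) ((ide C U \<boxtimes> \<sigma> Y W) \<cdot> ((f \<boxtimes> ide C W) \<cdot> (ide C U \<boxtimes> \<sigma> W X)))"
    using o f by (intro trace_natural_cod[symmetric]) (simp_all add: hom_iff)
  also have "(ide C U \<boxtimes> \<sigma> Y W) \<cdot> ((f \<boxtimes> ide C W) \<cdot> (ide C U \<boxtimes> \<sigma> W X)) = (\<sigma> W U \<boxtimes> ide C Y) \<cdot> (ide C W \<boxtimes> f) \<cdot> (\<sigma> U W \<boxtimes> ide C X)"
  proof -
    have "f \<boxtimes> ide C W = ((f \<boxtimes> ide C W) \<cdot> \<sigma> W (U \<otimes> X)) \<cdot> \<sigma> (U \<otimes> X) W"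
      using o f by (subst comp_assoc) (simp_all add: symm_involutive)
    also have "(f \<boxtimes> ide C W) \<cdot> \<sigma> W (U \<otimes> X) = \<sigma> W (U \<otimes> Y) \<cdot> (ide C W \<boxtimes> f)"
      using o f symm_nat[OF _ _ refl refl, of "ide C W" f] by simp
    finally have 1: "f \<boxtimes> ide C W = (\<sigma> W (U \<otimes> Y) \<cdot> (ide C W \<boxtimes> f)) \<cdot> \<sigma> (U \<otimes> X) W" .
    have 2: "(ide C U \<boxtimes> \<sigma> Y W) \<cdot> \<sigma> W (U \<otimes> Y) = \<sigma> W U \<boxtimes> ide C Y"
      using o by (simp add: symm_hexagon comp_assoc[symmetric] del: ide_tarr) (simp add: tarr_comp symm_involutive)
    have 3: "\<sigma> (U \<otimes> X) W \<cdot> (ide C U \<boxtimes> \<sigma> W X) = \<sigma> U W \<boxtimes> ide C X"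
      using o by (simp add: symm_hexagon2 comp_assoc) (simp add: tarr_comp symm_involutive)
    have "(ide C U \<boxtimes> \<sigma> Y W) \<cdot> ((f \<boxtimes> ide C W) \<cdot> (ide C U \<boxtimes> \<sigma> W X)) =
       ((ide C U \<boxtimes> \<sigma> Y W) \<cdot> \<sigma> W (U \<otimes> Y)) \<cdot> (ide C W \<boxtimes> f) \<cdot> (\<sigma> (U \<otimes> X) W \<cdot> (ide C U \<boxtimes> \<sigma> W X))"
      unfolding 1 using o f by (simp add: comp_assoc)
    then show ?thesis unfolding 2 3 .
  qed
  finally show ?thesis .
qed

end

text \<open>
  The numbers in the lists stand for objects. \<open>Bx b is os\<close> is the arrow variable \<open>b\<close> with its source and
  target, and \<open>Fb us t\<close> is the trace of \<open>t\<close> over \<open>us\<close>.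
\<close>

datatype trm = Bx nat "nat list" "nat list" | Id "nat list" | Sy "nat list" "nat list"
  | Cp trm trm | Ts trm trm | Fb "nat list" trm

primrec src :: "trm \<Rightarrow> nat list" where
  "src (Bx b is os) = is" | "src (Id xs) = xs" | "src (Sy xs ys) = xs @ ys" | "src (Cp g f) = src f"
| "src (Ts f g) = src f @ src g" | "src (Fb us t) = drop (length us) (src t)"

primrec tgt :: "trm \<Rightarrow> nat list" where
  "tgt (Bx b is os) = os" | "tgt (Id xs) = xs" | "tgt (Sy xs ys) = ys @ xs" | "tgt (Cp g f) = tgt g"
| "tgt (Ts f g) = tgt f @ tgt g" | "tgt (Fb us t) = drop (length us) (tgt t)"

primrec wt :: "trm \<Rightarrow> bool" where
  "wt (Bx b is os) = True" | "wt (Id xs) = True" | "wt (Sy xs ys) = True"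
| "wt (Cp g f) = (wt g \<and> wt f \<and> tgt f = src g)" | "wt (Ts f g) = (wt f \<and> wt g)"
| "wt (Fb us t) = (wt t \<and> take (length us) (src t) = us \<and> take (length us) (tgt t) = us)"

text \<open>The order is that of the instructions produced by \<open>compile\<close>: in a tensor
  product the right factor is executed first.\<close>

primrec boxes :: "trm \<Rightarrow> (nat \<times> nat list \<times> nat list) list" where
  "boxes (Bx b is os) = [(b, is, os)]" | "boxes (Id xs) = []" | "boxes (Sy xs ys) = []"
| "boxes (Cp g f) = boxes f @ boxes g" | "boxes (Ts f g) = boxes g @ boxes f" | "boxes (Fb us t) = boxes t"

text \<open>
  A wire is named by its source: an input of the diagram, or an output of a box.
  The names \<open>Tmp\<close> stand for the wires of a feedback loop until their actual source is known.
  The last component is the type of the wire.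
\<close>

datatype lab = In nat nat | Out nat nat nat | Tmp nat nat nat

primrec atom :: "lab \<Rightarrow> nat" where
  "atom (In i a) = a" | "atom (Out b i a) = a" | "atom (Tmp d i a) = a"

definition "ins xs = map (\<lambda>i. In i (xs ! i)) [0..<length xs]"
definition "outs b xs = map (\<lambda>i. Out b i (xs ! i)) [0..<length xs]"
definition "tmps d xs = map (\<lambda>i. Tmp d i (xs ! i)) [0..<length xs]"

text \<open>An instruction \<open>(b, os, is)\<close> runs box \<open>b\<close>, whose outputs have
  types \<open>os\<close>, on the wires \<open>is\<close>.\<close>

type_synonym instr = "nat \<times> nat list \<times> lab list"

definition lsubst :: "lab \<Rightarrow> lab \<Rightarrow> lab \<Rightarrow> lab" where "lsubst w v l = (if l = w then v else l)"

text \<open>Closing a loop identifies its temporary name \<open>w\<close> with the wire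
  \<open>v\<close> that returns to it. The wire may itself be another temporary, which a later round
  replaces. A wire that returns to itself is a closed circle without boxes, a scalar that the normal
  form cannot express, so the procedure gives up.\<close>

fun elim :: "lab list \<Rightarrow> instr list \<Rightarrow> lab list \<Rightarrow> (instr list \<times> lab list) option" where
  "elim [] p M = Some (p, M)"
| "elim (w # ws) p [] = None"
| "elim (w # ws) p (v # M) = (if v = w then None
     else elim ws (map (\<lambda>(b, os, is). (b, os, map (lsubst w v) is)) p) (map (lsubst w v) M))"

text \<open>\<open>L\<close> names the incoming wires and the result names the outgoing ones. The
  number \<open>d\<close> is the nesting depth of feedback and keeps temporary names of nested loops
  apart.\<close>

primrec compile :: "nat \<Rightarrow> lab list \<Rightarrow> trm \<Rightarrow> (instr list \<times> lab list) option" where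
  "compile d L (Bx b is os) = Some ([(b, os, L)], outs b os)"
| "compile d L (Id xs) = Some ([], L)"
| "compile d L (Sy xs ys) = Some ([], drop (length xs) L @ take (length xs) L)"
| "compile d L (Cp g f) = (case compile d L f of None \<Rightarrow> None | Some (p, M) \<Rightarrow>
     (case compile d M g of None \<Rightarrow> None | Some (q, N) \<Rightarrow> Some (p @ q, N)))"
| "compile d L (Ts f g) = (case compile d (take (length (src f)) L) f of None \<Rightarrow> None | Some (p, M) \<Rightarrow>
     (case compile d (drop (length (src f)) L) g of None \<Rightarrow> None | Some (q, N) \<Rightarrow> Some (q @ p, M @ N)))"
| "compile d L (Fb us t) = (case compile (Suc d) (tmps d us @ L) t of None \<Rightarrow> None
     | Some (p, M) \<Rightarrow> elim (tmps d us) p M)"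

text \<open>
  These code equations have no nested abstractions. Otherwise \<open>code_simp\<close> would rewrite under the
  abstractions in the branches of the case distinctions, which is exponential in the size of the term.
\<close>

definition "append_result p r = (case r of None \<Rightarrow> None | Some (q, N :: lab list) \<Rightarrow> Some (p @ q, N))"
definition "compile_after d g r = (case r of None \<Rightarrow> None | Some (p, M) \<Rightarrow> append_result p (compile d M g))"
definition "tensor_result p M r = (case r of None \<Rightarrow> None | Some (q, N :: lab list) \<Rightarrow> Some (q @ p, M @ N))"
definition "compile_beside d L g r = (case r of None \<Rightarrow> None | Some (p, M) \<Rightarrow> tensor_result p M (compile d L g))"
definition "elim_result ws r = (case r of None \<Rightarrow> None | Some (p, M) \<Rightarrow> elim ws p M)"

lemma compile_code [code]:
  "compile d L (Bx b is os) = Some ([(b, os, L)], outs b os)"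
  "compile d L (Id xs) = Some ([], L)"
  "compile d L (Sy xs ys) = Some ([], drop (length xs) L @ take (length xs) L)"
  "compile d L (Cp g f) = compile_after d g (compile d L f)"
  "compile d L (Ts f g) = compile_beside d (drop (length (src f)) L) g (compile d (take (length (src f)) L) f)"
  "compile d L (Fb us t) = elim_result (tmps d us) (compile (Suc d) (tmps d us @ L) t)"
  by (simp_all add: compile_after_def append_result_def compile_beside_def tensor_result_def elim_result_def split: option.split)

lemma result_code [code]:
  "append_result p None = None" "append_result p (Some (q, N)) = Some (p @ q, N)"
  "compile_after d g None = None" "compile_after d g (Some (p, M)) = append_result p (compile d M g)"
  "tensor_result p M None = None" "tensor_result p M (Some (q, N)) = Some (q @ p, M @ N)"
  "compile_beside d L g None = None" "compile_beside d L g (Some (p, M)) = tensor_result p M (compile d L g)"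
  "elim_result ws None = None" "elim_result ws (Some (p, M)) = elim ws p M"
  by (simp_all add: compile_after_def append_result_def compile_beside_def tensor_result_def elim_result_def)

text \<open>Programs are compared up to the order of their instructions. Box names must be distinct
  within a term, because an output wire is identified by the name of its box.\<close>

definition same_diagram :: "trm \<Rightarrow> trm \<Rightarrow> bool" where
  "same_diagram s t \<longleftrightarrow> wt s \<and> wt t \<and> src s = src t \<and> distinct (map fst (boxes s)) \<and> distinct (map fst (boxes t)) \<and>
     (case (compile 0 (ins (src s)) s, compile 0 (ins (src s)) t) of (Some (p, M), Some (q, N)) \<Rightarrow> M = N \<and> list_all (\<lambda>x. x \<in> set q) p \<and> list_all (\<lambda>x. x \<in> set p) q | _ \<Rightarrow> False)"

text \<open>The wires that leave boxes (\<open>po\<close>) and those that enter boxes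
  (\<open>pi\<close>), in program order.\<close>

definition po :: "instr list \<Rightarrow> lab list" where "po p = concat (map (\<lambda>(b, os, is). outs b os) p)"
definition pi :: "instr list \<Rightarrow> lab list" where "pi p = concat (map (\<lambda>(b, os, is). is) p)"

lemma po_pi_simps [simp]: "po [] = []" "pi [] = []" "po ((b, os, is) # p) = outs b os @ po p" "pi ((b, os, is) # p) = is @ pi p"
  "po (p @ q) = po p @ po q" "pi (p @ q) = pi p @ pi q"
  by (simp_all add: po_def pi_def)

lemma atom_map [simp]: "map atom (ins xs) = xs" "map atom (outs b xs) = xs" "map atom (tmps d xs) = xs"
  by (simp_all add: ins_def outs_def tmps_def comp_def map_nth)

lemma distinct_lab [simp]: "distinct (ins xs)" "distinct (outs b xs)" "distinct (tmps d xs)"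
  by (simp_all add: ins_def outs_def tmps_def distinct_map inj_on_def)

lemma in_po: "l \<in> set (po p) \<Longrightarrow> \<exists>b i a. l = Out b i a \<and> b \<in> fst ` set p"
  by (induction p) (auto simp: outs_def image_iff, metis fst_conv)

lemma po_disjoint: "fst ` set p \<inter> fst ` set q = {} \<Longrightarrow> set (po p) \<inter> set (po q) = {}"
  using in_po[of _ p] in_po[of _ q] by (metis disjoint_iff lab.inject(2))

lemma po_disjoint_labels:
  assumes "fst ` set p = fst ` set bs" "\<And>b i a is os. Out b i a \<in> set L \<Longrightarrow> (b, is, os) \<notin> set bs"
  shows "set (po p) \<inter> set L = {}"
proof -
  have False if l: "l \<in> set (po p)" "l \<in> set L" for l
  proof -
    obtain b i a where b: "l = Out b i a" "b \<in> fst ` set bs" using in_po[OF l(1)] assms(1) by auto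
    then obtain "is" os where "(b, is, os) \<in> set bs" by auto
    then show False using assms(2) b(1) l(2) by blast
  qed
  then show ?thesis by blast
qed

section \<open>Interpretation of diagrams and soundness of the normal form\<close>

locale interpretation_of_terms = traced_category C for C :: "('o, 'a, 'm) tracedcat_scheme" (structure) +
  fixes ob :: "nat \<Rightarrow> 'o" and bv :: "nat \<Rightarrow> 'a"
  assumes ob [simp]: "ob i \<in> Obj C"

sublocale interpretation_of_terms \<subseteq> labelled_smc C "\<lambda>l. ob (atom l)"
  by unfold_locales simp

context interpretation_of_terms
begin

definition "TT xs = tens (map ob xs)"

lemma TT_T: "TT (map atom L) = T L" by (simp add: TT_def T_def comp_def)

lemma TT_simps [simp]: "TT [] = \<one>" "TT (x # xs) = ob x \<otimes> TT xs" "TT (xs @ ys) = TT xs \<otimes> TT ys" "TT xs \<in> Obj C"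
proof -
  have "set (map ob xs) \<subseteq> Obj C" for xs by auto
  then show "TT (xs @ ys) = TT xs \<otimes> TT ys" "TT xs \<in> Obj C" by (simp_all add: TT_def)
qed (simp_all add: TT_def)

lemma T_lab [simp]: "T (ins xs) = TT xs" "T (outs b xs) = TT xs" "T (tmps d xs) = TT xs"
  by (simp_all flip: TT_T)

primrec ev :: "trm \<Rightarrow> 'a" where
  "ev (Bx b is os) = bv b" | "ev (Id xs) = ide C (TT xs)" | "ev (Sy xs ys) = \<sigma> (TT xs) (TT ys)"
| "ev (Cp g f) = ev g \<cdot> ev f" | "ev (Ts f g) = ev f \<boxtimes> ev g"
| "ev (Fb us t) = Tr (TT us) (TT (drop (length us) (src t))) (TT (drop (length us) (tgt t))) (ev t)"

lemma ev_hom: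
  assumes "wt t" "list_all (\<lambda>(b, is, os). bv b \<in> hom C (TT is) (TT os)) (boxes t)"
  shows "ev t \<in> hom C (TT (src t)) (TT (tgt t))"
  using assms
proof (induction t)
  case (Fb us t)
  have "TT (src t) = TT us \<otimes> TT (drop (length us) (src t))" "TT (tgt t) = TT us \<otimes> TT (drop (length us) (tgt t))"
    using Fb.prems(1) by (metis TT_simps(3) append_take_drop_id wt.simps(6))+
  then show ?case using Fb by (auto intro!: trace_hom)
qed (auto simp: hom_iff)

definition "bx p = foldr (\<lambda>i. tarr C (bv (fst i))) p (ide C \<one>)"

definition "typed p \<longleftrightarrow> (\<forall>(b, os, is)\<in>set p. bv b \<in> hom C (T is) (TT os))"

lemma bx_simps [simp]: "bx [] = ide C \<one>" "bx (i # p) = bv (fst i) \<boxtimes> bx p"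
  by (simp_all add: bx_def)

lemma typed_simps [simp]: "typed []" "typed ((b, os, is) # p) \<longleftrightarrow> bv b \<in> hom C (T is) (TT os) \<and> typed p"
  "typed (p @ q) \<longleftrightarrow> typed p \<and> typed q"
  by (simp_all add: typed_def ball_Un)

lemma bx_arr [simp]:
  assumes "typed p" shows "bx p \<in> Arr C" "Dom C (bx p) = T (pi p)" "Cod C (bx p) = T (po p)"
  using assms by (induction p) (auto simp: hom_iff)

lemma bx_append [simp]: "\<lbrakk>typed p; typed q\<rbrakk> \<Longrightarrow> bx (p @ q) = bx p \<boxtimes> bx q"
  by (induction p) (auto simp: hom_iff)

text \<open>All boxes side by side, with every wire that leaves a box fed back.\<close>

definition "nf L p M = Tr (T (po p)) (T L) (T M) ((bx p \<boxtimes> ide C (T M)) \<cdot> perm (po p @ L) (pi p @ M))"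

text \<open>Every wire has exactly one source and exactly one destination, so the wiring is a
  permutation.\<close>

definition "valid L p M \<longleftrightarrow> rearr (po p @ L) (pi p @ M) \<and> typed p"

lemma valid_rearr: "valid L p M \<Longrightarrow> rearr (po p @ L) (pi p @ M)" by (simp add: valid_def)

lemma valid_typed: "valid L p M \<Longrightarrow> typed p" by (simp add: valid_def)

lemma nf_arr [simp]:
  assumes "valid L p M"
  shows "nf L p M \<in> Arr C" "Dom C (nf L p M) = T L" "Cod C (nf L p M) = T M"
  unfolding nf_def using assms by (simp_all add: valid_def)

lemma nf_Nil: "rearr L M \<Longrightarrow> valid L [] M" "rearr L M \<Longrightarrow> nf L [] M = perm L M"
  by (simp_all add: valid_def nf_def trace_vanishing_unit hom_iff)

text \<open>Feeding all outputs of a single box once around the loop leaves the box as it is, by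
  \<open>trace_yank\<close>.\<close>

lemma nf_box:
  assumes "bv b \<in> hom C (T L) (TT os)" "distinct (outs b os @ L)"
  shows "valid L [(b, os, L)] (outs b os)" "nf L [(b, os, L)] (outs b os) = bv b"
proof -
  have r: "rearr (outs b os @ L) (L @ outs b os)" using assms(2) by (auto simp: rearr_def)
  have b: "bv b \<in> Arr C" "Dom C (bv b) = T L" "Cod C (bv b) = TT os" using assms(1) by (auto simp: hom_iff)
  have "(bv b \<boxtimes> ide C (TT os)) \<cdot> perm (outs b os @ L) (L @ outs b os) = \<sigma> (TT os) (TT os) \<cdot> (ide C (TT os) \<boxtimes> bv b)"
    using assms(2) b perm_symm[of "outs b os" L] symm_nat[OF _ _ refl refl, of "ide C (TT os)" "bv b"] by simp
  then show "nf L [(b, os, L)] (outs b os) = bv b"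
    using trace_yank[of "TT os" "bv b" "T L" "\<one>" "ide C (TT os)" "TT os"] b by (simp add: nf_def)
  show "valid L [(b, os, L)] (outs b os)" using r assms(1) by (simp add: valid_def)
qed

text \<open>Naturality pulls the first normal form into the trace of the second, superposing turns
  it into a trace over the remaining factors, and vanishing merges the two loops. The disjointness
  condition keeps the wire names of the joint program distinct.\<close>

lemma nf_comp:
  assumes v: "valid L p M" "valid M q N" and d: "set (po q) \<inter> (set (po p) \<union> set L) = {}"
  shows "valid L (p @ q) N" "nf M q N \<cdot> nf L p M = nf L (p @ q) N"
proof -
  note r = valid_rearr[OF v(1)] valid_rearr[OF v(2)] and t [simp] = valid_typed[OF v(1)] valid_typed[OF v(2)]
  have r1: "rearr (po q @ M) (pi q @ N)" "rearr (po p @ L) (pi p @ M)" by (rule r)+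
  have r2: "rearr (po p @ po q @ L) (po q @ pi p @ M)" "rearr (po p @ po q @ L) (po q @ po p @ L)" "rearr (po q @ po p @ L) (po q @ pi p @ M)"
     "rearr (po q @ pi p @ M) (pi p @ po q @ M)" "rearr (pi p @ po q @ M) (pi p @ pi q @ N)" "rearr (po p @ po q @ L) (pi p @ po q @ M)" 
     "rearr (po p @ po q @ L) (pi p @ pi q @ N)"
    using r d by (auto simp: rearr_def)
  show "valid L (p @ q) N" using r2(7) by (simp add: valid_def)
  let ?F = "(bx p \<boxtimes> ide C (T M)) \<cdot> perm (po p @ L) (pi p @ M)"
  let ?G = "(bx q \<boxtimes> ide C (T N)) \<cdot> perm (po q @ M) (pi q @ N)"
  let ?U = "T (po p)" and ?V = "T (po q)"
  let ?F' = "(\<sigma> ?V ?U \<boxtimes> ide C (T M)) \<cdot> (ide C ?V \<boxtimes> ?F) \<cdot> (\<sigma> ?U ?V \<boxtimes> ide C (T L))"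
  have F [simp]: "?F \<in> Arr C" "Dom C ?F = ?U \<otimes> T L" "Cod C ?F = ?U \<otimes> T M" using r1 by simp_all
  have G [simp]: "?G \<in> Arr C" "Dom C ?G = ?V \<otimes> T M" "Cod C ?G = ?V \<otimes> T N" using r1 by simp_all
  have "nf M q N \<cdot> nf L p M = Tr ?V (T L) (T N) (?G \<cdot> (ide C ?V \<boxtimes> nf L p M))"
    unfolding nf_def[of M q N] using v(1) r1 by (intro trace_natural_dom[symmetric]) (simp_all add: hom_iff)
  also have "ide C ?V \<boxtimes> nf L p M = Tr ?U (?V \<otimes> T L) (?V \<otimes> T M) ?F'"
    unfolding nf_def using r1 by (intro trace_superposing_left) simp_all
  also have "?G \<cdot> \<dots> = Tr ?U (?V \<otimes> T L) (?V \<otimes> T N) ((ide C ?U \<boxtimes> ?G) \<cdot> ?F')"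
    using F G by (intro trace_natural_cod[symmetric]) (simp_all add: hom_iff del: comp_arr, simp_all add: F G)
  \<comment> \<open>The boxes of \<open>p\<close> slide past the symmetry (\<open>e\<close>) and
    past the permutation of \<open>q\<close> (\<open>f\<close>), and then stand beside the boxes of
    \<open>q\<close> (\<open>g\<close>). The permutations left behind fuse by
    \<open>perm_comp\<close>.\<close>
  also have "(ide C ?U \<boxtimes> ?G) \<cdot> ?F' = (bx (p @ q) \<boxtimes> ide C (T N)) \<cdot> perm (po (p @ q) @ L) (pi (p @ q) @ N)"
  proof -
    have a: "ide C ?U \<boxtimes> ?G = (ide C ?U \<boxtimes> bx q \<boxtimes> ide C (T N)) \<cdot> (ide C ?U \<boxtimes> perm (po q @ M) (pi q @ N))"
      using r1 by (simp add: tarr_comp)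
    have b: "ide C ?V \<boxtimes> ?F = (ide C ?V \<boxtimes> bx p \<boxtimes> ide C (T M)) \<cdot> (ide C ?V \<boxtimes> perm (po p @ L) (pi p @ M))"
      using r1 by (simp add: tarr_comp)
    have c: "(ide C ?V \<boxtimes> perm (po p @ L) (pi p @ M)) \<cdot> (\<sigma> ?U ?V \<boxtimes> ide C (T L)) = perm (po p @ po q @ L) (po q @ pi p @ M)"
    proof -
      have "\<sigma> ?U ?V \<boxtimes> ide C (T L) = perm (po p @ po q @ L) (po q @ po p @ L)"
        using r2(2) perm_right[of "po p @ po q" L "po q @ po p"] perm_symm[of "po p" "po q"] by (simp add: rearr_def Int_Un_distrib)
      then show ?thesis using r2(1-3) perm_left[of "po q" "po p @ L" "pi p @ M"] perm_comp[OF r2(2,3)] by simp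
    qed
    have e: "(\<sigma> ?V ?U \<boxtimes> ide C (T M)) \<cdot> (ide C ?V \<boxtimes> bx p \<boxtimes> ide C (T M)) = (bx p \<boxtimes> ide C (?V \<otimes> T M)) \<cdot> perm (po q @ pi p @ M) (pi p @ po q @ M)"
    proof -
      have "(\<sigma> ?V ?U \<boxtimes> ide C (T M)) \<cdot> ((ide C ?V \<boxtimes> bx p) \<boxtimes> ide C (T M)) = ((bx p \<boxtimes> ide C ?V) \<boxtimes> ide C (T M)) \<cdot> (\<sigma> ?V (T (pi p)) \<boxtimes> ide C (T M))"
        using symm_nat[OF _ _ refl refl, of "ide C ?V" "bx p"] by (subst (1 2) tarr_comp) simp_all
      moreover have "\<sigma> ?V (T (pi p)) \<boxtimes> ide C (T M) = perm (po q @ pi p @ M) (pi p @ po q @ M)"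
        using r2(4) perm_right[of "po q @ pi p" M "pi p @ po q"] perm_symm[of "po q" "pi p"] by (simp add: rearr_def Int_Un_distrib)
      ultimately show ?thesis by simp
    qed
    have f: "(ide C ?U \<boxtimes> perm (po q @ M) (pi q @ N)) \<cdot> (bx p \<boxtimes> ide C (?V \<otimes> T M)) = (bx p \<boxtimes> ide C (T (pi q @ N))) \<cdot> perm (pi p @ po q @ M) (pi p @ pi q @ N)"
    proof -
      have "(ide C ?U \<boxtimes> perm (po q @ M) (pi q @ N)) \<cdot> (bx p \<boxtimes> ide C (?V \<otimes> T M)) = bx p \<boxtimes> perm (po q @ M) (pi q @ N)"
        using r1 by (simp add: whisker)
      also have "\<dots> = (bx p \<boxtimes> ide C (T (pi q @ N))) \<cdot> (ide C (T (pi p)) \<boxtimes> perm (po q @ M) (pi q @ N))"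
        using r1 by (intro whisker(2)[symmetric]) simp_all
      finally show ?thesis using perm_left[OF r2(5)] by simp
    qed
    have g: "(ide C ?U \<boxtimes> bx q \<boxtimes> ide C (T N)) \<cdot> (bx p \<boxtimes> ide C (T (pi q @ N))) = bx p \<boxtimes> bx q \<boxtimes> ide C (T N)"
      by (intro whisker(1)) simp_all
    have "(ide C ?U \<boxtimes> ?G) \<cdot> ?F' = (ide C ?U \<boxtimes> bx q \<boxtimes> ide C (T N)) \<cdot> (ide C ?U \<boxtimes> perm (po q @ M) (pi q @ N)) \<cdot>
        ((\<sigma> ?V ?U \<boxtimes> ide C (T M)) \<cdot> (ide C ?V \<boxtimes> bx p \<boxtimes> ide C (T M))) \<cdot> ((ide C ?V \<boxtimes> perm (po p @ L) (pi p @ M)) \<cdot> (\<sigma> ?U ?V \<boxtimes> ide C (T L)))"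
      unfolding a b using r1 by (simp add: comp_assoc)
    also have "\<dots> = (ide C ?U \<boxtimes> bx q \<boxtimes> ide C (T N)) \<cdot> ((ide C ?U \<boxtimes> perm (po q @ M) (pi q @ N)) \<cdot> (bx p \<boxtimes> ide C (?V \<otimes> T M))) \<cdot>
        (perm (po q @ pi p @ M) (pi p @ po q @ M) \<cdot> perm (po p @ po q @ L) (po q @ pi p @ M))"
      unfolding c e using r1 r2 by (simp add: comp_assoc)
    also have "\<dots> = ((ide C ?U \<boxtimes> bx q \<boxtimes> ide C (T N)) \<cdot> (bx p \<boxtimes> ide C (T (pi q @ N)))) \<cdot> (perm (pi p @ po q @ M) (pi p @ pi q @ N) \<cdot>
        perm (po p @ po q @ L) (pi p @ po q @ M))"
      unfolding f perm_comp[OF r2(1,4)] using r1 r2 by (simp add: comp_assoc)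
    finally show ?thesis unfolding g perm_comp[OF r2(6,5)] by simp
  qed
  also have "Tr ?V (T L) (T N) (Tr ?U (?V \<otimes> T L) (?V \<otimes> T N) \<dots>) = nf L (p @ q) N"
    unfolding nf_def po_pi_simps(5) T_simps(3)
    using r2(7) by (intro trace_vanishing_tensor[symmetric]) (simp_all add: hom_iff)
  finally show "nf M q N \<cdot> nf L p M = nf L (p @ q) N" .
qed

lemma nf_right:
  assumes v: "valid L p M" and d: "distinct K" "set K \<inter> (set (po p) \<union> set L) = {}"
  shows "valid (L @ K) p (M @ K)" "nf (L @ K) p (M @ K) = nf L p M \<boxtimes> ide C (T K)"
proof -
  note r = valid_rearr[OF v] and t [simp] = valid_typed[OF v]
  have r2: "rearr (po p @ L @ K) (pi p @ M @ K)" using r d by (auto simp: rearr_def)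
  then show "valid (L @ K) p (M @ K)" by (simp add: valid_def)
  let ?F = "(bx p \<boxtimes> ide C (T M)) \<cdot> perm (po p @ L) (pi p @ M)"
  have "nf L p M \<boxtimes> ide C (T K) = Tr (T (po p)) (T L \<otimes> T K) (T M \<otimes> T K) (?F \<boxtimes> ide C (T K))"
    unfolding nf_def using r by (intro trace_superposing[symmetric]) (simp_all add: hom_iff)
  also have "?F \<boxtimes> ide C (T K) = ((bx p \<boxtimes> ide C (T M)) \<boxtimes> ide C (T K)) \<cdot> (perm (po p @ L) (pi p @ M) \<boxtimes> ide C (T K))"
    using r by (subst tarr_comp) simp_all
  also have "perm (po p @ L) (pi p @ M) \<boxtimes> ide C (T K) = perm (po p @ L @ K) (pi p @ M @ K)"
    using perm_right[of "po p @ L" K "pi p @ M"] r2 by simp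
  finally show "nf (L @ K) p (M @ K) = nf L p M \<boxtimes> ide C (T K)" by (simp add: nf_def)
qed

text \<open>A block symmetry is a normal form without boxes, so conjugating \<open>nf_right\<close>
  by block symmetries with \<open>nf_comp\<close> moves the idle wires to the left without new work
  under the trace.\<close>

lemma nf_left:
  assumes v: "valid L p M" and d: "distinct K" "set K \<inter> (set (po p) \<union> set L) = {}"
  shows "valid (K @ L) p (K @ M)" "nf (K @ L) p (K @ M) = ide C (T K) \<boxtimes> nf L p M"
proof -
  note r = valid_rearr[OF v] and t [simp] = valid_typed[OF v] and R = nf_right[OF assms]
  have MK: "distinct (M @ K)" "distinct (L @ K)" using d r by (auto simp: rearr_def)
  have s: "rearr (K @ L) (L @ K)" "rearr (M @ K) (K @ M)" using MK by (auto simp: rearr_def)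
  note A = nf_comp[OF nf_Nil(1)[OF s(1)] R(1)]
  have A: "valid (K @ L) p (M @ K)" "nf (L @ K) p (M @ K) \<cdot> nf (K @ L) [] (L @ K) = nf (K @ L) p (M @ K)"
    using A r d by (auto simp: rearr_def)
  have B: "valid (K @ L) p (K @ M)" "nf (M @ K) [] (K @ M) \<cdot> nf (K @ L) p (M @ K) = nf (K @ L) p (K @ M)"
    using nf_comp[OF A(1) nf_Nil(1)[OF s(2)]] by auto
  show "valid (K @ L) p (K @ M)" by (rule B)
  have "nf (K @ L) p (K @ M) = \<sigma> (T M) (T K) \<cdot> (nf L p M \<boxtimes> ide C (T K)) \<cdot> \<sigma> (T K) (T L)"
    unfolding B(2)[symmetric] A(2)[symmetric] R(2) nf_Nil(2)[OF s(1)] nf_Nil(2)[OF s(2)]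
    using perm_symm[of K L] perm_symm[of M K] MK s by (simp add: rearr_def Int_commute)
  also have "\<dots> = (\<sigma> (T M) (T K) \<cdot> (nf L p M \<boxtimes> ide C (T K))) \<cdot> \<sigma> (T K) (T L)"
    using v by (simp add: comp_assoc)
  also have "\<sigma> (T M) (T K) \<cdot> (nf L p M \<boxtimes> ide C (T K)) = (ide C (T K) \<boxtimes> nf L p M) \<cdot> \<sigma> (T L) (T K)"
    using v symm_nat[OF _ _ refl refl, of "nf L p M" "ide C (T K)"] by simp
  finally show "nf (K @ L) p (K @ M) = ide C (T K) \<boxtimes> nf L p M"
    using v by (simp add: comp_assoc symm_involutive)
qed

text \<open>The wire \<open>v\<close> goes around the loop once and leaves where \<open>w\<close>
  left. So the traced permutation is the one in which \<open>v\<close> takes the place of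
  \<open>w\<close>.\<close>

lemma trace_perm:
  assumes r: "rearr (w # A) (v # B)" and w: "v \<noteq> w" "atom v = atom w"
  shows "rearr A (map (lsubst w v) B)" "Tr (ob (atom w)) (T A) (T B) (perm (w # A) (v # B)) = perm A (map (lsubst w v) B)"
proof -
  have "w \<in> set B" using r w by (auto simp: rearr_def)
  then obtain B1 B2 where B: "B = B1 @ w # B2" by (metis split_list)
  let ?Z = "B1 @ B2"
  have wB: "w \<notin> set B1" "w \<notin> set B2" using r B by (auto simp: rearr_def)
  then have s: "map (lsubst w v) B = B1 @ v # B2" "map (lsubst w v) B1 = B1" "map (lsubst w v) B2 = B2"
    using B by (auto simp: lsubst_def intro!: map_idI)
  have r2: "rearr A (v # ?Z)" "rearr (w # A) (w # v # ?Z)" "rearr (w # v # ?Z) (v # w # ?Z)" "rearr (v # w # ?Z) (v # B)" "rearr (w # ?Z) B"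
    "rearr A (B1 @ v # B2)" "rearr (v # ?Z) (B1 @ v # B2)" "distinct ?Z"
    using r w B by (auto simp: rearr_def)
  then show "rearr A (map (lsubst w v) B)" by (simp add: s)
  have vB: "v \<notin> set B1" using r B by (auto simp: rearr_def)
  let ?U = "ob (atom w)"
  have 1: "perm (w # A) (w # v # ?Z) = ide C ?U \<boxtimes> perm A (v # ?Z)" using perm_Cons[of w "[]" A "v # ?Z"] r2 by simp
  have 2: "perm (w # v # ?Z) (v # w # ?Z) = \<sigma> ?U ?U \<boxtimes> ide C (T ?Z)"
    using perm_Cons[of w "[v]" "v # ?Z" ?Z] w r2(1,8) by (simp add: rearr_def)
  have 3: "perm (v # w # ?Z) (v # B) = ide C ?U \<boxtimes> perm (w # ?Z) B"
    using perm_Cons[of v "[]" "w # ?Z" B] r2 w by simp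
  have 4: "perm (w # ?Z) B = perm (v # ?Z) (B1 @ v # B2)"
    using perm_Cons[OF wB(1), of ?Z B2] perm_Cons[OF vB, of ?Z B2] w B by simp
  \<comment> \<open>Factored so that the looped wire is touched only by the middle permutation,
    which exchanges \<open>w\<close> and \<open>v\<close>. This is the shape required by
    \<open>trace_yank\<close>.\<close>
  have "perm (w # A) (v # B) = perm (v # w # ?Z) (v # B) \<cdot> perm (w # v # ?Z) (v # w # ?Z) \<cdot> perm (w # A) (w # v # ?Z)"
  proof -
    have "rearr (w # A) (v # w # ?Z)" using r2 by (auto simp: rearr_def)
    then show ?thesis using perm_comp[OF r2(2,3)] perm_comp[of "w # A" "v # w # ?Z" "v # B"] r2(4) by simp
  qed
  then have "Tr ?U (T A) (T B) (perm (w # A) (v # B)) = perm (w # ?Z) B \<cdot> perm A (v # ?Z)"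
    unfolding 1 2 3 using r2 w(2) by (simp add: trace_yank)
  also have "\<dots> = perm A (map (lsubst w v) B)"
    unfolding 4 s using perm_comp[OF r2(1,7)] .
  finally show "Tr ?U (T A) (T B) (perm (w # A) (v # B)) = perm A (map (lsubst w v) B)" .
qed

lemma subst_simps:
  fixes p :: "instr list" and w v
  defines "p' \<equiv> map (\<lambda>(b, os, is). (b, os, map (lsubst w v) is)) p"
  shows "po p' = po p" "pi p' = map (lsubst w v) (pi p)" "bx p' = bx p" "map fst p' = map fst p"
    "atom v = atom w \<Longrightarrow> typed p' = typed p"
proof -
  have "T (map (lsubst w v) L) = T L" if "atom v = atom w" for L
    using that by (induction L) (auto simp: lsubst_def)
  then show "atom v = atom w \<Longrightarrow> typed p' = typed p" by (auto simp: typed_def p'_def)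
  show "po p' = po p" "pi p' = map (lsubst w v) (pi p)" "bx p' = bx p" "map fst p' = map fst p"
    unfolding p'_def by (induction p) auto
qed

text \<open>The new loop joins the loop of the boxes by vanishing; dinaturality moves its wire to
  the front, so that it can be traced first. The boxes then leave the inner trace by naturality, and
  only a permutation is left inside.\<close>

lemma nf_trace:
  fixes p :: "instr list" and w v
  defines "p' \<equiv> map (\<lambda>(b, os, is). (b, os, map (lsubst w v) is)) p"
  assumes vl: "valid (w # L) p (v # M)" and w: "v \<noteq> w" "atom v = atom w"
  shows "valid L p' (map (lsubst w v) M)"
    "Tr (ob (atom w)) (T L) (T M) (nf (w # L) p (v # M)) = nf L p' (map (lsubst w v) M)"
proof -
  note r = valid_rearr[OF vl] and t [simp] = valid_typed[OF vl]
  let ?A = "po p @ L" and ?B = "pi p @ M" and ?U = "ob (atom w)" and ?O = "T (po p)"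
  have r2: "rearr (w # ?A) (v # ?B)" "rearr (w # po p @ L) (po p @ w # L)" "rearr (pi p @ v # M) (v # ?B)" "rearr (po p @ w # L) (pi p @ v # M)"
    "rearr (w # po p @ L) (pi p @ v # M)" "rearr (po p @ [w]) (w # po p)" "rearr (pi p @ [v]) (v # pi p)"
    using r w by (auto simp: rearr_def)
  note tp = trace_perm[OF r2(1) w] and ss = subst_simps[where w = w and v = v and p = p, folded p'_def]
  show "valid L p' (map (lsubst w v) M)" using tp(1) t ss(5)[OF w(2)] by (simp add: valid_def ss(1,2))
  have TM: "T (map (lsubst w v) M) = T M" using w(2) by (induction M) (auto simp: lsubst_def)
  let ?F = "(bx p \<boxtimes> ide C (T (v # M))) \<cdot> perm (po p @ w # L) (pi p @ v # M)"
  let ?F' = "(\<sigma> ?O ?U \<boxtimes> ide C (T M)) \<cdot> ?F"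
  have "Tr ?U (T L) (T M) (nf (w # L) p (v # M)) = Tr (?O \<otimes> ?U) (T L) (T M) ?F"
    unfolding nf_def T_simps(2) w(2) using r2 w by (intro trace_vanishing_tensor[symmetric]) (simp_all add: hom_iff)
  also have "?F = (\<sigma> ?U ?O \<boxtimes> ide C (T M)) \<cdot> ?F'"
    using r2(4) w by (subst comp_assoc[symmetric]) (simp_all add: tarr_comp symm_involutive)
  also have "Tr (?O \<otimes> ?U) (T L) (T M) \<dots> = Tr (?U \<otimes> ?O) (T L) (T M) (?F' \<cdot> (\<sigma> ?U ?O \<boxtimes> ide C (T L)))"
    using r2(4) w by (intro trace_dinatural) (simp_all add: hom_iff)
  also have "?F' \<cdot> (\<sigma> ?U ?O \<boxtimes> ide C (T L)) = (ide C ?U \<boxtimes> (bx p \<boxtimes> ide C (T M))) \<cdot> perm (w # ?A) (v # ?B)"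
  proof -
    have a: "\<sigma> ?U ?O \<boxtimes> ide C (T L) = perm (w # po p @ L) (po p @ w # L)"
      using perm_right[of "w # po p" L "po p @ [w]"] perm_symm[of "[w]" "po p"] r2(2) by (auto simp: rearr_def)
    have b: "\<sigma> (T (pi p)) ?U \<boxtimes> ide C (T M) = perm (pi p @ v # M) (v # ?B)"
      using perm_right[of "pi p @ [v]" M "v # pi p"] perm_symm[of "pi p" "[v]"] r2(3) w by (auto simp: rearr_def)
    have c: "(\<sigma> ?O ?U \<boxtimes> ide C (T M)) \<cdot> ((bx p \<boxtimes> ide C ?U) \<boxtimes> ide C (T M)) = ((ide C ?U \<boxtimes> bx p) \<boxtimes> ide C (T M)) \<cdot> (\<sigma> (T (pi p)) ?U \<boxtimes> ide C (T M))"
      using symm_nat[OF _ _ refl refl, of "bx p" "ide C ?U"] by (subst (1 2) tarr_comp) simp_all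
    have "?F' \<cdot> (\<sigma> ?U ?O \<boxtimes> ide C (T L)) = ((\<sigma> ?O ?U \<boxtimes> ide C (T M)) \<cdot> ((bx p \<boxtimes> ide C ?U) \<boxtimes> ide C (T M))) \<cdot> (perm (po p @ w # L) (pi p @ v # M) \<cdot> perm (w # po p @ L) (po p @ w # L))"
      unfolding a using r2 w by (simp add: comp_assoc)
    also have "\<dots> = ((ide C ?U \<boxtimes> bx p) \<boxtimes> ide C (T M)) \<cdot> (perm (pi p @ v # M) (v # ?B) \<cdot> perm (w # po p @ L) (pi p @ v # M))"
      unfolding c b perm_comp[OF r2(2,4)] using r2 w by (simp add: comp_assoc)
    finally show ?thesis unfolding perm_comp[OF r2(5,3)] by simp
  qed
  also have "Tr (?U \<otimes> ?O) (T L) (T M) \<dots> = Tr ?O (T L) (T M) (Tr ?U (?O \<otimes> T L) (?O \<otimes> T M) \<dots>)"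
    using r2(1) w by (intro trace_vanishing_tensor) (simp_all add: hom_iff)
  also have "Tr ?U (?O \<otimes> T L) (?O \<otimes> T M) ((ide C ?U \<boxtimes> (bx p \<boxtimes> ide C (T M))) \<cdot> perm (w # ?A) (v # ?B)) =
      (bx p \<boxtimes> ide C (T M)) \<cdot> Tr ?U (?O \<otimes> T L) (T (pi p) \<otimes> T M) (perm (w # ?A) (v # ?B))"
    using r2(1) w by (intro trace_natural_cod) (simp_all add: hom_iff)
  also have "Tr ?U (?O \<otimes> T L) (T (pi p) \<otimes> T M) (perm (w # ?A) (v # ?B)) = perm (po p @ L) (pi p' @ map (lsubst w v) M)"
    using tp(2) by (simp add: ss)
  finally show "Tr (ob (atom w)) (T L) (T M) (nf (w # L) p (v # M)) = nf L p' (map (lsubst w v) M)"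
    by (simp add: nf_def ss TM)
qed

text \<open>Vanishing removes the feedback wires one at a time. The condition on types ensures that
  a temporary and the wire substituted for it stand for the same object.\<close>

lemma nf_elim:
  assumes "valid (ws @ L) p M" "elim ws p M = Some (q, N)" "map atom (take (length ws) M) = map atom ws"
  shows "valid L q N \<and> Tr (T ws) (T L) (TT (drop (length ws) (map atom M))) (nf (ws @ L) p M) = nf L q N \<and>
    map atom N = drop (length ws) (map atom M) \<and> map fst q = map fst p"
  using assms
proof (induction ws p M rule: elim.induct)
  case (1 p M)
  then show ?case by (simp add: trace_vanishing_unit hom_iff TT_T)
next
  case (2 w ws p)
  then show ?case by simp
next
  case (3 w ws p v M)
  let ?p = "map (\<lambda>(b, os, is). (b, os, map (lsubst w v) is)) p" and ?M = "map (lsubst w v) M"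
  have w: "v \<noteq> w" "atom v = atom w" and e: "elim ws ?p ?M = Some (q, N)" using 3(3,4) by (auto split: if_splits)
  have at: "map atom ?M = map atom M" using w(2) by (auto simp: lsubst_def)
  have V: "valid (w # ws @ L) p (v # M)" using 3(2) by simp
  note n = nf_trace[OF V w]
  have tk: "map atom (take (length ws) ?M) = map atom ws"
    unfolding take_map[symmetric] at using 3(4) by (simp add: take_map)
  note IH = 3(1)[OF w(1) n(1) e tk, unfolded at]
  have TM: "T M = TT (take (length ws) (map atom M)) \<otimes> TT (drop (length ws) (map atom M))"
    by (simp flip: TT_simps(3) TT_T)
  have "take (length ws) (map atom M) = map atom ws" using 3(4) by (simp add: take_map)
  then have TM: "T M = T ws \<otimes> TT (drop (length ws) (map atom M))" using TM by (simp add: TT_T)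
  have "Tr (T (w # ws)) (T L) (TT (drop (length ws) (map atom M))) (nf (w # ws @ L) p (v # M)) = nf L q N"
    using IH trace_vanishing_tensor[of "ob (atom w)" "T ws" "T L" "TT (drop (length ws) (map atom M))" "nf (w # ws @ L) p (v # M)"]
      n(2) nf_arr[OF V] w TM by (simp add: hom_iff at)
  then show ?case using IH by (simp add: at comp_def split_beta)
qed

text \<open>The assumptions on \<open>L\<close> make new names fresh: its temporaries belong to
  enclosing loops and its outputs to boxes outside \<open>t\<close>. The equality of box names in
  the conclusion carries freshness from one part of a term to the next.\<close>

lemma compile_sound:
  assumes "wt t" "map atom L = src t" "distinct L" "\<And>k i a. Tmp k i a \<in> set L \<Longrightarrow> k < d"
    "distinct (map fst (boxes t))" "\<And>b i a is os. Out b i a \<in> set L \<Longrightarrow> (b, is, os) \<notin> set (boxes t)"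
    "\<And>b is os. (b, is, os) \<in> set (boxes t) \<Longrightarrow> bv b \<in> hom C (TT is) (TT os)" "compile d L t = Some (p, M)"
  shows "valid L p M \<and> map atom M = tgt t \<and> nf L p M = ev t \<and> map fst p = map fst (boxes t)"
  using assms
proof (induction t arbitrary: d L p M)
  case (Bx b "is" os)
  have "set (outs b os) \<inter> set L = {}" using Bx.prems(6) by (fastforce simp: outs_def)
  then have "distinct (outs b os @ L)" using Bx.prems(3) by simp
  moreover have "bv b \<in> hom C (T L) (TT os)" using Bx.prems(7)[of b "is" os] Bx.prems(2) by (simp flip: TT_T)
  ultimately show ?case using nf_box Bx.prems(8) by auto
next
  case (Id xs)
  then show ?case using nf_Nil[of L L] by (auto simp: rearr_def simp flip: TT_T)
next
  case (Sy xs ys)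
  define A B where "A = take (length xs) L" "B = drop (length xs) L"
  have L: "L = A @ B" "map atom A = xs" "map atom B = ys"
    using Sy.prems(2) by (simp_all add: A_B_def flip: take_map drop_map)
  have "p = []" "M = B @ A" using Sy.prems(8) by (auto simp: A_B_def)
  moreover have "rearr L (B @ A)" using L Sy.prems(3) by (auto simp: rearr_def)
  ultimately show ?case
    using nf_Nil[of L "B @ A"] perm_symm[of A B] Sy.prems(3) L by (simp flip: TT_T)
next
  case (Cp g f)
  obtain p1 M1 where 1: "compile d L f = Some (p1, M1)" using Cp.prems(8) by (auto split: option.splits)
  then obtain p2 where 2: "compile d M1 g = Some (p2, M)" "p = p1 @ p2" using Cp.prems(8) by (auto split: option.splits)
  have F: "valid L p1 M1 \<and> map atom M1 = tgt f \<and> nf L p1 M1 = ev f \<and> map fst p1 = map fst (boxes f)"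
    by (rule Cp.IH(2)[OF _ _ _ _ _ _ _ 1]) (use Cp.prems in auto)
  have r: "rearr (po p1 @ L) (pi p1 @ M1)" using F by (simp add: valid_def)
  have M1: "set M1 \<subseteq> set (po p1) \<union> set L" "distinct M1" using r by (auto simp: rearr_def)
  have b1: "fst ` set p1 = fst ` set (boxes f)" using F by (metis list.set_map)
  have G: "valid M1 p2 M \<and> map atom M = tgt g \<and> nf M1 p2 M = ev g \<and> map fst p2 = map fst (boxes g)"
  proof (rule Cp.IH(1)[OF _ _ _ _ _ _ _ 2(1)])
    show "k < d" if "Tmp k i a \<in> set M1" for k i a using that M1 Cp.prems(4) in_po by blast
    show "(b, is, os) \<notin> set (boxes g)" if "Out b i a \<in> set M1" for b i a "is" os
    proof -
      have "Out b i a \<in> set (po p1) \<union> set L" using that M1 by auto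
      then have "Out b i a \<in> set L \<or> b \<in> fst ` set (boxes f)" using in_po[of "Out b i a" p1] b1 by auto
      moreover have "fst ` set (boxes f) \<inter> fst ` set (boxes g) = {}" using Cp.prems(5) by simp
      moreover have "b \<in> fst ` set (boxes g)" if "(b, is, os) \<in> set (boxes g)" using that by force
      ultimately show ?thesis using Cp.prems(6)[of b i a "is" os] by auto
    qed
  qed (use Cp.prems M1 F in auto)
  have b2: "fst ` set p2 = fst ` set (boxes g)" using G by (metis list.set_map)
  have "fst ` set p2 \<inter> fst ` set p1 = {}" unfolding b1 b2 using Cp.prems(5) by auto
  moreover have "set (po p2) \<inter> set L = {}" using Cp.prems(6) by (intro po_disjoint_labels[OF b2]) auto
  ultimately have "set (po p2) \<inter> (set (po p1) \<union> set L) = {}" using po_disjoint[of p2 p1] by auto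
  then show ?case using nf_comp[of L p1 M1 p2 M] F G 2(2) by simp
next
  case (Ts f g)
  define A B where "A = take (length (src f)) L" "B = drop (length (src f)) L"
  have L: "L = A @ B" "map atom A = src f" "map atom B = src g"
    using Ts.prems(2) by (simp_all add: A_B_def flip: take_map drop_map)
  obtain p1 M1 where 1: "compile d A f = Some (p1, M1)" using Ts.prems(8) by (auto simp: A_B_def split: option.splits)
  then obtain p2 M2 where 2: "compile d B g = Some (p2, M2)" "p = p2 @ p1" "M = M1 @ M2"
    using Ts.prems(8) by (auto simp: A_B_def split: option.splits)
  have F: "valid A p1 M1 \<and> map atom M1 = tgt f \<and> nf A p1 M1 = ev f \<and> map fst p1 = map fst (boxes f)"
  proof (rule Ts.IH(1)[OF _ _ _ _ _ _ _ 1])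
    show "(b, is, os) \<notin> set (boxes f)" if "Out b i a \<in> set A" for b i a "is" os
      using that Ts.prems(6)[of b i a "is" os] L by auto
  qed (use Ts.prems(1-5,7) L in auto)
  have G: "valid B p2 M2 \<and> map atom M2 = tgt g \<and> nf B p2 M2 = ev g \<and> map fst p2 = map fst (boxes g)"
  proof (rule Ts.IH(2)[OF _ _ _ _ _ _ _ 2(1)])
    show "(b, is, os) \<notin> set (boxes g)" if "Out b i a \<in> set B" for b i a "is" os
      using that Ts.prems(6)[of b i a "is" os] L by auto
  qed (use Ts.prems(1-5,7) L in auto)
  have b: "fst ` set p1 = fst ` set (boxes f)" "fst ` set p2 = fst ` set (boxes g)" using F G by (metis list.set_map)+
  have M2: "set M2 \<subseteq> set (po p2) \<union> set B" "distinct M2" using G by (auto simp: valid_def rearr_def)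
  have "fst ` set p2 \<inter> fst ` set p1 = {}" unfolding b using Ts.prems(5) by auto
  moreover have "set (po p2) \<inter> set L = {}" using Ts.prems(6) by (intro po_disjoint_labels[OF b(2)]) auto
  moreover have "set (po p1) \<inter> set L = {}" using Ts.prems(6) by (intro po_disjoint_labels[OF b(1)]) auto
  ultimately have d: "set (po p2) \<inter> (set (po p1) \<union> set L) = {}" "set (po p1) \<inter> (set (po p2) \<union> set L) = {}"
    using po_disjoint[of p2 p1] by auto
  \<comment> \<open>A tensor product is computed as the right factor beside idle wires, followed by
    the left factor beside idle wires.\<close>
  have 3: "valid (A @ B) p2 (A @ M2)" "nf (A @ B) p2 (A @ M2) = ide C (T A) \<boxtimes> nf B p2 M2"
    using nf_left[of B p2 M2 A] G d Ts.prems(3) L by auto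
  have 4: "valid (A @ M2) p1 (M1 @ M2)" "nf (A @ M2) p1 (M1 @ M2) = nf A p1 M1 \<boxtimes> ide C (T M2)"
    using nf_right[of A p1 M1 M2] F M2 d Ts.prems(3) L by auto
  have "(nf A p1 M1 \<boxtimes> ide C (T M2)) \<cdot> (ide C (T A) \<boxtimes> nf B p2 M2) = nf A p1 M1 \<boxtimes> nf B p2 M2"
    using nf_arr[OF conjunct1[OF F]] nf_arr[OF conjunct1[OF G]] by (intro whisker(2))
  then have "valid L p M" "nf L p M = nf A p1 M1 \<boxtimes> nf B p2 M2"
    using nf_comp[OF 3(1) 4(1)] 3(2) 4(2) d L 2 by simp_all
  then show ?case using F G 2 by simp
next
  case (Fb us t)
  obtain p1 M1 where 1: "compile (Suc d) (tmps d us @ L) t = Some (p1, M1)" "elim (tmps d us) p1 M1 = Some (p, M)"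
    using Fb.prems(8) by (auto split: option.splits)
  have l: "length (tmps d us) = length us" by (simp add: tmps_def)
  have s: "us @ drop (length us) (src t) = src t" using Fb.prems(1) by (metis append_take_drop_id wt.simps(6))
  have F: "valid (tmps d us @ L) p1 M1 \<and> map atom M1 = tgt t \<and> nf (tmps d us @ L) p1 M1 = ev t \<and> map fst p1 = map fst (boxes t)"
  proof (rule Fb.IH[OF _ _ _ _ _ _ _ 1(1)])
    show "map atom (tmps d us @ L) = src t" using Fb.prems(2) s by simp
    \<comment> \<open>The names in \<open>L\<close> have depth below \<open>d\<close>, and the new
      loop uses depth exactly \<open>d\<close>.\<close>
    have "l \<notin> set L" if "l \<in> set (tmps d us)" for l
      using that Fb.prems(4)[of d] by (auto simp: tmps_def)
    then show "distinct (tmps d us @ L)" using Fb.prems(3) by auto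
    show "k < Suc d" if "Tmp k i a \<in> set (tmps d us @ L)" for k i a
      using that Fb.prems(4) by (auto simp: tmps_def less_Suc_eq)
    show "(b, is, os) \<notin> set (boxes t)" if "Out b i a \<in> set (tmps d us @ L)" for b i a "is" os
      using that Fb.prems(6) by (auto simp: tmps_def)
  qed (use Fb.prems in auto)
  have "map atom (take (length (tmps d us)) M1) = map atom (tmps d us)"
    using F Fb.prems(1) l by (simp flip: take_map)
  from nf_elim[OF conjunct1[OF F] 1(2) this] show ?case
    using F l Fb.prems(2) by (simp flip: TT_T)
qed

text \<open>A block symmetry between two groups of boxes slides through the boxes by naturality and
  around the loop by dinaturality. On the other side it is absorbed by the permutation.\<close>

lemma nf_swap:
  assumes v: "valid L (r @ a @ b @ c) M"
  shows "valid L (r @ b @ a @ c) M" "nf L (r @ a @ b @ c) M = nf L (r @ b @ a @ c) M"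
proof -
  let ?p = "r @ a @ b @ c" and ?q = "r @ b @ a @ c"
  note R = valid_rearr[OF v] and t = valid_typed[OF v]
  have [simp]: "typed r" "typed a" "typed b" "typed c" using t by auto
  have r: "rearr (po ?q @ L) (pi ?q @ M)" "rearr (po ?q @ L) (pi ?p @ M)" "rearr (pi ?p @ M) (pi ?q @ M)" "rearr (po ?p @ L) (po ?q @ L)"
    "rearr (pi a @ pi b) (pi b @ pi a)" "rearr (po a @ po b) (po b @ po a)"
    using R by (auto simp: rearr_def)
  then show "valid L ?q M" by (simp add: valid_def)
  let ?s = "ide C (T (po r)) \<boxtimes> \<sigma> (T (po a)) (T (po b)) \<boxtimes> ide C (T (po c))"
  have s: "?s \<boxtimes> ide C (T L) = perm (po ?p @ L) (po ?q @ L)"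
  proof -
    have 0: "distinct (po a @ po b)" using r(6) by (simp add: rearr_def)
    have 1: "\<sigma> (T (po a)) (T (po b)) \<boxtimes> ide C (T (po c @ L)) = perm (po a @ po b @ po c @ L) (po b @ po a @ po c @ L)"
      unfolding perm_symm[OF 0, symmetric] using perm_right[of "po a @ po b" "po c @ L" "po b @ po a"] r(4) by (auto simp: rearr_def)
    have "?s \<boxtimes> ide C (T L) = ide C (T (po r)) \<boxtimes> (\<sigma> (T (po a)) (T (po b)) \<boxtimes> ide C (T (po c @ L)))" by simp
    then show ?thesis unfolding 1 using perm_left[of "po r" "po a @ po b @ po c @ L" "po b @ po a @ po c @ L"] r(4) by simp
  qed
  have s': "(ide C (T (pi r)) \<boxtimes> \<sigma> (T (pi a)) (T (pi b)) \<boxtimes> ide C (T (pi c))) \<boxtimes> ide C (T M) = perm (pi ?p @ M) (pi ?q @ M)" (is "?s' \<boxtimes> _ = _")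
  proof -
    have 0: "distinct (pi a @ pi b)" using r(5) by (simp add: rearr_def)
    have 1: "\<sigma> (T (pi a)) (T (pi b)) \<boxtimes> ide C (T (pi c @ M)) = perm (pi a @ pi b @ pi c @ M) (pi b @ pi a @ pi c @ M)"
      unfolding perm_symm[OF 0, symmetric] using perm_right[of "pi a @ pi b" "pi c @ M" "pi b @ pi a"] r(3) by (auto simp: rearr_def)
    have "?s' \<boxtimes> ide C (T M) = ide C (T (pi r)) \<boxtimes> (\<sigma> (T (pi a)) (T (pi b)) \<boxtimes> ide C (T (pi c @ M)))" by simp
    then show ?thesis unfolding 1 using perm_left[of "pi r" "pi a @ pi b @ pi c @ M" "pi b @ pi a @ pi c @ M"] r(3) by simp
  qed
  have sl: "bx ?q \<cdot> ?s' = ?s \<cdot> bx ?p"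
  proof -
    have "(bx r \<boxtimes> (bx b \<boxtimes> bx a) \<boxtimes> bx c) \<cdot> ?s' = bx r \<boxtimes> (\<sigma> (T (po a)) (T (po b)) \<cdot> (bx a \<boxtimes> bx b)) \<boxtimes> bx c"
      using symm_nat[OF _ _ refl refl, of "bx a" "bx b"] by (simp add: tarr_comp del: tarr_simps)
    also have "\<dots> = ?s \<cdot> (bx r \<boxtimes> (bx a \<boxtimes> bx b) \<boxtimes> bx c)"
      by (simp add: tarr_comp del: tarr_simps)
    finally show ?thesis by simp
  qed
  have sl': "(bx ?q \<boxtimes> ide C (T M)) \<cdot> (?s' \<boxtimes> ide C (T M)) = (?s \<boxtimes> ide C (T M)) \<cdot> (bx ?p \<boxtimes> ide C (T M))"
    using sl by (simp add: tarr_comp del: tarr_simps bx_append) 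
  let ?G = "(bx ?p \<boxtimes> ide C (T M)) \<cdot> perm (po ?q @ L) (pi ?p @ M)"
  have tp: "typed ?p" "typed ?q" by simp_all
  have "(bx ?q \<boxtimes> ide C (T M)) \<cdot> perm (po ?q @ L) (pi ?q @ M) = ((bx ?q \<boxtimes> ide C (T M)) \<cdot> (?s' \<boxtimes> ide C (T M))) \<cdot> perm (po ?q @ L) (pi ?p @ M)"
    unfolding s' perm_comp[OF r(2,3), symmetric] using r(1-4) tp by (intro comp_assoc[symmetric]) (simp_all del: bx_append)
  also have "\<dots> = (?s \<boxtimes> ide C (T M)) \<cdot> ?G"
    unfolding sl' using r(1-4) tp by (intro comp_assoc) (simp_all del: bx_append)
  finally have "nf L ?q M = Tr (T (po ?q)) (T L) (T M) ((?s \<boxtimes> ide C (T M)) \<cdot> ?G)"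
    by (simp only: nf_def)
  also have "\<dots> = Tr (T (po ?p)) (T L) (T M) (?G \<cdot> (?s \<boxtimes> ide C (T L)))"
    using r(1-4) tp by (intro trace_dinatural) (simp_all add: hom_iff del: bx_append)
  also have "?G \<cdot> (?s \<boxtimes> ide C (T L)) = (bx ?p \<boxtimes> ide C (T M)) \<cdot> (perm (po ?q @ L) (pi ?p @ M) \<cdot> perm (po ?p @ L) (po ?q @ L))"
    unfolding s using r(1-4) tp by (intro comp_assoc) (simp_all del: bx_append)
  finally show "nf L ?p M = nf L ?q M"
    unfolding perm_comp[OF r(4,2)] nf_def by (rule sym)
qed

text \<open>The head of \<open>p\<close> is pulled to the front of \<open>q\<close> by one block
  swap; the prefix \<open>r\<close> collects the instructions already in place.\<close>

lemma nf_reorder: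
  assumes "valid L (r @ p) M" "distinct p" "distinct q" "set p = set q"
  shows "valid L (r @ q) M \<and> nf L (r @ p) M = nf L (r @ q) M"
  using assms
proof (induction p arbitrary: r q)
  case Nil then show ?case by simp
next
  case (Cons i p)
  then obtain a c where q: "q = a @ i # c" by (metis list.set_intros(1) split_list)
  have "set p = set (i # p) - {i}" "set (a @ c) = set q - {i}" using Cons.prems(2,3) q by auto
  then have "set p = set (a @ c)" by (simp only: Cons.prems(4))
  then have "valid L ((r @ [i]) @ a @ c) M \<and> nf L ((r @ [i]) @ p) M = nf L ((r @ [i]) @ a @ c) M"
    using Cons.prems q by (intro Cons.IH) auto
  then show ?case using nf_swap[of L r "[i]" a c M] q by simp
qed

theorem same_diagram_ev:
  assumes s: "same_diagram s t"
    and b: "list_all (\<lambda>(b, is, os). bv b \<in> hom C (TT is) (TT os)) (boxes s)" "list_all (\<lambda>(b, is, os). bv b \<in> hom C (TT is) (TT os)) (boxes t)"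
  shows "ev s = ev t"
proof -
  let ?L = "ins (src s)"
  obtain p q M where 1: "compile 0 ?L s = Some (p, M)" "compile 0 ?L t = Some (q, M)" "set p \<subseteq> set q" "set q \<subseteq> set p"
    using s by (auto simp: same_diagram_def list_all_iff subset_iff split: option.splits)
  \<comment> \<open>Initially all wires are inputs, so the freshness conditions hold
    vacuously.\<close>
  have L: "\<And>k i a. Tmp k i a \<notin> set ?L" "\<And>b i a. Out b i a \<notin> set ?L" by (auto simp: ins_def)
  have S: "valid ?L p M \<and> map atom M = tgt s \<and> nf ?L p M = ev s \<and> map fst p = map fst (boxes s)"
    by (rule compile_sound[OF _ _ _ _ _ _ _ 1(1)]) (use s b L in \<open>auto simp: same_diagram_def list_all_iff\<close>)
  have T: "valid ?L q M \<and> map atom M = tgt t \<and> nf ?L q M = ev t \<and> map fst q = map fst (boxes t)"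
    by (rule compile_sound[OF _ _ _ _ _ _ _ 1(2)]) (use s b L in \<open>auto simp: same_diagram_def list_all_iff\<close>)
  have "distinct (map fst p)" "distinct (map fst q)" using S T s by (simp_all add: same_diagram_def)
  then have "distinct p" "distinct q" by (simp_all add: distinct_map)
  then show ?thesis using nf_reorder[of ?L "[]" p M q] S T 1(3,4) by simp
qed

end

section \<open>The Int construction\<close>

definition pick :: "'x \<Rightarrow> 'x list \<Rightarrow> nat \<Rightarrow> 'x" where
  "pick d xs i = (if i < length xs then xs ! i else d)"

lemma pick_simps [simp]:
  "pick d [] i = d" "pick d (x # xs) 0 = x" "pick d (x # xs) (Suc n) = pick d xs n"
  "pick d (x # xs) (numeral k) = pick d xs (pred_numeral k)"
  by (simp_all add: pick_def numeral_eq_Suc)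

lemma pick_in: "d \<in> A \<Longrightarrow> set xs \<subseteq> A \<Longrightarrow> pick d xs i \<in> A"
  by (auto simp: pick_def)

text \<open>A finite list becomes a total valuation. The default for objects has to be an object,
  hence the unit; arrows may default to anything, because typing is demanded only of boxes that
  occur.\<close>

lemma (in traced_category) interpretation_pick:
  "set os \<subseteq> Obj C \<Longrightarrow> interpretation_of_terms C (pick \<one> os)"
  by unfold_locales (simp add: pick_in)

section \<open>Diagrams for arrows of Int\<close>

type_synonym iobj = "nat list \<times> nat list"
type_synonym itrm = "iobj \<times> trm \<times> iobj"

fun iwt :: "itrm \<Rightarrow> bool" where
  "iwt ((x, x'), t, (y, y')) \<longleftrightarrow> wt t \<and> src t = x @ y' \<and> tgt t = x' @ y"

fun iBx :: "nat \<Rightarrow> iobj \<Rightarrow> iobj \<Rightarrow> itrm" where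
  "iBx b (x, x') (y, y') = ((x, x'), Bx b (x @ y') (x' @ y), (y, y'))"

text \<open>This and the next three functions repeat the structure of \<open>Int\<close> on terms,
  symbol by symbol, so that interpretation commutes with them by definition.\<close>

fun iCp :: "itrm \<Rightarrow> itrm \<Rightarrow> itrm" where
  "iCp ((y, y'), g, (z, z')) ((x, x'), f, _) = ((x, x'),
     Fb y' (Cp (Ts (Sy x' y') (Id z)) (Cp (Ts (Id x') g) (Cp (Ts f (Id z')) (Ts (Sy y' x) (Id z'))))), (z, z'))"

fun iTs :: "itrm \<Rightarrow> itrm \<Rightarrow> itrm" where
  "iTs ((x, x'), f, (y, y')) ((w, w'), g, (z, z')) = ((x @ w, x' @ w'),
     Cp (Ts (Id x') (Ts (Sy y w') (Id z))) (Cp (Ts f g) (Ts (Id x) (Ts (Sy w y') (Id z')))), (y @ z, y' @ z'))"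

fun iId :: "iobj \<Rightarrow> itrm" where
  "iId (x, x') = ((x, x'), Sy x x', (x, x'))"

fun iSy :: "iobj \<Rightarrow> iobj \<Rightarrow> itrm" where
  "iSy (x, x') (y, y') = ((x @ y, x' @ y'), Cp (Ts (Sy y' x') (Sy x y)) (Sy (x @ y) (y' @ x')), (y @ x, y' @ x'))"

definition same_idiagram :: "itrm \<Rightarrow> itrm \<Rightarrow> bool" where
  "same_idiagram d e \<longleftrightarrow> fst d = fst e \<and> snd (snd d) = snd (snd e) \<and> iwt d \<and> iwt e \<and> same_diagram (fst (snd d)) (fst (snd e))"

definition iboxes :: "itrm \<Rightarrow> (nat \<times> nat list \<times> nat list) list" where
  "iboxes d = boxes (fst (snd d))"

lemma iboxes_simps [simp]:
  "iboxes (iBx b (x, x') (y, y')) = [(b, x @ y', x' @ y)]" "iboxes (X, t, Y) = boxes t"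
  "iboxes (iTs d d') = iboxes d' @ iboxes d" "iboxes (iCp d d') = iboxes d' @ iboxes d" "iboxes (iId X) = []" "iboxes (iSy X X') = []"
  by (auto simp: iboxes_def split: prod.splits elim!: iTs.elims iCp.elims iId.elims iSy.elims)
    (cases d; cases d'; cases X; cases X'; auto)+

context interpretation_of_terms
begin

definition "btyped bs \<longleftrightarrow> list_all (\<lambda>(b, is, os). bv b \<in> hom C (TT is) (TT os)) bs"

fun iev :: "itrm \<Rightarrow> ('o \<times> 'o) \<times> 'a \<times> ('o \<times> 'o)" where
  "iev ((x, x'), t, (y, y')) = ((TT x, TT x'), ev t, (TT y, TT y'))"

theorem same_idiagram_iev:
  assumes "same_idiagram d e" "btyped (iboxes d)" "btyped (iboxes e)"
  shows "iev d = iev e"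
  using assms same_diagram_ev[of "fst (snd d)" "fst (snd e)"]
  by (cases d rule: iev.cases; cases e rule: iev.cases) (auto simp: same_idiagram_def btyped_def)

lemma iev_hom:
  assumes "iwt ((x, x'), t, (y, y'))" "btyped (boxes t)"
  shows "iev ((x, x'), t, (y, y')) \<in> hom (Int_cat C) (TT x, TT x') (TT y, TT y')"
  using assms ev_hom[of t] by (simp add: Int_cat_def hom_cat_of_homs btyped_def)

end

section \<open>Int as a symmetric monoidal category\<close>

lemma Int_smc_simps [simp]:
  "Obj (Int_smc T) = Obj (Int_cat T)" "Arr (Int_smc T) = Arr (Int_cat T)" "Dom (Int_smc T) = Dom (Int_cat T)"
  "Cod (Int_smc T) = Cod (Int_cat T)" "ide (Int_smc T) = ide (Int_cat T)" "Comp (Int_smc T) = Comp (Int_cat T)"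
  "unit_obj (Int_smc T) = (\<one>\<^bsub>T\<^esub>, \<one>\<^bsub>T\<^esub>)"
  by (simp_all add: Int_smc_def Let_def cat.defs smc.defs)

lemma hom_Int_smc [simp]: "hom (Int_smc T) = hom (Int_cat T)"
  by (simp add: hom_def fun_eq_iff)

lemma Int_smc_tobj:
  "\<lbrakk>X \<in> Obj T; X' \<in> Obj T; Y \<in> Obj T; Y' \<in> Obj T\<rbrakk> \<Longrightarrow> tobj (Int_smc T) (X, X') (Y, Y') = (X \<otimes>\<^bsub>T\<^esub> Y, X' \<otimes>\<^bsub>T\<^esub> Y')"
  by (simp add: Int_smc_def Let_def cat.defs smc.defs)

lemma Int_smc_tarr:
  "\<lbrakk>((X, X'), f, (Y, Y')) \<in> Arr (Int_cat T); ((W, W'), g, (Z, Z')) \<in> Arr (Int_cat T)\<rbrakk> \<Longrightarrow>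
    tarr (Int_smc T) ((X, X'), f, (Y, Y')) ((W, W'), g, (Z, Z')) = ((X \<otimes>\<^bsub>T\<^esub> W, X' \<otimes>\<^bsub>T\<^esub> W'),
      (ide T X' \<boxtimes>\<^bsub>T\<^esub> \<sigma>\<^bsub>T\<^esub> Y W' \<boxtimes>\<^bsub>T\<^esub> ide T Z) \<cdot>\<^bsub>T\<^esub> (f \<boxtimes>\<^bsub>T\<^esub> g) \<cdot>\<^bsub>T\<^esub> (ide T X \<boxtimes>\<^bsub>T\<^esub> \<sigma>\<^bsub>T\<^esub> W Y' \<boxtimes>\<^bsub>T\<^esub> ide T Z'), (Y \<otimes>\<^bsub>T\<^esub> Z, Y' \<otimes>\<^bsub>T\<^esub> Z'))"
  by (simp add: Int_smc_def Let_def cat.defs smc.defs)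

lemma Int_smc_symm:
  "\<lbrakk>X \<in> Obj T; X' \<in> Obj T; Y \<in> Obj T; Y' \<in> Obj T\<rbrakk> \<Longrightarrow> symm (Int_smc T) (X, X') (Y, Y') =
    ((X \<otimes>\<^bsub>T\<^esub> Y, X' \<otimes>\<^bsub>T\<^esub> Y'), (\<sigma>\<^bsub>T\<^esub> Y' X' \<boxtimes>\<^bsub>T\<^esub> \<sigma>\<^bsub>T\<^esub> X Y) \<cdot>\<^bsub>T\<^esub> \<sigma>\<^bsub>T\<^esub> (X \<otimes>\<^bsub>T\<^esub> Y) (Y' \<otimes>\<^bsub>T\<^esub> X'), (Y \<otimes>\<^bsub>T\<^esub> X, Y' \<otimes>\<^bsub>T\<^esub> X'))"
  by (simp add: Int_smc_def Let_def cat.defs smc.defs)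

lemma Int_cat_simps:
  "Obj (Int_cat T) = Obj T \<times> Obj T"
  "((X, X'), f, (Y, Y')) \<in> Arr (Int_cat T) \<longleftrightarrow> X \<in> Obj T \<and> X' \<in> Obj T \<and> Y \<in> Obj T \<and> Y' \<in> Obj T \<and> f \<in> hom T (X \<otimes>\<^bsub>T\<^esub> Y') (X' \<otimes>\<^bsub>T\<^esub> Y)"
  "u \<in> hom (Int_cat T) (X, X') (Y, Y') \<longleftrightarrow> (\<exists>f. u = ((X, X'), f, (Y, Y')) \<and> X \<in> Obj T \<and> X' \<in> Obj T \<and> Y \<in> Obj T \<and> Y' \<in> Obj T \<and> f \<in> hom T (X \<otimes>\<^bsub>T\<^esub> Y') (X' \<otimes>\<^bsub>T\<^esub> Y))"
  "((X, X'), f, (Y, Y')) \<in> Arr (Int_cat T) \<Longrightarrow> Dom (Int_cat T) ((X, X'), f, (Y, Y')) = (X, X')"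
  "((X, X'), f, (Y, Y')) \<in> Arr (Int_cat T) \<Longrightarrow> Cod (Int_cat T) ((X, X'), f, (Y, Y')) = (Y, Y')"
  by (auto simp: Int_cat_def hom_cat_of_homs)

lemma Int_cat_comp:
  "\<lbrakk>((Y, Y'), g, (Z, Z')) \<in> Arr (Int_cat T); ((X, X'), f, (Y, Y')) \<in> Arr (Int_cat T)\<rbrakk> \<Longrightarrow>
   ((Y, Y'), g, (Z, Z')) \<cdot>\<^bsub>Int_cat T\<^esub> ((X, X'), f, (Y, Y')) = ((X, X'),
        Tr\<^bsub>T\<^esub> Y' (X \<otimes>\<^bsub>T\<^esub> Z') (X' \<otimes>\<^bsub>T\<^esub> Z)
          ((\<sigma>\<^bsub>T\<^esub> X' Y' \<boxtimes>\<^bsub>T\<^esub> ide T Z) \<cdot>\<^bsub>T\<^esub> (ide T X' \<boxtimes>\<^bsub>T\<^esub> g) \<cdot>\<^bsub>T\<^esub>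
           (f \<boxtimes>\<^bsub>T\<^esub> ide T Z') \<cdot>\<^bsub>T\<^esub> (\<sigma>\<^bsub>T\<^esub> Y' X \<boxtimes>\<^bsub>T\<^esub> ide T Z')), (Z, Z'))"
  by (simp add: Int_cat_def)

lemma Int_cat_ide: "\<lbrakk>X \<in> Obj T; X' \<in> Obj T\<rbrakk> \<Longrightarrow> ide (Int_cat T) (X, X') = ((X, X'), \<sigma>\<^bsub>T\<^esub> X X', (X, X'))"
  by (simp add: Int_cat_def)

context interpretation_of_terms
begin

lemma iev_arr: "iwt d \<Longrightarrow> btyped (iboxes d) \<Longrightarrow> iev d \<in> Arr (Int_cat C)"
  by (cases d rule: iev.cases) (use iev_hom in \<open>auto simp: hom_iff\<close>)

lemma iev_iCp:
  assumes "iwt d" "iwt e" "btyped (iboxes d)" "btyped (iboxes e)" "fst d = snd (snd e)"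
  shows "iev (iCp d e) = iev d \<cdot>\<^bsub>Int_cat C\<^esub> iev e"
  using assms iev_arr[of d] iev_arr[of e]
  by (cases d rule: iev.cases; cases e rule: iev.cases) (simp add: Int_cat_comp)

lemma iev_iTs:
  assumes "iwt d" "iwt e" "btyped (iboxes d)" "btyped (iboxes e)"
  shows "iev (iTs d e) = iev d \<boxtimes>\<^bsub>Int_smc C\<^esub> iev e"
  using assms iev_arr[of d] iev_arr[of e]
  by (cases d rule: iev.cases; cases e rule: iev.cases) (simp add: Int_smc_tarr)

lemma iev_iId: "iev (iId (x, x')) = ide (Int_cat C) (TT x, TT x')"
  by (simp add: Int_cat_ide)

lemma iev_iSy: "iev (iSy (x, x') (y, y')) = \<sigma>\<^bsub>Int_smc C\<^esub> (TT x, TT x') (TT y, TT y')"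
  by (simp add: Int_smc_symm)

end

context traced_category
begin

text \<open>Unfolded, each law is an equation between traced diagrams in which the arrows are
  variables, so it holds once the two normal forms coincide.\<close>

lemma category_Int_cat: "category (Int_cat C)"
  unfolding Int_cat_def
proof (rule category_cat_of_homs; clarsimp)
  fix X X' assume "X \<in> Obj C" "X' \<in> Obj C"
  then show "\<sigma> X X' \<in> hom C (X \<otimes> X') (X' \<otimes> X)" by (rule symm_hom)
next
  fix X X' Y Y' Z Z' f g
  assume "X \<in> Obj C" "X' \<in> Obj C" "Y \<in> Obj C" "Y' \<in> Obj C" "Z \<in> Obj C" "Z' \<in> Obj C"
    "f \<in> hom C (X \<otimes> Y') (X' \<otimes> Y)" "g \<in> hom C (Y \<otimes> Z') (Y' \<otimes> Z)"
  then show "Tr Y' (X \<otimes> Z') (X' \<otimes> Z) ((\<sigma> X' Y' \<boxtimes> ide C Z) \<cdot> (ide C X' \<boxtimes> g) \<cdot> (f \<boxtimes> ide C Z') \<cdot> (\<sigma> Y' X \<boxtimes> ide C Z'))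
      \<in> hom C (X \<otimes> Z') (X' \<otimes> Z)"
    by (intro trace_hom) (auto simp: hom_iff)
next
  fix X X' Y Y' f
  assume a: "X \<in> Obj C" "X' \<in> Obj C" "Y \<in> Obj C" "Y' \<in> Obj C" "f \<in> hom C (X \<otimes> Y') (X' \<otimes> Y)"
  interpret I: interpretation_of_terms C "pick \<one> [X, X', Y, Y']" "pick undefined [f]"
    by (rule interpretation_pick) (use a in auto)
  let ?X = "([0], [1])" and ?Y = "([2], [3])"
  \<comment> \<open>The comparison of two closed terms is decided by evaluation. The remaining
    premises only state that the boxes are interpreted by arrows of the right type.\<close>
  have "I.iev (iCp (iId ?Y) (iBx 0 ?X ?Y)) = I.iev (iBx 0 ?X ?Y)"
    by (rule I.same_idiagram_iev, code_simp) (use a in \<open>simp_all add: I.btyped_def\<close>)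
  then show "Tr Y' (X \<otimes> Y') (X' \<otimes> Y) ((\<sigma> X' Y' \<boxtimes> ide C Y) \<cdot> (ide C X' \<boxtimes> \<sigma> Y Y') \<cdot> (f \<boxtimes> ide C Y') \<cdot> (\<sigma> Y' X \<boxtimes> ide C Y')) = f"
    using a by simp
  have "I.iev (iCp (iBx 0 ?X ?Y) (iId ?X)) = I.iev (iBx 0 ?X ?Y)"
    by (rule I.same_idiagram_iev, code_simp) (use a in \<open>simp_all add: I.btyped_def\<close>)
  then show "Tr X' (X \<otimes> Y') (X' \<otimes> Y) ((\<sigma> X' X' \<boxtimes> ide C Y) \<cdot> (ide C X' \<boxtimes> f) \<cdot> (\<sigma> X X' \<boxtimes> ide C Y') \<cdot> (\<sigma> X' X \<boxtimes> ide C Y')) = f"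
    using a by simp
next
  fix W W' X X' Y Y' Z Z' f g h
  assume a: "W \<in> Obj C" "W' \<in> Obj C" "X \<in> Obj C" "X' \<in> Obj C" "Y \<in> Obj C" "Y' \<in> Obj C" "Z \<in> Obj C" "Z' \<in> Obj C"
    "f \<in> hom C (W \<otimes> X') (W' \<otimes> X)" "g \<in> hom C (X \<otimes> Y') (X' \<otimes> Y)" "h \<in> hom C (Y \<otimes> Z') (Y' \<otimes> Z)"
  interpret I: interpretation_of_terms C "pick \<one> [W, W', X, X', Y, Y', Z, Z']" "pick undefined [f, g, h]"
    by (rule interpretation_pick) (use a in auto)
  let ?W = "([0], [1])" and ?X = "([2], [3])" and ?Y = "([4], [5])" and ?Z = "([6], [7])"
  let ?f = "iBx 0 ?W ?X" and ?g = "iBx 1 ?X ?Y" and ?h = "iBx 2 ?Y ?Z"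
  have "I.iev (iCp ?h (iCp ?g ?f)) = I.iev (iCp (iCp ?h ?g) ?f)"
    by (rule I.same_idiagram_iev, code_simp) (use a in \<open>simp_all add: I.btyped_def\<close>)
  then show "Tr Y' (W \<otimes> Z') (W' \<otimes> Z) ((\<sigma> W' Y' \<boxtimes> ide C Z) \<cdot> (ide C W' \<boxtimes> h) \<cdot>
      (Tr X' (W \<otimes> Y') (W' \<otimes> Y) ((\<sigma> W' X' \<boxtimes> ide C Y) \<cdot> (ide C W' \<boxtimes> g) \<cdot> (f \<boxtimes> ide C Y') \<cdot> (\<sigma> X' W \<boxtimes> ide C Y')) \<boxtimes> ide C Z') \<cdot> (\<sigma> Y' W \<boxtimes> ide C Z')) =
    Tr X' (W \<otimes> Z') (W' \<otimes> Z) ((\<sigma> W' X' \<boxtimes> ide C Z) \<cdot> (ide C W' \<boxtimes>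
      Tr Y' (X \<otimes> Z') (X' \<otimes> Z) ((\<sigma> X' Y' \<boxtimes> ide C Z) \<cdot> (ide C X' \<boxtimes> h) \<cdot> (g \<boxtimes> ide C Z') \<cdot> (\<sigma> Y' X \<boxtimes> ide C Z'))) \<cdot> (f \<boxtimes> ide C Z') \<cdot> (\<sigma> X' W \<boxtimes> ide C Z'))"
    using a by simp
qed

lemma category_Int_smc: "category (Int_smc C)"
  using category_Int_cat unfolding category_def by simp

end

lemma iterm_simps [simp]:
  "fst (iBx b X Y) = X" "snd (snd (iBx b X Y)) = Y" "iwt (iBx b X Y)"
  "fst (iId X) = X" "snd (snd (iId X)) = X" "iwt (iId X)"
  "fst (iSy X Y) = (fst X @ fst Y, snd X @ snd Y)" "snd (snd (iSy X Y)) = (fst Y @ fst X, snd Y @ snd X)" "iwt (iSy X Y)"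
  "fst (iTs d e) = (fst (fst d) @ fst (fst e), snd (fst d) @ snd (fst e))"
  "snd (snd (iTs d e)) = (fst (snd (snd d)) @ fst (snd (snd e)), snd (snd (snd d)) @ snd (snd (snd e)))"
  "\<lbrakk>iwt d; iwt e\<rbrakk> \<Longrightarrow> iwt (iTs d e)"
  "fst (iCp d e) = fst e" "snd (snd (iCp d e)) = snd (snd d)"
  "\<lbrakk>iwt d; iwt e; fst d = snd (snd e)\<rbrakk> \<Longrightarrow> iwt (iCp d e)"
  by (cases X; cases Y; cases d rule: iwt.cases; cases e rule: iwt.cases; simp)+

text \<open>From here on terms are interpreted at the level of \<open>Int\<close> by
  \<open>iev_simps\<close>, and unfolding them to traced diagrams would get in the way.\<close>

declare iBx.simps [simp del] iId.simps [simp del] iSy.simps [simp del] iTs.simps [simp del] iCp.simps [simp del]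

context interpretation_of_terms
begin

lemma btyped_simps [simp]: "btyped []" "btyped ((b, is, os) # bs) \<longleftrightarrow> bv b \<in> hom C (TT is) (TT os) \<and> btyped bs"
  "btyped (bs @ cs) \<longleftrightarrow> btyped bs \<and> btyped cs"
  by (auto simp: btyped_def)

lemma iev_iBx: "iev (iBx b (x, x') (y, y')) = ((TT x, TT x'), bv b, (TT y, TT y'))"
  by (simp add: iBx.simps)

lemmas iev_simps = iev_iCp iev_iTs iev_iId iev_iSy iev_iBx

end

context traced_category
begin

lemma Int_arrE:
  assumes "u \<in> Arr (Int_cat C)"
  obtains X X' f Y Y' where "u = ((X, X'), f, (Y, Y'))" "X \<in> Obj C" "X' \<in> Obj C" "Y \<in> Obj C" "Y' \<in> Obj C" "f \<in> hom C (X \<otimes> Y') (X' \<otimes> Y)"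
proof -
  obtain X X' f Y Y' where u: "u = ((X, X'), f, (Y, Y'))" by (cases u) auto
  show thesis using assms that[OF u] unfolding u Int_cat_simps by blast
qed

lemma Int_tarr_hom:
  assumes "u \<in> hom (Int_cat C) (X, X') (Y, Y')" "v \<in> hom (Int_cat C) (W, W') (Z, Z')"
  shows "u \<boxtimes>\<^bsub>Int_smc C\<^esub> v \<in> hom (Int_cat C) (X \<otimes> W, X' \<otimes> W') (Y \<otimes> Z, Y' \<otimes> Z')"
proof -
  obtain f g where *: "u = ((X, X'), f, (Y, Y'))" "v = ((W, W'), g, (Z, Z'))" 
    "X \<in> Obj C" "X' \<in> Obj C" "Y \<in> Obj C" "Y' \<in> Obj C" "f \<in> hom C (X \<otimes> Y') (X' \<otimes> Y)"
    "W \<in> Obj C" "W' \<in> Obj C" "Z \<in> Obj C" "Z' \<in> Obj C" "g \<in> hom C (W \<otimes> Z') (W' \<otimes> Z)"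
    using assms by (auto simp: Int_cat_simps)
  then show ?thesis by (simp add: Int_smc_tarr Int_cat_simps) (simp add: hom_iff)
qed

lemma Int_symm_hom:
  assumes "X \<in> Obj C" "X' \<in> Obj C" "Y \<in> Obj C" "Y' \<in> Obj C"
  shows "\<sigma>\<^bsub>Int_smc C\<^esub> (X, X') (Y, Y') \<in> hom (Int_cat C) (X \<otimes> Y, X' \<otimes> Y') (Y \<otimes> X, Y' \<otimes> X')"
  using assms by (simp add: Int_smc_symm Int_cat_simps) (simp add: hom_iff)

text \<open>An object of \<open>Int\<close> is represented by two numbers and an arrow by one box.
  Each equational law on arrows is then one comparison of diagrams, while laws on objects hold
  componentwise.\<close>

theorem symmetric_monoidal_Int: "symmetric_monoidal (Int_smc C)"
proof -
  interpret M: category "Int_cat C" by (rule category_Int_cat)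
  note sm = Int_smc_tobj Int_cat_simps(1)
  show ?thesis
  proof (rule symmetric_monoidal.intro[OF category_Int_smc], unfold symmetric_monoidal_axioms_def hom_Int_smc Int_smc_simps, intro conjI allI impI)
    show "(\<one>, \<one>) \<in> Obj (Int_cat C)" by (simp add: Int_cat_simps)
  next
    show "tobj (Int_smc C) \<in> Obj (Int_cat C) \<rightarrow>\<^sub>E Obj (Int_cat C) \<rightarrow>\<^sub>E Obj (Int_cat C)"
      by (auto simp: PiE_iff Int_cat_simps Int_smc_tobj)
        (auto simp: Int_smc_def Let_def cat.defs smc.defs extensional_def)
  next
    have "u \<boxtimes>\<^bsub>Int_smc C\<^esub> v \<in> Arr (Int_cat C)" if "u \<in> Arr (Int_cat C)" "v \<in> Arr (Int_cat C)" for u v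
      using Int_tarr_hom[of u _ _ _ _ v] M.arr_hom[OF that(1)] M.arr_hom[OF that(2)] by (metis M.homD(1) surj_pair)
    then show "tarr (Int_smc C) \<in> Arr (Int_cat C) \<rightarrow>\<^sub>E Arr (Int_cat C) \<rightarrow>\<^sub>E Arr (Int_cat C)"
      by (auto simp: PiE_iff)
        (auto simp: Int_smc_def Let_def cat.defs smc.defs extensional_def)
  next
    fix u X Y v X' Y' assume "u \<in> hom (Int_cat C) X Y" "v \<in> hom (Int_cat C) X' Y'"
    moreover from this have "X \<in> Obj C \<times> Obj C" "X' \<in> Obj C \<times> Obj C" "Y \<in> Obj C \<times> Obj C" "Y' \<in> Obj C \<times> Obj C"
      using M.homD(4,5) by (auto simp: Int_cat_simps)
    ultimately show "u \<boxtimes>\<^bsub>Int_smc C\<^esub> v \<in> hom (Int_cat C) (X \<otimes>\<^bsub>Int_smc C\<^esub> X') (Y \<otimes>\<^bsub>Int_smc C\<^esub> Y')"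
      using Int_tarr_hom[of u _ _ _ _ v] by (auto simp: Int_smc_tobj)
  next
    fix X Y assume "X \<in> Obj (Int_cat C)" "Y \<in> Obj (Int_cat C)"
    then obtain X1 X2 Y1 Y2 where a: "X = (X1, X2)" "Y = (Y1, Y2)" "X1 \<in> Obj C" "X2 \<in> Obj C" "Y1 \<in> Obj C" "Y2 \<in> Obj C"
      by (auto simp: Int_cat_simps)
    interpret I: interpretation_of_terms C "pick \<one> [X1, X2, Y1, Y2]" "pick undefined []"
      by (rule interpretation_pick) (use a in auto)
    have "I.iev (iTs (iId ([0], [1])) (iId ([2], [3]))) = I.iev (iId ([0, 2], [1, 3]))"
      by (rule I.same_idiagram_iev, code_simp) simp_all
    then show "ide (Int_cat C) X \<boxtimes>\<^bsub>Int_smc C\<^esub> ide (Int_cat C) Y = ide (Int_cat C) (X \<otimes>\<^bsub>Int_smc C\<^esub> Y)"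
      using a by (simp add: I.iev_simps sm)
    have "I.iev (iCp (iSy ([2], [3]) ([0], [1])) (iSy ([0], [1]) ([2], [3]))) = I.iev (iId ([0, 2], [1, 3]))"
      by (rule I.same_idiagram_iev, code_simp) simp_all
    then show "\<sigma>\<^bsub>Int_smc C\<^esub> Y X \<cdot>\<^bsub>Int_cat C\<^esub> \<sigma>\<^bsub>Int_smc C\<^esub> X Y = ide (Int_cat C) (X \<otimes>\<^bsub>Int_smc C\<^esub> Y)"
      using a by (simp add: I.iev_simps sm)
  next
    fix u X Y v Z u' X' Y' v' Z'
    assume "u \<in> hom (Int_cat C) X Y" "v \<in> hom (Int_cat C) Y Z" "u' \<in> hom (Int_cat C) X' Y'" "v' \<in> hom (Int_cat C) Y' Z'"
    then obtain X1 X2 Y1 Y2 Z1 Z2 X3 X4 Y3 Y4 Z3 Z4 f g f' g' where a: "u = ((X1, X2), f, (Y1, Y2))" "v = ((Y1, Y2), g, (Z1, Z2))"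
      "u' = ((X3, X4), f', (Y3, Y4))" "v' = ((Y3, Y4), g', (Z3, Z4))"
      "X1 \<in> Obj C" "X2 \<in> Obj C" "Y1 \<in> Obj C" "Y2 \<in> Obj C" "Z1 \<in> Obj C" "Z2 \<in> Obj C" "X3 \<in> Obj C" "X4 \<in> Obj C" "Y3 \<in> Obj C" "Y4 \<in> Obj C" "Z3 \<in> Obj C" "Z4 \<in> Obj C"
      "f \<in> hom C (X1 \<otimes> Y2) (X2 \<otimes> Y1)" "g \<in> hom C (Y1 \<otimes> Z2) (Y2 \<otimes> Z1)" "f' \<in> hom C (X3 \<otimes> Y4) (X4 \<otimes> Y3)" "g' \<in> hom C (Y3 \<otimes> Z4) (Y4 \<otimes> Z3)"
      by (cases X; cases Y; cases Z; cases X'; cases Y'; cases Z') (auto simp: Int_cat_simps)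
    interpret I: interpretation_of_terms C "pick \<one> [X1, X2, Y1, Y2, Z1, Z2, X3, X4, Y3, Y4, Z3, Z4]" "pick undefined [f, g, f', g']"
      by (rule interpretation_pick) (use a in auto)
    let ?u = "iBx 0 ([0], [1]) ([2], [3])" and ?v = "iBx 1 ([2], [3]) ([4], [5])"
    let ?u' = "iBx 2 ([6], [7]) ([8], [9])" and ?v' = "iBx 3 ([8], [9]) ([10], [11])"
    have "I.iev (iTs (iCp ?v ?u) (iCp ?v' ?u')) = I.iev (iCp (iTs ?v ?v') (iTs ?u ?u'))"
      by (rule I.same_idiagram_iev, code_simp) (use a in simp_all)
    then show "(v \<cdot>\<^bsub>Int_cat C\<^esub> u) \<boxtimes>\<^bsub>Int_smc C\<^esub> (v' \<cdot>\<^bsub>Int_cat C\<^esub> u') = (v \<boxtimes>\<^bsub>Int_smc C\<^esub> v') \<cdot>\<^bsub>Int_cat C\<^esub> (u \<boxtimes>\<^bsub>Int_smc C\<^esub> u')"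
      using a by (simp add: I.iev_simps)
  next
    fix u v w assume "u \<in> Arr (Int_cat C)" "v \<in> Arr (Int_cat C)" "w \<in> Arr (Int_cat C)"
    then obtain X1 X2 Y1 Y2 f X3 X4 Y3 Y4 g X5 X6 Y5 Y6 h where a: "u = ((X1, X2), f, (Y1, Y2))" "v = ((X3, X4), g, (Y3, Y4))" "w = ((X5, X6), h, (Y5, Y6))"
      "X1 \<in> Obj C" "X2 \<in> Obj C" "Y1 \<in> Obj C" "Y2 \<in> Obj C" "X3 \<in> Obj C" "X4 \<in> Obj C" "Y3 \<in> Obj C" "Y4 \<in> Obj C" "X5 \<in> Obj C" "X6 \<in> Obj C" "Y5 \<in> Obj C" "Y6 \<in> Obj C"
      "f \<in> hom C (X1 \<otimes> Y2) (X2 \<otimes> Y1)" "g \<in> hom C (X3 \<otimes> Y4) (X4 \<otimes> Y3)" "h \<in> hom C (X5 \<otimes> Y6) (X6 \<otimes> Y5)"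
      by (auto elim!: Int_arrE)
    interpret I: interpretation_of_terms C "pick \<one> [X1, X2, Y1, Y2, X3, X4, Y3, Y4, X5, X6, Y5, Y6]" "pick undefined [f, g, h]"
      by (rule interpretation_pick) (use a in auto)
    let ?u = "iBx 0 ([0], [1]) ([2], [3])" and ?v = "iBx 1 ([4], [5]) ([6], [7])" and ?w = "iBx 2 ([8], [9]) ([10], [11])"
    have "I.iev (iTs (iTs ?u ?v) ?w) = I.iev (iTs ?u (iTs ?v ?w))"
      by (rule I.same_idiagram_iev, code_simp) (use a in simp_all)
    then show "(u \<boxtimes>\<^bsub>Int_smc C\<^esub> v) \<boxtimes>\<^bsub>Int_smc C\<^esub> w = u \<boxtimes>\<^bsub>Int_smc C\<^esub> v \<boxtimes>\<^bsub>Int_smc C\<^esub> w"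
      using a by (simp add: I.iev_simps)
  next
    fix u assume "u \<in> Arr (Int_cat C)"
    then obtain X1 X2 Y1 Y2 f where a: "u = ((X1, X2), f, (Y1, Y2))" "X1 \<in> Obj C" "X2 \<in> Obj C" "Y1 \<in> Obj C" "Y2 \<in> Obj C" "f \<in> hom C (X1 \<otimes> Y2) (X2 \<otimes> Y1)"
      by (auto elim!: Int_arrE)
    interpret I: interpretation_of_terms C "pick \<one> [X1, X2, Y1, Y2]" "pick undefined [f]"
      by (rule interpretation_pick) (use a in auto)
    let ?u = "iBx 0 ([0], [1]) ([2], [3])"
    have "I.iev (iTs (iId ([], [])) ?u) = I.iev ?u" "I.iev (iTs ?u (iId ([], []))) = I.iev ?u"
      by (rule I.same_idiagram_iev, code_simp; use a in simp)+
    then show "ide (Int_cat C) (\<one>, \<one>) \<boxtimes>\<^bsub>Int_smc C\<^esub> u = u" "u \<boxtimes>\<^bsub>Int_smc C\<^esub> ide (Int_cat C) (\<one>, \<one>) = u"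
      using a by (simp_all add: I.iev_simps)
  next
    show "symm (Int_smc C) \<in> (\<Pi>\<^sub>E X\<in>Obj (Int_cat C). \<Pi>\<^sub>E Y\<in>Obj (Int_cat C). hom (Int_cat C) (X \<otimes>\<^bsub>Int_smc C\<^esub> Y) (Y \<otimes>\<^bsub>Int_smc C\<^esub> X))"
      using Int_symm_hom by (auto simp: PiE_iff Int_cat_simps(1) Int_smc_tobj)
        (auto simp: Int_smc_def Let_def cat.defs smc.defs extensional_def)
  next
    fix u X Y v X' Y'
    assume "u \<in> hom (Int_cat C) X Y" "v \<in> hom (Int_cat C) X' Y'"
    then obtain X1 X2 Y1 Y2 X3 X4 Y3 Y4 f g where a: "X = (X1, X2)" "Y = (Y1, Y2)" "X' = (X3, X4)" "Y' = (Y3, Y4)" "u = ((X1, X2), f, (Y1, Y2))" "v = ((X3, X4), g, (Y3, Y4))"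
      "X1 \<in> Obj C" "X2 \<in> Obj C" "Y1 \<in> Obj C" "Y2 \<in> Obj C" "X3 \<in> Obj C" "X4 \<in> Obj C" "Y3 \<in> Obj C" "Y4 \<in> Obj C" 
      "f \<in> hom C (X1 \<otimes> Y2) (X2 \<otimes> Y1)" "g \<in> hom C (X3 \<otimes> Y4) (X4 \<otimes> Y3)"
      by (cases X; cases Y; cases X'; cases Y') (auto simp: Int_cat_simps)
    interpret I: interpretation_of_terms C "pick \<one> [X1, X2, Y1, Y2, X3, X4, Y3, Y4]" "pick undefined [f, g]"
      by (rule interpretation_pick) (use a in auto)
    let ?u = "iBx 0 ([0], [1]) ([2], [3])" and ?v = "iBx 1 ([4], [5]) ([6], [7])"
    have "I.iev (iCp (iSy ([2], [3]) ([6], [7])) (iTs ?u ?v)) = I.iev (iCp (iTs ?v ?u) (iSy ([0], [1]) ([4], [5])))"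
      by (rule I.same_idiagram_iev, code_simp) (use a in simp_all)
    then show "\<sigma>\<^bsub>Int_smc C\<^esub> Y Y' \<cdot>\<^bsub>Int_cat C\<^esub> (u \<boxtimes>\<^bsub>Int_smc C\<^esub> v) = (v \<boxtimes>\<^bsub>Int_smc C\<^esub> u) \<cdot>\<^bsub>Int_cat C\<^esub> \<sigma>\<^bsub>Int_smc C\<^esub> X X'"
      using a by (simp add: I.iev_simps)
  next
    fix X Y Z assume "X \<in> Obj (Int_cat C)" "Y \<in> Obj (Int_cat C)" "Z \<in> Obj (Int_cat C)"
    then obtain X1 X2 Y1 Y2 Z1 Z2 where a: "X = (X1, X2)" "Y = (Y1, Y2)" "Z = (Z1, Z2)" "X1 \<in> Obj C" "X2 \<in> Obj C" "Y1 \<in> Obj C" "Y2 \<in> Obj C" "Z1 \<in> Obj C" "Z2 \<in> Obj C"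
      by (auto simp: Int_cat_simps)
    interpret I: interpretation_of_terms C "pick \<one> [X1, X2, Y1, Y2, Z1, Z2]" "pick undefined []"
      by (rule interpretation_pick) (use a in auto)
    let ?X = "([0], [1])" and ?Y = "([2], [3])" and ?Z = "([4], [5])"
    have "I.iev (iSy ?X ([2, 4], [3, 5])) = I.iev (iCp (iTs (iId ?Y) (iSy ?X ?Z)) (iTs (iSy ?X ?Y) (iId ?Z)))"
      by (rule I.same_idiagram_iev, code_simp) simp_all
    then show "\<sigma>\<^bsub>Int_smc C\<^esub> X (Y \<otimes>\<^bsub>Int_smc C\<^esub> Z) = (ide (Int_cat C) Y \<boxtimes>\<^bsub>Int_smc C\<^esub> \<sigma>\<^bsub>Int_smc C\<^esub> X Z) \<cdot>\<^bsub>Int_cat C\<^esub> (\<sigma>\<^bsub>Int_smc C\<^esub> X Y \<boxtimes>\<^bsub>Int_smc C\<^esub> ide (Int_cat C) Z)"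
      using a by (simp add: I.iev_simps sm)
    show "(X \<otimes>\<^bsub>Int_smc C\<^esub> Y) \<otimes>\<^bsub>Int_smc C\<^esub> Z = X \<otimes>\<^bsub>Int_smc C\<^esub> Y \<otimes>\<^bsub>Int_smc C\<^esub> Z"
      using a by (simp add: sm)
  next
    fix X assume "X \<in> Obj (Int_cat C)"
    then show "(\<one>, \<one>) \<otimes>\<^bsub>Int_smc C\<^esub> X = X" "X \<otimes>\<^bsub>Int_smc C\<^esub> (\<one>, \<one>) = X" by (auto simp: sm)
  qed
qed

end

section \<open>Traced functors\<close>

lemma Int_map_simps:
  "\<lbrakk>X \<in> Obj T; X' \<in> Obj T\<rbrakk> \<Longrightarrow> omap (Int_map T G) (X, X') = (omap G X, omap G X')"
  "((X, X'), f, (Y, Y')) \<in> Arr (Int_cat T) \<Longrightarrow> amap (Int_map T G) ((X, X'), f, (Y, Y')) = ((omap G X, omap G X'), amap G f, (omap G Y, omap G Y'))"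
  by (simp_all add: Int_map_def Int_cat_simps(1))

lemma traced_functor_trace:
  assumes "traced_functor T S G" "U \<in> Obj T" "X \<in> Obj T" "Y \<in> Obj T" "f \<in> Arr T" "Dom T f = U \<otimes>\<^bsub>T\<^esub> X" "Cod T f = U \<otimes>\<^bsub>T\<^esub> Y"
  shows "amap G (Tr\<^bsub>T\<^esub> U X Y f) = Tr\<^bsub>S\<^esub> (omap G U) (omap G X) (omap G Y) (amap G f)"
proof -
  have "f \<in> hom T (U \<otimes>\<^bsub>T\<^esub> X) (U \<otimes>\<^bsub>T\<^esub> Y)" using assms by (simp add: hom_iff)
  then show ?thesis using assms(1-4) by (simp add: traced_functor_def)
qed

lemma functor_comp_arr:
  "\<lbrakk>is_functor C D F; g \<in> Arr C; f \<in> Arr C; Cod C f = Dom C g\<rbrakk> \<Longrightarrow> amap F (g \<cdot>\<^bsub>C\<^esub> f) = amap F g \<cdot>\<^bsub>D\<^esub> amap F f"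
  by (simp add: is_functor_def)

text \<open>The whole structure of \<open>Int\<close> is written in terms of composition, tensor,
  symmetry and trace, all of which a traced functor preserves strictly.\<close>

lemma strict_monoidal_Int_map:
  assumes T: "traced_category T" and S: "traced_category S" and G: "traced_functor T S G"
  shows "strict_monoidal_functor (Int_smc T) (Int_smc S) (Int_map T G)"
proof -
  interpret T: traced_category T by fact
  interpret S: traced_category S by fact
  interpret M: category "Int_cat T" by (rule T.category_Int_cat)
  have Gs: "strict_monoidal_functor T S G" using G by (simp add: traced_functor_def)
  note Gf = strict_functor[OF Gs]
  note [simp] = functor_obj[OF Gf] functor_arr[OF T.category_axioms Gf] functor_ide[OF Gf] strict_functor_simps[OF Gs]
    traced_functor_trace[OF G] functor_comp_arr[OF Gf]
  have ho: "((omap G X, omap G X'), amap G f, (omap G Y, omap G Y')) \<in> Arr (Int_cat S)"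
    if "((X, X'), f, (Y, Y')) \<in> Arr (Int_cat T)" for X X' f Y Y'
    using that by (auto simp: Int_cat_simps hom_iff)
  have "is_functor (Int_cat T) (Int_cat S) (Int_map T G)"
  proof (rule is_functorI[OF T.category_Int_cat])
    show "omap (Int_map T G) \<in> extensional (Obj (Int_cat T))" "amap (Int_map T G) \<in> extensional (Arr (Int_cat T))"
      by (simp_all add: Int_map_def)
  next
    fix X assume X: "X \<in> Obj (Int_cat T)"
    then show "omap (Int_map T G) X \<in> Obj (Int_cat S)" by (auto simp: Int_cat_simps Int_map_simps)
    from X obtain X1 X2 where a: "X = (X1, X2)" "X1 \<in> Obj T" "X2 \<in> Obj T" by (auto simp: Int_cat_simps)
    then have "((X1, X2), \<sigma>\<^bsub>T\<^esub> X1 X2, (X1, X2)) \<in> Arr (Int_cat T)" by (simp add: Int_cat_simps T.symm_hom)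
    then show "amap (Int_map T G) (ide (Int_cat T) X) = ide (Int_cat S) (omap (Int_map T G) X)"
      using a by (simp add: Int_cat_ide Int_map_simps)
  next
    fix X Y u assume u: "u \<in> hom (Int_cat T) X Y"
    then obtain X1 X2 Y1 Y2 f where a: "X = (X1, X2)" "Y = (Y1, Y2)" "u = ((X1, X2), f, (Y1, Y2))" 
      "X1 \<in> Obj T" "X2 \<in> Obj T" "Y1 \<in> Obj T" "Y2 \<in> Obj T" "f \<in> hom T (X1 \<otimes>\<^bsub>T\<^esub> Y2) (X2 \<otimes>\<^bsub>T\<^esub> Y1)"
      by (cases X; cases Y) (auto simp: Int_cat_simps)
    then show "amap (Int_map T G) u \<in> hom (Int_cat S) (omap (Int_map T G) X) (omap (Int_map T G) Y)"
      by (simp add: Int_cat_simps Int_map_simps) (simp add: hom_iff)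
  next
    fix X Y Z v u assume v: "v \<in> hom (Int_cat T) Y Z" and u: "u \<in> hom (Int_cat T) X Y"
    obtain X1 X2 Y1 Y2 Z1 Z2 f g where a: "u = ((X1, X2), f, (Y1, Y2))" "v = ((Y1, Y2), g, (Z1, Z2))" 
      "X1 \<in> Obj T" "X2 \<in> Obj T" "Y1 \<in> Obj T" "Y2 \<in> Obj T" "Z1 \<in> Obj T" "Z2 \<in> Obj T"
      "f \<in> hom T (X1 \<otimes>\<^bsub>T\<^esub> Y2) (X2 \<otimes>\<^bsub>T\<^esub> Y1)" "g \<in> hom T (Y1 \<otimes>\<^bsub>T\<^esub> Z2) (Y2 \<otimes>\<^bsub>T\<^esub> Z1)"
      using u v by (cases X; cases Y; cases Z) (auto simp: Int_cat_simps)
    have A: "((X1, X2), f, (Y1, Y2)) \<in> Arr (Int_cat T)" "((Y1, Y2), g, (Z1, Z2)) \<in> Arr (Int_cat T)"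
      using u v a by (auto simp: hom_iff)
    have vu: "v \<cdot>\<^bsub>Int_cat T\<^esub> u \<in> Arr (Int_cat T)" using M.comp_hom[OF v u] by (simp add: hom_iff)
    show "amap (Int_map T G) (v \<cdot>\<^bsub>Int_cat T\<^esub> u) = amap (Int_map T G) v \<cdot>\<^bsub>Int_cat S\<^esub> amap (Int_map T G) u"
      using vu a(3-) unfolding a(1,2) Int_cat_comp[OF A(2,1)] Int_map_simps(2)[OF A(1)] Int_map_simps(2)[OF A(2)] Int_cat_comp[OF ho[OF A(2)] ho[OF A(1)]]
      by (simp add: Int_map_simps(2)) (simp add: hom_iff)
  qed
  moreover have "amap (Int_map T G) (u \<boxtimes>\<^bsub>Int_smc T\<^esub> v) = amap (Int_map T G) u \<boxtimes>\<^bsub>Int_smc S\<^esub> amap (Int_map T G) v"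
    if u: "u \<in> Arr (Int_cat T)" and v: "v \<in> Arr (Int_cat T)" for u v
  proof -
    obtain X1 X2 Y1 Y2 f X3 X4 Y3 Y4 g where a: "u = ((X1, X2), f, (Y1, Y2))" "v = ((X3, X4), g, (Y3, Y4))" 
      "X1 \<in> Obj T" "X2 \<in> Obj T" "Y1 \<in> Obj T" "Y2 \<in> Obj T" "X3 \<in> Obj T" "X4 \<in> Obj T" "Y3 \<in> Obj T" "Y4 \<in> Obj T" 
      "f \<in> hom T (X1 \<otimes>\<^bsub>T\<^esub> Y2) (X2 \<otimes>\<^bsub>T\<^esub> Y1)" "g \<in> hom T (X3 \<otimes>\<^bsub>T\<^esub> Y4) (X4 \<otimes>\<^bsub>T\<^esub> Y3)"
      using u v by (auto elim!: T.Int_arrE)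
    have A: "((X1, X2), f, (Y1, Y2)) \<in> Arr (Int_cat T)" "((X3, X4), g, (Y3, Y4)) \<in> Arr (Int_cat T)"
      using u v a by auto
    have uv: "u \<boxtimes>\<^bsub>Int_smc T\<^esub> v \<in> Arr (Int_cat T)"
      using T.Int_tarr_hom[of u X1 X2 Y1 Y2 v X3 X4 Y3 Y4] A u v unfolding a(1,2) by (simp add: hom_iff Int_cat_simps(4,5))
    show ?thesis
      using uv a(3-) unfolding a(1,2) Int_smc_tarr[OF A(1,2)] Int_map_simps(2)[OF A(1)] Int_map_simps(2)[OF A(2)] Int_smc_tarr[OF ho[OF A(1)] ho[OF A(2)]]
      by (simp add: Int_map_simps(2)) (simp add: hom_iff)
  qed
  moreover have "amap (Int_map T G) (\<sigma>\<^bsub>Int_smc T\<^esub> X Y) = \<sigma>\<^bsub>Int_smc S\<^esub> (omap (Int_map T G) X) (omap (Int_map T G) Y)"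
    if "X \<in> Obj (Int_cat T)" "Y \<in> Obj (Int_cat T)" for X Y
  proof -
    obtain X1 X2 Y1 Y2 where a: "X = (X1, X2)" "Y = (Y1, Y2)" "X1 \<in> Obj T" "X2 \<in> Obj T" "Y1 \<in> Obj T" "Y2 \<in> Obj T"
      using \<open>X \<in> _\<close> \<open>Y \<in> _\<close> by (auto simp: Int_cat_simps)
    then show ?thesis
      using T.Int_symm_hom[of X1 X2 Y1 Y2] by (simp add: Int_smc_symm Int_map_simps hom_iff)
  qed
  ultimately show ?thesis
    unfolding strict_monoidal_functor_def is_functor_def by (auto simp: Int_map_simps Int_smc_tobj Int_cat_simps(1))
qed

section \<open>The categories of traced and of compact categories\<close>

lemma strict_monoidal_functor_id: "symmetric_monoidal C \<Longrightarrow> strict_monoidal_functor C C (func_id C)"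
proof -
  assume "symmetric_monoidal C"
  then interpret symmetric_monoidal C .
  show ?thesis using is_functor_id[OF category_axioms] by (simp add: strict_monoidal_functor_def)
qed

lemma strict_monoidal_functor_comp:
  assumes "symmetric_monoidal C" "symmetric_monoidal D" "strict_monoidal_functor C D F" "strict_monoidal_functor D E G"
  shows "strict_monoidal_functor C E (func_comp C G F)"
proof -
  interpret C: symmetric_monoidal C by fact
  interpret D: symmetric_monoidal D by fact
  note Ff = strict_functor[OF assms(3)]
  show ?thesis
    using is_functor_comp[OF C.category_axioms D.category_axioms Ff strict_functor[OF assms(4)]]
      functor_obj[OF Ff] functor_arr[OF C.category_axioms Ff] strict_functor_simps[OF assms(3)] strict_functor_simps[OF assms(4)]
    by (simp add: strict_monoidal_functor_def compose_def)
qed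

lemma traced_functor_id: "traced_category C \<Longrightarrow> traced_functor C C (func_id C)"
proof -
  assume "traced_category C"
  then interpret traced_category C .
  show ?thesis using strict_monoidal_functor_id[OF symmetric_monoidal_axioms] by (simp add: traced_functor_def hom_iff)
qed

lemma traced_functor_comp:
  assumes "traced_category C" "traced_category D" "traced_functor C D F" "traced_functor D E G"
  shows "traced_functor C E (func_comp C G F)"
proof -
  interpret C: traced_category C by fact
  interpret D: traced_category D by fact
  have s: "strict_monoidal_functor C D F" "strict_monoidal_functor D E G" using assms by (auto simp: traced_functor_def)
  note Ff = strict_functor[OF s(1)]
  show ?thesis
    using strict_monoidal_functor_comp[OF C.symmetric_monoidal_axioms D.symmetric_monoidal_axioms s]
      functor_obj[OF Ff] functor_arr[OF C.category_axioms Ff] strict_functor_simps[OF s(1)] 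
    by (auto simp: traced_functor_def[of C E] compose_def hom_iff traced_functor_trace[OF assms(3)] traced_functor_trace[OF assms(4)])
qed

lemma category_TrCat: "category TrCat"
  unfolding TrCat_def
proof (rule category_cat_of_homs, unfold mem_Collect_eq)
  fix C D E K :: "('a, 'a) tracedcat" and F G H :: "'a small_func"
  note c = symmetric_monoidal.axioms(1)[OF traced_category.axioms(1)] and s = strict_functor[OF traced_functor_def[THEN iffD1, THEN conjunct1]]
  show "traced_functor C C (func_id C)" if "traced_category C" using that by (rule traced_functor_id)
  show "traced_functor C E (func_comp C G F)" if "traced_category C" "traced_category D" "traced_functor C D F" "traced_functor D E G"
    using that by (rule traced_functor_comp)
  show "func_comp C (func_id D) F = F" "func_comp C F (func_id C) = F" if "traced_category C" "traced_category D" "traced_functor C D F"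
    using func_comp_id[OF c[OF that(1)] c[OF that(2)] s[OF that(3)]] by auto
  show "func_comp C H (func_comp C G F) = func_comp C (func_comp D H G) F" if "traced_category C" "traced_category D" "traced_functor C D F"
    by (rule func_comp_assoc[OF c[OF that(1)] c[OF that(2)] s[OF that(3)], symmetric])
qed

lemma category_CompCat: "category CompCat"
  unfolding CompCat_def
proof (rule category_cat_of_homs, unfold mem_Collect_eq)
  fix C D E K :: "('a, 'a) smc" and F G H :: "'a small_func"
  note m = compact_category.axioms(1) note c = symmetric_monoidal.axioms(1)[OF m] and s = strict_functor
  show "strict_monoidal_functor C C (func_id C)" if "compact_category C" using m[OF that] by (rule strict_monoidal_functor_id)
  show "strict_monoidal_functor C E (func_comp C G F)" if "compact_category C" "compact_category D" "strict_monoidal_functor C D F" "strict_monoidal_functor D E G"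
    using m[OF that(1)] m[OF that(2)] that(3,4) by (rule strict_monoidal_functor_comp)
  show "func_comp C (func_id D) F = F" "func_comp C F (func_id C) = F" if "compact_category C" "compact_category D" "strict_monoidal_functor C D F"
    using func_comp_id[OF c[OF that(1)] c[OF that(2)] s[OF that(3)]] by auto
  show "func_comp C H (func_comp C G F) = func_comp C (func_comp D H G) F" if "compact_category C" "compact_category D" "strict_monoidal_functor C D F"
    by (rule func_comp_assoc[OF c[OF that(1)] c[OF that(2)] s[OF that(3)], symmetric])
qed

lemma Int_map_id: "traced_category T \<Longrightarrow> Int_map T (func_id T) = func_id (Int_smc T)"
  by (rule func_eqI[where A = "Obj (Int_cat T)" and B = "Arr (Int_cat T)"])
    (auto simp: Int_map_def Int_cat_simps hom_iff elim!: traced_category.Int_arrE)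

lemma Int_map_comp:
  assumes T: "traced_category T" and S: "traced_category S" and G: "traced_functor T S G"
  shows "Int_map T (func_comp T H G) = func_comp (Int_smc T) (Int_map S H) (Int_map T G)"
proof (rule func_eqI[where A = "Obj (Int_cat T)" and B = "Arr (Int_cat T)"])
  interpret T: traced_category T by fact
  have Gs: "strict_monoidal_functor T S G" using G by (simp add: traced_functor_def)
  note Gf = strict_functor[OF Gs] 
  note Go = functor_obj[OF Gf]
  note If = strict_functor[OF strict_monoidal_Int_map[OF assms]]
  fix u assume u: "u \<in> Arr (Int_cat T)"
  then obtain X X' f Y Y' where a: "u = ((X, X'), f, (Y, Y'))" "X \<in> Obj T" "X' \<in> Obj T" "Y \<in> Obj T" "Y' \<in> Obj T" "f \<in> hom T (X \<otimes>\<^bsub>T\<^esub> Y') (X' \<otimes>\<^bsub>T\<^esub> Y)"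
    by (rule T.Int_arrE)
  have "amap (Int_map T G) u \<in> Arr (Int_cat S)"
    using functor_arr(1)[OF T.category_Int_smc If] u by simp
  then show "amap (Int_map T (func_comp T H G)) u = amap (func_comp (Int_smc T) (Int_map S H) (Int_map T G)) u"
    using a u by (simp add: Int_map_simps compose_def hom_iff)
next
  fix X assume "X \<in> Obj (Int_cat T)"
  then show "omap (Int_map T (func_comp T H G)) X = omap (func_comp (Int_smc T) (Int_map S H) (Int_map T G)) X"
    using functor_obj[OF strict_functor[of T S G]] G by (auto simp: traced_functor_def Int_cat_simps Int_map_simps compose_def)
qed (auto simp: Int_map_def compose_def)

section \<open>Naming arrows in Int\<close>

text \<open>An arrow from the unit of \<open>Int\<close> to \<open>(Y, X)\<close> is an arrow from
  \<open>\<one> \<otimes> X\<close> to \<open>\<one> \<otimes> Y\<close>, that is, from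
  \<open>X\<close> to \<open>Y\<close>. So points of \<open>Int\<close> are arrows of
  \<open>T\<close>.\<close>

definition nam :: "('o, 'a, 'm) tracedcat_scheme \<Rightarrow> 'o \<Rightarrow> 'o \<Rightarrow> 'a \<Rightarrow> ('o \<times> 'o) \<times> 'a \<times> ('o \<times> 'o)" where
  "nam T X Y f = ((\<one>\<^bsub>T\<^esub>, \<one>\<^bsub>T\<^esub>), f, (Y, X))"

text \<open>Pure wiring from \<open>(Y, X) \<otimes> (Z, Y)\<close> to \<open>(Z, X)\<close>: the
  output \<open>Y\<close> of the first slot is plugged into the input \<open>Y\<close> of the
  second.\<close>

definition compose_wires :: "('o, 'a, 'm) tracedcat_scheme \<Rightarrow> 'o \<Rightarrow> 'o \<Rightarrow> 'o \<Rightarrow> ('o \<times> 'o) \<times> 'a \<times> ('o \<times> 'o)" where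
  "compose_wires T X Y Z = ((Y \<otimes>\<^bsub>T\<^esub> Z, X \<otimes>\<^bsub>T\<^esub> Y), \<sigma>\<^bsub>T\<^esub> (Y \<otimes>\<^bsub>T\<^esub> Z) X, (Z, X))"

text \<open>Pure wiring from \<open>(U \<otimes> Y, U \<otimes> X)\<close> to \<open>(Y, X)\<close>,
  which feeds the output \<open>U\<close> back into the input \<open>U\<close>.\<close>

definition trace_wires :: "('o, 'a, 'm) tracedcat_scheme \<Rightarrow> 'o \<Rightarrow> 'o \<Rightarrow> 'o \<Rightarrow> ('o \<times> 'o) \<times> 'a \<times> ('o \<times> 'o)" where
  "trace_wires T U X Y = ((U \<otimes>\<^bsub>T\<^esub> Y, U \<otimes>\<^bsub>T\<^esub> X), ide T U \<boxtimes>\<^bsub>T\<^esub> \<sigma>\<^bsub>T\<^esub> Y X, (Y, X))"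

context traced_category
begin

lemma nam_hom: "\<lbrakk>X \<in> Obj C; Y \<in> Obj C\<rbrakk> \<Longrightarrow> nam C X Y f \<in> hom (Int_cat C) (\<one>, \<one>) (Y, X) \<longleftrightarrow> f \<in> hom C X Y"
  by (simp add: nam_def Int_cat_simps)

lemma hom_nam: "u \<in> hom (Int_cat C) (\<one>, \<one>) (Y, X) \<longleftrightarrow> (\<exists>f. u = nam C X Y f \<and> X \<in> Obj C \<and> Y \<in> Obj C \<and> f \<in> hom C X Y)"
  by (auto simp: nam_def Int_cat_simps)

lemma compose_wires_hom: "\<lbrakk>X \<in> Obj C; Y \<in> Obj C; Z \<in> Obj C\<rbrakk> \<Longrightarrow> compose_wires C X Y Z \<in> hom (Int_cat C) (Y \<otimes> Z, X \<otimes> Y) (Z, X)"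
  by (simp add: compose_wires_def Int_cat_simps) (simp add: hom_iff)

lemma trace_wires_hom: "\<lbrakk>U \<in> Obj C; X \<in> Obj C; Y \<in> Obj C\<rbrakk> \<Longrightarrow> trace_wires C U X Y \<in> hom (Int_cat C) (U \<otimes> Y, U \<otimes> X) (Y, X)"
  by (simp add: trace_wires_def Int_cat_simps) (simp add: hom_iff)

lemma nam_tarr:
  assumes "X \<in> Obj C" "Y \<in> Obj C" "X' \<in> Obj C" "Y' \<in> Obj C" "f \<in> hom C X Y" "f' \<in> hom C X' Y'"
  shows "nam C X Y f \<boxtimes>\<^bsub>Int_smc C\<^esub> nam C X' Y' f' = nam C (X \<otimes> X') (Y \<otimes> Y') (f \<boxtimes> f')"
  using assms by (simp add: nam_def Int_smc_tarr Int_cat_simps hom_iff)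

text \<open>Composition in the traced category thus becomes the effect of an arrow of
  \<open>Int\<close> that does not depend on \<open>f\<close> and \<open>g\<close>. A lax functor on
  \<open>Int\<close> can apply that arrow to arbitrary elements, which is how such elements come to
  be composed.\<close>

lemma compose_nam:
  assumes "f \<in> hom C X Y" "g \<in> hom C Y Z"
  shows "compose_wires C X Y Z \<cdot>\<^bsub>Int_smc C\<^esub> (nam C X Y f \<boxtimes>\<^bsub>Int_smc C\<^esub> nam C Y Z g) = nam C X Z (g \<cdot> f)"
proof -
  have o: "X \<in> Obj C" "Y \<in> Obj C" "Z \<in> Obj C" using homD(4,5)[OF assms(1)] homD(5)[OF assms(2)] by auto
  interpret I: interpretation_of_terms C "pick \<one> [X, Y, Z]" "pick undefined [f, g]"
    by (rule interpretation_pick) (use o in auto)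
  let ?I = "([], [])" and ?f = "iBx 0 ([], []) ([1], [0])" and ?g = "iBx 1 ([], []) ([2], [1])"
  have "I.iev (iCp (([1, 2], [0, 1]), Sy [1, 2] [0], ([2], [0])) (iTs ?f ?g)) = I.iev (?I, Cp (Bx 1 [1] [2]) (Bx 0 [0] [1]), ([2], [0]))"
    by (rule I.same_idiagram_iev, code_simp) (use assms o in simp_all)
  then show ?thesis
    using assms o by (simp add: I.iev_simps nam_def compose_wires_def)
qed

lemma trace_nam:
  assumes "U \<in> Obj C" "X \<in> Obj C" "Y \<in> Obj C" "f \<in> hom C (U \<otimes> X) (U \<otimes> Y)"
  shows "trace_wires C U X Y \<cdot>\<^bsub>Int_smc C\<^esub> nam C (U \<otimes> X) (U \<otimes> Y) f = nam C X Y (Tr U X Y f)"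
proof -
  interpret I: interpretation_of_terms C "pick \<one> [U, X, Y]" "pick undefined [f]"
    by (rule interpretation_pick) (use assms in auto)
  let ?f = "iBx 0 ([], []) ([0, 2], [0, 1])"
  have "I.iev (iCp (([0, 2], [0, 1]), Ts (Id [0]) (Sy [2] [1]), ([2], [1])) ?f) = I.iev (([], []), Fb [0] (Bx 0 [0, 1] [0, 2]), ([2], [1]))"
    by (rule I.same_idiagram_iev, code_simp) (use assms in simp_all)
  then show ?thesis
    using assms by (simp add: I.iev_simps nam_def trace_wires_def)
qed

end

lemma Int_map_wires:
  assumes T: "traced_category T" and S: "traced_category S" and G: "traced_functor T S G"
  shows "\<lbrakk>X \<in> Obj T; Y \<in> Obj T; Z \<in> Obj T\<rbrakk> \<Longrightarrow> amap (Int_map T G) (compose_wires T X Y Z) = compose_wires S (omap G X) (omap G Y) (omap G Z)"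
    and "\<lbrakk>U \<in> Obj T; X \<in> Obj T; Y \<in> Obj T\<rbrakk> \<Longrightarrow> amap (Int_map T G) (trace_wires T U X Y) = trace_wires S (omap G U) (omap G X) (omap G Y)"
    and "f \<in> hom T X Y \<Longrightarrow> amap (Int_map T G) (nam T X Y f) = nam S (omap G X) (omap G Y) (amap G f)"
proof -
  interpret T: traced_category T by fact
  have Gs: "strict_monoidal_functor T S G" using G by (simp add: traced_functor_def)
  note Gf = strict_functor[OF Gs]
  note [simp] = functor_obj[OF Gf] functor_arr[OF T.category_axioms Gf] functor_ide[OF Gf] strict_functor_simps[OF Gs]
  show "\<lbrakk>X \<in> Obj T; Y \<in> Obj T; Z \<in> Obj T\<rbrakk> \<Longrightarrow> amap (Int_map T G) (compose_wires T X Y Z) = compose_wires S (omap G X) (omap G Y) (omap G Z)"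
    using T.compose_wires_hom[of X Y Z] by (simp add: compose_wires_def Int_map_simps(2) hom_iff)
  show "\<lbrakk>U \<in> Obj T; X \<in> Obj T; Y \<in> Obj T\<rbrakk> \<Longrightarrow> amap (Int_map T G) (trace_wires T U X Y) = trace_wires S (omap G U) (omap G X) (omap G Y)"
    using T.trace_wires_hom[of U X Y] by (simp add: trace_wires_def Int_map_simps(2) hom_iff)
  show "f \<in> hom T X Y \<Longrightarrow> amap (Int_map T G) (nam T X Y f) = nam S (omap G X) (omap G Y) (amap G f)"
    using T.nam_hom[of X Y f] T.homD(4,5)[of f X Y] by (simp add: nam_def Int_map_simps(2) hom_iff)
qed

section \<open>The functor of points of a traced functor\<close>

lemma inj_on_untag: "inj_on (fst \<circ> snd) (hom (Int_smc T) X Y)"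
  by (cases X; cases Y) (auto simp: Int_cat_simps inj_on_def)

abbreviation "rep_Int T S F \<equiv> rep_lax (Int_smc T) (Int_smc S) (Int_map T F) (fst \<circ> snd)"

text \<open>A dictionary: in the functor of points the lax product is the tensor of arrows, and the
  two wirings act as composition and trace. Names acting on the unit element give the values of
  \<open>F\<close>. A natural monoidal family therefore preserves all of these.\<close>

lemma rep_Int_simps:
  assumes T: "traced_category T" and S: "traced_category S" and F: "traced_functor T S F"
  shows "\<lbrakk>X \<in> Obj T; Y \<in> Obj T\<rbrakk> \<Longrightarrow> lset (rep_Int T S F) (Y, X) = hom S (omap F X) (omap F Y)"
    and "lunit (rep_Int T S F) = ide S \<one>\<^bsub>S\<^esub>"
    and "\<lbrakk>X \<in> Obj T; Y \<in> Obj T; X' \<in> Obj T; Y' \<in> Obj T; s \<in> hom S (omap F X) (omap F Y); s' \<in> hom S (omap F X') (omap F Y')\<rbrakk>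
      \<Longrightarrow> lmult (rep_Int T S F) (Y, X) (Y', X') s s' = s \<boxtimes>\<^bsub>S\<^esub> s'"
    and "\<lbrakk>X \<in> Obj T; Y \<in> Obj T; Z \<in> Obj T; s \<in> hom S (omap F X) (omap F Y); t \<in> hom S (omap F Y) (omap F Z)\<rbrakk>
      \<Longrightarrow> lact (rep_Int T S F) (compose_wires T X Y Z) (s \<boxtimes>\<^bsub>S\<^esub> t) = t \<cdot>\<^bsub>S\<^esub> s"
    and "\<lbrakk>U \<in> Obj T; X \<in> Obj T; Y \<in> Obj T; s \<in> hom S (omap F U \<otimes>\<^bsub>S\<^esub> omap F X) (omap F U \<otimes>\<^bsub>S\<^esub> omap F Y)\<rbrakk>
      \<Longrightarrow> lact (rep_Int T S F) (trace_wires T U X Y) s = Tr\<^bsub>S\<^esub> (omap F U) (omap F X) (omap F Y) s"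
    and "f \<in> hom T X Y \<Longrightarrow> lact (rep_Int T S F) (nam T X Y f) (ide S \<one>\<^bsub>S\<^esub>) = amap F f"
proof -
  let ?e = "fst \<circ> snd"
  interpret T: traced_category T by fact
  interpret S: traced_category S by fact
  have Fs: "strict_monoidal_functor T S F" using F by (simp add: traced_functor_def)
  note Ff = strict_functor[OF Fs]
  note Fo = functor_obj[OF Ff] and Fa = functor_arr[OF T.category_axioms Ff] and Fm = strict_functor_simps[OF Fs]
  note MT = T.symmetric_monoidal_Int and MS = S.symmetric_monoidal_Int and IF = strict_monoidal_Int_map[OF assms]
  interpret IT: symmetric_monoidal "Int_smc T" by (rule MT)
  interpret IS: symmetric_monoidal "Int_smc S" by (rule MS)
  note r = rep_lax_simps[OF MT MS IF inj_on_untag]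
  have e: "s = ?e (nam S X Y s)" for s X Y by (simp add: nam_def)
  have p: "nam S (omap F X) (omap F Y) s \<in> hom (Int_smc S) \<one>\<^bsub>Int_smc S\<^esub> (omap (Int_map T F) (Y, X))"
    if "X \<in> Obj T" "Y \<in> Obj T" "s \<in> hom S (omap F X) (omap F Y)" for X Y s
    using that by (simp add: Int_map_simps S.nam_hom Fo)
  have ob: "(Y, X) \<in> Obj (Int_smc T)" if "X \<in> Obj T" "Y \<in> Obj T" for X Y using that by (simp add: Int_cat_simps)
  show set: "lset (rep_Int T S F) (Y, X) = hom S (omap F X) (omap F Y)" if "X \<in> Obj T" "Y \<in> Obj T" for X Y
  proof -
    have "hom (Int_cat S) (\<one>\<^bsub>S\<^esub>, \<one>\<^bsub>S\<^esub>) (omap F Y, omap F X) = nam S (omap F X) (omap F Y) ` hom S (omap F X) (omap F Y)"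
      using that by (auto simp: S.hom_nam Fo image_iff)
    then show ?thesis
      using that r(1)[OF ob[OF that]] by (simp add: Int_map_simps image_image) (simp add: nam_def)
  qed
  show "lunit (rep_Int T S F) = ide S \<one>\<^bsub>S\<^esub>"
    unfolding r(3) by (simp add: Int_cat_ide)
  show mul: "lmult (rep_Int T S F) (Y, X) (Y', X') s s' = s \<boxtimes>\<^bsub>S\<^esub> s'"
    if "X \<in> Obj T" "Y \<in> Obj T" "X' \<in> Obj T" "Y' \<in> Obj T" "s \<in> hom S (omap F X) (omap F Y)" "s' \<in> hom S (omap F X') (omap F Y')" for X Y X' Y' s s'
    using r(4)[OF ob[OF that(1,2)] ob[OF that(3,4)] p[OF that(1,2,5)] p[OF that(3,4,6)]] that
    by (simp add: S.nam_tarr Fo) (simp add: nam_def)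
  show "lact (rep_Int T S F) (compose_wires T X Y Z) (s \<boxtimes>\<^bsub>S\<^esub> t) = t \<cdot>\<^bsub>S\<^esub> s"
    if *: "X \<in> Obj T" "Y \<in> Obj T" "Z \<in> Obj T" "s \<in> hom S (omap F X) (omap F Y)" "t \<in> hom S (omap F Y) (omap F Z)" for X Y Z s t
  proof -
    have st: "s \<boxtimes>\<^bsub>S\<^esub> t \<in> hom S (omap F (X \<otimes>\<^bsub>T\<^esub> Y)) (omap F (Y \<otimes>\<^bsub>T\<^esub> Z))" using S.tarr_closed[OF *(4,5)] * by (simp add: Fm)
    have c: "compose_wires T X Y Z \<in> hom (Int_smc T) (Y \<otimes>\<^bsub>T\<^esub> Z, X \<otimes>\<^bsub>T\<^esub> Y) (Z, X)" using * T.compose_wires_hom by simp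
    have 1: "nam S (omap F (X \<otimes>\<^bsub>T\<^esub> Y)) (omap F (Y \<otimes>\<^bsub>T\<^esub> Z)) (s \<boxtimes>\<^bsub>S\<^esub> t) = nam S (omap F X) (omap F Y) s \<boxtimes>\<^bsub>Int_smc S\<^esub> nam S (omap F Y) (omap F Z) t"
      using * by (simp add: S.nam_tarr Fo Fm)
    have 2: "(Y \<otimes>\<^bsub>T\<^esub> Z) \<in> Obj T" "X \<otimes>\<^bsub>T\<^esub> Y \<in> Obj T" using * by simp_all
    have "lact (rep_Int T S F) (compose_wires T X Y Z) (s \<boxtimes>\<^bsub>S\<^esub> t) = ?e (amap (Int_map T F) (compose_wires T X Y Z) \<cdot>\<^bsub>Int_smc S\<^esub> nam S (omap F (X \<otimes>\<^bsub>T\<^esub> Y)) (omap F (Y \<otimes>\<^bsub>T\<^esub> Z)) (s \<boxtimes>\<^bsub>S\<^esub> t))"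
      using r(2)[OF c p[OF 2(2,1) st]] unfolding e[symmetric] .
    also have "\<dots> = ?e (compose_wires S (omap F X) (omap F Y) (omap F Z) \<cdot>\<^bsub>Int_smc S\<^esub>
       (nam S (omap F X) (omap F Y) s \<boxtimes>\<^bsub>Int_smc S\<^esub> nam S (omap F Y) (omap F Z) t))"
      unfolding 1 Int_map_wires(1)[OF assms *(1-3)] ..
    also have "\<dots> = t \<cdot>\<^bsub>S\<^esub> s" unfolding S.compose_nam[OF *(4,5)] by (simp add: nam_def)
    finally show ?thesis .
  qed
  show "lact (rep_Int T S F) (trace_wires T U X Y) s = Tr\<^bsub>S\<^esub> (omap F U) (omap F X) (omap F Y) s"
    if *: "U \<in> Obj T" "X \<in> Obj T" "Y \<in> Obj T" "s \<in> hom S (omap F U \<otimes>\<^bsub>S\<^esub> omap F X) (omap F U \<otimes>\<^bsub>S\<^esub> omap F Y)" for U X Y s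
  proof -
    have s: "s \<in> hom S (omap F (U \<otimes>\<^bsub>T\<^esub> X)) (omap F (U \<otimes>\<^bsub>T\<^esub> Y))" using * by (simp add: Fm)
    have c: "trace_wires T U X Y \<in> hom (Int_smc T) (U \<otimes>\<^bsub>T\<^esub> Y, U \<otimes>\<^bsub>T\<^esub> X) (Y, X)" using * T.trace_wires_hom by simp
    have "lact (rep_Int T S F) (trace_wires T U X Y) s = ?e (trace_wires S (omap F U) (omap F X) (omap F Y) \<cdot>\<^bsub>Int_smc S\<^esub>
       nam S (omap F U \<otimes>\<^bsub>S\<^esub> omap F X) (omap F U \<otimes>\<^bsub>S\<^esub> omap F Y) s)"
      using r(2)[OF c p[OF _ _ s]] * Int_map_wires(2)[OF assms *(1-3)] by (simp add: e[symmetric] Fm) (simp add: nam_def)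
    also have "\<dots> = Tr\<^bsub>S\<^esub> (omap F U) (omap F X) (omap F Y) s" using S.trace_nam[OF Fo Fo Fo *(4)] * by (simp add: nam_def)
    finally show ?thesis .
  qed
  show "lact (rep_Int T S F) (nam T X Y f) (ide S \<one>\<^bsub>S\<^esub>) = amap F f" if f: "f \<in> hom T X Y" for f X Y
  proof -
    note o = T.homD[OF f]
    have c: "nam T X Y f \<in> hom (Int_smc T) (\<one>\<^bsub>T\<^esub>, \<one>\<^bsub>T\<^esub>) (Y, X)" using f o T.nam_hom by simp
    have i: "ide S \<one>\<^bsub>S\<^esub> = ?e (ide (Int_smc S) \<one>\<^bsub>Int_smc S\<^esub>)" by (simp add: Int_cat_ide)
    have n: "nam S (omap F X) (omap F Y) (amap F f) \<in> hom (Int_smc S) \<one>\<^bsub>Int_smc S\<^esub> (omap F Y, omap F X)"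
      using functor_hom[OF T.category_axioms Ff f] o by (simp add: S.nam_hom Fo)
    have "lact (rep_Int T S F) (nam T X Y f) (ide S \<one>\<^bsub>S\<^esub>) = ?e (nam S (omap F X) (omap F Y) (amap F f) \<cdot>\<^bsub>Int_smc S\<^esub> ide (Int_smc S) \<one>\<^bsub>Int_smc S\<^esub>)"
      unfolding i using r(2)[OF c, of "ide (Int_smc S) \<one>\<^bsub>Int_smc S\<^esub>"] IS.ide_hom[OF IS.unit_obj] Int_map_wires(3)[OF assms f]
      by (simp add: Int_map_simps Fm)
    also have "\<dots> = amap F f" using IS.comp_ide(2) IS.homD[OF n] by (simp add: nam_def)
    finally show ?thesis .
  qed
qed

lemma Int_map_nam:
  assumes "traced_category S" "s \<in> hom S X Y"
  shows "(fst \<circ> snd) (amap (Int_map S k) (nam S X Y s)) = amap k s"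
proof -
  interpret traced_category S by fact
  show ?thesis using nam_hom[of X Y s] homD(4,5)[OF assms(2)] assms(2) by (simp add: nam_def Int_map_simps hom_iff)
qed

text \<open>The components of \<open>\<theta>\<close> already are maps between hom-sets. Naturality
  at \<open>compose_wires\<close>, \<open>trace_wires\<close> and \<open>nam\<close> makes them
  preserve composition and trace and extend the given functor on \<open>T\<close>; monoidality makes
  them preserve tensor products. Bijectivity on objects ensures that these hom-sets are all those of
  \<open>S\<close>.\<close>

lemma traced_square_unique:
  assumes T: "traced_category T" and S: "traced_category S" and T': "traced_category T'" and S': "traced_category S'"
    and F: "traced_functor T S F" and F': "traced_functor T' S' F'" and G: "traced_functor T T' G"
    and bij: "bij_betw (omap F) (Obj T) (Obj S)"
    and \<theta>: "monoidal_transformation (Int_smc T) (rep_Int T S F) (lax_precomp (Int_smc T) (Int_map T G) (rep_Int T' S' F')) \<theta>"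
  shows "\<exists>!h. traced_functor S S' h \<and> func_comp T h F = func_comp T F' G \<and>
    (\<forall>x\<in>Obj (Int_smc T). \<forall>p\<in>hom (Int_smc S) \<one>\<^bsub>Int_smc S\<^esub> (omap (Int_map T F) x). (fst \<circ> snd) (amap (Int_map S h) p) = \<theta> x ((fst \<circ> snd) p))"
proof -
  interpret T: traced_category T by fact
  interpret S: traced_category S by fact
  interpret T': traced_category T' by fact
  interpret S': traced_category S' by fact
  interpret IT: symmetric_monoidal "Int_smc T" by (rule T.symmetric_monoidal_Int)
  have Fs: "strict_monoidal_functor T S F" "strict_monoidal_functor T' S' F'" "strict_monoidal_functor T T' G"
    using F F' G by (auto simp: traced_functor_def)
  note Ff = strict_functor[OF Fs(1)] and F'f = strict_functor[OF Fs(2)] and Gf = strict_functor[OF Fs(3)]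
  note [simp] = functor_obj[OF Ff] functor_obj[OF F'f] functor_obj[OF Gf] 
    functor_ide[OF Ff] functor_ide[OF F'f] functor_ide[OF Gf]
    strict_functor_simps[OF Fs(1)] strict_functor_simps[OF Fs(2)] strict_functor_simps[OF Fs(3)] Int_cat_simps(1)
  note Ga = functor_hom[OF T.category_axioms Gf] and Fa = functor_hom[OF T.category_axioms Ff]
  let ?R = "rep_Int T S F" and ?R' = "rep_Int T' S' F'"
  let ?K = "\<lambda>X. omap F' (omap G X)"
  note R = rep_Int_simps[OF T S F] and R' = rep_Int_simps[OF T' S' F'] and W = Int_map_wires[OF T T' G]
  have ob: "(Y, X) \<in> Obj (Int_smc T)" if "X \<in> Obj T" "Y \<in> Obj T" for X Y using that by (simp add: Int_cat_simps)
  note nat = monoidal_transformation_natural[OF T.symmetric_monoidal_Int \<theta>]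
  have t_closed: "\<theta> (Y, X) s \<in> hom S' (?K X) (?K Y)" if "X \<in> Obj T" "Y \<in> Obj T" "s \<in> hom S (omap F X) (omap F Y)" for X Y s
    using monoidal_transformation_closed[OF T.symmetric_monoidal_Int \<theta> ob[OF that(1,2)], of s] that
    by (simp add: R ob R' Int_map_simps)
  have t_unit: "\<theta> (\<one>\<^bsub>T\<^esub>, \<one>\<^bsub>T\<^esub>) (ide S \<one>\<^bsub>S\<^esub>) = ide S' \<one>\<^bsub>S'\<^esub>"
    using \<theta> R(2) R'(2) by (simp add: monoidal_transformation_def)
  have t_tarr: "\<theta> (Y \<otimes>\<^bsub>T\<^esub> Y', X \<otimes>\<^bsub>T\<^esub> X') (s \<boxtimes>\<^bsub>S\<^esub> s') = \<theta> (Y, X) s \<boxtimes>\<^bsub>S'\<^esub> \<theta> (Y', X') s'"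
    if *: "X \<in> Obj T" "Y \<in> Obj T" "X' \<in> Obj T" "Y' \<in> Obj T" "s \<in> hom S (omap F X) (omap F Y)" "s' \<in> hom S (omap F X') (omap F Y')" for X Y X' Y' s s'
  proof -
    have "\<theta> ((Y, X) \<otimes>\<^bsub>Int_smc T\<^esub> (Y', X')) (lmult ?R (Y, X) (Y', X') s s') =
        lmult (lax_precomp (Int_smc T) (Int_map T G) ?R') (Y, X) (Y', X') (\<theta> (Y, X) s) (\<theta> (Y', X') s')"
      using \<theta> ob[OF *(1,2)] ob[OF *(3,4)] * unfolding monoidal_transformation_def by (simp add: R)
    then show ?thesis
      using * ob[OF *(1,2)] ob[OF *(3,4)] t_closed[OF *(1,2,5)] t_closed[OF *(3,4,6)] by (simp add: R R' Int_smc_tobj Int_map_simps)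
  qed
  have t_comp: "\<theta> (Z, X) (t \<cdot>\<^bsub>S\<^esub> s) = \<theta> (Z, Y) t \<cdot>\<^bsub>S'\<^esub> \<theta> (Y, X) s"
    if *: "X \<in> Obj T" "Y \<in> Obj T" "Z \<in> Obj T" "s \<in> hom S (omap F X) (omap F Y)" "t \<in> hom S (omap F Y) (omap F Z)" for X Y Z s t
  proof -
    have c: "compose_wires T X Y Z \<in> hom (Int_smc T) (Y \<otimes>\<^bsub>T\<^esub> Z, X \<otimes>\<^bsub>T\<^esub> Y) (Z, X)" using * T.compose_wires_hom by simp
    have st: "s \<boxtimes>\<^bsub>S\<^esub> t \<in> lset ?R (Y \<otimes>\<^bsub>T\<^esub> Z, X \<otimes>\<^bsub>T\<^esub> Y)" using S.tarr_closed[OF *(4,5)] * by (simp add: R)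
    show ?thesis
      using nat[OF c st] * t_closed[OF *(1,2,4)] t_closed[OF *(2,3,5)] IT.homD(1)[OF c]
      by (simp add: R R' t_tarr W)
  qed
  have t_trace: "\<theta> (Y, X) (Tr\<^bsub>S\<^esub> (omap F U) (omap F X) (omap F Y) s) = Tr\<^bsub>S'\<^esub> (?K U) (?K X) (?K Y) (\<theta> (U \<otimes>\<^bsub>T\<^esub> Y, U \<otimes>\<^bsub>T\<^esub> X) s)"
    if *: "U \<in> Obj T" "X \<in> Obj T" "Y \<in> Obj T" "s \<in> hom S (omap F U \<otimes>\<^bsub>S\<^esub> omap F X) (omap F U \<otimes>\<^bsub>S\<^esub> omap F Y)" for U X Y s
  proof -
    have c: "trace_wires T U X Y \<in> hom (Int_smc T) (U \<otimes>\<^bsub>T\<^esub> Y, U \<otimes>\<^bsub>T\<^esub> X) (Y, X)" using * T.trace_wires_hom by simp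
    have s: "s \<in> lset ?R (U \<otimes>\<^bsub>T\<^esub> Y, U \<otimes>\<^bsub>T\<^esub> X)" using * by (simp add: R)
    have "\<theta> (U \<otimes>\<^bsub>T\<^esub> Y, U \<otimes>\<^bsub>T\<^esub> X) s \<in> hom S' (?K U \<otimes>\<^bsub>S'\<^esub> ?K X) (?K U \<otimes>\<^bsub>S'\<^esub> ?K Y)"
      using t_closed[of "U \<otimes>\<^bsub>T\<^esub> X" "U \<otimes>\<^bsub>T\<^esub> Y" s] * by simp
    then show ?thesis
      using nat[OF c s] * IT.homD(1)[OF c] by (simp add: R R' W)
  qed
  have t_fun: "\<theta> (Y, X) (amap F f) = amap F' (amap G f)" if f: "f \<in> hom T X Y" for f X Y
  proof -
    note o = T.homD[OF f]
    have c: "nam T X Y f \<in> hom (Int_smc T) (\<one>\<^bsub>T\<^esub>, \<one>\<^bsub>T\<^esub>) (Y, X)" using f o T.nam_hom by simp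
    have s: "ide S \<one>\<^bsub>S\<^esub> \<in> lset ?R (\<one>\<^bsub>T\<^esub>, \<one>\<^bsub>T\<^esub>)" using S.ide_hom by (simp add: R)
    show ?thesis
      using nat[OF c s] R'(6)[OF Ga[OF f]] IT.homD(1)[OF c] by (simp add: R(6)[OF f] W(3)[OF f] t_unit)
  qed
  \<comment> \<open>Objects of \<open>S\<close> are replaced by their unique preimages in
    \<open>T\<close>, where \<open>\<theta>\<close> is indexed.\<close>
  define \<phi> where "\<phi> = inv_into (Obj T) (omap F)"
  have \<phi>F: "\<phi> (omap F X) = X" if "X \<in> Obj T" for X using bij that by (simp add: \<phi>_def bij_betw_def)
  have F\<phi>: "omap F (\<phi> Y) = Y" "\<phi> Y \<in> Obj T" if "Y \<in> Obj S" for Y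
    using bij that by (auto simp: \<phi>_def bij_betw_def f_inv_into_f inv_into_into)
  \<comment> \<open>On objects the square leaves no choice; on an arrow from \<open>X\<close> to
    \<open>Y\<close> it is the component at the pair of preimages, target first.\<close>
  define h where "h = \<lparr>omap = (\<lambda>Y\<in>Obj S. ?K (\<phi> Y)), amap = (\<lambda>s\<in>Arr S. \<theta> (\<phi> (Cod S s), \<phi> (Dom S s)) s)\<rparr>"
  have ho: "omap h X = ?K (\<phi> X)" if "X \<in> Obj S" for X using that by (simp add: h_def)
  have ha: "amap h s = \<theta> (\<phi> Y, \<phi> X) s" if "s \<in> hom S X Y" for s X Y using that by (simp add: h_def hom_iff)
  have hF: "amap h s = \<theta> (Y, X) s" if "s \<in> hom S (omap F X) (omap F Y)" "X \<in> Obj T" "Y \<in> Obj T" for s X Y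
    using that by (simp add: ha \<phi>F)
  note [simp] = ho F\<phi>
  \<comment> \<open>A strict monoidal functor that is bijective on objects has a strictly monoidal
    inverse on objects.\<close>
  have \<phi>t: "\<phi> (X \<otimes>\<^bsub>S\<^esub> Y) = \<phi> X \<otimes>\<^bsub>T\<^esub> \<phi> Y" "\<phi> \<one>\<^bsub>S\<^esub> = \<one>\<^bsub>T\<^esub>" if "X \<in> Obj S" "Y \<in> Obj S" for X Y
    using \<phi>F[of "\<phi> X \<otimes>\<^bsub>T\<^esub> \<phi> Y"] \<phi>F[of "\<one>\<^bsub>T\<^esub>"] that by auto
  have h_hom: "amap h s \<in> hom S' (omap h X) (omap h Y)" if "s \<in> hom S X Y" for s X Y
    using S.homD[OF that] t_closed[of "\<phi> X" "\<phi> Y" s] that by (simp add: ha)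
  have hf: "is_functor S S' h"
  proof (rule is_functorI[OF S.category_axioms])
    fix X assume X: "X \<in> Obj S"
    then show "amap h (ide S X) = ide S' (omap h X)"
      using t_fun[OF T.ide_hom[of "\<phi> X"]] ha[OF S.ide_hom[OF X]] by simp
  next
    fix X Y Z t s assume t: "t \<in> hom S Y Z" and s: "s \<in> hom S X Y"
    note o = S.homD[OF t] S.homD[OF s]
    show "amap h (t \<cdot>\<^bsub>S\<^esub> s) = amap h t \<cdot>\<^bsub>S'\<^esub> amap h s"
      using ha[OF S.comp_hom[OF t s]] ha[OF t] ha[OF s] t_comp[of "\<phi> X" "\<phi> Y" "\<phi> Z" s t] o t s by simp
  qed (use h_hom in \<open>simp_all add: h_def\<close>)
  have h_tarr: "amap h (s \<boxtimes>\<^bsub>S\<^esub> t) = amap h s \<boxtimes>\<^bsub>S'\<^esub> amap h t" if "s \<in> Arr S" "t \<in> Arr S" for s t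
    using ha[OF S.tarr_closed[OF S.arr_hom[OF that(1)] S.arr_hom[OF that(2)]]] ha[OF S.arr_hom[OF that(1)]] ha[OF S.arr_hom[OF that(2)]]
      t_tarr[of "\<phi> (Dom S s)" "\<phi> (Cod S s)" "\<phi> (Dom S t)" "\<phi> (Cod S t)" s t] that S.arr_hom by (simp add: \<phi>t)
  have h_symm: "amap h (\<sigma>\<^bsub>S\<^esub> X Y) = \<sigma>\<^bsub>S'\<^esub> (omap h X) (omap h Y)" if "X \<in> Obj S" "Y \<in> Obj S" for X Y
    using ha[OF S.symm_hom[OF that]] t_fun[OF T.symm_hom[of "\<phi> X" "\<phi> Y"]] that by (simp add: \<phi>t)
  have h_trace: "amap h (Tr\<^bsub>S\<^esub> U X Y s) = Tr\<^bsub>S'\<^esub> (omap h U) (omap h X) (omap h Y) (amap h s)"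
    if "U \<in> Obj S" "X \<in> Obj S" "Y \<in> Obj S" "s \<in> hom S (U \<otimes>\<^bsub>S\<^esub> X) (U \<otimes>\<^bsub>S\<^esub> Y)" for U X Y s
    using ha[OF S.trace_hom[OF that]] ha[OF that(4)] t_trace[of "\<phi> U" "\<phi> X" "\<phi> Y" s] that by (simp add: \<phi>t)
  have h: "traced_functor S S' h"
    unfolding traced_functor_def strict_monoidal_functor_def
    using hf h_tarr h_symm h_trace by (simp add: \<phi>t[OF S.unit_obj S.unit_obj]) (simp add: \<phi>t)
  have sq: "func_comp T h F = func_comp T F' G"
  proof (rule func_eqI[where A = "Obj T" and B = "Arr T"])
    fix f assume f: "f \<in> Arr T"
    show "amap (func_comp T h F) f = amap (func_comp T F' G) f"
      using hF[OF Fa[OF T.arr_hom[OF f]]] t_fun[OF T.arr_hom[OF f]] f by (simp add: compose_def)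
  qed (simp_all add: compose_def \<phi>F)
  have pE: "\<exists>s. p = nam S (omap F X) (omap F Y) s" if "X \<in> Obj T" "Y \<in> Obj T" "p \<in> hom (Int_smc S) \<one>\<^bsub>Int_smc S\<^esub> (omap (Int_map T F) (Y, X))" for X Y p
    using that by (auto simp: Int_map_simps S.hom_nam)
  show ?thesis
  proof (rule ex1I[of _ h], intro conjI h sq ballI)
    fix x p assume x: "x \<in> Obj (Int_smc T)" and p: "p \<in> hom (Int_smc S) \<one>\<^bsub>Int_smc S\<^esub> (omap (Int_map T F) x)"
    then obtain X Y where xy: "x = (Y, X)" "X \<in> Obj T" "Y \<in> Obj T" by (auto simp: Int_cat_simps)
    obtain s where s: "p = nam S (omap F X) (omap F Y) s" using pE[OF xy(2,3), of p] p unfolding xy(1) by blast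
    show "(fst \<circ> snd) (amap (Int_map S h) p) = \<theta> x ((fst \<circ> snd) p)"
    proof -
      have sh: "s \<in> hom S (omap F X) (omap F Y)"
        using p xy s S.nam_hom[of "omap F X" "omap F Y" s] by (simp add: Int_map_simps)
      show ?thesis
        unfolding Int_map_nam[OF S sh, folded s] hF[OF sh xy(2,3)] xy(1) by (simp add: s nam_def)
    qed
  next
    fix k assume k: "traced_functor S S' k \<and> func_comp T k F = func_comp T F' G \<and>
      (\<forall>x\<in>Obj (Int_smc T). \<forall>p\<in>hom (Int_smc S) \<one>\<^bsub>Int_smc S\<^esub> (omap (Int_map T F) x). (fst \<circ> snd) (amap (Int_map S k) p) = \<theta> x ((fst \<circ> snd) p))"
    then have kf: "is_functor S S' k" by (simp add: traced_functor_def strict_monoidal_functor_def)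
    \<comment> \<open>On objects \<open>k\<close> is fixed by the square because \<open>F\<close> is
      surjective; on arrows it is fixed by \<open>\<theta>\<close> because every arrow has a
      name.\<close>
    show "k = h"
    proof (rule functor_eqI[OF kf hf])
      fix X assume X: "X \<in> Obj S"
      have "omap (func_comp T k F) (\<phi> X) = omap (func_comp T F' G) (\<phi> X)" using k by simp
      then show "omap k X = omap h X" using X by (simp add: compose_def)
    next
      fix s assume s: "s \<in> Arr S"
      let ?X = "\<phi> (Dom S s)" and ?Y = "\<phi> (Cod S s)"
      have o: "?X \<in> Obj T" "?Y \<in> Obj T" using s by auto
      have p: "nam S (omap F ?X) (omap F ?Y) s \<in> hom (Int_smc S) \<one>\<^bsub>Int_smc S\<^esub> (omap (Int_map T F) (?Y, ?X))"
        using s o S.nam_hom[of "omap F ?X" "omap F ?Y" s] by (simp add: Int_map_simps hom_iff)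
      show "amap k s = amap h s"
      proof -
        have sh: "s \<in> hom S (omap F ?X) (omap F ?Y)" using s by (simp add: hom_iff)
        have "amap k s = (fst \<circ> snd) (amap (Int_map S k) (nam S (omap F ?X) (omap F ?Y) s))"
          by (rule Int_map_nam[OF S sh, symmetric])
        also have "\<dots> = \<theta> (?Y, ?X) ((fst \<circ> snd) (nam S (omap F ?X) (omap F ?Y) s))"
          using k ob[OF o] p by blast
        finally show ?thesis using s by (simp add: h_def nam_def)
      qed
    qed
  qed
qed

section \<open>Symmetric monoidal categories on the objects of a given one\<close>

text \<open>
  All categories of the base have the same type of arrows, which the injection \<open>k\<close> makes available for
  the triples of source, arrow and target.
\<close>

locale arrow_family = symmetric_monoidal C for C :: "('o, 'a, 'm) smc_scheme" (structure) +
  fixes k :: "'o \<times> 'h \<times> 'o \<Rightarrow> 'b" and H :: "'o \<Rightarrow> 'o \<Rightarrow> 'h set" and i :: "'o \<Rightarrow> 'h" and c :: "'o \<Rightarrow> 'o \<Rightarrow> 'o \<Rightarrow> 'h \<Rightarrow> 'h \<Rightarrow> 'h"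
    and t :: "'o \<Rightarrow> 'o \<Rightarrow> 'o \<Rightarrow> 'o \<Rightarrow> 'h \<Rightarrow> 'h \<Rightarrow> 'h" and s :: "'o \<Rightarrow> 'o \<Rightarrow> 'h"
  assumes k: "inj k"
    and i_closed: "X \<in> Obj C \<Longrightarrow> i X \<in> H X X"
    and c_closed: "\<lbrakk>X \<in> Obj C; Y \<in> Obj C; Z \<in> Obj C; f \<in> H X Y; g \<in> H Y Z\<rbrakk> \<Longrightarrow> c X Y Z g f \<in> H X Z"
    and c_ide: "\<lbrakk>X \<in> Obj C; Y \<in> Obj C; f \<in> H X Y\<rbrakk> \<Longrightarrow> c X Y Y (i Y) f = f" "\<lbrakk>X \<in> Obj C; Y \<in> Obj C; f \<in> H X Y\<rbrakk> \<Longrightarrow> c X X Y f (i X) = f"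
    and c_assoc: "\<lbrakk>W \<in> Obj C; X \<in> Obj C; Y \<in> Obj C; Z \<in> Obj C; f \<in> H W X; g \<in> H X Y; h \<in> H Y Z\<rbrakk>
        \<Longrightarrow> c W Y Z h (c W X Y g f) = c W X Z (c X Y Z h g) f"
    and t_closed: "\<lbrakk>X \<in> Obj C; Y \<in> Obj C; X' \<in> Obj C; Y' \<in> Obj C; f \<in> H X Y; f' \<in> H X' Y'\<rbrakk> \<Longrightarrow> t X Y X' Y' f f' \<in> H (X \<otimes> X') (Y \<otimes> Y')"
    and t_ide: "\<lbrakk>X \<in> Obj C; Y \<in> Obj C\<rbrakk> \<Longrightarrow> t X X Y Y (i X) (i Y) = i (X \<otimes> Y)"
    and t_comp: "\<lbrakk>X \<in> Obj C; Y \<in> Obj C; Z \<in> Obj C; X' \<in> Obj C; Y' \<in> Obj C; Z' \<in> Obj C; f \<in> H X Y; g \<in> H Y Z; f' \<in> H X' Y'; g' \<in> H Y' Z'\<rbrakk>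
        \<Longrightarrow> t X Z X' Z' (c X Y Z g f) (c X' Y' Z' g' f') = c (X \<otimes> X') (Y \<otimes> Y') (Z \<otimes> Z') (t Y Z Y' Z' g g') (t X Y X' Y' f f')"
    and t_assoc: "\<lbrakk>X \<in> Obj C; Y \<in> Obj C; X' \<in> Obj C; Y' \<in> Obj C; X'' \<in> Obj C; Y'' \<in> Obj C; f \<in> H X Y; g \<in> H X' Y'; h \<in> H X'' Y''\<rbrakk>
        \<Longrightarrow> t (X \<otimes> X') (Y \<otimes> Y') X'' Y'' (t X Y X' Y' f g) h = t X Y (X' \<otimes> X'') (Y' \<otimes> Y'') f (t X' Y' X'' Y'' g h)"
    and t_unit: "\<lbrakk>X \<in> Obj C; Y \<in> Obj C; f \<in> H X Y\<rbrakk> \<Longrightarrow> t \<one> \<one> X Y (i \<one>) f = f" "\<lbrakk>X \<in> Obj C; Y \<in> Obj C; f \<in> H X Y\<rbrakk> \<Longrightarrow> t X Y \<one> \<one> f (i \<one>) = f"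
    and s_closed: "\<lbrakk>X \<in> Obj C; Y \<in> Obj C\<rbrakk> \<Longrightarrow> s X Y \<in> H (X \<otimes> Y) (Y \<otimes> X)"
    and s_natural: "\<lbrakk>X \<in> Obj C; Y \<in> Obj C; X' \<in> Obj C; Y' \<in> Obj C; f \<in> H X X'; g \<in> H Y Y'\<rbrakk>
        \<Longrightarrow> c (X \<otimes> Y) (X' \<otimes> Y') (Y' \<otimes> X') (s X' Y') (t X X' Y Y' f g) = c (X \<otimes> Y) (Y \<otimes> X) (Y' \<otimes> X') (t Y Y' X X' g f) (s X Y)"
    and s_involutive: "\<lbrakk>X \<in> Obj C; Y \<in> Obj C\<rbrakk> \<Longrightarrow> c (X \<otimes> Y) (Y \<otimes> X) (X \<otimes> Y) (s Y X) (s X Y) = i (X \<otimes> Y)"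
    and s_hexagon: "\<lbrakk>X \<in> Obj C; Y \<in> Obj C; Z \<in> Obj C\<rbrakk>
        \<Longrightarrow> s X (Y \<otimes> Z) = c (X \<otimes> Y \<otimes> Z) (Y \<otimes> X \<otimes> Z) (Y \<otimes> Z \<otimes> X) (t Y Y (X \<otimes> Z) (Z \<otimes> X) (i Y) (s X Z)) (t (X \<otimes> Y) (Y \<otimes> X) Z Z (s X Y) (i Z))"
begin

definition "arrows = {k (X, f, Y) | X f Y. X \<in> Obj C \<and> Y \<in> Obj C \<and> f \<in> H X Y}"

abbreviation "dec \<equiv> inv k"

text \<open>Objects, unit and tensor of objects are taken over from \<open>C\<close>, so that the
  functor from \<open>C\<close> can be the identity on objects.\<close>

definition D :: "('o, 'b) smc" where
  "D = \<lparr> Obj = Obj C, Arr = arrows, Dom = (\<lambda>u\<in>arrows. fst (dec u)), Cod = (\<lambda>u\<in>arrows. snd (snd (dec u))),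
    ide = (\<lambda>X\<in>Obj C. k (X, i X, X)),
    Comp = (\<lambda>u\<in>arrows. \<lambda>v\<in>{v \<in> arrows. snd (snd (dec v)) = fst (dec u)}.
      (case (dec u, dec v) of ((Y, g, Z), (X, f, _)) \<Rightarrow> k (X, c X Y Z g f, Z))),
    unit_obj = \<one>, tobj = tobj C,
    tarr = (\<lambda>u\<in>arrows. \<lambda>v\<in>arrows. (case (dec u, dec v) of ((X, f, Y), (X', f', Y')) \<Rightarrow> k (X \<otimes> X', t X Y X' Y' f f', Y \<otimes> Y'))),
    symm = (\<lambda>X\<in>Obj C. \<lambda>Y\<in>Obj C. k (X \<otimes> Y, s X Y, Y \<otimes> X)) \<rparr>"

lemma dec [simp]: "dec (k u) = u" using k by simp

lemma k_eq [simp]: "k u = k v \<longleftrightarrow> u = v" using k by (auto dest: injD)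

lemma k_arrows [simp]: "k (X, f, Y) \<in> arrows \<longleftrightarrow> X \<in> Obj C \<and> Y \<in> Obj C \<and> f \<in> H X Y"
  by (auto simp: arrows_def)

lemma arrowsE: "u \<in> arrows \<Longrightarrow> (\<And>X f Y. \<lbrakk>u = k (X, f, Y); X \<in> Obj C; Y \<in> Obj C; f \<in> H X Y\<rbrakk> \<Longrightarrow> thesis) \<Longrightarrow> thesis"
  by (auto simp: arrows_def)

lemma D_simps [simp]:
  "Obj D = Obj C" "Arr D = arrows" "unit_obj D = \<one>" "tobj D = tobj C"
  "\<lbrakk>X \<in> Obj C; Y \<in> Obj C; f \<in> H X Y\<rbrakk> \<Longrightarrow> Dom D (k (X, f, Y)) = X"
  "\<lbrakk>X \<in> Obj C; Y \<in> Obj C; f \<in> H X Y\<rbrakk> \<Longrightarrow> Cod D (k (X, f, Y)) = Y"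
  "X \<in> Obj C \<Longrightarrow> ide D X = k (X, i X, X)"
  "\<lbrakk>X \<in> Obj C; Y \<in> Obj C; Z \<in> Obj C; f \<in> H X Y; g \<in> H Y Z\<rbrakk> \<Longrightarrow> Comp D (k (Y, g, Z)) (k (X, f, Y)) = k (X, c X Y Z g f, Z)"
  "\<lbrakk>X \<in> Obj C; Y \<in> Obj C; X' \<in> Obj C; Y' \<in> Obj C; f \<in> H X Y; f' \<in> H X' Y'\<rbrakk> \<Longrightarrow>
    tarr D (k (X, f, Y)) (k (X', f', Y')) = k (X \<otimes> X', t X Y X' Y' f f', Y \<otimes> Y')"
  "\<lbrakk>X \<in> Obj C; Y \<in> Obj C\<rbrakk> \<Longrightarrow> symm D X Y = k (X \<otimes> Y, s X Y, Y \<otimes> X)"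
  by (simp_all add: D_def)

lemma hom_D: "u \<in> hom D X Y \<longleftrightarrow> (\<exists>f. u = k (X, f, Y) \<and> X \<in> Obj C \<and> Y \<in> Obj C \<and> f \<in> H X Y)"
  by (auto simp: hom_iff elim!: arrowsE)

theorem symmetric_monoidal_D: "symmetric_monoidal D"
proof
  show "Dom D \<in> Arr D \<rightarrow>\<^sub>E Obj D" "Cod D \<in> Arr D \<rightarrow>\<^sub>E Obj D"
    by (auto simp: PiE_iff elim!: arrowsE) (auto simp: D_def)
  show "ide D \<in> (\<Pi>\<^sub>E X\<in>Obj D. hom D X X)"
    by (auto simp: PiE_iff hom_D i_closed) (auto simp: D_def)
  show "Comp D \<in> (\<Pi>\<^sub>E g\<in>Arr D. \<Pi>\<^sub>E f\<in>{f \<in> Arr D. Cod D f = Dom D g}. hom D (Dom D f) (Cod D g))"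
  proof (intro PiE_I)
    fix u v assume "u \<in> Arr D" "v \<in> {f \<in> Arr D. Cod D f = Dom D u}"
    then show "Comp D u v \<in> hom D (Dom D v) (Cod D u)"
      by (auto simp: hom_D c_closed elim!: arrowsE)
  next
    fix u v assume u: "u \<in> Arr D" "v \<notin> {f \<in> Arr D. Cod D f = Dom D u}"
    then have "v \<notin> {v \<in> arrows. snd (snd (dec v)) = fst (dec u)}" by (auto elim!: arrowsE)
    then show "Comp D u v = undefined" using u by (simp only: D_def cat.simps smc.simps) auto
  next
    fix u assume "u \<notin> Arr D" then show "Comp D u = undefined" by (simp add: D_def)
  qed
  show "tobj D \<in> Obj D \<rightarrow>\<^sub>E Obj D \<rightarrow>\<^sub>E Obj D" using tobj_closed by simp
  show "tarr D \<in> Arr D \<rightarrow>\<^sub>E Arr D \<rightarrow>\<^sub>E Arr D"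
    by (auto simp: PiE_iff t_closed elim!: arrowsE) (auto simp: D_def)
  show "symm D \<in> (\<Pi>\<^sub>E X\<in>Obj D. \<Pi>\<^sub>E Y\<in>Obj D. hom D (X \<otimes>\<^bsub>D\<^esub> Y) (Y \<otimes>\<^bsub>D\<^esub> X))"
    by (auto simp: PiE_iff hom_D s_closed) (auto simp: D_def extensional_def)
  fix X Y Z assume "X \<in> Obj D" "Y \<in> Obj D" "Z \<in> Obj D"
  then have o: "X \<in> Obj C" "Y \<in> Obj C" "Z \<in> Obj C" by simp_all
  have "t (X \<otimes> Y) (Y \<otimes> X) Z Z (s X Y) (i Z) \<in> H (X \<otimes> Y \<otimes> Z) (Y \<otimes> X \<otimes> Z)"
    using t_closed[of "X \<otimes> Y" "Y \<otimes> X" Z Z "s X Y" "i Z"] o by (simp add: s_closed i_closed)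
  then show "symm D X (Y \<otimes>\<^bsub>D\<^esub> Z) = (ide D Y \<boxtimes>\<^bsub>D\<^esub> symm D X Z) \<cdot>\<^bsub>D\<^esub> (symm D X Y \<boxtimes>\<^bsub>D\<^esub> ide D Z)"
    using o s_hexagon[OF o] by (simp add: s_closed i_closed t_closed)
qed (auto simp: hom_D i_closed c_closed c_ide c_assoc t_closed t_ide t_comp t_assoc t_unit s_closed s_natural s_involutive elim!: arrowsE)

end

section \<open>Elements of lax monoidal functors on Int\<close>

text \<open>
  By naturality of the lax structure, every element term is the action of a single arrow of \<open>Int\<close>, its
  \<open>wire\<close>, on the tensor product of the variables. So equations of elements follow from equations in \<open>Int\<close>.
\<close>

datatype ptrm = PV nat iobj | PU | PM ptrm ptrm | PA itrm ptrm

definition iapp :: "iobj \<Rightarrow> iobj \<Rightarrow> iobj" where "iapp X Y = (fst X @ fst Y, snd X @ snd Y)"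

primrec pty :: "ptrm \<Rightarrow> iobj" where
  "pty (PV v X) = X" | "pty PU = ([], [])" | "pty (PM p q) = iapp (pty p) (pty q)" | "pty (PA w p) = snd (snd w)"

primrec pwt :: "ptrm \<Rightarrow> bool" where
  "pwt (PV v X) = True" | "pwt PU = True" | "pwt (PM p q) = (pwt p \<and> pwt q)" | "pwt (PA w p) = (iwt w \<and> fst w = pty p \<and> pwt p)"

primrec pvars :: "ptrm \<Rightarrow> (nat \<times> iobj) list" where
  "pvars (PV v X) = [(v, X)]" | "pvars PU = []" | "pvars (PM p q) = pvars p @ pvars q" | "pvars (PA w p) = pvars p"

primrec pboxes :: "ptrm \<Rightarrow> (nat \<times> nat list \<times> nat list) list" where
  "pboxes (PV v X) = []" | "pboxes PU = []" | "pboxes (PM p q) = pboxes p @ pboxes q" | "pboxes (PA w p) = iboxes w @ pboxes p"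

primrec wire :: "ptrm \<Rightarrow> itrm" where
  "wire (PV v X) = iId X" | "wire PU = iId ([], [])" | "wire (PM p q) = iTs (wire p) (wire q)" | "wire (PA w p) = iCp w (wire p)"

text \<open>The variables must occur in the same order on both sides. Where they do not, an exchange
  is first inserted by hand as the action of a symmetry, by the symmetry axiom of the lax
  functor.\<close>

definition same_pdiagram :: "ptrm \<Rightarrow> ptrm \<Rightarrow> bool" where
  "same_pdiagram p q \<longleftrightarrow> pwt p \<and> pwt q \<and> pvars p = pvars q \<and> same_idiagram (wire p) (wire q)"

primrec tys :: "(nat \<times> iobj) list \<Rightarrow> iobj" where
  "tys [] = ([], [])" | "tys (v # vs) = iapp (snd v) (tys vs)"

lemma iapp_simps [simp]: "iapp ([], []) X = X" "iapp X ([], []) = X" "iapp (iapp X Y) Z = iapp X (iapp Y Z)"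
  by (simp_all add: iapp_def)

lemma tys_append [simp]: "tys (vs @ ws) = iapp (tys vs) (tys ws)"
  by (induction vs) auto

lemma wire_props:
  assumes "pwt p" shows "iwt (wire p)" "fst (wire p) = tys (pvars p)" "snd (snd (wire p)) = pty p"
  using assms by (induction p) (auto simp: iapp_def)

fun wire_comp :: "nat list \<Rightarrow> nat list \<Rightarrow> nat list \<Rightarrow> itrm" where
  "wire_comp x y z = ((y @ z, x @ y), Sy (y @ z) x, (z, x))"

fun wire_trace :: "nat list \<Rightarrow> nat list \<Rightarrow> nat list \<Rightarrow> itrm" where
  "wire_trace u x y = ((u @ y, u @ x), Ts (Id u) (Sy y x), (y, x))"

fun wire_nam :: "nat list \<Rightarrow> nat list \<Rightarrow> trm \<Rightarrow> itrm" where
  "wire_nam x y t = (([], []), t, (y, x))"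

locale lax_terms = interpretation_of_terms C ob bv + P: lax_functor "Int_smc C" P
  for C :: "('o, 'a, 'm) tracedcat_scheme" (structure) and ob bv and P :: "('o \<times> 'o, ('o \<times> 'o) \<times> 'a \<times> ('o \<times> 'o), 's) lax" +
  fixes pv :: "nat \<Rightarrow> 's"
begin

definition IO :: "iobj \<Rightarrow> 'o \<times> 'o" where "IO X = (TT (fst X), TT (snd X))"

lemma IO_simps [simp]: "IO (x, x') = (TT x, TT x')" by (simp add: IO_def)

lemma IO_obj: "IO X \<in> Obj (Int_smc C)" by (simp add: IO_def Int_cat_simps)

lemma IO_iapp: "IO (iapp X Y) = IO X \<otimes>\<^bsub>Int_smc C\<^esub> IO Y" by (simp add: IO_def iapp_def Int_smc_tobj)

primrec pev :: "ptrm \<Rightarrow> 's" where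
  "pev (PV v X) = pv v" | "pev PU = lunit P" | "pev (PM p q) = lmult P (IO (pty p)) (IO (pty q)) (pev p) (pev q)" | "pev (PA w p) = lact P (iev w) (pev p)"

definition "vtyped vs \<longleftrightarrow> list_all (\<lambda>(v, X). pv v \<in> lset P (IO X)) vs"

lemma vtyped_Cons: "vtyped (v # vs) \<longleftrightarrow> pv (fst v) \<in> lset P (IO (snd v)) \<and> vtyped vs"
  by (simp add: vtyped_def split_beta)

lemma vtyped_simps [simp]: "vtyped []" "vtyped ((v, X) # vs) \<longleftrightarrow> pv v \<in> lset P (IO X) \<and> vtyped vs" "vtyped (vs @ ws) \<longleftrightarrow> vtyped vs \<and> vtyped ws"
  by (auto simp: vtyped_def)

primrec tensor_vars :: "(nat \<times> iobj) list \<Rightarrow> 's" where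
  "tensor_vars [] = lunit P" | "tensor_vars (v # vs) = lmult P (IO (snd v)) (IO (tys vs)) (pv (fst v)) (tensor_vars vs)"

lemma tensor_vars_closed: "vtyped vs \<Longrightarrow> tensor_vars vs \<in> lset P (IO (tys vs))"
proof (induction vs)
  case Nil then show ?case using P.lunit_closed by simp
next
  case (Cons v vs)
  then show ?case
    using P.lmult_closed[OF IO_obj[of "snd v"] IO_obj[of "tys vs"], of "pv (fst v)" "tensor_vars vs"] by (simp add: IO_iapp vtyped_Cons)
qed

lemma tensor_vars_append: "\<lbrakk>vtyped vs; vtyped ws\<rbrakk> \<Longrightarrow> tensor_vars (vs @ ws) = lmult P (IO (tys vs)) (IO (tys ws)) (tensor_vars vs) (tensor_vars ws)"
proof (induction vs)
  case Nil then show ?case using P.lmult_unit(1)[OF IO_obj tensor_vars_closed, of ws] by simp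
next
  case (Cons v vs)
  then show ?case
    using P.lmult_assoc[OF IO_obj IO_obj IO_obj _ tensor_vars_closed tensor_vars_closed, of "pv (fst v)" "snd v" vs ws] by (simp add: IO_iapp vtyped_Cons)
qed

lemma iev_hom': "iwt d \<Longrightarrow> btyped (iboxes d) \<Longrightarrow> iev d \<in> hom (Int_smc C) (IO (fst d)) (IO (snd (snd d)))"
  by (cases d rule: iev.cases) (use iev_hom in auto)

text \<open>A variable is the identity acting on itself. A product of two actions is one action by
  naturality of \<open>lmult\<close>, with associativity merging the tensor products of variables;
  an action on an action is one action by functoriality.\<close>

lemma pev_wire:
  assumes "pwt p" "vtyped (pvars p)" "btyped (pboxes p)"
  shows "btyped (iboxes (wire p))" "pev p = lact P (iev (wire p)) (tensor_vars (pvars p))" "pev p \<in> lset P (IO (pty p))"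
proof -
  have "btyped (iboxes (wire p)) \<and> pev p = lact P (iev (wire p)) (tensor_vars (pvars p)) \<and> pev p \<in> lset P (IO (pty p))"
    using assms
  proof (induction p)
    case (PV v X)
    have "iev (iId X) = ide (Int_smc C) (IO X)" by (cases X) (simp add: iev_iId)
    then show ?case using PV P.act_ide[OF IO_obj, of "pv v" X] P.lmult_unit(2)[OF IO_obj, of "pv v" X] by simp
  next
    case PU
    have "iev (iId ([], [])) = ide (Int_smc C) (\<one>, \<one>)" by (simp add: iev_iId)
    then show ?case using PU P.act_ide[OF P.unit_obj P.lunit_closed] P.lunit_closed by simp
  next
    case (PM p q)
    note w = wire_props[of p] wire_props[of q]
    have h: "iev (wire p) \<in> hom (Int_smc C) (IO (tys (pvars p))) (IO (pty p))" "iev (wire q) \<in> hom (Int_smc C) (IO (tys (pvars q))) (IO (pty q))"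
      using PM iev_hom'[of "wire p"] iev_hom'[of "wire q"] w by simp_all
    have A: "btyped (iboxes (wire p)) \<and> pev p = lact P (iev (wire p)) (tensor_vars (pvars p)) \<and> pev p \<in> lset P (IO (pty p))"
      by (rule PM.IH(1)) (use PM.prems in simp_all)
    have B: "btyped (iboxes (wire q)) \<and> pev q = lact P (iev (wire q)) (tensor_vars (pvars q)) \<and> pev q \<in> lset P (IO (pty q))"
      by (rule PM.IH(2)) (use PM.prems in simp_all)
    note ih = conjunct1[OF A] conjunct1[OF conjunct2[OF A]] conjunct2[OF conjunct2[OF A]]
      conjunct1[OF B] conjunct1[OF conjunct2[OF B]] conjunct2[OF conjunct2[OF B]]
    have "pev (PM p q) = lmult P (IO (pty p)) (IO (pty q)) (lact P (iev (wire p)) (tensor_vars (pvars p))) (lact P (iev (wire q)) (tensor_vars (pvars q)))"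
      by (simp only: pev.simps ih(2)[symmetric] ih(5)[symmetric])
    also have "\<dots> = lact P (iev (wire p) \<boxtimes>\<^bsub>Int_smc C\<^esub> iev (wire q)) (tensor_vars (pvars p @ pvars q))"
      using PM.prems P.lmult_natural[OF h tensor_vars_closed tensor_vars_closed] by (simp add: tensor_vars_append)
    finally have "pev (PM p q) = lact P (iev (wire (PM p q))) (tensor_vars (pvars (PM p q)))"
      using ih PM.prems w by (simp add: iev_iTs)
    moreover have "pev (PM p q) \<in> lset P (IO (pty (PM p q)))"
      using P.lmult_closed[OF IO_obj IO_obj ih(3,6)] by (simp add: IO_iapp)
    moreover have "btyped (iboxes (wire (PM p q)))" using ih by simp
    ultimately show ?case by blast
  next
    case (PA u p)
    note w = wire_props[of p]
    have h: "iev (wire p) \<in> hom (Int_smc C) (IO (tys (pvars p))) (IO (pty p))" "iev u \<in> hom (Int_smc C) (IO (pty p)) (IO (pty (PA u p)))"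
      using PA iev_hom'[of "wire p"] iev_hom'[of u] w by simp_all
    have A: "btyped (iboxes (wire p)) \<and> pev p = lact P (iev (wire p)) (tensor_vars (pvars p)) \<and> pev p \<in> lset P (IO (pty p))"
      by (rule PA.IH) (use PA.prems in simp_all)
    note ih = conjunct1[OF A] conjunct1[OF conjunct2[OF A]] conjunct2[OF conjunct2[OF A]]
    have "pev (PA u p) = lact P (iev u) (lact P (iev (wire p)) (tensor_vars (pvars p)))"
      by (simp only: pev.simps ih(2)[symmetric])
    also have "\<dots> = lact P (iev u \<cdot>\<^bsub>Int_smc C\<^esub> iev (wire p)) (tensor_vars (pvars p))"
      using PA.prems P.act_comp[OF h(2,1) tensor_vars_closed] by simp
    finally have "pev (PA u p) = lact P (iev (wire (PA u p))) (tensor_vars (pvars (PA u p)))"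
      using ih PA.prems w by (simp add: iev_iCp)
    moreover have "pev (PA u p) \<in> lset P (IO (pty (PA u p)))"
      using P.act_closed[OF h(2) ih(3)] by simp
    moreover have "btyped (iboxes (wire (PA u p)))" using ih PA.prems by simp
    ultimately show ?case by blast
  qed
  then show "btyped (iboxes (wire p))" "pev p = lact P (iev (wire p)) (tensor_vars (pvars p))" "pev p \<in> lset P (IO (pty p))" by auto
qed

theorem same_pdiagram_pev:
  assumes "same_pdiagram p q" "vtyped (pvars p)" "vtyped (pvars q)" "btyped (pboxes p)" "btyped (pboxes q)"
  shows "pev p = pev q"
  using assms pev_wire[of p] pev_wire[of q] same_idiagram_iev[of "wire p" "wire q"] by (auto simp: same_pdiagram_def)

end

section \<open>Traced structures on arrow families\<close>

text \<open>The trace axioms, stated on the untagged hom-sets.\<close>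

locale traced_family = arrow_family C k H i c t s for C :: "('o, 'a, 'm) smc_scheme" (structure) and k :: "'o \<times> 'h \<times> 'o \<Rightarrow> 'b" and H i c t s +
  fixes \<tau> :: "'o \<Rightarrow> 'o \<Rightarrow> 'o \<Rightarrow> 'h \<Rightarrow> 'h"
  assumes \<tau>_closed: "\<lbrakk>U \<in> Obj C; X \<in> Obj C; Y \<in> Obj C; f \<in> H (U \<otimes> X) (U \<otimes> Y)\<rbrakk> \<Longrightarrow> \<tau> U X Y f \<in> H X Y"
    and \<tau>_dom: "\<lbrakk>U \<in> Obj C; X \<in> Obj C; Y \<in> Obj C; X' \<in> Obj C; f \<in> H (U \<otimes> X) (U \<otimes> Y); g \<in> H X' X\<rbrakk>
      \<Longrightarrow> \<tau> U X' Y (c (U \<otimes> X') (U \<otimes> X) (U \<otimes> Y) f (t U U X' X (i U) g)) = c X' X Y (\<tau> U X Y f) g"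
    and \<tau>_cod: "\<lbrakk>U \<in> Obj C; X \<in> Obj C; Y \<in> Obj C; Y' \<in> Obj C; f \<in> H (U \<otimes> X) (U \<otimes> Y); h \<in> H Y Y'\<rbrakk>
      \<Longrightarrow> \<tau> U X Y' (c (U \<otimes> X) (U \<otimes> Y) (U \<otimes> Y') (t U U Y Y' (i U) h) f) = c X Y Y' h (\<tau> U X Y f)"
    and \<tau>_dinatural: "\<lbrakk>U \<in> Obj C; V \<in> Obj C; X \<in> Obj C; Y \<in> Obj C; f \<in> H (U \<otimes> X) (V \<otimes> Y); g \<in> H V U\<rbrakk>
      \<Longrightarrow> \<tau> U X Y (c (U \<otimes> X) (V \<otimes> Y) (U \<otimes> Y) (t V U Y Y g (i Y)) f) = \<tau> V X Y (c (V \<otimes> X) (U \<otimes> X) (V \<otimes> Y) f (t V U X X g (i X)))"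
    and \<tau>_unit: "\<lbrakk>X \<in> Obj C; Y \<in> Obj C; f \<in> H X Y\<rbrakk> \<Longrightarrow> \<tau> \<one> X Y f = f"
    and \<tau>_tensor: "\<lbrakk>U \<in> Obj C; V \<in> Obj C; X \<in> Obj C; Y \<in> Obj C; f \<in> H (U \<otimes> V \<otimes> X) (U \<otimes> V \<otimes> Y)\<rbrakk>
      \<Longrightarrow> \<tau> (U \<otimes> V) X Y f = \<tau> V X Y (\<tau> U (V \<otimes> X) (V \<otimes> Y) f)"
    and \<tau>_superposing: "\<lbrakk>U \<in> Obj C; X \<in> Obj C; Y \<in> Obj C; X' \<in> Obj C; Y' \<in> Obj C; f \<in> H (U \<otimes> X) (U \<otimes> Y); g \<in> H X' Y'\<rbrakk>
      \<Longrightarrow> \<tau> U (X \<otimes> X') (Y \<otimes> Y') (t (U \<otimes> X) (U \<otimes> Y) X' Y' f g) = t X Y X' Y' (\<tau> U X Y f) g"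
    and \<tau>_yanking: "U \<in> Obj C \<Longrightarrow> \<tau> U U U (s U U) = i U"
begin

definition DT :: "('o, 'b) tracedcat" where
  "DT = smc.extend D (tracedcat.fields (\<lambda>U\<in>Obj C. \<lambda>X\<in>Obj C. \<lambda>Y\<in>Obj C. \<lambda>u\<in>hom D (U \<otimes> X) (U \<otimes> Y). k (X, \<tau> U X Y (fst (snd (dec u))), Y)))"

lemma DT_simps [simp]:
  "Obj DT = Obj D" "Arr DT = Arr D" "Dom DT = Dom D" "Cod DT = Cod D" "ide DT = ide D" "Comp DT = Comp D"
  "unit_obj DT = unit_obj D" "tobj DT = tobj D" "tarr DT = tarr D" "symm DT = symm D" "hom DT = hom D"
  by (simp_all add: DT_def smc.defs tracedcat.defs hom_def fun_eq_iff)

lemma trace_DT: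
  "\<lbrakk>U \<in> Obj C; X \<in> Obj C; Y \<in> Obj C; f \<in> H (U \<otimes> X) (U \<otimes> Y)\<rbrakk> \<Longrightarrow> trace DT U X Y (k (U \<otimes> X, f, U \<otimes> Y)) = k (X, \<tau> U X Y f, Y)"
  by (simp add: DT_def smc.defs tracedcat.defs hom_D)

theorem traced_category_DT: "traced_category DT"
proof -
  have m: "symmetric_monoidal DT"
    using symmetric_monoidal_D unfolding symmetric_monoidal_def symmetric_monoidal_axioms_def category_def by simp
  have ext: "trace DT \<in> (\<Pi>\<^sub>E U\<in>Obj C. \<Pi>\<^sub>E X\<in>Obj C. \<Pi>\<^sub>E Y\<in>Obj C. hom D (U \<otimes> X) (U \<otimes> Y) \<rightarrow>\<^sub>E hom D X Y)"
    by (auto simp: PiE_iff hom_D trace_DT \<tau>_closed) (auto simp: DT_def smc.defs tracedcat.defs extensional_def hom_D)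
  show ?thesis
  proof (rule traced_category.intro[OF m], unfold traced_category_axioms_def DT_simps, intro conjI allI impI)
    show "trace DT \<in> (\<Pi>\<^sub>E U\<in>Obj D. \<Pi>\<^sub>E X\<in>Obj D. \<Pi>\<^sub>E Y\<in>Obj D. hom D (U \<otimes>\<^bsub>D\<^esub> X) (U \<otimes>\<^bsub>D\<^esub> Y) \<rightarrow>\<^sub>E hom D X Y)"
      using ext by simp
  next
    fix U X Y u v X' assume "U \<in> Obj D" "X \<in> Obj D" "Y \<in> Obj D" "u \<in> hom D (U \<otimes>\<^bsub>D\<^esub> X) (U \<otimes>\<^bsub>D\<^esub> Y)" "v \<in> hom D X' X"
    then obtain f g where a: "U \<in> Obj C" "X \<in> Obj C" "Y \<in> Obj C" "X' \<in> Obj C" "u = k (U \<otimes> X, f, U \<otimes> Y)" "f \<in> H (U \<otimes> X) (U \<otimes> Y)" "v = k (X', g, X)" "g \<in> H X' X"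
      by (auto simp: hom_D)
    then show "trace DT U X' Y (u \<cdot>\<^bsub>D\<^esub> (ide D U \<boxtimes>\<^bsub>D\<^esub> v)) = trace DT U X Y u \<cdot>\<^bsub>D\<^esub> v"
      using \<tau>_dom[of U X Y X' f g] by (simp add: trace_DT \<tau>_closed i_closed t_closed c_closed)
  next
    fix U X Y u v Y' assume "U \<in> Obj D" "X \<in> Obj D" "Y \<in> Obj D" "u \<in> hom D (U \<otimes>\<^bsub>D\<^esub> X) (U \<otimes>\<^bsub>D\<^esub> Y)" "v \<in> hom D Y Y'"
    then obtain f g where a: "U \<in> Obj C" "X \<in> Obj C" "Y \<in> Obj C" "Y' \<in> Obj C" "u = k (U \<otimes> X, f, U \<otimes> Y)" "f \<in> H (U \<otimes> X) (U \<otimes> Y)" "v = k (Y, g, Y')" "g \<in> H Y Y'"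
      by (auto simp: hom_D)
    then show "trace DT U X Y' ((ide D U \<boxtimes>\<^bsub>D\<^esub> v) \<cdot>\<^bsub>D\<^esub> u) = v \<cdot>\<^bsub>D\<^esub> trace DT U X Y u"
      using \<tau>_cod[of U X Y Y' f g] by (simp add: trace_DT \<tau>_closed i_closed t_closed c_closed)
  next
    fix U V X Y u v assume "U \<in> Obj D" "V \<in> Obj D" "X \<in> Obj D" "Y \<in> Obj D" "u \<in> hom D (U \<otimes>\<^bsub>D\<^esub> X) (V \<otimes>\<^bsub>D\<^esub> Y)" "v \<in> hom D V U"
    then obtain f g where a: "U \<in> Obj C" "V \<in> Obj C" "X \<in> Obj C" "Y \<in> Obj C" "u = k (U \<otimes> X, f, V \<otimes> Y)" "f \<in> H (U \<otimes> X) (V \<otimes> Y)" "v = k (V, g, U)" "g \<in> H V U"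
      by (auto simp: hom_D)
    then show "trace DT U X Y ((v \<boxtimes>\<^bsub>D\<^esub> ide D Y) \<cdot>\<^bsub>D\<^esub> u) = trace DT V X Y (u \<cdot>\<^bsub>D\<^esub> (v \<boxtimes>\<^bsub>D\<^esub> ide D X))"
      using \<tau>_dinatural[of U V X Y f g] by (simp add: trace_DT i_closed t_closed c_closed)
  next
    fix X Y u assume "X \<in> Obj D" "Y \<in> Obj D" "u \<in> hom D X Y"
    then obtain f where "X \<in> Obj C" "Y \<in> Obj C" "u = k (X, f, Y)" "f \<in> H X Y" by (auto simp: hom_D)
    then show "trace DT \<one>\<^bsub>D\<^esub> X Y u = u" using trace_DT[of \<one> X Y f] by (simp add: \<tau>_unit)
  next
    fix U V X Y u assume "U \<in> Obj D" "V \<in> Obj D" "X \<in> Obj D" "Y \<in> Obj D" "u \<in> hom D (U \<otimes>\<^bsub>D\<^esub> V \<otimes>\<^bsub>D\<^esub> X) (U \<otimes>\<^bsub>D\<^esub> V \<otimes>\<^bsub>D\<^esub> Y)"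
    then obtain f where a: "U \<in> Obj C" "V \<in> Obj C" "X \<in> Obj C" "Y \<in> Obj C" "u = k (U \<otimes> V \<otimes> X, f, U \<otimes> V \<otimes> Y)" "f \<in> H (U \<otimes> V \<otimes> X) (U \<otimes> V \<otimes> Y)"
      by (auto simp: hom_D)
    then show "trace DT (U \<otimes>\<^bsub>D\<^esub> V) X Y u = trace DT V X Y (trace DT U (V \<otimes>\<^bsub>D\<^esub> X) (V \<otimes>\<^bsub>D\<^esub> Y) u)"
      using trace_DT[of "U \<otimes> V" X Y f] \<tau>_tensor[OF a(1-4,6)] by (simp add: trace_DT \<tau>_closed)
  next
    fix U X Y u v X' Y' assume "U \<in> Obj D" "X \<in> Obj D" "Y \<in> Obj D" "u \<in> hom D (U \<otimes>\<^bsub>D\<^esub> X) (U \<otimes>\<^bsub>D\<^esub> Y)" "v \<in> hom D X' Y'"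
    then obtain f g where a: "U \<in> Obj C" "X \<in> Obj C" "Y \<in> Obj C" "X' \<in> Obj C" "Y' \<in> Obj C" "u = k (U \<otimes> X, f, U \<otimes> Y)" "f \<in> H (U \<otimes> X) (U \<otimes> Y)" "v = k (X', g, Y')" "g \<in> H X' Y'"
      by (auto simp: hom_D)
    have "t (U \<otimes> X) (U \<otimes> Y) X' Y' f g \<in> H (U \<otimes> X \<otimes> X') (U \<otimes> Y \<otimes> Y')"
      using t_closed[of "U \<otimes> X" "U \<otimes> Y" X' Y' f g] a by simp
    then show "trace DT U (X \<otimes>\<^bsub>D\<^esub> X') (Y \<otimes>\<^bsub>D\<^esub> Y') (u \<boxtimes>\<^bsub>D\<^esub> v) = trace DT U X Y u \<boxtimes>\<^bsub>D\<^esub> v"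
      using a \<tau>_superposing[of U X Y X' Y' f g] by (simp add: trace_DT \<tau>_closed)
  next
    fix U assume "U \<in> Obj D"
    then show "trace DT U U U (symm D U U) = ide D U" by (simp add: trace_DT s_closed \<tau>_yanking)
  qed
qed

end

section \<open>The traced category of a lax monoidal functor on Int\<close>

locale lax_on_Int = traced_category C + P: lax_functor "Int_smc C" P
  for C :: "('o, 'a, 'm) tracedcat_scheme" (structure) and P :: "('o \<times> 'o, ('o \<times> 'o) \<times> 'a \<times> ('o \<times> 'o), 's) lax" +
  fixes k :: "'o \<times> 's \<times> 'o \<Rightarrow> 's"
  assumes k: "inj k"
begin

text \<open>\<open>fn\<close> will be the functor from \<open>C\<close> on arrows: the name of
  \<open>f\<close> acts on the unit element. Identities and symmetries are its values, while
  composition and trace are the actions of the two wirings.\<close>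

definition "Hs X Y = lset P (Y, X)"
definition "fn X Y f = lact P (nam C X Y f) (lunit P)"
definition "is X = fn X X (ide C X)"
definition "cs X Y Z g f = lact P (compose_wires C X Y Z) (lmult P (Y, X) (Z, Y) f g)"
definition "ts X Y X' Y' f f' = lmult P (Y, X) (Y', X') f f'"
definition "ss X Y = fn (X \<otimes> Y) (Y \<otimes> X) (\<sigma> X Y)"
definition "trs U X Y f = lact P (trace_wires C U X Y) f"

lemma lax_terms_pick: "set os \<subseteq> Obj C \<Longrightarrow> lax_terms C (pick \<one> os) P"
  by (intro lax_terms.intro interpretation_pick P.lax_functor_axioms)

lemma ob [simp]: "(X, Y) \<in> Obj (Int_cat C) \<longleftrightarrow> X \<in> Obj C \<and> Y \<in> Obj C"
  by (simp add: Int_cat_simps)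

lemma fn_closed: "f \<in> hom C X Y \<Longrightarrow> fn X Y f \<in> Hs X Y"
  unfolding fn_def Hs_def using P.act_closed[OF _ P.lunit_closed, of "nam C X Y f"] homD(4,5) nam_hom by simp

lemma ts_closed: "\<lbrakk>X \<in> Obj C; Y \<in> Obj C; X' \<in> Obj C; Y' \<in> Obj C; f \<in> Hs X Y; f' \<in> Hs X' Y'\<rbrakk> \<Longrightarrow> ts X Y X' Y' f f' \<in> Hs (X \<otimes> X') (Y \<otimes> Y')"
  unfolding ts_def Hs_def using P.lmult_closed[of "(Y, X)" "(Y', X')" f f'] by (simp add: Int_smc_tobj)

lemma cs_closed: "\<lbrakk>X \<in> Obj C; Y \<in> Obj C; Z \<in> Obj C; f \<in> Hs X Y; g \<in> Hs Y Z\<rbrakk> \<Longrightarrow> cs X Y Z g f \<in> Hs X Z"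
  unfolding cs_def using P.act_closed[of "compose_wires C X Y Z"] compose_wires_hom[of X Y Z] ts_closed[of X Y Y Z f g] by (simp add: ts_def Hs_def)

lemma trs_closed: "\<lbrakk>U \<in> Obj C; X \<in> Obj C; Y \<in> Obj C; f \<in> Hs (U \<otimes> X) (U \<otimes> Y)\<rbrakk> \<Longrightarrow> trs U X Y f \<in> Hs X Y"
  unfolding trs_def Hs_def using P.act_closed[of "trace_wires C U X Y"] trace_wires_hom[of U X Y] by simp

text \<open>Both names act on the unit element, and the product of the unit element with itself is
  the unit element, so naturality of \<open>lmult\<close> leaves the action of a tensor product of
  names.\<close>

lemma fn_tensor:
  assumes "f \<in> hom C X Y" "f' \<in> hom C X' Y'"
  shows "ts X Y X' Y' (fn X Y f) (fn X' Y' f') = fn (X \<otimes> X') (Y \<otimes> Y') (f \<boxtimes> f')"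
proof -
  note o = homD[OF assms(1)] homD[OF assms(2)]
  show ?thesis
    using P.lmult_natural[of "nam C X Y f" "(\<one>, \<one>)" "(Y, X)" "nam C X' Y' f'" "(\<one>, \<one>)" "(Y', X')" "lunit P" "lunit P"]
      P.lunit_closed P.lmult_unit[OF P.unit_obj P.lunit_closed] o assms
    by (simp add: ts_def fn_def nam_hom nam_tarr)
qed

lemma fn_comp:
  assumes "f \<in> hom C X Y" "g \<in> hom C Y Z"
  shows "cs X Y Z (fn Y Z g) (fn X Y f) = fn X Z (g \<cdot> f)"
proof -
  note o = homD[OF assms(1)] homD[OF assms(2)]
  have n: "nam C (X \<otimes> Y) (Y \<otimes> Z) (f \<boxtimes> g) \<in> hom (Int_smc C) (\<one>, \<one>) (Y \<otimes> Z, X \<otimes> Y)"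
    using o tarr_closed[OF assms] by (simp add: nam_hom)
  show ?thesis
    using fn_tensor[OF assms] P.act_comp[of "compose_wires C X Y Z" _ _ "nam C (X \<otimes> Y) (Y \<otimes> Z) (f \<boxtimes> g)", OF _ n P.lunit_closed[simplified]]
      compose_wires_hom[of X Y Z] compose_nam[OF assms] o assms
    by (simp add: cs_def ts_def fn_def nam_tarr)
qed

lemma fn_trace:
  assumes "U \<in> Obj C" "X \<in> Obj C" "Y \<in> Obj C" "f \<in> hom C (U \<otimes> X) (U \<otimes> Y)"
  shows "trs U X Y (fn (U \<otimes> X) (U \<otimes> Y) f) = fn X Y (Tr U X Y f)"
proof -
  have n: "nam C (U \<otimes> X) (U \<otimes> Y) f \<in> hom (Int_smc C) (\<one>, \<one>) (U \<otimes> Y, U \<otimes> X)"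
    using assms by (simp add: nam_hom)
  show ?thesis
    using P.act_comp[of "trace_wires C U X Y" _ _ "nam C (U \<otimes> X) (U \<otimes> Y) f", OF _ n P.lunit_closed[simplified]]
      trace_wires_hom[of U X Y] trace_nam[OF assms] assms
    by (simp add: trs_def fn_def)
qed

lemma is_unit: "is \<one> = lunit P"
proof -
  have "nam C \<one> \<one> (ide C \<one>) = ide (Int_smc C) (\<one>, \<one>)" by (simp add: nam_def Int_cat_ide)
  then show ?thesis using P.act_ide[OF P.unit_obj P.lunit_closed] by (simp add: is_def fn_def)
qed

lemmas s_defs = Hs_def cs_def ts_def is_def fn_def ss_def trs_def nam_def compose_wires_def trace_wires_def

lemma cs_ide:
  assumes "X \<in> Obj C" "Y \<in> Obj C" "f \<in> Hs X Y"
  shows "cs X Y Y (is Y) f = f" "cs X X Y f (is X) = f"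
proof -
  interpret I: lax_terms C "pick \<one> [X, Y]" "pick undefined []" P "pick undefined [f]"
    by (rule lax_terms_pick) (use assms in auto)
  have "I.pev (PA (wire_comp [0] [1] [1]) (PM (PV 0 ([1], [0])) (PA (wire_nam [1] [1] (Id [1])) PU))) = I.pev (PV 0 ([1], [0]))"
    by (rule I.same_pdiagram_pev, code_simp) (use assms in \<open>simp_all add: Hs_def\<close>)
  then show "cs X Y Y (is Y) f = f" using assms by (simp add: s_defs)
  have "I.pev (PA (wire_comp [0] [0] [1]) (PM (PA (wire_nam [0] [0] (Id [0])) PU) (PV 0 ([1], [0])))) = I.pev (PV 0 ([1], [0]))"
    by (rule I.same_pdiagram_pev, code_simp) (use assms in \<open>simp_all add: Hs_def\<close>)
  then show "cs X X Y f (is X) = f" using assms by (simp add: s_defs)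
qed

lemma cs_assoc:
  assumes "W \<in> Obj C" "X \<in> Obj C" "Y \<in> Obj C" "Z \<in> Obj C" "f \<in> Hs W X" "g \<in> Hs X Y" "h \<in> Hs Y Z"
  shows "cs W Y Z h (cs W X Y g f) = cs W X Z (cs X Y Z h g) f"
proof -
  interpret I: lax_terms C "pick \<one> [W, X, Y, Z]" "pick undefined []" P "pick undefined [f, g, h]"
    by (rule lax_terms_pick) (use assms in auto)
  let ?f = "PV 0 ([1], [0])" and ?g = "PV 1 ([2], [1])" and ?h = "PV 2 ([3], [2])"
  have "I.pev (PA (wire_comp [0] [2] [3]) (PM (PA (wire_comp [0] [1] [2]) (PM ?f ?g)) ?h)) =
        I.pev (PA (wire_comp [0] [1] [3]) (PM ?f (PA (wire_comp [1] [2] [3]) (PM ?g ?h))))"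
    by (rule I.same_pdiagram_pev, code_simp) (use assms in \<open>simp_all add: Hs_def\<close>)
  then show ?thesis using assms by (simp add: s_defs)
qed

lemma lmult_swap:
  "\<lbrakk>X \<in> Obj C; Y \<in> Obj C; X' \<in> Obj C; Y' \<in> Obj C; f \<in> Hs X Y; f' \<in> Hs X' Y'\<rbrakk> \<Longrightarrow>
    lmult P (Y', X') (Y, X) f' f = lact P (\<sigma>\<^bsub>Int_smc C\<^esub> (Y, X) (Y', X')) (lmult P (Y, X) (Y', X') f f')"
  using P.lmult_symm[of "(Y, X)" "(Y', X')" f f'] by (simp add: Hs_def)

text \<open>The two sides list the variables as \<open>f, g, f', g'\<close> and as
  \<open>f, f', g, g'\<close>. After one exchange of the middle pair it is an equation of
  diagrams.\<close>

lemma ts_comp: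
  assumes "X \<in> Obj C" "Y \<in> Obj C" "Z \<in> Obj C" "X' \<in> Obj C" "Y' \<in> Obj C" "Z' \<in> Obj C" "f \<in> Hs X Y" "g \<in> Hs Y Z" "f' \<in> Hs X' Y'" "g' \<in> Hs Y' Z'"
  shows "ts X Z X' Z' (cs X Y Z g f) (cs X' Y' Z' g' f') = cs (X \<otimes> X') (Y \<otimes> Y') (Z \<otimes> Z') (ts Y Z Y' Z' g g') (ts X Y X' Y' f f')"
proof -
  interpret I: lax_terms C "pick \<one> [X, Y, Z, X', Y', Z']" "pick undefined []" P "pick undefined [f, g, f', g']"
    by (rule lax_terms_pick) (use assms in auto)
  let ?f = "PV 0 ([1], [0])" and ?g = "PV 1 ([2], [1])" and ?f' = "PV 2 ([4], [3])" and ?g' = "PV 3 ([5], [4])"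
  \<comment> \<open>The symmetry axiom is applied to the middle pair alone. Equation
    \<open>2\<close> brings that pair together by associativity, so that the replacement can happen
    in place.\<close>
  have 1: "I.pev (PM ?f' ?g) = I.pev (PA (iSy ([2], [1]) ([4], [3])) (PM ?g ?f'))"
    using assms lmult_swap[of Y Z X' Y' g f'] by (simp add: I.iev_iSy)
  have 2: "I.pev (PM (PM ?f ?f') (PM ?g ?g')) = I.pev (PM ?f (PM (PM ?f' ?g) ?g'))"
    by (rule I.same_pdiagram_pev, code_simp) (use assms in \<open>simp_all add: Hs_def\<close>)
  have 3: "I.pev (PM ?f (PM (PM ?f' ?g) ?g')) = I.pev (PM ?f (PM (PA (iSy ([2], [1]) ([4], [3])) (PM ?g ?f')) ?g'))"
    using 1 by (simp add: iapp_def)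
  have "I.pev (PM (PA (wire_comp [0] [1] [2]) (PM ?f ?g)) (PA (wire_comp [3] [4] [5]) (PM ?f' ?g'))) =
    I.pev (PA (wire_comp [0, 3] [1, 4] [2, 5]) (PM ?f (PM (PA (iSy ([2], [1]) ([4], [3])) (PM ?g ?f')) ?g')))"
    by (rule I.same_pdiagram_pev, code_simp) (use assms in \<open>simp_all add: Hs_def\<close>)
  also have "\<dots> = I.pev (PA (wire_comp [0, 3] [1, 4] [2, 5]) (PM (PM ?f ?f') (PM ?g ?g')))"
    using 2 3 by (simp only: I.pev.simps)
  finally show ?thesis using assms by (simp add: s_defs iapp_def)
qed

lemma ss_natural:
  assumes "X \<in> Obj C" "Y \<in> Obj C" "X' \<in> Obj C" "Y' \<in> Obj C" "f \<in> Hs X X'" "g \<in> Hs Y Y'"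
  shows "cs (X \<otimes> Y) (X' \<otimes> Y') (Y' \<otimes> X') (ss X' Y') (ts X X' Y Y' f g) = cs (X \<otimes> Y) (Y \<otimes> X) (Y' \<otimes> X') (ts Y Y' X X' g f) (ss X Y)"
proof -
  interpret I: lax_terms C "pick \<one> [X, X', Y, Y']" "pick undefined []" P "pick undefined [f, g]"
    by (rule lax_terms_pick) (use assms in auto)
  let ?f = "PV 0 ([1], [0])" and ?g = "PV 1 ([3], [2])"
  have 1: "I.pev (PM ?g ?f) = I.pev (PA (iSy ([1], [0]) ([3], [2])) (PM ?f ?g))"
    using assms lmult_swap[of X X' Y Y' f g] by (simp add: I.iev_iSy)
  have "I.pev (PA (wire_comp [0, 2] [1, 3] [3, 1]) (PM (PM ?f ?g) (PA (wire_nam [1, 3] [3, 1] (Sy [1] [3])) PU))) =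
     I.pev (PA (wire_comp [0, 2] [2, 0] [3, 1]) (PM (PA (wire_nam [0, 2] [2, 0] (Sy [0] [2])) PU) (PA (iSy ([1], [0]) ([3], [2])) (PM ?f ?g))))"
    by (rule I.same_pdiagram_pev, code_simp) (use assms in \<open>simp_all add: Hs_def\<close>)
  also have "\<dots> = I.pev (PA (wire_comp [0, 2] [2, 0] [3, 1]) (PM (PA (wire_nam [0, 2] [2, 0] (Sy [0] [2])) PU) (PM ?g ?f)))"
    using 1 by (simp add: iapp_def)
  finally show ?thesis using assms by (simp add: s_defs iapp_def)
qed

text \<open>Laws that mention only identities and symmetries, such as the hexagon and yanking, are
  laws of \<open>C\<close> transported by \<open>fn\<close>. Laws about arbitrary elements are
  comparisons of diagrams or axioms of the lax functor.\<close>

sublocale S: traced_family C k Hs "is" cs ts ss trs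
proof
  fix X Y assume o: "X \<in> Obj C" "Y \<in> Obj C"
  show "ts X X Y Y (is X) (is Y) = is (X \<otimes> Y)" using o by (simp add: is_def fn_tensor ide_hom)
  show "ss X Y \<in> Hs (X \<otimes> Y) (Y \<otimes> X)" using o by (simp add: ss_def fn_closed symm_hom)
  show "cs (X \<otimes> Y) (Y \<otimes> X) (X \<otimes> Y) (ss Y X) (ss X Y) = is (X \<otimes> Y)"
    using o fn_comp[OF symm_hom symm_hom, of X Y] by (simp add: ss_def is_def symm_involutive)
  fix f assume f: "f \<in> Hs X Y"
  show "ts \<one> \<one> X Y (is \<one>) f = f" "ts X Y \<one> \<one> f (is \<one>) = f"
    using o f P.lmult_unit[of "(Y, X)" f] by (simp_all add: is_unit ts_def Hs_def)
  interpret I: lax_terms C "pick \<one> [X, Y]" "pick undefined []" P "pick undefined [f]"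
    by (rule lax_terms_pick) (use o in auto)
  have "I.pev (PA (wire_trace [] [0] [1]) (PV 0 ([1], [0]))) = I.pev (PV 0 ([1], [0]))"
    by (rule I.same_pdiagram_pev, code_simp) (use f o in \<open>simp_all add: Hs_def\<close>)
  then show "trs \<one> X Y f = f" using o by (simp add: s_defs)
next
  fix X Y Z assume o: "X \<in> Obj C" "Y \<in> Obj C" "Z \<in> Obj C"
  have h: "\<sigma> X Y \<boxtimes> ide C Z \<in> hom C (X \<otimes> Y \<otimes> Z) (Y \<otimes> X \<otimes> Z)" "ide C Y \<boxtimes> \<sigma> X Z \<in> hom C (Y \<otimes> X \<otimes> Z) (Y \<otimes> Z \<otimes> X)"
    using o by (simp_all add: hom_iff)
  show "ss X (Y \<otimes> Z) = cs (X \<otimes> Y \<otimes> Z) (Y \<otimes> X \<otimes> Z) (Y \<otimes> Z \<otimes> X) (ts Y Y (X \<otimes> Z) (Z \<otimes> X) (is Y) (ss X Z)) (ts (X \<otimes> Y) (Y \<otimes> X) Z Z (ss X Y) (is Z))"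
    using o fn_comp[OF h] fn_tensor[OF symm_hom[of X Y] ide_hom[of Z]] fn_tensor[OF ide_hom[of Y] symm_hom[of X Z]] by (simp add: ss_def is_def symm_hexagon)
next
  fix X Y X' Y' X'' Y'' f g h
  assume o: "X \<in> Obj C" "Y \<in> Obj C" "X' \<in> Obj C" "Y' \<in> Obj C" "X'' \<in> Obj C" "Y'' \<in> Obj C" "f \<in> Hs X Y" "g \<in> Hs X' Y'" "h \<in> Hs X'' Y''"
  then show "ts (X \<otimes> X') (Y \<otimes> Y') X'' Y'' (ts X Y X' Y' f g) h = ts X Y (X' \<otimes> X'') (Y' \<otimes> Y'') f (ts X' Y' X'' Y'' g h)"
    using P.lmult_assoc[of "(Y, X)" "(Y', X')" "(Y'', X'')" f g h] by (simp add: ts_def Hs_def Int_smc_tobj)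
next
  fix U X Y X' f g assume o: "U \<in> Obj C" "X \<in> Obj C" "Y \<in> Obj C" "X' \<in> Obj C" "f \<in> Hs (U \<otimes> X) (U \<otimes> Y)" "g \<in> Hs X' X"
  interpret I: lax_terms C "pick \<one> [U, X, Y, X']" "pick undefined []" P "pick undefined [f, g]"
    by (rule lax_terms_pick) (use o in auto)
  let ?f = "PV 0 ([0, 2], [0, 1])" and ?g = "PV 1 ([1], [3])"
  have "I.pev (PA (wire_trace [0] [3] [2]) (PA (wire_comp [0, 3] [0, 1] [0, 2]) (PM (PM (PA (wire_nam [0] [0] (Id [0])) PU) ?g) ?f))) =
     I.pev (PA (wire_comp [3] [1] [2]) (PM ?g (PA (wire_trace [0] [1] [2]) ?f)))"
    by (rule I.same_pdiagram_pev, code_simp) (use o in \<open>simp_all add: Hs_def\<close>)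
  then show "trs U X' Y (cs (U \<otimes> X') (U \<otimes> X) (U \<otimes> Y) f (ts U U X' X (is U) g)) = cs X' X Y (trs U X Y f) g"
    using o by (simp add: s_defs iapp_def)
next
  fix U X Y Y' f g assume o: "U \<in> Obj C" "X \<in> Obj C" "Y \<in> Obj C" "Y' \<in> Obj C" "f \<in> Hs (U \<otimes> X) (U \<otimes> Y)" "g \<in> Hs Y Y'"
  interpret I: lax_terms C "pick \<one> [U, X, Y, Y']" "pick undefined []" P "pick undefined [f, g]"
    by (rule lax_terms_pick) (use o in auto)
  let ?f = "PV 0 ([0, 2], [0, 1])" and ?g = "PV 1 ([3], [2])"
  have "I.pev (PA (wire_trace [0] [1] [3]) (PA (wire_comp [0, 1] [0, 2] [0, 3]) (PM ?f (PM (PA (wire_nam [0] [0] (Id [0])) PU) ?g)))) =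
     I.pev (PA (wire_comp [1] [2] [3]) (PM (PA (wire_trace [0] [1] [2]) ?f) ?g))"
    by (rule I.same_pdiagram_pev, code_simp) (use o in \<open>simp_all add: Hs_def\<close>)
  then show "trs U X Y' (cs (U \<otimes> X) (U \<otimes> Y) (U \<otimes> Y') (ts U U Y Y' (is U) g) f) = cs X Y Y' g (trs U X Y f)"
    using o by (simp add: s_defs iapp_def)
next
  fix U V X Y f g assume o: "U \<in> Obj C" "V \<in> Obj C" "X \<in> Obj C" "Y \<in> Obj C" "f \<in> Hs (U \<otimes> X) (V \<otimes> Y)" "g \<in> Hs V U"
  interpret I: lax_terms C "pick \<one> [U, V, X, Y]" "pick undefined []" P "pick undefined [f, g]"
    by (rule lax_terms_pick) (use o in auto)
  let ?f = "PV 0 ([1, 3], [0, 2])" and ?g = "PV 1 ([0], [1])"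
  \<comment> \<open>Dinaturality uses \<open>f\<close> and \<open>g\<close> in opposite orders,
    hence the exchange. Equation \<open>2\<close> first isolates the plain pair of \<open>g\<close>
    and \<open>f\<close> by pulling the identity on \<open>X\<close> out of it.\<close>
  have 1: "I.pev (PM ?g ?f) = I.pev (PA (iSy ([1, 3], [0, 2]) ([0], [1])) (PM ?f ?g))"
    using o lmult_swap[of "U \<otimes> X" "V \<otimes> Y" V U f g] by (simp add: I.iev_iSy)
  have 2: "I.pev (PM (PM ?g (PA (wire_nam [2] [2] (Id [2])) PU)) ?f) = I.pev (PA (iTs (iTs (iId ([0], [1])) (wire_nam [2] [2] (Id [2]))) (iId ([1, 3], [0, 2]))) (PM ?g ?f))"
    by (rule I.same_pdiagram_pev, code_simp) (use o in \<open>simp_all add: Hs_def\<close>)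
  have "I.pev (PA (wire_trace [0] [2] [3]) (PA (wire_comp [0, 2] [1, 3] [0, 3]) (PM ?f (PM ?g (PA (wire_nam [3] [3] (Id [3])) PU))))) =
     I.pev (PA (wire_trace [1] [2] [3]) (PA (wire_comp [1, 2] [0, 2] [1, 3]) (PA (iTs (iTs (iId ([0], [1])) (wire_nam [2] [2] (Id [2]))) (iId ([1, 3], [0, 2]))) (PA (iSy ([1, 3], [0, 2]) ([0], [1])) (PM ?f ?g)))))"
    by (rule I.same_pdiagram_pev, code_simp) (use o in \<open>simp_all add: Hs_def\<close>)
  also have "\<dots> = I.pev (PA (wire_trace [1] [2] [3]) (PA (wire_comp [1, 2] [0, 2] [1, 3]) (PM (PM ?g (PA (wire_nam [2] [2] (Id [2])) PU)) ?f)))"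
    using 1 2 by (simp only: I.pev.simps)
  finally show "trs U X Y (cs (U \<otimes> X) (V \<otimes> Y) (U \<otimes> Y) (ts V U Y Y g (is Y)) f) = trs V X Y (cs (V \<otimes> X) (U \<otimes> X) (V \<otimes> Y) f (ts V U X X g (is X)))"
    using o by (simp add: s_defs iapp_def)
next
  fix U V X Y f assume o: "U \<in> Obj C" "V \<in> Obj C" "X \<in> Obj C" "Y \<in> Obj C" "f \<in> Hs (U \<otimes> V \<otimes> X) (U \<otimes> V \<otimes> Y)"
  interpret I: lax_terms C "pick \<one> [U, V, X, Y]" "pick undefined []" P "pick undefined [f]"
    by (rule lax_terms_pick) (use o in auto)
  let ?f = "PV 0 ([0, 1, 3], [0, 1, 2])"
  have "I.pev (PA (wire_trace [0, 1] [2] [3]) ?f) = I.pev (PA (wire_trace [1] [2] [3]) (PA (wire_trace [0] [1, 2] [1, 3]) ?f))"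
    by (rule I.same_pdiagram_pev, code_simp) (use o in \<open>simp_all add: Hs_def\<close>)
  then show "trs (U \<otimes> V) X Y f = trs V X Y (trs U (V \<otimes> X) (V \<otimes> Y) f)" using o by (simp add: s_defs)
next
  fix U X Y X' Y' f g assume o: "U \<in> Obj C" "X \<in> Obj C" "Y \<in> Obj C" "X' \<in> Obj C" "Y' \<in> Obj C" "f \<in> Hs (U \<otimes> X) (U \<otimes> Y)" "g \<in> Hs X' Y'"
  interpret I: lax_terms C "pick \<one> [U, X, Y, X', Y']" "pick undefined []" P "pick undefined [f, g]"
    by (rule lax_terms_pick) (use o in auto)
  let ?f = "PV 0 ([0, 2], [0, 1])" and ?g = "PV 1 ([4], [3])"
  have "I.pev (PA (wire_trace [0] [1, 3] [2, 4]) (PM ?f ?g)) = I.pev (PM (PA (wire_trace [0] [1] [2]) ?f) ?g)"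
    by (rule I.same_pdiagram_pev, code_simp) (use o in \<open>simp_all add: Hs_def\<close>)
  then show "trs U (X \<otimes> X') (Y \<otimes> Y') (ts (U \<otimes> X) (U \<otimes> Y) X' Y' f g) = ts X Y X' Y' (trs U X Y f) g" using o by (simp add: s_defs)
next
  fix U assume "U \<in> Obj C"
  then show "trs U U U (ss U U) = is U" using fn_trace[of U U U "\<sigma> U U"] symm_hom[of U U] by (simp add: ss_def is_def trace_yanking)
next
  fix X assume "X \<in> Obj C"
  then show "is X \<in> Hs X X" by (simp add: is_def fn_closed ide_hom)
qed (auto simp: k cs_closed cs_ide cs_assoc ts_closed ts_comp ss_natural trs_closed)

definition F :: "('o, 'a, 'o, 's) func" where
  "F = \<lparr> omap = (\<lambda>X\<in>Obj C. X), amap = (\<lambda>f\<in>Arr C. k (Dom C f, fn (Dom C f) (Cod C f) f, Cod C f)) \<rparr>"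

lemma F_simps: "X \<in> Obj C \<Longrightarrow> omap F X = X" "f \<in> hom C X Y \<Longrightarrow> amap F f = k (X, fn X Y f, Y)"
  by (auto simp: F_def hom_iff)

lemma traced_functor_F: "traced_functor C S.DT F"
proof -
  have "is_functor C S.DT F"
  proof (rule is_functorI[OF category_axioms])
    fix X assume X: "X \<in> Obj C"
    show "amap F (ide C X) = ide S.DT (omap F X)"
      using F_simps(2)[OF ide_hom[OF X]] X by (simp add: F_simps(1) is_def)
  next
    fix X Y f assume f: "f \<in> hom C X Y"
    show "amap F f \<in> hom S.DT (omap F X) (omap F Y)"
      using F_simps(2)[OF f] homD[OF f] fn_closed[OF f] by (simp add: F_simps(1) S.hom_D)
  next
    fix X Y Z g f assume g: "g \<in> hom C Y Z" and f: "f \<in> hom C X Y"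
    show "amap F (g \<cdot> f) = amap F g \<cdot>\<^bsub>S.DT\<^esub> amap F f"
      using F_simps(2)[OF f] F_simps(2)[OF g] F_simps(2)[OF comp_hom[OF g f]] homD[OF f] homD[OF g] fn_closed[OF f] fn_closed[OF g]
      by (simp add: fn_comp[OF f g])
  qed (simp_all add: F_def)
  moreover have "amap F (f \<boxtimes> g) = amap F f \<boxtimes>\<^bsub>S.DT\<^esub> amap F g" if "f \<in> Arr C" "g \<in> Arr C" for f g
  proof -
    note f = arr_hom[OF that(1)] and g = arr_hom[OF that(2)]
    show ?thesis
      using F_simps(2)[OF f] F_simps(2)[OF g] F_simps(2)[OF tarr_closed[OF f g]] that fn_closed[OF f] fn_closed[OF g]
      by (simp add: fn_tensor[OF f g])
  qed
  moreover have "amap F (\<sigma> X Y) = \<sigma>\<^bsub>S.DT\<^esub> (omap F X) (omap F Y)" if "X \<in> Obj C" "Y \<in> Obj C" for X Y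
    using F_simps(2)[OF symm_hom[OF that]] that by (simp add: F_simps(1) ss_def)
  moreover have "amap F (Tr U X Y f) = trace S.DT (omap F U) (omap F X) (omap F Y) (amap F f)"
    if o: "U \<in> Obj C" "X \<in> Obj C" "Y \<in> Obj C" "f \<in> hom C (U \<otimes> X) (U \<otimes> Y)" for U X Y f
    using F_simps(2)[OF trace_hom[OF o]] F_simps(2)[OF o(4)] o fn_closed[OF o(4)] by (simp add: F_simps(1) S.trace_DT fn_trace)
  ultimately show ?thesis
    by (simp add: traced_functor_def strict_monoidal_functor_def F_simps(1))
qed

text \<open>In \<open>Int\<close>, applying an arrow to a point is a composition followed by a
  trace. The comparison of diagrams carries this over to elements of \<open>P\<close>, so the action
  of every arrow is recovered from the traced structure that \<open>P\<close> defines.\<close>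

lemma action_formula:
  assumes o: "X \<in> Obj C" "X' \<in> Obj C" "Y \<in> Obj C" "Y' \<in> Obj C" "f \<in> hom C (X \<otimes> Y') (X' \<otimes> Y)" "p \<in> lset P (X, X')"
  shows "lact P ((X, X'), f, (Y, Y')) p = trs X' Y' Y (cs (X' \<otimes> Y') (X \<otimes> Y') (X' \<otimes> Y) (fn (X \<otimes> Y') (X' \<otimes> Y) f) (ts X' X Y' Y' p (is Y')))"
proof -
  interpret I: lax_terms C "pick \<one> [X, X', Y, Y']" "pick undefined [f]" P "pick undefined [p]"
    by (rule lax_terms_pick) (use o in auto)
  let ?p = "PV 0 ([0], [1])"
  have "I.pev (PA (iBx 0 ([0], [1]) ([2], [3])) ?p) =
     I.pev (PA (wire_trace [1] [3] [2]) (PA (wire_comp [1, 3] [0, 3] [1, 2]) (PM (PM ?p (PA (wire_nam [3] [3] (Id [3])) PU)) (PA (wire_nam [0, 3] [1, 2] (Bx 0 [0, 3] [1, 2])) PU))))"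
    by (rule I.same_pdiagram_pev, code_simp) (use o in simp_all)
  then show ?thesis using o by (simp add: s_defs iapp_def I.iev_iBx)
qed

end

text \<open>The counterpart of \<open>action_formula\<close> for functors of points, by unfolding
  one composite in \<open>Int\<close> with a point; the symmetries with the unit disappear.\<close>

lemma rep_Int_act:
  assumes T: "traced_category T" and S: "traced_category S" and F: "traced_functor T S F"
    and o: "X \<in> Obj T" "X' \<in> Obj T" "Y \<in> Obj T" "Y' \<in> Obj T" and f: "f \<in> hom T (X \<otimes>\<^bsub>T\<^esub> Y') (X' \<otimes>\<^bsub>T\<^esub> Y)"
    and s: "s \<in> hom S (omap F X') (omap F X)"
  shows "lact (rep_Int T S F) ((X, X'), f, (Y, Y')) s =
    Tr\<^bsub>S\<^esub> (omap F X') (omap F Y') (omap F Y) (amap F f \<cdot>\<^bsub>S\<^esub> (s \<boxtimes>\<^bsub>S\<^esub> ide S (omap F Y')))"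
proof -
  interpret T: traced_category T by fact
  interpret S: traced_category S by fact
  have Fs: "strict_monoidal_functor T S F" using F by (simp add: traced_functor_def)
  note Ff = strict_functor[OF Fs] 
  note Fo = functor_obj[OF Ff] and Fh = functor_hom[OF T.category_axioms Ff f]
  have u: "((X, X'), f, (Y, Y')) \<in> hom (Int_smc T) (X, X') (Y, Y')" using o f by (simp add: Int_cat_simps)
  have p: "nam S (omap F X') (omap F X) s \<in> hom (Int_smc S) \<one>\<^bsub>Int_smc S\<^esub> (omap (Int_map T F) (X, X'))"
    using o s by (simp add: Int_map_simps S.nam_hom Fo)
  have Fu: "amap (Int_map T F) ((X, X'), f, (Y, Y')) = ((omap F X, omap F X'), amap F f, (omap F Y, omap F Y'))"
    using o f by (simp add: Int_map_simps(2) Int_cat_simps)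
  have Fh': "amap F f \<in> hom S (omap F X \<otimes>\<^bsub>S\<^esub> omap F Y') (omap F X' \<otimes>\<^bsub>S\<^esub> omap F Y)"
    using Fh o by (simp add: strict_functor_simps[OF Fs])
  have "lact (rep_Int T S F) ((X, X'), f, (Y, Y')) ((fst \<circ> snd) (nam S (omap F X') (omap F X) s)) =
      (fst \<circ> snd) (((omap F X, omap F X'), amap F f, (omap F Y, omap F Y')) \<cdot>\<^bsub>Int_smc S\<^esub> nam S (omap F X') (omap F X) s)"
    using rep_lax_simps(2)[OF T.symmetric_monoidal_Int S.symmetric_monoidal_Int strict_monoidal_Int_map[OF T S F] inj_on_untag u p] Fu by simp
  also have "\<dots> = Tr\<^bsub>S\<^esub> (omap F X') (omap F Y') (omap F Y) (amap F f \<cdot>\<^bsub>S\<^esub> (s \<boxtimes>\<^bsub>S\<^esub> ide S (omap F Y')))"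
  proof -
    have a: "((omap F X, omap F X'), amap F f, (omap F Y, omap F Y')) \<in> Arr (Int_cat S)"
      "((\<one>\<^bsub>S\<^esub>, \<one>\<^bsub>S\<^esub>), s, (omap F X, omap F X')) \<in> Arr (Int_cat S)"
      using Fh' s o by (simp_all add: Int_cat_simps Fo)
    show ?thesis
      using Fh' s o by (simp add: nam_def Int_cat_comp[OF a] Fo hom_iff)
  qed
  finally show ?thesis by (simp add: nam_def)
qed

context lax_on_Int
begin

text \<open>The map only adds tags, since the hom-sets of the new category were defined from the
  sets of \<open>P\<close>. Its naturality is the substance, and it comes from matching
  \<open>action_formula\<close> with \<open>rep_Int_act\<close>.\<close>

lemma rep_F:
  defines "\<alpha> \<equiv> \<lambda>x\<in>Obj (Int_smc C). \<lambda>p\<in>lset P x. k (snd x, p, fst x)"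
  shows "monoidal_transformation (Int_smc C) P (rep_Int C S.DT F) \<alpha>"
    "x \<in> Obj (Int_smc C) \<Longrightarrow> bij_betw (\<alpha> x) (lset P x) (lset (rep_Int C S.DT F) x)"
proof -
  note R = rep_Int_simps[OF traced_category_axioms S.traced_category_DT traced_functor_F]
    and act = rep_Int_act[OF traced_category_axioms S.traced_category_DT traced_functor_F]
  have \<alpha>: "\<alpha> (Y, X) p = k (X, p, Y)" "p \<in> Hs X Y" if "X \<in> Obj C" "Y \<in> Obj C" "p \<in> lset P (Y, X)" for X Y p
    using that by (simp_all add: \<alpha>_def Hs_def)
  have set: "lset (rep_Int C S.DT F) (Y, X) = {k (X, p, Y) |p. p \<in> lset P (Y, X)}" if "X \<in> Obj C" "Y \<in> Obj C" for X Y
    using that by (auto simp: R F_simps S.hom_D Hs_def)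
  show "bij_betw (\<alpha> x) (lset P x) (lset (rep_Int C S.DT F) x)" if x: "x \<in> Obj (Int_smc C)" for x
  proof -
    obtain Y X where "x = (Y, X)" "X \<in> Obj C" "Y \<in> Obj C" using x by (auto simp: Int_cat_simps)
    then show ?thesis by (auto simp: bij_betw_def inj_on_def set \<alpha>)
  qed
  have nat: "\<alpha> (Y, Y') (lact P ((X, X'), f, (Y, Y')) p) = lact (rep_Int C S.DT F) ((X, X'), f, (Y, Y')) (\<alpha> (X, X') p)"
    if o: "X \<in> Obj C" "X' \<in> Obj C" "Y \<in> Obj C" "Y' \<in> Obj C" "f \<in> hom C (X \<otimes> Y') (X' \<otimes> Y)" "p \<in> lset P (X, X')" for X X' Y Y' f p
  proof -
    have c: "((X, X'), f, (Y, Y')) \<in> hom (Int_smc C) (X, X') (Y, Y')" using o by (simp add: Int_cat_simps)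
    have p: "p \<in> Hs X' X" using o by (simp add: Hs_def)
    have 1: "k (X', p, X) \<in> hom S.DT (omap F X') (omap F X)" using o p by (simp add: F_simps S.hom_D)
    have i: "is Y' \<in> Hs Y' Y'" using o by (simp add: is_def fn_closed ide_hom)
    have "amap F f \<cdot>\<^bsub>S.DT\<^esub> (k (X', p, X) \<boxtimes>\<^bsub>S.DT\<^esub> ide S.DT Y') =
       k (X' \<otimes> Y', cs (X' \<otimes> Y') (X \<otimes> Y') (X' \<otimes> Y) (fn (X \<otimes> Y') (X' \<otimes> Y) f) (ts X' X Y' Y' p (is Y')), X' \<otimes> Y)"
      using o p i fn_closed[OF o(5)] by (simp add: F_simps(2)[OF o(5)] ts_closed)
    moreover have "cs (X' \<otimes> Y') (X \<otimes> Y') (X' \<otimes> Y) (fn (X \<otimes> Y') (X' \<otimes> Y) f) (ts X' X Y' Y' p (is Y')) \<in> Hs (X' \<otimes> Y') (X' \<otimes> Y)"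
      using o p i fn_closed[OF o(5)] by (simp add: cs_closed ts_closed)
    ultimately have "lact (rep_Int C S.DT F) ((X, X'), f, (Y, Y')) (k (X', p, X)) = k (Y', lact P ((X, X'), f, (Y, Y')) p, Y)"
      using act[OF o(1-5) 1] o by (simp add: F_simps(1) S.trace_DT action_formula[OF o])
    then show ?thesis using P.act_closed[OF c o(6)] o by (simp add: \<alpha>)
  qed
  show "monoidal_transformation (Int_smc C) P (rep_Int C S.DT F) \<alpha>"
    unfolding monoidal_transformation_def
  proof (intro conjI ballI)
    show "\<alpha> \<in> (\<Pi>\<^sub>E X\<in>Obj (Int_smc C). lset P X \<rightarrow>\<^sub>E lset (rep_Int C S.DT F) X)"
    proof (intro PiE_I)
      fix x p assume "x \<in> Obj (Int_smc C)" "p \<in> lset P x"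
      then show "\<alpha> x p \<in> lset (rep_Int C S.DT F) x" by (cases x) (auto simp: set \<alpha>)
    qed (auto simp: \<alpha>_def)
  next
    fix u p assume u: "u \<in> Arr (Int_smc C)" and p: "p \<in> lset P (Dom (Int_smc C) u)"
    then obtain X X' f Y Y' where a: "u = ((X, X'), f, (Y, Y'))" "X \<in> Obj C" "X' \<in> Obj C" "Y \<in> Obj C" "Y' \<in> Obj C" "f \<in> hom C (X \<otimes> Y') (X' \<otimes> Y)"
      by (auto elim!: Int_arrE)
    have "Dom (Int_smc C) u = (X, X')" "Cod (Int_smc C) u = (Y, Y')" using u by (simp_all add: a(1) Int_cat_simps(4,5))
    then show "\<alpha> (Cod (Int_smc C) u) (lact P u p) = lact (rep_Int C S.DT F) u (\<alpha> (Dom (Int_smc C) u) p)"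
      using nat[OF a(2-6), of p] p by (simp add: a(1))
  next
    show "\<alpha> \<one>\<^bsub>Int_smc C\<^esub> (lunit P) = lunit (rep_Int C S.DT F)"
      using P.lunit_closed by (simp add: \<alpha> R is_unit)
  next
    fix x y p q assume a: "x \<in> Obj (Int_smc C)" "y \<in> Obj (Int_smc C)" "p \<in> lset P x" "q \<in> lset P y"
    obtain Y X Y' X' where xy: "x = (Y, X)" "y = (Y', X')" by (cases x; cases y) auto
    have o: "X \<in> Obj C" "Y \<in> Obj C" "X' \<in> Obj C" "Y' \<in> Obj C" using a by (simp_all add: xy)
    have m: "lmult P (Y, X) (Y', X') p q \<in> lset P (Y \<otimes> Y', X \<otimes> X')"
      using P.lmult_closed[of x y p q] a o by (simp add: xy Int_smc_tobj)
    have h: "k (X, p, Y) \<in> hom S.DT (omap F X) (omap F Y)" "k (X', q, Y') \<in> hom S.DT (omap F X') (omap F Y')"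
      using o a by (simp_all add: S.hom_D F_simps xy Hs_def)
    show "\<alpha> (x \<otimes>\<^bsub>Int_smc C\<^esub> y) (lmult P x y p q) = lmult (rep_Int C S.DT F) x y (\<alpha> x p) (\<alpha> y q)"
      using a o m R(3)[OF o h] by (simp add: xy \<alpha> Int_smc_tobj) (simp add: ts_def Hs_def)
  qed
qed

end

text \<open>An infinite set is equipotent to its square. This gives room in the universe for arrows
  stored with their source and target.\<close>

lemma infinite_UNIV_triples:
  assumes "infinite (UNIV :: 'u set)"
  shows "\<exists>k :: 'u \<times> 'u \<times> 'u \<Rightarrow> 'u. inj k"
proof -
  have "\<exists>g. bij_betw g ((UNIV :: 'u set) \<times> (UNIV :: 'u set)) (UNIV :: 'u set)"
    using card_of_Times_same_infinite[OF assms] by (simp only: card_of_ordIso)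
  then obtain g :: "'u \<times> 'u \<Rightarrow> 'u" where g: "inj g" by (auto simp: bij_betw_def)
  then have "inj (\<lambda>(x, y, z). g (x, g (y, z)))" by (auto intro!: injI dest!: injD[OF g])
  then show ?thesis by blast
qed

section \<open>The equivalence over traced categories\<close>

theorem traced_equivalence:
  assumes "infinite (UNIV :: 'u set)"
  shows "\<exists>\<Psi>. equivalence_of_fibrations (TrCat :: 'u trcat)
        (grothendieck TrCat Lax_Int_TrCat) (grothendieck_proj TrCat Lax_Int_TrCat)
        TrCat_bo (dom_functor TrCat trcat_bo) \<Psi>"
proof -
  interpret R: smc_indexing "{T :: ('u, 'u) tracedcat. traced_category T}" "\<lambda>T S. {F. traced_functor T S F}" func_id "\<lambda>T _ _. func_comp T"
    Int_smc Int_map "fst \<circ> snd" trcat_bo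
  proof (rule smc_indexing.intro; (unfold mem_Collect_eq)?)
    show "category (cat_of_homs {T :: ('u, 'u) tracedcat. traced_category T} (\<lambda>T S. {F. traced_functor T S F}) func_id (\<lambda>T _ _. func_comp T))"
      using category_TrCat by (simp add: TrCat_def)
  next
    fix b F d b' F' d' g \<theta>
    assume a: "(b, F, d) \<in> (trcat_bo :: 'u trcat_arrow set)" "(b', F', d') \<in> (trcat_bo :: 'u trcat_arrow set)" "traced_functor b b' g"
      and t: "monoidal_transformation (Int_smc b) (rep_Int b d F) (lax_precomp (Int_smc b) (Int_map b g) (rep_Int b' d' F')) \<theta>"
    show "\<exists>!h. traced_functor d d' h \<and> func_comp b h F = func_comp b F' g \<and>
       (\<forall>x\<in>Obj (Int_smc b). \<forall>p\<in>hom (Int_smc d) \<one>\<^bsub>Int_smc d\<^esub> (omap (Int_map b F) x). (fst \<circ> snd) (amap (Int_map d h) p) = \<theta> x ((fst \<circ> snd) p))"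
      by (rule traced_square_unique[OF _ _ _ _ _ _ a(3) _ t]) (use a in \<open>auto simp: trcat_bo_def TrCat_def\<close>)
  next
    fix b :: "('u, 'u) tracedcat" and x
    show "inj_on (fst \<circ> snd) (hom (Int_smc b) \<one>\<^bsub>Int_smc b\<^esub> x)" by (rule inj_on_untag)
  next
    fix T :: "('u, 'u) tracedcat" and P :: "('u \<times> 'u, 'u int_arrow, 'u) lax"
    assume T: "traced_category T" and P: "lax_monoidal (Int_smc T) P"
    obtain k :: "'u \<times> 'u \<times> 'u \<Rightarrow> 'u" where k: "inj k" using infinite_UNIV_triples[OF assms] by blast
    interpret lax_on_Int T P k
      by (intro lax_on_Int.intro T lax_functor.intro traced_category.symmetric_monoidal_Int lax_functor_axioms.intro P lax_on_Int_axioms.intro k)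
    \<comment> \<open>The functor is the identity on objects, as the new category has the same
      objects as \<open>T\<close>.\<close>
    have "(T, F, S.DT) \<in> trcat_bo"
      using T S.traced_category_DT traced_functor_F by (auto simp: trcat_bo_def TrCat_def bij_betw_def inj_on_def F_simps)
    then show "\<exists>d F \<alpha>. (T, F, d) \<in> trcat_bo \<and> monoidal_transformation (Int_smc T) P (rep_Int T d F) \<alpha> \<and>
       (\<forall>x\<in>Obj (Int_smc T). bij_betw (\<alpha> x) (lset P x) (lset (rep_Int T d F) x))"
      using rep_F by blast
  qed (auto simp: traced_category.symmetric_monoidal_Int strict_monoidal_Int_map Int_map_id Int_map_comp trcat_bo_def TrCat_def)
  have "R.I = Lax_Int_TrCat" by (simp add: R.I_def Lax_Int_TrCat_def)
  then show ?thesis using R.equivalence by (simp add: TrCat_def)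
qed

section \<open>Compact categories\<close>

text \<open>Rewrites a block symmetry in context as a permutation of labels, after which equations
  between composites are settled by \<open>perm_comp\<close>.\<close>

lemma (in labelled_smc) perm_block:
  assumes "distinct (K @ L @ M @ N)"
  shows "ide C (T K) \<boxtimes> \<sigma> (T L) (T M) \<boxtimes> ide C (T N) = perm (K @ L @ M @ N) (K @ M @ L @ N)"
proof -
  have "distinct (L @ M)" using assms by auto
  then have "\<sigma> (T L) (T M) \<boxtimes> ide C (T N) = perm (L @ M @ N) (M @ L @ N)"
    using perm_right[of "L @ M" N "M @ L"] perm_symm[of L M] assms by (auto simp: rearr_def)
  then show ?thesis using perm_left[of K "L @ M @ N" "M @ L @ N"] assms by (auto simp: rearr_def)
qed

lemma (in symmetric_monoidal) labelled_pick: "set os \<subseteq> Obj C \<Longrightarrow> labelled_smc C (pick \<one> os)"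
  by unfold_locales (simp add: pick_in)

locale dualised = compact_category C for C :: "('o, 'a, 'm) smc_scheme" (structure)
begin

text \<open>The dual object, unit and counit are chosen together, so that the triangle identities
  hold between them.\<close>

definition "dual X = (SOME d. is_dual C X (fst d) (fst (snd d)) (snd (snd d)))"
definition "ds X = fst (dual X)"
definition "et X = fst (snd (dual X))"
definition "ep X = snd (snd (dual X))"

lemma is_dual: assumes "X \<in> Obj C" shows "is_dual C X (ds X) (et X) (ep X)"
proof -
  obtain Y \<eta> \<epsilon> where "is_dual C X Y \<eta> \<epsilon>" using dual_exists[OF assms] by blast
  then have "is_dual C X (fst (Y, \<eta>, \<epsilon>)) (fst (snd (Y, \<eta>, \<epsilon>))) (snd (snd (Y, \<eta>, \<epsilon>)))" by simp
  then show ?thesis unfolding ds_def et_def ep_def dual_def by (rule someI)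
qed

lemma dual_simps [simp]:
  assumes "X \<in> Obj C"
  shows "ds X \<in> Obj C" "et X \<in> Arr C" "Dom C (et X) = \<one>" "Cod C (et X) = X \<otimes> ds X" "ep X \<in> Arr C" "Dom C (ep X) = ds X \<otimes> X" "Cod C (ep X) = \<one>"
    "(ide C X \<boxtimes> ep X) \<cdot> (et X \<boxtimes> ide C X) = ide C X" "(ep X \<boxtimes> ide C (ds X)) \<cdot> (ide C (ds X) \<boxtimes> et X) = ide C (ds X)"
  using is_dual[OF assms] by (auto simp: is_dual_def hom_iff)

text \<open>\<open>hat A X f\<close> is the transpose of \<open>f\<close> from
  \<open>A \<otimes> X\<close> to \<open>Y\<close>, an arrow from \<open>A\<close> to
  \<open>Y \<otimes> ds X\<close>; \<open>can X Y\<close> is the evaluation that undoes it.\<close>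

definition "hat A X f = (f \<boxtimes> ide C (ds X)) \<cdot> (ide C A \<boxtimes> et X)"
definition "can X Y = ide C Y \<boxtimes> ep X"

lemma can_arr [simp]:
  assumes "X \<in> Obj C" "Y \<in> Obj C"
  shows "can X Y \<in> Arr C" "Dom C (can X Y) = Y \<otimes> ds X \<otimes> X" "Cod C (can X Y) = Y"
  using assms by (simp_all add: can_def)

lemma hat_arr [simp]:
  assumes "A \<in> Obj C" "X \<in> Obj C" "f \<in> Arr C" "Dom C f = A \<otimes> X"
  shows "hat A X f \<in> Arr C" "Dom C (hat A X f) = A" "Cod C (hat A X f) = Cod C f \<otimes> ds X"
  using assms by (simp_all add: hat_def)

text \<open>Transposition is natural in \<open>A\<close>: the arrow \<open>a\<close> does not touch
  the factor on which the unit of the duality acts, so the two slide past each other.\<close>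

lemma hat_step:
  assumes "A \<in> Obj C" "X \<in> Obj C" "f \<in> Arr C" "Dom C f = A \<otimes> X" "a \<in> Arr C" "Cod C a = A" "Dom C a = A'"
  shows "hat A' X (f \<cdot> (a \<boxtimes> ide C X)) = hat A X f \<cdot> a"
proof -
  have A': "A' \<in> Obj C" using assms by auto
  have "(f \<cdot> (a \<boxtimes> ide C X)) \<boxtimes> ide C (ds X) = (f \<boxtimes> ide C (ds X)) \<cdot> (a \<boxtimes> ide C (X \<otimes> ds X))"
    using assms tarr_comp[of "a \<boxtimes> ide C X" f "ide C (ds X)" "ide C (ds X)"] by simp
  then have "hat A' X (f \<cdot> (a \<boxtimes> ide C X)) = (f \<boxtimes> ide C (ds X)) \<cdot> ((a \<boxtimes> ide C (X \<otimes> ds X)) \<cdot> (ide C A' \<boxtimes> et X))"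
    using assms A' by (simp add: hat_def comp_assoc)
  also have "(a \<boxtimes> ide C (X \<otimes> ds X)) \<cdot> (ide C A' \<boxtimes> et X) = (ide C A \<boxtimes> et X) \<cdot> a"
    using assms A' whisker(2)[of a "et X"] whisker(1)[of a "et X" A \<one>] by simp
  finally show ?thesis using assms A' by (simp add: hat_def comp_assoc)
qed

text \<open>After the counit slides past \<open>f\<close>, unit and counit of the duality straighten
  by a triangle identity. With \<open>hat_can\<close>, from the other triangle identity,
  transposition is a bijection.\<close>

lemma can_hat:
  assumes "A \<in> Obj C" "X \<in> Obj C" "f \<in> Arr C" "Dom C f = A \<otimes> X" "Cod C f = Y"
  shows "can X Y \<cdot> (hat A X f \<boxtimes> ide C X) = f"
proof -
  have Y: "Y \<in> Obj C" using assms by auto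
  have "hat A X f \<boxtimes> ide C X = (f \<boxtimes> ide C (ds X \<otimes> X)) \<cdot> (ide C A \<boxtimes> et X \<boxtimes> ide C X)"
    using assms tarr_comp[of "ide C A \<boxtimes> et X" "f \<boxtimes> ide C (ds X)" "ide C X" "ide C X"] by (simp add: hat_def)
  then have "can X Y \<cdot> (hat A X f \<boxtimes> ide C X) = ((ide C Y \<boxtimes> ep X) \<cdot> (f \<boxtimes> ide C (ds X \<otimes> X))) \<cdot> (ide C A \<boxtimes> et X \<boxtimes> ide C X)"
    using assms Y by (simp add: can_def comp_assoc)
  also have "(ide C Y \<boxtimes> ep X) \<cdot> (f \<boxtimes> ide C (ds X \<otimes> X)) = f \<cdot> (ide C (A \<otimes> X) \<boxtimes> ep X)"
    using assms Y whisker(1)[of f "ep X"] whisker(2)[of f "ep X" \<one>] by simp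
  also have "(f \<cdot> (ide C (A \<otimes> X) \<boxtimes> ep X)) \<cdot> (ide C A \<boxtimes> et X \<boxtimes> ide C X) = f \<cdot> ((ide C A \<boxtimes> (ide C X \<boxtimes> ep X)) \<cdot> (ide C A \<boxtimes> (et X \<boxtimes> ide C X)))"
    using assms by (simp add: comp_assoc)
  also have "(ide C A \<boxtimes> (ide C X \<boxtimes> ep X)) \<cdot> (ide C A \<boxtimes> (et X \<boxtimes> ide C X)) = ide C (A \<otimes> X)"
    using assms by (subst tarr_comp) simp_all
  finally show ?thesis using assms by simp
qed

lemma hat_can:
  assumes "X \<in> Obj C" "Y \<in> Obj C"
  shows "hat (Y \<otimes> ds X) X (can X Y) = ide C (Y \<otimes> ds X)"
proof -
  have "(ide C Y \<boxtimes> (ep X \<boxtimes> ide C (ds X))) \<cdot> (ide C Y \<boxtimes> (ide C (ds X) \<boxtimes> et X)) = ide C (Y \<otimes> ds X)"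
    using assms by (subst tarr_comp) simp_all
  then show ?thesis using assms by (simp add: hat_def can_def)
qed

end

text \<open>The point \<open>q\<close> slides past the first arrow, so the representatives compose
  by \<open>q \<boxtimes> p\<close> and \<open>g \<cdot> (ide C B \<boxtimes> f)\<close>. The same
  formula later defines composition where no category is given yet.\<close>

lemma val_comp:
  assumes "symmetric_monoidal C" "symmetric_monoidal D" "strict_monoidal_functor C D J"
    and o: "A \<in> Obj C" "B \<in> Obj C" "X \<in> Obj C" and f: "f \<in> hom C (A \<otimes>\<^bsub>C\<^esub> X) Y" and g: "g \<in> hom C (B \<otimes>\<^bsub>C\<^esub> Y) Z"
    and p: "p \<in> hom D \<one>\<^bsub>D\<^esub> (omap J A)" and q: "q \<in> hom D \<one>\<^bsub>D\<^esub> (omap J B)"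
  shows "(amap J g \<cdot>\<^bsub>D\<^esub> (q \<boxtimes>\<^bsub>D\<^esub> ide D (omap J Y))) \<cdot>\<^bsub>D\<^esub> (amap J f \<cdot>\<^bsub>D\<^esub> (p \<boxtimes>\<^bsub>D\<^esub> ide D (omap J X))) =
    amap J (g \<cdot>\<^bsub>C\<^esub> (ide C B \<boxtimes>\<^bsub>C\<^esub> f)) \<cdot>\<^bsub>D\<^esub> ((q \<boxtimes>\<^bsub>D\<^esub> p) \<boxtimes>\<^bsub>D\<^esub> ide D (omap J X))"
proof -
  interpret C: symmetric_monoidal C by fact
  interpret D: symmetric_monoidal D by fact
  note Jf = strict_functor[OF assms(3)]
  note [simp] = functor_obj[OF Jf] functor_arr[OF C.category_axioms Jf] functor_ide[OF Jf] strict_functor_simps[OF assms(3)] functor_comp_arr[OF Jf]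
  note h = C.homD[OF f] C.homD[OF g] D.homD[OF p] D.homD[OF q]
  have "(q \<boxtimes>\<^bsub>D\<^esub> ide D (omap J Y)) \<cdot>\<^bsub>D\<^esub> (amap J f \<cdot>\<^bsub>D\<^esub> (p \<boxtimes>\<^bsub>D\<^esub> ide D (omap J X))) = q \<boxtimes>\<^bsub>D\<^esub> (amap J f \<cdot>\<^bsub>D\<^esub> (p \<boxtimes>\<^bsub>D\<^esub> ide D (omap J X)))"
    using D.whisker(2)[of q "amap J f \<cdot>\<^bsub>D\<^esub> (p \<boxtimes>\<^bsub>D\<^esub> ide D (omap J X))" "omap J Y" "\<one>\<^bsub>D\<^esub>"] h o by simp
  also have "\<dots> = (ide D (omap J B) \<boxtimes>\<^bsub>D\<^esub> amap J f) \<cdot>\<^bsub>D\<^esub> (q \<boxtimes>\<^bsub>D\<^esub> (p \<boxtimes>\<^bsub>D\<^esub> ide D (omap J X)))"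
    using h o by (simp add: D.tarr_comp)
  finally show ?thesis using h o by (simp add: D.comp_assoc)
qed

text \<open>To bring the two points together, \<open>p'\<close> has to pass the input
  \<open>X\<close>, which produces the symmetry in the representative.\<close>

lemma val_tarr:
  assumes "symmetric_monoidal C" "symmetric_monoidal D" "strict_monoidal_functor C D J"
    and o: "A \<in> Obj C" "A' \<in> Obj C" "X \<in> Obj C" "X' \<in> Obj C" and f: "f \<in> hom C (A \<otimes>\<^bsub>C\<^esub> X) Y" and g: "f' \<in> hom C (A' \<otimes>\<^bsub>C\<^esub> X') Y'"
    and p: "p \<in> hom D \<one>\<^bsub>D\<^esub> (omap J A)" and q: "p' \<in> hom D \<one>\<^bsub>D\<^esub> (omap J A')"
  shows "(amap J f \<cdot>\<^bsub>D\<^esub> (p \<boxtimes>\<^bsub>D\<^esub> ide D (omap J X))) \<boxtimes>\<^bsub>D\<^esub> (amap J f' \<cdot>\<^bsub>D\<^esub> (p' \<boxtimes>\<^bsub>D\<^esub> ide D (omap J X'))) =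
    amap J ((f \<boxtimes>\<^bsub>C\<^esub> f') \<cdot>\<^bsub>C\<^esub> (ide C A \<boxtimes>\<^bsub>C\<^esub> \<sigma>\<^bsub>C\<^esub> A' X \<boxtimes>\<^bsub>C\<^esub> ide C X')) \<cdot>\<^bsub>D\<^esub> ((p \<boxtimes>\<^bsub>D\<^esub> p') \<boxtimes>\<^bsub>D\<^esub> ide D (omap J (X \<otimes>\<^bsub>C\<^esub> X')))"
proof -
  interpret C: symmetric_monoidal C by fact
  interpret D: symmetric_monoidal D by fact
  note Jf = strict_functor[OF assms(3)]
  note [simp] = functor_obj[OF Jf] functor_arr[OF C.category_axioms Jf] functor_ide[OF Jf] strict_functor_simps[OF assms(3)] functor_comp_arr[OF Jf]
  note h = C.homD[OF f] C.homD[OF g] D.homD[OF p] D.homD[OF q]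
  let ?X = "ide D (omap J X)" and ?X' = "ide D (omap J X')"
  have 1: "\<sigma>\<^bsub>D\<^esub> (omap J A') (omap J X) \<cdot>\<^bsub>D\<^esub> (p' \<boxtimes>\<^bsub>D\<^esub> ?X) = ?X \<boxtimes>\<^bsub>D\<^esub> p'"
    using D.symm_nat[of p' ?X "omap J A'" "omap J X"] h o by simp
  have "(ide D (omap J A) \<boxtimes>\<^bsub>D\<^esub> (\<sigma>\<^bsub>D\<^esub> (omap J A') (omap J X) \<boxtimes>\<^bsub>D\<^esub> ?X')) \<cdot>\<^bsub>D\<^esub> (p \<boxtimes>\<^bsub>D\<^esub> ((p' \<boxtimes>\<^bsub>D\<^esub> ?X) \<boxtimes>\<^bsub>D\<^esub> ?X')) = p \<boxtimes>\<^bsub>D\<^esub> ((?X \<boxtimes>\<^bsub>D\<^esub> p') \<boxtimes>\<^bsub>D\<^esub> ?X')"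
    using h o by (simp add: D.tarr_comp 1 del: D.tarr_simps)
  then have 2: "(ide D (omap J A) \<boxtimes>\<^bsub>D\<^esub> \<sigma>\<^bsub>D\<^esub> (omap J A') (omap J X) \<boxtimes>\<^bsub>D\<^esub> ?X') \<cdot>\<^bsub>D\<^esub> ((p \<boxtimes>\<^bsub>D\<^esub> p') \<boxtimes>\<^bsub>D\<^esub> ide D (omap J (X \<otimes>\<^bsub>C\<^esub> X'))) = (p \<boxtimes>\<^bsub>D\<^esub> ?X) \<boxtimes>\<^bsub>D\<^esub> (p' \<boxtimes>\<^bsub>D\<^esub> ?X')"
    using h o by simp
  have "(amap J f \<cdot>\<^bsub>D\<^esub> (p \<boxtimes>\<^bsub>D\<^esub> ?X)) \<boxtimes>\<^bsub>D\<^esub> (amap J f' \<cdot>\<^bsub>D\<^esub> (p' \<boxtimes>\<^bsub>D\<^esub> ?X')) = (amap J f \<boxtimes>\<^bsub>D\<^esub> amap J f') \<cdot>\<^bsub>D\<^esub> ((p \<boxtimes>\<^bsub>D\<^esub> ?X) \<boxtimes>\<^bsub>D\<^esub> (p' \<boxtimes>\<^bsub>D\<^esub> ?X'))"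
    using h o by (intro D.tarr_comp[symmetric]) simp_all
  then show ?thesis using h o unfolding 2[symmetric] by (simp add: D.comp_assoc)
qed

text \<open>Here \<open>\<theta>\<close> says only what happens to points. An arrow of
  \<open>D\<close> is written with a point \<open>p\<close> and an arrow \<open>f\<close> of
  \<open>C\<close>; the functor has to send it to the same expression with \<open>\<theta>\<close>
  applied to the point. The work is to show that the result does not depend on the
  expression.\<close>

lemma compact_square_unique:
  assumes C: "compact_category C" and D: "symmetric_monoidal D" and C': "symmetric_monoidal C'" and D': "symmetric_monoidal D'"
    and F: "strict_monoidal_functor C D F" and F': "strict_monoidal_functor C' D' F'" and G: "strict_monoidal_functor C C' G"
    and bij: "bij_betw (omap F) (Obj C) (Obj D)"
    and \<theta>: "monoidal_transformation C (rep_lax C D F id) (lax_precomp C G (rep_lax C' D' F' id)) \<theta>"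
  shows "\<exists>!h. strict_monoidal_functor D D' h \<and> func_comp C h F = func_comp C F' G \<and>
    (\<forall>x\<in>Obj C. \<forall>p\<in>hom D \<one>\<^bsub>D\<^esub> (omap F x). id (amap h p) = \<theta> x (id p))"
proof -
  interpret C: dualised C using C by (simp add: dualised_def)
  note mC = C.symmetric_monoidal_axioms
  interpret D: symmetric_monoidal D by fact
  interpret C': symmetric_monoidal C' by fact
  interpret D': symmetric_monoidal D' by fact
  define K where "K = func_comp C F' G"
  have K: "strict_monoidal_functor C D' K" unfolding K_def by (rule strict_monoidal_functor_comp[OF mC C' G F'])
  have Kv: "omap K X = omap F' (omap G X)" if "X \<in> Obj C" for X using that by (simp add: K_def compose_def)
  have Ka: "amap K f = amap F' (amap G f)" if "f \<in> Arr C" for f using that by (simp add: K_def compose_def)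
  note Ff = strict_functor[OF F] and Kf = strict_functor[OF K] and Gf = strict_functor[OF G]
  note [simp] = functor_obj[OF Ff] functor_obj[OF Kf] functor_arr[OF C.category_axioms Ff] functor_arr[OF C.category_axioms Kf]
    functor_ide[OF Ff] functor_ide[OF Kf] strict_functor_simps[OF F] strict_functor_simps[OF K] functor_comp_arr[OF Ff] functor_comp_arr[OF Kf]
  note Go = functor_obj[OF Gf] and Ga = functor_hom[OF C.category_axioms Gf]
  note R = rep_lax_simps[OF mC D F, where e = id, simplified] and R' = rep_lax_simps[OF C' D' F', where e = id, simplified]
  have t_closed: "\<theta> X p \<in> hom D' \<one>\<^bsub>D'\<^esub> (omap K X)" if "X \<in> Obj C" "p \<in> hom D \<one>\<^bsub>D\<^esub> (omap F X)" for X p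
    using monoidal_transformation_closed[OF mC \<theta> that(1), of p] that by (simp add: R R' Go Kv)
  have t_nat: "\<theta> Y (amap F f \<cdot>\<^bsub>D\<^esub> p) = amap K f \<cdot>\<^bsub>D'\<^esub> \<theta> X p" if f: "f \<in> hom C X Y" and p: "p \<in> hom D \<one>\<^bsub>D\<^esub> (omap F X)" for X Y f p
  proof -
    note o = C.homD[OF f]
    have "p \<in> lset (rep_lax C D F id) X" using o p by (simp add: R)
    from monoidal_transformation_natural[OF mC \<theta> f this] show ?thesis
      using R(2)[OF f p] R'(2)[OF Ga[OF f], of "\<theta> X p"] t_closed[OF o(4) p] o by (simp add: Kv Ka)
  qed
  have t_unit: "\<theta> \<one>\<^bsub>C\<^esub> (ide D \<one>\<^bsub>D\<^esub>) = ide D' \<one>\<^bsub>D'\<^esub>"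
    using \<theta> R(3) R'(3) by (simp add: monoidal_transformation_def)
  have t_tarr: "\<theta> (X \<otimes>\<^bsub>C\<^esub> Y) (p \<boxtimes>\<^bsub>D\<^esub> q) = \<theta> X p \<boxtimes>\<^bsub>D'\<^esub> \<theta> Y q"
    if o: "X \<in> Obj C" "Y \<in> Obj C" and p: "p \<in> hom D \<one>\<^bsub>D\<^esub> (omap F X)" and q: "q \<in> hom D \<one>\<^bsub>D\<^esub> (omap F Y)" for X Y p q
  proof -
    have "\<theta> (X \<otimes>\<^bsub>C\<^esub> Y) (lmult (rep_lax C D F id) X Y p q) = lmult (lax_precomp C G (rep_lax C' D' F' id)) X Y (\<theta> X p) (\<theta> Y q)"
      using \<theta> o p q unfolding monoidal_transformation_def by (simp add: R)
    then show ?thesis using R(4)[OF o p q] R'(4)[OF Go[OF o(1)] Go[OF o(2)], of "\<theta> X p" "\<theta> Y q"] t_closed[OF o(1) p] t_closed[OF o(2) q] o by (simp add: Kv)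
  qed
  \<comment> \<open>\<open>v\<close> is the arrow of \<open>D\<close> represented by
    \<open>f\<close> and the point \<open>p\<close>; \<open>w\<close> is the same expression in
    \<open>D'\<close>, along the composite \<open>K\<close>.\<close>
  define v where "v X f p = amap F f \<cdot>\<^bsub>D\<^esub> (p \<boxtimes>\<^bsub>D\<^esub> ide D (omap F X))" for A X f p
  define w where "w X f p = amap K f \<cdot>\<^bsub>D'\<^esub> (p \<boxtimes>\<^bsub>D'\<^esub> ide D' (omap K X))" for A X f p
  define \<phi> where "\<phi> = inv_into (Obj C) (omap F)"
  have \<phi>F: "\<phi> (omap F X) = X" if "X \<in> Obj C" for X using bij that by (simp add: \<phi>_def bij_betw_def)
  have F\<phi> [simp]: "omap F (\<phi> Y) = Y" "\<phi> Y \<in> Obj C" if "Y \<in> Obj D" for Y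
    using bij that by (auto simp: \<phi>_def bij_betw_def f_inv_into_f inv_into_into)
  \<comment> \<open>The name of \<open>d\<close>, a point over \<open>Y \<otimes> ds X\<close>. It
    supplies a canonical representative of \<open>d\<close>.\<close>
  define nm where "nm X d = (d \<boxtimes>\<^bsub>D\<^esub> ide D (omap F (C.ds X))) \<cdot>\<^bsub>D\<^esub> amap F (C.et X)" for X d
  have nm: "nm X d \<in> hom D \<one>\<^bsub>D\<^esub> (omap F (Y \<otimes>\<^bsub>C\<^esub> C.ds X))" if "X \<in> Obj C" "Y \<in> Obj C" "d \<in> hom D (omap F X) (omap F Y)" for X Y d
    using that by (simp add: nm_def hom_iff)
  \<comment> \<open>Any representative is related to the canonical one by the transpose of its
    arrow. As that transpose comes from \<open>C\<close>, naturality of \<open>\<theta>\<close>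
    applies to it.\<close>
  have nm_v: "nm X (v X f p) = amap F (C.hat A X f) \<cdot>\<^bsub>D\<^esub> p" if o: "A \<in> Obj C" "X \<in> Obj C" and f: "f \<in> hom C (A \<otimes>\<^bsub>C\<^esub> X) Y" and p: "p \<in> hom D \<one>\<^bsub>D\<^esub> (omap F A)" for A X Y f p
  proof -
    note h = o C.homD[OF f] D.homD[OF p]
    let ?S = "ide D (omap F (C.ds X))"
    have "v X f p \<boxtimes>\<^bsub>D\<^esub> ?S = (amap F f \<boxtimes>\<^bsub>D\<^esub> ?S) \<cdot>\<^bsub>D\<^esub> (p \<boxtimes>\<^bsub>D\<^esub> ide D (omap F X \<otimes>\<^bsub>D\<^esub> omap F (C.ds X)))"
      using h D.tarr_comp[of "p \<boxtimes>\<^bsub>D\<^esub> ide D (omap F X)" "amap F f" ?S ?S] by (simp add: v_def)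
    moreover have "(p \<boxtimes>\<^bsub>D\<^esub> ide D (omap F X \<otimes>\<^bsub>D\<^esub> omap F (C.ds X))) \<cdot>\<^bsub>D\<^esub> amap F (C.et X) = (ide D (omap F A) \<boxtimes>\<^bsub>D\<^esub> amap F (C.et X)) \<cdot>\<^bsub>D\<^esub> p"
      using h D.whisker(2)[of p "amap F (C.et X)" "omap F X \<otimes>\<^bsub>D\<^esub> omap F (C.ds X)" "\<one>\<^bsub>D\<^esub>"] D.whisker(1)[of p "amap F (C.et X)" "omap F A" "\<one>\<^bsub>D\<^esub>"] by simp
    ultimately show ?thesis using h by (simp add: nm_def C.hat_def D.comp_assoc)
  qed
  \<comment> \<open>A triangle identity of the duality, transported to \<open>D\<close> by
    \<open>F\<close>.\<close>
  have v_nm: "v X (C.can X Y) (nm X d) = d" if o: "X \<in> Obj C" "Y \<in> Obj C" and d: "d \<in> hom D (omap F X) (omap F Y)" for X Y d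
  proof -
    note h = o D.homD[OF d]
    let ?X = "ide D (omap F X)" and ?S = "omap F (C.ds X)"
    have a: "nm X d \<boxtimes>\<^bsub>D\<^esub> ?X = (d \<boxtimes>\<^bsub>D\<^esub> ide D (?S \<otimes>\<^bsub>D\<^esub> omap F X)) \<cdot>\<^bsub>D\<^esub> (amap F (C.et X) \<boxtimes>\<^bsub>D\<^esub> ?X)"
      using h D.tarr_comp[of "amap F (C.et X)" "d \<boxtimes>\<^bsub>D\<^esub> ide D ?S" ?X ?X] by (simp add: nm_def)
    have b: "(ide D (omap F Y) \<boxtimes>\<^bsub>D\<^esub> amap F (C.ep X)) \<cdot>\<^bsub>D\<^esub> (d \<boxtimes>\<^bsub>D\<^esub> ide D (?S \<otimes>\<^bsub>D\<^esub> omap F X)) = d \<cdot>\<^bsub>D\<^esub> (?X \<boxtimes>\<^bsub>D\<^esub> amap F (C.ep X))"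
      using h D.whisker(1)[of d "amap F (C.ep X)" "omap F Y" "?S \<otimes>\<^bsub>D\<^esub> omap F X"] D.whisker(2)[of d "amap F (C.ep X)" "\<one>\<^bsub>D\<^esub>" "omap F X"] by simp
    have c: "(?X \<boxtimes>\<^bsub>D\<^esub> amap F (C.ep X)) \<cdot>\<^bsub>D\<^esub> (amap F (C.et X) \<boxtimes>\<^bsub>D\<^esub> ?X) = ?X"
      using C.dual_simps(8)[OF o(1), THEN arg_cong, of "amap F"] h by (simp del: C.dual_simps(8))
    have "v X (C.can X Y) (nm X d) = ((ide D (omap F Y) \<boxtimes>\<^bsub>D\<^esub> amap F (C.ep X)) \<cdot>\<^bsub>D\<^esub> (d \<boxtimes>\<^bsub>D\<^esub> ide D (?S \<otimes>\<^bsub>D\<^esub> omap F X))) \<cdot>\<^bsub>D\<^esub> (amap F (C.et X) \<boxtimes>\<^bsub>D\<^esub> ?X)"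
      unfolding v_def a using h by (simp add: C.can_def D.comp_assoc)
    also have "\<dots> = d \<cdot>\<^bsub>D\<^esub> ((?X \<boxtimes>\<^bsub>D\<^esub> amap F (C.ep X)) \<cdot>\<^bsub>D\<^esub> (amap F (C.et X) \<boxtimes>\<^bsub>D\<^esub> ?X))"
      unfolding b using h by (intro D.comp_assoc) simp_all
    finally show ?thesis unfolding c using h by simp
  qed
  have vE: "\<exists>A f p. A \<in> Obj C \<and> f \<in> hom C (A \<otimes>\<^bsub>C\<^esub> X) Y \<and> p \<in> hom D \<one>\<^bsub>D\<^esub> (omap F A) \<and> d = v X f p"
    if o: "X \<in> Obj C" "Y \<in> Obj C" and d: "d \<in> hom D (omap F X) (omap F Y)" for X Y d
    using v_nm[OF o d] nm[OF o d] o
    by (intro exI[of _ "Y \<otimes>\<^bsub>C\<^esub> C.ds X"] exI[of _ "C.can X Y"] exI[of _ "nm X d"]) (simp add: hom_iff)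
  \<comment> \<open>Defined through the canonical representative, with \<open>\<theta>\<close>
    applied to the name.\<close>
  define h where "h = \<lparr>omap = (\<lambda>Y\<in>Obj D. omap K (\<phi> Y)),
    amap = (\<lambda>d\<in>Arr D. let X = \<phi> (Dom D d); Y = \<phi> (Cod D d) in w X (C.can X Y) (\<theta> (Y \<otimes>\<^bsub>C\<^esub> C.ds X) (nm X d)))\<rparr>"
  have ho: "omap h X = omap K (\<phi> X)" if "X \<in> Obj D" for X using that by (simp add: h_def)
  have v_hom: "v X f p \<in> hom D (omap F X) (omap F Y)" if "A \<in> Obj C" "X \<in> Obj C" "f \<in> hom C (A \<otimes>\<^bsub>C\<^esub> X) Y" "p \<in> hom D \<one>\<^bsub>D\<^esub> (omap F A)" for A X Y f p
    using that by (auto simp: v_def hom_iff)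
  have w_hom: "w X f p \<in> hom D' (omap K X) (omap K Y)" if "A \<in> Obj C" "X \<in> Obj C" "f \<in> hom C (A \<otimes>\<^bsub>C\<^esub> X) Y" "p \<in> hom D' \<one>\<^bsub>D'\<^esub> (omap K A)" for A X Y f p
    using that by (auto simp: w_def hom_iff)
  \<comment> \<open>Independence of the representative: \<open>\<theta>\<close> commutes with the
    transpose, and \<open>can_hat\<close> turns the canonical arrow back into
    \<open>f\<close>.\<close>
  have hv: "amap h (v X f p) = w X f (\<theta> A p)" if o: "A \<in> Obj C" "X \<in> Obj C" and f: "f \<in> hom C (A \<otimes>\<^bsub>C\<^esub> X) Y" and p: "p \<in> hom D \<one>\<^bsub>D\<^esub> (omap F A)" for A X Y f p
  proof -
    note hh = o C.homD[OF f] D.homD[OF p]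
    have t: "\<theta> A p \<in> hom D' \<one>\<^bsub>D'\<^esub> (omap K A)" by (rule t_closed[OF o(1) p])
    note tt = D'.homD[OF t]
    have hat: "C.hat A X f \<in> hom C A (Y \<otimes>\<^bsub>C\<^esub> C.ds X)" using hh by (simp add: hom_iff)
    have "amap h (v X f p) = w X (C.can X Y) (\<theta> (Y \<otimes>\<^bsub>C\<^esub> C.ds X) (nm X (v X f p)))"
      using v_hom[OF o f p] o hh by (simp add: h_def hom_iff Let_def \<phi>F)
    also have "\<dots> = w X (C.can X Y) (amap K (C.hat A X f) \<cdot>\<^bsub>D'\<^esub> \<theta> A p)"
      unfolding nm_v[OF o f p] t_nat[OF hat p] ..
    also have "\<dots> = amap K (C.can X Y \<cdot>\<^bsub>C\<^esub> (C.hat A X f \<boxtimes>\<^bsub>C\<^esub> ide C X)) \<cdot>\<^bsub>D'\<^esub> (\<theta> A p \<boxtimes>\<^bsub>D'\<^esub> ide D' (omap K X))"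
      using hh tt D'.tarr_comp[of "\<theta> A p" "amap K (C.hat A X f)" "ide D' (omap K X)" "ide D' (omap K X)"]
      by (simp add: w_def D'.comp_assoc)
    finally show ?thesis using hh by (simp add: C.can_hat w_def)
  qed
  have h_hom: "amap h d \<in> hom D' (omap h X) (omap h Y)" if d: "d \<in> hom D X Y" for d X Y
  proof -
    note o = D.homD[OF d]
    obtain A f p where a: "A \<in> Obj C" "f \<in> hom C (A \<otimes>\<^bsub>C\<^esub> \<phi> X) (\<phi> Y)" "p \<in> hom D \<one>\<^bsub>D\<^esub> (omap F A)" "d = v (\<phi> X) f p"
      using vE[of "\<phi> X" "\<phi> Y" d] o d by auto
    show ?thesis using hv[OF a(1) _ a(2,3)] w_hom[OF a(1) _ a(2) t_closed[OF a(1,3)]] o by (simp add: ho a(4)[symmetric])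
  qed
  have h_elt: "amap h p = \<theta> X p" if o: "X \<in> Obj C" and p: "p \<in> hom D \<one>\<^bsub>D\<^esub> (omap F X)" for X p
  proof -
    \<comment> \<open>A point represents itself, with the unit as input and an identity as
      arrow.\<close>
    have "v \<one>\<^bsub>C\<^esub> (ide C X) p = p" using D.homD[OF p] o by (simp add: v_def)
    moreover have "w \<one>\<^bsub>C\<^esub> (ide C X) (\<theta> X p) = \<theta> X p" using D'.homD[OF t_closed[OF o p]] o by (simp add: w_def)
    ultimately show ?thesis using hv[OF o _ _ p, of "\<one>\<^bsub>C\<^esub>" "ide C X" X] o C.ide_hom by simp
  qed
  have h_fun: "amap h (amap F f) = amap K f" if f: "f \<in> hom C X Y" for f X Y
  proof -
    note o = C.homD[OF f]
    \<comment> \<open>The image of an arrow of \<open>C\<close> is represented by that arrow and the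
      trivial point.\<close>
    have "v X f (ide D \<one>\<^bsub>D\<^esub>) = amap F f" "w X f (ide D' \<one>\<^bsub>D'\<^esub>) = amap K f" using o by (simp_all add: v_def w_def)
    then show ?thesis using hv[of "\<one>\<^bsub>C\<^esub>" X f Y "ide D \<one>\<^bsub>D\<^esub>"] f o D.ide_hom[OF D.unit_obj] by (simp add: t_unit)
  qed
  have h_comp: "amap h (d' \<cdot>\<^bsub>D\<^esub> d) = amap h d' \<cdot>\<^bsub>D'\<^esub> amap h d" if d': "d' \<in> hom D Y Z" and d: "d \<in> hom D X Y" for d d' X Y Z
  proof -
    note o = D.homD[OF d] D.homD[OF d']
    obtain A f p where a: "A \<in> Obj C" "f \<in> hom C (A \<otimes>\<^bsub>C\<^esub> \<phi> X) (\<phi> Y)" "p \<in> hom D \<one>\<^bsub>D\<^esub> (omap F A)" "d = v (\<phi> X) f p"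
      using vE[of "\<phi> X" "\<phi> Y" d] o d by auto
    obtain B g q where b: "B \<in> Obj C" "g \<in> hom C (B \<otimes>\<^bsub>C\<^esub> \<phi> Y) (\<phi> Z)" "q \<in> hom D \<one>\<^bsub>D\<^esub> (omap F B)" "d' = v (\<phi> Y) g q"
      using vE[of "\<phi> Y" "\<phi> Z" d'] o d' by auto
    have X: "\<phi> X \<in> Obj C" "\<phi> Y \<in> Obj C" using o by auto
    have gf: "g \<cdot>\<^bsub>C\<^esub> (ide C B \<boxtimes>\<^bsub>C\<^esub> f) \<in> hom C ((B \<otimes>\<^bsub>C\<^esub> A) \<otimes>\<^bsub>C\<^esub> \<phi> X) (\<phi> Z)"
      using a(1,2) b(1,2) X by (simp add: hom_iff)
    have qp: "q \<boxtimes>\<^bsub>D\<^esub> p \<in> hom D \<one>\<^bsub>D\<^esub> (omap F (B \<otimes>\<^bsub>C\<^esub> A))" using D.tarr_closed[OF b(3) a(3)] a b by simp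
    have "d' \<cdot>\<^bsub>D\<^esub> d = v (\<phi> X) (g \<cdot>\<^bsub>C\<^esub> (ide C B \<boxtimes>\<^bsub>C\<^esub> f)) (q \<boxtimes>\<^bsub>D\<^esub> p)"
      unfolding a(4) b(4) v_def by (rule val_comp[OF mC D F a(1) b(1) X(1) a(2) b(2) a(3) b(3)])
    then have "amap h (d' \<cdot>\<^bsub>D\<^esub> d) = w (\<phi> X) (g \<cdot>\<^bsub>C\<^esub> (ide C B \<boxtimes>\<^bsub>C\<^esub> f)) (\<theta> B q \<boxtimes>\<^bsub>D'\<^esub> \<theta> A p)"
      using hv[OF _ X(1) gf qp] a b by (simp add: t_tarr)
    also have "\<dots> = w (\<phi> Y) g (\<theta> B q) \<cdot>\<^bsub>D'\<^esub> w (\<phi> X) f (\<theta> A p)"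
      unfolding w_def by (rule val_comp[OF mC D' K a(1) b(1) X(1) a(2) b(2) t_closed[OF a(1,3)] t_closed[OF b(1,3)], symmetric])
    finally show ?thesis unfolding a(4) b(4) hv[OF a(1) X(1) a(2,3)] hv[OF b(1) X(2) b(2,3)] .
  qed
  have \<phi>t: "\<phi> (X \<otimes>\<^bsub>D\<^esub> Y) = \<phi> X \<otimes>\<^bsub>C\<^esub> \<phi> Y" "\<phi> \<one>\<^bsub>D\<^esub> = \<one>\<^bsub>C\<^esub>" if "X \<in> Obj D" "Y \<in> Obj D" for X Y
    using \<phi>F[of "\<phi> X \<otimes>\<^bsub>C\<^esub> \<phi> Y"] \<phi>F[of "\<one>\<^bsub>C\<^esub>"] that by auto
  have h_tarr: "amap h (d \<boxtimes>\<^bsub>D\<^esub> d') = amap h d \<boxtimes>\<^bsub>D'\<^esub> amap h d'" if "d \<in> Arr D" "d' \<in> Arr D" for d d'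
  proof -
    define X Y X' Y' where "X = \<phi> (Dom D d)" "Y = \<phi> (Cod D d)" "X' = \<phi> (Dom D d')" "Y' = \<phi> (Cod D d')"
    note XY = this
    have o: "X \<in> Obj C" "Y \<in> Obj C" "X' \<in> Obj C" "Y' \<in> Obj C" "d \<in> hom D (omap F X) (omap F Y)" "d' \<in> hom D (omap F X') (omap F Y')"
      using that by (simp_all add: XY hom_iff)
    obtain A f p where a: "A \<in> Obj C" "f \<in> hom C (A \<otimes>\<^bsub>C\<^esub> X) Y" "p \<in> hom D \<one>\<^bsub>D\<^esub> (omap F A)" "d = v X f p"
      using vE[OF o(1,2,5)] by auto
    obtain B g q where b: "B \<in> Obj C" "g \<in> hom C (B \<otimes>\<^bsub>C\<^esub> X') Y'" "q \<in> hom D \<one>\<^bsub>D\<^esub> (omap F B)" "d' = v X' g q"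
      using vE[OF o(3,4,6)] by auto
    let ?f = "(f \<boxtimes>\<^bsub>C\<^esub> g) \<cdot>\<^bsub>C\<^esub> (ide C A \<boxtimes>\<^bsub>C\<^esub> \<sigma>\<^bsub>C\<^esub> B X \<boxtimes>\<^bsub>C\<^esub> ide C X')"
    have gf: "?f \<in> hom C ((A \<otimes>\<^bsub>C\<^esub> B) \<otimes>\<^bsub>C\<^esub> (X \<otimes>\<^bsub>C\<^esub> X')) (Y \<otimes>\<^bsub>C\<^esub> Y')"
      using a(1,2) b(1,2) o by (simp add: hom_iff)
    have qp: "p \<boxtimes>\<^bsub>D\<^esub> q \<in> hom D \<one>\<^bsub>D\<^esub> (omap F (A \<otimes>\<^bsub>C\<^esub> B))" using D.tarr_closed[OF a(3) b(3)] a b by simp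
    have "d \<boxtimes>\<^bsub>D\<^esub> d' = v (X \<otimes>\<^bsub>C\<^esub> X') ?f (p \<boxtimes>\<^bsub>D\<^esub> q)"
      unfolding a(4) b(4) v_def by (rule val_tarr[OF mC D F a(1) b(1) o(1,3) a(2) b(2) a(3) b(3)])
    then have "amap h (d \<boxtimes>\<^bsub>D\<^esub> d') = w (X \<otimes>\<^bsub>C\<^esub> X') ?f (\<theta> A p \<boxtimes>\<^bsub>D'\<^esub> \<theta> B q)"
      using hv[OF _ _ gf qp] a b o by (simp add: t_tarr)
    also have "\<dots> = w X f (\<theta> A p) \<boxtimes>\<^bsub>D'\<^esub> w X' g (\<theta> B q)"
      unfolding w_def by (rule val_tarr[OF mC D' K a(1) b(1) o(1,3) a(2) b(2) t_closed[OF a(1,3)] t_closed[OF b(1,3)], symmetric])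
    finally show ?thesis unfolding a(4) b(4) hv[OF a(1) o(1) a(2,3)] hv[OF b(1) o(3) b(2,3)] .
  qed
  have hf: "is_functor D D' h"
  proof (rule is_functorI[OF D.category_axioms])
    fix X assume X: "X \<in> Obj D"
    then show "amap h (ide D X) = ide D' (omap h X)"
      using h_fun[OF C.ide_hom[of "\<phi> X"]] by (simp add: ho)
  qed (use h_hom h_comp in \<open>simp_all add: h_def\<close>)
  have h: "strict_monoidal_functor D D' h"
    unfolding strict_monoidal_functor_def
  proof (intro conjI ballI hf)
    show "omap h \<one>\<^bsub>D\<^esub> = \<one>\<^bsub>D'\<^esub>" using ho[OF D.unit_obj] \<phi>t(2)[OF D.unit_obj D.unit_obj] by simp
    fix X Y assume X: "X \<in> Obj D" "Y \<in> Obj D"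
    then show "omap h (X \<otimes>\<^bsub>D\<^esub> Y) = omap h X \<otimes>\<^bsub>D'\<^esub> omap h Y" by (simp add: ho \<phi>t)
    show "amap h (\<sigma>\<^bsub>D\<^esub> X Y) = \<sigma>\<^bsub>D'\<^esub> (omap h X) (omap h Y)"
      using h_fun[OF C.symm_hom[of "\<phi> X" "\<phi> Y"]] X by (simp add: ho)
  qed (rule h_tarr)
  have sq: "func_comp C h F = K"
  proof (rule functor_eqI[OF is_functor_comp[OF C.category_axioms D.category_axioms Ff hf] Kf])
    fix f assume f: "f \<in> Arr C"
    show "amap (func_comp C h F) f = amap K f" using h_fun[OF C.arr_hom[OF f]] f by (simp add: compose_def)
  qed (simp add: compose_def ho \<phi>F)
  show ?thesis
    unfolding K_def[symmetric]
  proof (rule ex1I[of _ h], intro conjI h sq ballI)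
    fix x p assume "x \<in> Obj C" "p \<in> hom D \<one>\<^bsub>D\<^esub> (omap F x)"
    then show "id (amap h p) = \<theta> x (id p)" by (simp add: h_elt)
  next
    fix k assume k: "strict_monoidal_functor D D' k \<and> func_comp C k F = K \<and> (\<forall>x\<in>Obj C. \<forall>p\<in>hom D \<one>\<^bsub>D\<^esub> (omap F x). id (amap k p) = \<theta> x (id p))"
    then have ks: "strict_monoidal_functor D D' k" and kK: "func_comp C k F = K" by auto
    note kf = strict_functor[OF ks]
    have kFo: "omap k (omap F X) = omap K X" if "X \<in> Obj C" for X
      unfolding kK[symmetric] using that by (simp add: compose_def)
    have kFa: "amap k (amap F f) = amap K f" if "f \<in> Arr C" for f
      unfolding kK[symmetric] using that by (simp add: compose_def)
    show "k = h"
    proof (rule functor_eqI[OF kf hf])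
      fix X assume X: "X \<in> Obj D"
      then show "omap k X = omap h X" using kFo[of "\<phi> X"] by (simp add: ho)
    next
      fix d assume d: "d \<in> Arr D"
      define X Y where "X = \<phi> (Dom D d)" "Y = \<phi> (Cod D d)"
      have o: "X \<in> Obj C" "Y \<in> Obj C" "d \<in> hom D (omap F X) (omap F Y)" using d by (simp_all add: X_Y_def hom_iff)
      obtain A f p where a: "A \<in> Obj C" "f \<in> hom C (A \<otimes>\<^bsub>C\<^esub> X) Y" "p \<in> hom D \<one>\<^bsub>D\<^esub> (omap F A)" "d = v X f p"
        using vE[OF o] by auto
      have kp: "amap k p = \<theta> A p" using k a by simp
      \<comment> \<open>A strict functor that agrees with \<open>\<theta>\<close> on points and with
        \<open>K\<close> on the image of \<open>F\<close> has no freedom on represented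
        arrows.\<close>
      have "amap k (v X f p) = w X f (\<theta> A p)"
        using C.homD[OF a(2)] D.homD[OF a(3)] a(1) o kp
        by (simp add: v_def w_def functor_comp_arr[OF kf] kFa strict_functor_simps[OF ks] functor_ide[OF kf] kFo)
      then show "amap k d = amap h d" unfolding a(4) hv[OF a(1) o(1) a(2,3)] .
    qed
  qed
qed

section \<open>Permutations behind the tensor product of representatives\<close>

context symmetric_monoidal
begin

text \<open>For associativity of the tensor product: both sides sort three parameters in front of
  three inputs, in different orders of moves. The six factors are numbered, and the two composites
  have the same source and target lists.\<close>

lemma shuffle_assoc:
  assumes "A \<in> Obj C" "B \<in> Obj C" "D \<in> Obj C" "X \<in> Obj C" "Y \<in> Obj C" "Z \<in> Obj C"
  shows "(ide C A \<boxtimes> \<sigma> B X \<boxtimes> ide C (Y \<otimes> D \<otimes> Z)) \<cdot> (ide C (A \<otimes> B) \<boxtimes> \<sigma> D (X \<otimes> Y) \<boxtimes> ide C Z) =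
    (ide C (A \<otimes> X \<otimes> B) \<boxtimes> \<sigma> D Y \<boxtimes> ide C Z) \<cdot> (ide C A \<boxtimes> \<sigma> (B \<otimes> D) X \<boxtimes> ide C (Y \<otimes> Z))"
proof -
  interpret L: labelled_smc C "pick \<one> [A, B, D, X, Y, Z]" by (rule labelled_pick) (use assms in auto)
  show ?thesis
    using assms L.perm_block[of "[0]" "[1]" "[3]" "[4, 2, 5]"] L.perm_block[of "[0, 1]" "[2]" "[3, 4]" "[5]"]
      L.perm_block[of "[0, 3, 1]" "[2]" "[4]" "[5]"] L.perm_block[of "[0]" "[1, 2]" "[3]" "[4, 5]"]
      L.perm_comp[of "[0, 1, 2, 3, 4, 5]" "[0, 1, 3, 4, 2, 5]" "[0, 3, 1, 4, 2, 5]"]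
      L.perm_comp[of "[0, 1, 2, 3, 4, 5]" "[0, 3, 1, 2, 4, 5]" "[0, 3, 1, 4, 2, 5]"]
    by (simp add: rearr_def insert_commute)
qed

text \<open>For the interchange law: the moves of parameters past inputs on the two sides differ by
  the exchange of the middle parameters \<open>A\<close> and \<open>B'\<close>.\<close>

lemma shuffle_comp:
  assumes "A \<in> Obj C" "B \<in> Obj C" "X \<in> Obj C" "A' \<in> Obj C" "B' \<in> Obj C" "X' \<in> Obj C"
  shows "(ide C B \<boxtimes> \<sigma> B' (A \<otimes> X) \<boxtimes> ide C (A' \<otimes> X')) \<cdot> ((ide C (B \<otimes> B' \<otimes> A) \<boxtimes> \<sigma> A' X \<boxtimes> ide C X') \<cdot> (ide C B \<boxtimes> \<sigma> A B' \<boxtimes> ide C (A' \<otimes> X \<otimes> X'))) =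
    ide C (B \<otimes> A) \<boxtimes> \<sigma> (B' \<otimes> A') X \<boxtimes> ide C X'"
proof -
  interpret L: labelled_smc C "pick \<one> [B, A, B', A', X, X']" by (rule labelled_pick) (use assms in auto)
  show ?thesis
    using assms L.perm_block[of "[0]" "[2]" "[1, 4]" "[3, 5]"] L.perm_block[of "[0, 2, 1]" "[3]" "[4]" "[5]"]
      L.perm_block[of "[0]" "[1]" "[2]" "[3, 4, 5]"] L.perm_block[of "[0, 1]" "[2, 3]" "[4]" "[5]"]
      L.perm_comp[of "[0, 1, 2, 3, 4, 5]" "[0, 2, 1, 3, 4, 5]" "[0, 2, 1, 4, 3, 5]"]
      L.perm_comp[of "[0, 1, 2, 3, 4, 5]" "[0, 2, 1, 4, 3, 5]" "[0, 1, 4, 2, 3, 5]"]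
    by (simp add: rearr_def insert_commute)
qed

text \<open>For naturality of the symmetry: exchanging two parameter-input pairs is the same as
  exchanging parameters and inputs separately.\<close>

lemma shuffle_symm:
  assumes "A \<in> Obj C" "B \<in> Obj C" "X \<in> Obj C" "Y \<in> Obj C"
  shows "\<sigma> (A \<otimes> X) (B \<otimes> Y) \<cdot> (ide C A \<boxtimes> \<sigma> B X \<boxtimes> ide C Y) =
    (ide C B \<boxtimes> \<sigma> A Y \<boxtimes> ide C X) \<cdot> ((ide C (B \<otimes> A) \<boxtimes> \<sigma> X Y) \<cdot> (\<sigma> A B \<boxtimes> ide C (X \<otimes> Y)))"
proof -
  interpret L: labelled_smc C "pick \<one> [A, B, X, Y]" by (rule labelled_pick) (use assms in auto)
  show ?thesis
    using assms L.perm_block[of "[]" "[0, 2]" "[1, 3]" "[]"] L.perm_block[of "[0]" "[1]" "[2]" "[3]"]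
      L.perm_block[of "[1]" "[0]" "[3]" "[2]"] L.perm_block[of "[1, 0]" "[2]" "[3]" "[]"] L.perm_block[of "[]" "[0]" "[1]" "[2, 3]"]
      L.perm_comp[of "[0, 1, 2, 3]" "[0, 2, 1, 3]" "[1, 3, 0, 2]"]
      L.perm_comp[of "[0, 1, 2, 3]" "[1, 0, 2, 3]" "[1, 0, 3, 2]"]
      L.perm_comp[of "[0, 1, 2, 3]" "[1, 0, 3, 2]" "[1, 3, 0, 2]"]
    by (simp add: rearr_def insert_commute)
qed

end

context lax_functor
begin

text \<open>Reassociation puts the middle pair next to each other, where the symmetry axiom
  exchanges it.\<close>

lemma lmult_middle_four:
  assumes "A \<in> Obj M" "B \<in> Obj M" "A' \<in> Obj M" "B' \<in> Obj M" "p \<in> lset P A" "q \<in> lset P B" "p' \<in> lset P A'" "q' \<in> lset P B'"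
  shows "lact P (ide M A \<boxtimes> \<sigma> B A' \<boxtimes> ide M B') (lmult P (A \<otimes> B) (A' \<otimes> B') (lmult P A B p q) (lmult P A' B' p' q')) =
    lmult P (A \<otimes> A') (B \<otimes> B') (lmult P A A' p p') (lmult P B B' q q')"
proof -
  note c = lmult_closed
  \<comment> \<open>The bracketing with the middle pair innermost, used in both directions.\<close>
  have s: "lmult P (X \<otimes> Y) (Z \<otimes> W) (lmult P X Y x y) (lmult P Z W z w) =
      lmult P X (Y \<otimes> Z \<otimes> W) x (lmult P (Y \<otimes> Z) W (lmult P Y Z y z) w)"
    if "X \<in> Obj M" "Y \<in> Obj M" "Z \<in> Obj M" "W \<in> Obj M" "x \<in> lset P X" "y \<in> lset P Y" "z \<in> lset P Z" "w \<in> lset P W" for X Y Z W x y z w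
    using that c by (simp add: lmult_assoc)
  have "lact P (\<sigma> B A' \<boxtimes> ide M B') (lmult P (B \<otimes> A') B' (lmult P B A' q p') q') = lmult P (A' \<otimes> B) B' (lmult P A' B p' q) q'"
    using lmult_natural[OF symm_hom[of B A'] ide_hom[of B'], of "lmult P B A' q p'" q'] assms c by (simp add: lmult_symm act_ide)
  moreover have "lact P (ide M A \<boxtimes> (\<sigma> B A' \<boxtimes> ide M B')) (lmult P A (B \<otimes> A' \<otimes> B') p (lmult P (B \<otimes> A') B' (lmult P B A' q p') q')) =
      lmult P A (A' \<otimes> B \<otimes> B') p (lact P (\<sigma> B A' \<boxtimes> ide M B') (lmult P (B \<otimes> A') B' (lmult P B A' q p') q'))"
    using lmult_natural[OF ide_hom[of A] arr_hom[of "\<sigma> B A' \<boxtimes> ide M B'"], of p "lmult P (B \<otimes> A') B' (lmult P B A' q p') q'"]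
      assms c[of "B \<otimes> A'" B' "lmult P B A' q p'" q'] c[of B A' q p'] by (simp add: act_ide)
  ultimately show ?thesis using assms by (simp add: s)
qed

end

section \<open>The compact category of a lax monoidal functor\<close>

locale lax_on_compact = dualised C + lax_functor C P for C :: "('o, 'a, 'm) smc_scheme" (structure) and P :: "('o, 'a, 's) lax" +
  fixes k :: "'o \<times> 's \<times> 'o \<Rightarrow> 's"
  assumes k: "inj k"
begin

text \<open>
  \<open>val A X f p\<close> is the image in \<open>P (Y \<otimes> X\<^sup>*)\<close> of the class of \<open>(p, f)\<close> in the coend over \<open>A\<close> of
  \<open>P A \<times> C(A \<otimes> X, Y)\<close>. So operations on \<open>P (Y \<otimes> X\<^sup>*)\<close> can be computed on arbitrary representatives.
\<close>

definition "Hs X Y = lset P (Y \<otimes> ds X)"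
definition "val A X f p = lact P (hat A X f) p"

lemma hat_hom: "\<lbrakk>A \<in> Obj C; X \<in> Obj C; f \<in> hom C (A \<otimes> X) Y\<rbrakk> \<Longrightarrow> hat A X f \<in> hom C A (Y \<otimes> ds X)"
  by (simp add: hom_iff)

lemma val_closed: "\<lbrakk>A \<in> Obj C; X \<in> Obj C; f \<in> hom C (A \<otimes> X) Y; p \<in> lset P A\<rbrakk> \<Longrightarrow> val A X f p \<in> Hs X Y"
  using act_closed[OF hat_hom] by (simp add: val_def Hs_def)

text \<open>The coend relation: an arrow \<open>a\<close> acting on the element may instead be
  composed into the arrow. It holds because transposition is natural.\<close>

lemma val_step:
  assumes "A \<in> Obj C" "X \<in> Obj C" "f \<in> hom C (A \<otimes> X) Y" "a \<in> hom C A' A" "p \<in> lset P A'"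
  shows "val A X f (lact P a p) = val A' X (f \<cdot> (a \<boxtimes> ide C X)) p"
  using act_comp[OF hat_hom[OF assms(1-3)] assms(4,5)] hat_step[of A X f a A'] assms homD[OF assms(3)] homD[OF assms(4)]
  by (simp add: val_def)

lemma val_can: "\<lbrakk>X \<in> Obj C; Y \<in> Obj C; q \<in> Hs X Y\<rbrakk> \<Longrightarrow> val (Y \<otimes> ds X) X (can X Y) q = q"
  by (simp add: val_def hat_can act_ide Hs_def)

lemma valE:
  assumes "q \<in> Hs X Y" "X \<in> Obj C" "Y \<in> Obj C"
  obtains A f p where "A \<in> Obj C" "f \<in> hom C (A \<otimes> X) Y" "p \<in> lset P A" "q = val A X f p"
  using that[of "Y \<otimes> ds X" "can X Y" q] assms val_can[of X Y q] by (simp add: hom_iff Hs_def)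

text \<open>The composition formula of \<open>val_comp\<close>, taken at the canonical
  representatives of both elements, whose arrows are evaluations.\<close>

definition "cs X Y Z q' q = val (Z \<otimes> ds Y \<otimes> Y \<otimes> ds X) X (can Y Z \<cdot> (ide C (Z \<otimes> ds Y) \<boxtimes> can X Y)) (lmult P (Z \<otimes> ds Y) (Y \<otimes> ds X) q' q)"

text \<open>Composition is well defined on coend classes. The elements are images of
  \<open>p\<close> and \<open>q\<close> under transposes; \<open>val_step\<close> moves these
  transposes into the arrow, where the evaluations cancel them.\<close>

lemma cs_val:
  assumes o: "A \<in> Obj C" "B \<in> Obj C" "X \<in> Obj C" and f: "f \<in> hom C (A \<otimes> X) Y" and g: "g \<in> hom C (B \<otimes> Y) Z"
    and p: "p \<in> lset P A" "q \<in> lset P B"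
  shows "cs X Y Z (val B Y g q) (val A X f p) = val (B \<otimes> A) X (g \<cdot> (ide C B \<boxtimes> f)) (lmult P B A q p)"
proof -
  note h = o homD[OF f] homD[OF g]
  let ?a = "hat A X f" and ?b = "hat B Y g"
  have a: "?a \<in> hom C A (Y \<otimes> ds X)" and b: "?b \<in> hom C B (Z \<otimes> ds Y)" using h by (simp_all add: hom_iff)
  have ba: "?b \<boxtimes> ?a \<in> hom C (B \<otimes> A) (Z \<otimes> ds Y \<otimes> Y \<otimes> ds X)" using tarr_closed[OF b a] h by simp
  have v: "can Y Z \<cdot> (ide C (Z \<otimes> ds Y) \<boxtimes> can X Y) \<in> hom C ((Z \<otimes> ds Y \<otimes> Y \<otimes> ds X) \<otimes> X) Z" using h by (simp add: hom_iff)
  have "(ide C (Z \<otimes> ds Y) \<boxtimes> can X Y) \<cdot> (?b \<boxtimes> (?a \<boxtimes> ide C X)) = (?b \<boxtimes> ide C Y) \<cdot> (ide C B \<boxtimes> f)"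
    using h by (simp add: tarr_comp can_hat del: tarr_simps)
  then have "(can Y Z \<cdot> (ide C (Z \<otimes> ds Y) \<boxtimes> can X Y)) \<cdot> ((?b \<boxtimes> ?a) \<boxtimes> ide C X) = can Y Z \<cdot> ((?b \<boxtimes> ide C Y) \<cdot> (ide C B \<boxtimes> f))"
    using h by (simp add: comp_assoc)
  also have "\<dots> = (can Y Z \<cdot> (?b \<boxtimes> ide C Y)) \<cdot> (ide C B \<boxtimes> f)"
    using h by (intro comp_assoc[symmetric]) simp_all
  finally have e: "(can Y Z \<cdot> (ide C (Z \<otimes> ds Y) \<boxtimes> can X Y)) \<cdot> ((?b \<boxtimes> ?a) \<boxtimes> ide C X) = g \<cdot> (ide C B \<boxtimes> f)"
    using h by (simp add: can_hat)
  show ?thesis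
    unfolding e[symmetric]
    using val_step[OF _ _ v ba lmult_closed[OF o(2,1) p(2,1)]] lmult_natural[OF b a p(2,1)] h
    by (simp add: cs_def) (simp add: val_def)
qed

definition "ts X Y X' Y' q q' = val (Y \<otimes> ds X \<otimes> Y' \<otimes> ds X') (X \<otimes> X')
  ((can X Y \<boxtimes> can X' Y') \<cdot> (ide C (Y \<otimes> ds X) \<boxtimes> \<sigma> (Y' \<otimes> ds X') X \<boxtimes> ide C X')) (lmult P (Y \<otimes> ds X) (Y' \<otimes> ds X') q q')"

text \<open>As for composition, with one more ingredient: naturality slides the second transpose
  through the symmetry that passes \<open>X\<close>.\<close>

lemma ts_val:
  assumes o: "A \<in> Obj C" "A' \<in> Obj C" "X \<in> Obj C" "X' \<in> Obj C" and f: "f \<in> hom C (A \<otimes> X) Y" and f': "f' \<in> hom C (A' \<otimes> X') Y'"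
    and p: "p \<in> lset P A" "p' \<in> lset P A'"
  shows "ts X Y X' Y' (val A X f p) (val A' X' f' p') =
    val (A \<otimes> A') (X \<otimes> X') ((f \<boxtimes> f') \<cdot> (ide C A \<boxtimes> \<sigma> A' X \<boxtimes> ide C X')) (lmult P A A' p p')"
proof -
  note h = o homD[OF f] homD[OF f']
  let ?a = "hat A X f" and ?b = "hat A' X' f'" and ?Q = "Y \<otimes> ds X" and ?Q' = "Y' \<otimes> ds X'"
  let ?v = "(can X Y \<boxtimes> can X' Y') \<cdot> (ide C ?Q \<boxtimes> \<sigma> ?Q' X \<boxtimes> ide C X')"
  have a: "?a \<in> hom C A ?Q" and b: "?b \<in> hom C A' ?Q'" using h by (simp_all add: hom_iff)
  have ba: "?a \<boxtimes> ?b \<in> hom C (A \<otimes> A') (Y \<otimes> ds X \<otimes> ?Q')" using tarr_closed[OF a b] h by simp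
  have v: "?v \<in> hom C ((Y \<otimes> ds X \<otimes> ?Q') \<otimes> (X \<otimes> X')) (Y \<otimes> Y')" using h by (simp add: hom_iff)
  have 1: "\<sigma> ?Q' X \<cdot> (?b \<boxtimes> ide C X) = (ide C X \<boxtimes> ?b) \<cdot> \<sigma> A' X"
    using symm_nat[of ?b "ide C X" ?Q' X] h by simp
  have "(ide C ?Q \<boxtimes> (\<sigma> ?Q' X \<boxtimes> ide C X')) \<cdot> (?a \<boxtimes> ((?b \<boxtimes> ide C X) \<boxtimes> ide C X')) = (?a \<boxtimes> ((ide C X \<boxtimes> ?b) \<boxtimes> ide C X')) \<cdot> (ide C A \<boxtimes> (\<sigma> A' X \<boxtimes> ide C X'))"
    using h by (simp add: tarr_comp 1 del: tarr_simps)
  then have 2: "(ide C ?Q \<boxtimes> \<sigma> ?Q' X \<boxtimes> ide C X') \<cdot> ((?a \<boxtimes> ?b) \<boxtimes> ide C (X \<otimes> X')) = ((?a \<boxtimes> ide C X) \<boxtimes> (?b \<boxtimes> ide C X')) \<cdot> (ide C A \<boxtimes> \<sigma> A' X \<boxtimes> ide C X')"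
    using h by simp
  have 3: "(can X Y \<boxtimes> can X' Y') \<cdot> ((?a \<boxtimes> ide C X) \<boxtimes> (?b \<boxtimes> ide C X')) = f \<boxtimes> f'"
    using h by (simp add: tarr_comp can_hat del: tarr_simps)
  have "?v \<cdot> ((?a \<boxtimes> ?b) \<boxtimes> ide C (X \<otimes> X')) = (can X Y \<boxtimes> can X' Y') \<cdot> (((?a \<boxtimes> ide C X) \<boxtimes> (?b \<boxtimes> ide C X')) \<cdot> (ide C A \<boxtimes> \<sigma> A' X \<boxtimes> ide C X'))"
    unfolding 2[symmetric] using h by (intro comp_assoc) simp_all
  also have "\<dots> = (f \<boxtimes> f') \<cdot> (ide C A \<boxtimes> \<sigma> A' X \<boxtimes> ide C X')"
    unfolding 3[symmetric] using h by (intro comp_assoc[symmetric]) simp_all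
  finally have e: "?v \<cdot> ((?a \<boxtimes> ?b) \<boxtimes> ide C (X \<otimes> X')) = (f \<boxtimes> f') \<cdot> (ide C A \<boxtimes> \<sigma> A' X \<boxtimes> ide C X')" .
  show ?thesis
    unfolding e[symmetric]
    using val_step[OF _ _ v ba lmult_closed[OF o(1,2) p]] lmult_natural[OF a b p] h
    by (simp add: ts_def) (simp add: val_def)
qed

text \<open>The class of \<open>f\<close> with the unit object as parameter and the unit element;
  this will be the functor on arrows.\<close>

definition "fn X f = val \<one> X f (lunit P)"

lemma fn_closed: "f \<in> hom C X Y \<Longrightarrow> fn X f \<in> Hs X Y"
  using val_closed[of "\<one>" X f Y] homD[of f X Y] lunit_closed by (simp add: fn_def)

lemma fn_comp:
  assumes "f \<in> hom C X Y" "g \<in> hom C Y Z" shows "cs X Y Z (fn Y g) (fn X f) = fn X (g \<cdot> f)"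
  using cs_val[of \<one> \<one> X f Y g Z] homD[OF assms(1)] homD[OF assms(2)] assms lunit_closed by (simp add: fn_def lmult_unit)

lemma fn_tensor:
  assumes "f \<in> hom C X Y" "g \<in> hom C X' Y'" shows "ts X Y X' Y' (fn X f) (fn X' g) = fn (X \<otimes> X') (f \<boxtimes> g)"
  using ts_val[of \<one> \<one> X X' f Y g Y'] homD[OF assms(1)] homD[OF assms(2)] assms lunit_closed by (simp add: fn_def lmult_unit)

lemma cs_closed: "\<lbrakk>X \<in> Obj C; Y \<in> Obj C; Z \<in> Obj C; q \<in> Hs X Y; q' \<in> Hs Y Z\<rbrakk> \<Longrightarrow> cs X Y Z q' q \<in> Hs X Z"
  unfolding cs_def by (rule val_closed) (use lmult_closed[of "Z \<otimes> ds Y" "Y \<otimes> ds X" q' q] in \<open>simp_all add: hom_iff Hs_def\<close>)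

lemma ts_closed: "\<lbrakk>X \<in> Obj C; Y \<in> Obj C; X' \<in> Obj C; Y' \<in> Obj C; q \<in> Hs X Y; q' \<in> Hs X' Y'\<rbrakk> \<Longrightarrow> ts X Y X' Y' q q' \<in> Hs (X \<otimes> X') (Y \<otimes> Y')"
  unfolding ts_def
  by (rule val_closed) (use lmult_closed[of "Y \<otimes> ds X" "Y' \<otimes> ds X'" q q'] in \<open>simp_all add: hom_iff Hs_def\<close>)

text \<open>For laws on arbitrary elements representatives are chosen, and \<open>cs_val\<close> and
  \<open>ts_val\<close> turn both sides into values of \<open>val\<close>. It remains to compare two
  arrows of \<open>C\<close> and two products of elements; a difference in the order of the factors
  is carried from one to the other by \<open>val_step\<close>.\<close>

sublocale S: arrow_family C k Hs "\<lambda>X. fn X (ide C X)" cs ts "\<lambda>X Y. fn (X \<otimes> Y) (\<sigma> X Y)"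
proof (unfold_locales, goal_cases)
  case 1 show ?case by (rule k)
next
  case (2 X) then show ?case by (intro fn_closed ide_hom)
next
  case (3 X Y Z f g) then show ?case by (intro cs_closed)
next
  case (4 X Y q)
  from 4(3,1,2) show ?case
  proof (rule valE)
    fix A f p assume a: "A \<in> Obj C" "f \<in> hom C (A \<otimes> X) Y" "p \<in> lset P A" and q: "q = val A X f p"
    show ?thesis
      using cs_val[OF a(1) unit_obj 4(1) a(2) _ a(3) lunit_closed, of "ide C Y"] homD[OF a(2)] a 4
      by (simp add: q fn_def lmult_unit hom_iff)
  qed
next
  case (5 X Y q)
  from 5(3,1,2) show ?case
  proof (rule valE)
    fix A f p assume a: "A \<in> Obj C" "f \<in> hom C (A \<otimes> X) Y" "p \<in> lset P A" and q: "q = val A X f p"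
    show ?thesis
      using cs_val[OF unit_obj a(1) 5(1) _ a(2) lunit_closed a(3), of "ide C X"] homD[OF a(2)] a 5
      by (simp add: q fn_def lmult_unit hom_iff)
  qed
next
  case (6 W X Y Z q q' q'')
  obtain A f p where a: "A \<in> Obj C" "f \<in> hom C (A \<otimes> W) X" "p \<in> lset P A" "q = val A W f p" using 6 by (auto elim: valE)
  obtain A' f' p' where a': "A' \<in> Obj C" "f' \<in> hom C (A' \<otimes> X) Y" "p' \<in> lset P A'" "q' = val A' X f' p'" using 6 by (auto elim: valE)
  obtain A'' f'' p'' where a'': "A'' \<in> Obj C" "f'' \<in> hom C (A'' \<otimes> Y) Z" "p'' \<in> lset P A''" "q'' = val A'' Y f'' p''" using 6 by (auto elim: valE)
  note h = 6 a a' a'' homD[OF a(2)] homD[OF a'(2)] homD[OF a''(2)]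
  have e: "f'' \<cdot> (ide C A'' \<boxtimes> (f' \<cdot> (ide C A' \<boxtimes> f))) = (f'' \<cdot> (ide C A'' \<boxtimes> f')) \<cdot> (ide C (A'' \<otimes> A') \<boxtimes> f)"
  proof -
    have "ide C A'' \<boxtimes> (f' \<cdot> (ide C A' \<boxtimes> f)) = (ide C A'' \<boxtimes> f') \<cdot> (ide C A'' \<boxtimes> (ide C A' \<boxtimes> f))"
      using h by (subst tarr_comp) simp_all
    then show ?thesis using h by (simp add: comp_assoc)
  qed
  have 1: "cs W X Y q' q = val (A' \<otimes> A) W (f' \<cdot> (ide C A' \<boxtimes> f)) (lmult P A' A p' p)"
    unfolding a(4) a'(4) using h by (intro cs_val)
  have 2: "cs X Y Z q'' q' = val (A'' \<otimes> A') X (f'' \<cdot> (ide C A'' \<boxtimes> f')) (lmult P A'' A' p'' p')"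
    unfolding a'(4) a''(4) using h by (intro cs_val)
  have g: "f' \<cdot> (ide C A' \<boxtimes> f) \<in> hom C ((A' \<otimes> A) \<otimes> W) Y" "f'' \<cdot> (ide C A'' \<boxtimes> f') \<in> hom C ((A'' \<otimes> A') \<otimes> X) Z"
    using h by (simp_all add: hom_iff)
  note m = lmult_closed[OF a'(1) a(1) a'(3) a(3)] lmult_closed[OF a''(1) a'(1) a''(3) a'(3)]
  have "cs W Y Z q'' (cs W X Y q' q) = val (A'' \<otimes> A' \<otimes> A) W (f'' \<cdot> (ide C A'' \<boxtimes> (f' \<cdot> (ide C A' \<boxtimes> f)))) (lmult P A'' (A' \<otimes> A) p'' (lmult P A' A p' p))"
    unfolding 1 a''(4) using h g m by (intro cs_val) simp_all
  also have "\<dots> = val ((A'' \<otimes> A') \<otimes> A) W ((f'' \<cdot> (ide C A'' \<boxtimes> f')) \<cdot> (ide C (A'' \<otimes> A') \<boxtimes> f)) (lmult P (A'' \<otimes> A') A (lmult P A'' A' p'' p') p)"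
    unfolding e using h by (simp add: lmult_assoc)
  also have "\<dots> = cs W X Z (cs X Y Z q'' q') q"
    unfolding 2 a(4) using h g m by (intro cs_val[symmetric]) simp_all
  finally show ?case .
next
  case 7 then show ?case by (intro ts_closed)
next
  case (8 X Y) then show ?case by (simp add: fn_tensor ide_hom)
next
  case (9 X Y Z X' Y' Z' q r q' r')
  obtain A f p where a: "A \<in> Obj C" "f \<in> hom C (A \<otimes> X) Y" "p \<in> lset P A" "q = val A X f p" using 9 by (auto elim: valE)
  obtain B g s where b: "B \<in> Obj C" "g \<in> hom C (B \<otimes> Y) Z" "s \<in> lset P B" "r = val B Y g s" using 9 by (auto elim: valE)
  obtain A' f' p' where a': "A' \<in> Obj C" "f' \<in> hom C (A' \<otimes> X') Y'" "p' \<in> lset P A'" "q' = val A' X' f' p'" using 9 by (auto elim: valE)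
  obtain B' g' s' where b': "B' \<in> Obj C" "g' \<in> hom C (B' \<otimes> Y') Z'" "s' \<in> lset P B'" "r' = val B' Y' g' s'" using 9 by (auto elim: valE)
  note h = 9(1-6) a(1,3) a'(1,3) b(1,3) b'(1,3) homD[OF a(2)] homD[OF b(2)] homD[OF a'(2)] homD[OF b'(2)]
  \<comment> \<open>The left side has the elements in the order \<open>s, p, s', p'\<close>, the
    right side in the order \<open>s, s', p, p'\<close>. The exchange of the middle parameters acts
    on the product by \<open>lmult_middle_four\<close> and on the arrow by composition.\<close>
  let ?u = "ide C B \<boxtimes> \<sigma> A B' \<boxtimes> ide C A'"
  let ?v = "((g \<boxtimes> g') \<cdot> (ide C B \<boxtimes> \<sigma> B' Y \<boxtimes> ide C Y')) \<cdot> (ide C (B \<otimes> B') \<boxtimes> ((f \<boxtimes> f') \<cdot> (ide C A \<boxtimes> \<sigma> A' X \<boxtimes> ide C X')))"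
  \<comment> \<open>Naturality carries \<open>f\<close> through the symmetry, so that all arrows
    stand on one side and only a permutation is left for \<open>shuffle_comp\<close>.\<close>
  have "(ide C B \<boxtimes> (\<sigma> B' Y \<boxtimes> ide C Y')) \<cdot> (ide C B \<boxtimes> ((ide C B' \<boxtimes> f) \<boxtimes> f')) = (ide C B \<boxtimes> (f \<boxtimes> ide C B') \<boxtimes> f') \<cdot> (ide C B \<boxtimes> (\<sigma> B' (A \<otimes> X) \<boxtimes> ide C (A' \<otimes> X')))"
    using h symm_nat[of "ide C B'" f B' Y] by (simp add: tarr_comp del: tarr_simps ide_tarr)
  then have 1: "(ide C B \<boxtimes> \<sigma> B' Y \<boxtimes> ide C Y') \<cdot> (ide C (B \<otimes> B') \<boxtimes> (f \<boxtimes> f')) = ((ide C B \<boxtimes> f) \<boxtimes> (ide C B' \<boxtimes> f')) \<cdot> (ide C B \<boxtimes> \<sigma> B' (A \<otimes> X) \<boxtimes> ide C (A' \<otimes> X'))"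
    using h by simp
  have 2: "ide C (B \<otimes> B') \<boxtimes> ((f \<boxtimes> f') \<cdot> (ide C A \<boxtimes> \<sigma> A' X \<boxtimes> ide C X')) = (ide C (B \<otimes> B') \<boxtimes> (f \<boxtimes> f')) \<cdot> (ide C (B \<otimes> B' \<otimes> A) \<boxtimes> \<sigma> A' X \<boxtimes> ide C X')"
    using h tarr_comp[of "ide C (B \<otimes> B')" "ide C (B \<otimes> B')" "ide C A \<boxtimes> \<sigma> A' X \<boxtimes> ide C X'" "f \<boxtimes> f'"] by simp
  have "?v \<cdot> (?u \<boxtimes> ide C (X \<otimes> X')) = (g \<boxtimes> g') \<cdot> (((ide C B \<boxtimes> \<sigma> B' Y \<boxtimes> ide C Y') \<cdot> (ide C (B \<otimes> B') \<boxtimes> (f \<boxtimes> f'))) \<cdot>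
      ((ide C (B \<otimes> B' \<otimes> A) \<boxtimes> \<sigma> A' X \<boxtimes> ide C X') \<cdot> (ide C B \<boxtimes> \<sigma> A B' \<boxtimes> ide C (A' \<otimes> X \<otimes> X'))))"
    unfolding 2 using h by (simp add: comp_assoc)
  also have "\<dots> = ((g \<boxtimes> g') \<cdot> ((ide C B \<boxtimes> f) \<boxtimes> (ide C B' \<boxtimes> f'))) \<cdot> ((ide C B \<boxtimes> \<sigma> B' (A \<otimes> X) \<boxtimes> ide C (A' \<otimes> X')) \<cdot>
      ((ide C (B \<otimes> B' \<otimes> A) \<boxtimes> \<sigma> A' X \<boxtimes> ide C X') \<cdot> (ide C B \<boxtimes> \<sigma> A B' \<boxtimes> ide C (A' \<otimes> X \<otimes> X'))))"
    unfolding 1 using h by (simp add: comp_assoc)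
  also have "\<dots> = ((g \<cdot> (ide C B \<boxtimes> f)) \<boxtimes> (g' \<cdot> (ide C B' \<boxtimes> f'))) \<cdot> (ide C (B \<otimes> A) \<boxtimes> \<sigma> (B' \<otimes> A') X \<boxtimes> ide C X')"
    using h by (subst shuffle_comp) (simp_all add: tarr_comp del: tarr_simps)
  finally have e: "?v \<cdot> (?u \<boxtimes> ide C (X \<otimes> X')) = ((g \<cdot> (ide C B \<boxtimes> f)) \<boxtimes> (g' \<cdot> (ide C B' \<boxtimes> f'))) \<cdot> (ide C (B \<otimes> A) \<boxtimes> \<sigma> (B' \<otimes> A') X \<boxtimes> ide C X')" .
  have c: "cs X Y Z r q = val (B \<otimes> A) X (g \<cdot> (ide C B \<boxtimes> f)) (lmult P B A s p)" "cs X' Y' Z' r' q' = val (B' \<otimes> A') X' (g' \<cdot> (ide C B' \<boxtimes> f')) (lmult P B' A' s' p')"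
    unfolding a(4) b(4) a'(4) b'(4) using h a b a' b' by (intro cs_val; simp)+
  have t: "ts X Y X' Y' q q' = val (A \<otimes> A') (X \<otimes> X') ((f \<boxtimes> f') \<cdot> (ide C A \<boxtimes> \<sigma> A' X \<boxtimes> ide C X')) (lmult P A A' p p')"
    "ts Y Z Y' Z' r r' = val (B \<otimes> B') (Y \<otimes> Y') ((g \<boxtimes> g') \<cdot> (ide C B \<boxtimes> \<sigma> B' Y \<boxtimes> ide C Y')) (lmult P B B' s s')"
    unfolding a(4) b(4) a'(4) b'(4) using h a b a' b' by (intro ts_val; simp)+
  have m: "lmult P B A s p \<in> lset P (B \<otimes> A)" "lmult P B' A' s' p' \<in> lset P (B' \<otimes> A')" "lmult P A A' p p' \<in> lset P (A \<otimes> A')" "lmult P B B' s s' \<in> lset P (B \<otimes> B')"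
    using h by (simp_all add: lmult_closed)
  have u: "?u \<in> hom C ((B \<otimes> A) \<otimes> B' \<otimes> A') ((B \<otimes> B') \<otimes> A \<otimes> A')" and v: "?v \<in> hom C (((B \<otimes> B') \<otimes> A \<otimes> A') \<otimes> (X \<otimes> X')) (Z \<otimes> Z')"
    using h by (simp_all add: hom_iff)
  have "ts X Z X' Z' (cs X Y Z r q) (cs X' Y' Z' r' q') = val ((B \<otimes> A) \<otimes> B' \<otimes> A') (X \<otimes> X')
      (((g \<cdot> (ide C B \<boxtimes> f)) \<boxtimes> (g' \<cdot> (ide C B' \<boxtimes> f'))) \<cdot> (ide C (B \<otimes> A) \<boxtimes> \<sigma> (B' \<otimes> A') X \<boxtimes> ide C X')) (lmult P (B \<otimes> A) (B' \<otimes> A') (lmult P B A s p) (lmult P B' A' s' p'))"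
    unfolding c using h m by (intro ts_val) (simp_all add: hom_iff)
  also have "\<dots> = val ((B \<otimes> B') \<otimes> A \<otimes> A') (X \<otimes> X') ?v (lmult P (B \<otimes> B') (A \<otimes> A') (lmult P B B' s s') (lmult P A A' p p'))"
    unfolding e[symmetric] using lmult_middle_four[of B A B' A' s p s' p'] lmult_closed[of "B \<otimes> A" "B' \<otimes> A'" "lmult P B A s p" "lmult P B' A' s' p'"] h m
    by (subst val_step[OF _ _ v u, symmetric]) simp_all
  also have "\<dots> = cs (X \<otimes> X') (Y \<otimes> Y') (Z \<otimes> Z') (ts Y Z Y' Z' r r') (ts X Y X' Y' q q')"
    unfolding t using h m by (intro cs_val[symmetric]) (simp_all add: hom_iff)
  finally show ?case .
next
  case (10 X Y X' Y' X'' Y'' q q' q'')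
  obtain A f p where a: "A \<in> Obj C" "f \<in> hom C (A \<otimes> X) Y" "p \<in> lset P A" "q = val A X f p" using 10 by (auto elim: valE)
  obtain A' f' p' where a': "A' \<in> Obj C" "f' \<in> hom C (A' \<otimes> X') Y'" "p' \<in> lset P A'" "q' = val A' X' f' p'" using 10 by (auto elim: valE)
  obtain A'' f'' p'' where a'': "A'' \<in> Obj C" "f'' \<in> hom C (A'' \<otimes> X'') Y''" "p'' \<in> lset P A''" "q'' = val A'' X'' f'' p''" using 10 by (auto elim: valE)
  note h = 10(1-6) a(1,3) a'(1,3) a''(1,3) homD[OF a(2)] homD[OF a'(2)] homD[OF a''(2)]
  let ?l = "(((f \<boxtimes> f') \<cdot> (ide C A \<boxtimes> \<sigma> A' X \<boxtimes> ide C X')) \<boxtimes> f'') \<cdot> (ide C (A \<otimes> A') \<boxtimes> \<sigma> A'' (X \<otimes> X') \<boxtimes> ide C X'')"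
  let ?r = "(f \<boxtimes> ((f' \<boxtimes> f'') \<cdot> (ide C A' \<boxtimes> \<sigma> A'' X' \<boxtimes> ide C X''))) \<cdot> (ide C A \<boxtimes> \<sigma> (A' \<otimes> A'') X \<boxtimes> ide C (X' \<otimes> X''))"
  have "((f \<boxtimes> f') \<cdot> (ide C A \<boxtimes> \<sigma> A' X \<boxtimes> ide C X')) \<boxtimes> f'' = (f \<boxtimes> f' \<boxtimes> f'') \<cdot> (ide C A \<boxtimes> \<sigma> A' X \<boxtimes> ide C (X' \<otimes> A'' \<otimes> X''))"
    using h tarr_comp[of "ide C A \<boxtimes> \<sigma> A' X \<boxtimes> ide C X'" "f \<boxtimes> f'" "ide C (A'' \<otimes> X'')" f''] by simp
  moreover have "f \<boxtimes> ((f' \<boxtimes> f'') \<cdot> (ide C A' \<boxtimes> \<sigma> A'' X' \<boxtimes> ide C X'')) = (f \<boxtimes> f' \<boxtimes> f'') \<cdot> (ide C (A \<otimes> X \<otimes> A') \<boxtimes> \<sigma> A'' X' \<boxtimes> ide C X'')"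
    using h tarr_comp[of "ide C (A \<otimes> X)" f "ide C A' \<boxtimes> \<sigma> A'' X' \<boxtimes> ide C X''" "f' \<boxtimes> f''"] by simp
  ultimately have e: "?l = ?r"
    using h shuffle_assoc[of A A' A'' X X' X''] by (simp add: comp_assoc)
  have t: "ts X Y X' Y' q q' = val (A \<otimes> A') (X \<otimes> X') ((f \<boxtimes> f') \<cdot> (ide C A \<boxtimes> \<sigma> A' X \<boxtimes> ide C X')) (lmult P A A' p p')"
    "ts X' Y' X'' Y'' q' q'' = val (A' \<otimes> A'') (X' \<otimes> X'') ((f' \<boxtimes> f'') \<cdot> (ide C A' \<boxtimes> \<sigma> A'' X' \<boxtimes> ide C X'')) (lmult P A' A'' p' p'')"
    unfolding a(4) a'(4) a''(4) using h a a' a'' by (intro ts_val; simp)+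
  have m: "lmult P A A' p p' \<in> lset P (A \<otimes> A')" "lmult P A' A'' p' p'' \<in> lset P (A' \<otimes> A'')" using h by (simp_all add: lmult_closed)
  have "ts (X \<otimes> X') (Y \<otimes> Y') X'' Y'' (ts X Y X' Y' q q') q'' = val ((A \<otimes> A') \<otimes> A'') ((X \<otimes> X') \<otimes> X'') ?l (lmult P (A \<otimes> A') A'' (lmult P A A' p p') p'')"
    unfolding t a''(4) using h m a by (intro ts_val) (simp_all add: hom_iff)
  also have "\<dots> = val (A \<otimes> A' \<otimes> A'') (X \<otimes> X' \<otimes> X'') ?r (lmult P A (A' \<otimes> A'') p (lmult P A' A'' p' p''))"
    unfolding e using h by (simp add: lmult_assoc)
  also have "\<dots> = ts X Y (X' \<otimes> X'') (Y' \<otimes> Y'') q (ts X' Y' X'' Y'' q' q'')"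
    unfolding t a(4) using h m a by (intro ts_val[symmetric]) (simp_all add: hom_iff)
  finally show ?case .
next
  case (11 X Y q)
  from 11(3,1,2) show ?case
  proof (rule valE)
    fix A f p assume a: "A \<in> Obj C" "f \<in> hom C (A \<otimes> X) Y" "p \<in> lset P A" and q: "q = val A X f p"
    show ?thesis
      using ts_val[OF unit_obj a(1) unit_obj 11(1) _ a(2) lunit_closed a(3), of "ide C \<one>"] homD[OF a(2)] a 11
      by (simp add: q fn_def lmult_unit hom_iff)
  qed
next
  case (12 X Y q)
  from 12(3,1,2) show ?case
  proof (rule valE)
    fix A f p assume a: "A \<in> Obj C" "f \<in> hom C (A \<otimes> X) Y" "p \<in> lset P A" and q: "q = val A X f p"
    show ?thesis
      using ts_val[OF a(1) unit_obj 12(1) unit_obj a(2) _ a(3) lunit_closed, of "ide C \<one>"] homD[OF a(2)] a 12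
      by (simp add: q fn_def lmult_unit hom_iff)
  qed
next
  case 13 then show ?case by (intro fn_closed symm_hom)
next
  case (14 X Y X' Y' q r)
  obtain A f p where a: "A \<in> Obj C" "f \<in> hom C (A \<otimes> X) X'" "p \<in> lset P A" "q = val A X f p" using 14 by (auto elim: valE)
  obtain B g s where b: "B \<in> Obj C" "g \<in> hom C (B \<otimes> Y) Y'" "s \<in> lset P B" "r = val B Y g s" using 14 by (auto elim: valE)
  note h = 14(1-4) a(1,3) b(1,3) homD[OF a(2)] homD[OF b(2)]
  let ?t = "(f \<boxtimes> g) \<cdot> (ide C A \<boxtimes> \<sigma> B X \<boxtimes> ide C Y)" and ?t' = "(g \<boxtimes> f) \<cdot> (ide C B \<boxtimes> \<sigma> A Y \<boxtimes> ide C X)"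
  \<comment> \<open>The symmetry of the results splits into one of the inputs, wanted on the right
    side, and one of the parameters, which \<open>val_step\<close> turns into an exchange of the
    elements \<open>p\<close> and \<open>s\<close>.\<close>
  have "\<sigma> X' Y' \<cdot> ?t = (\<sigma> X' Y' \<cdot> (f \<boxtimes> g)) \<cdot> (ide C A \<boxtimes> \<sigma> B X \<boxtimes> ide C Y)"
    using h by (intro comp_assoc[symmetric]) simp_all
  also have "\<dots> = (g \<boxtimes> f) \<cdot> (\<sigma> (A \<otimes> X) (B \<otimes> Y) \<cdot> (ide C A \<boxtimes> \<sigma> B X \<boxtimes> ide C Y))"
    using h symm_nat[of f g X' Y'] by (simp add: comp_assoc)
  also have "\<dots> = (?t' \<cdot> (ide C (B \<otimes> A) \<boxtimes> \<sigma> X Y)) \<cdot> (\<sigma> A B \<boxtimes> ide C (X \<otimes> Y))"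
    using h by (simp add: shuffle_symm comp_assoc)
  finally have e: "\<sigma> X' Y' \<cdot> ?t = (?t' \<cdot> (ide C (B \<otimes> A) \<boxtimes> \<sigma> X Y)) \<cdot> (\<sigma> A B \<boxtimes> ide C (X \<otimes> Y))" .
  have t: "ts X X' Y Y' q r = val (A \<otimes> B) (X \<otimes> Y) ?t (lmult P A B p s)" "ts Y Y' X X' r q = val (B \<otimes> A) (Y \<otimes> X) ?t' (lmult P B A s p)"
    unfolding a(4) b(4) using h a b by (intro ts_val; simp)+
  have v: "?t' \<cdot> (ide C (B \<otimes> A) \<boxtimes> \<sigma> X Y) \<in> hom C ((B \<otimes> A) \<otimes> X \<otimes> Y) (Y' \<otimes> X')" using h by (simp add: hom_iff)
  have m: "lmult P A B p s \<in> lset P (A \<otimes> B)" "lmult P B A s p \<in> lset P (B \<otimes> A)" using h by (simp_all add: lmult_closed)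
  have "cs (X \<otimes> Y) (X' \<otimes> Y') (Y' \<otimes> X') (fn (X' \<otimes> Y') (\<sigma> X' Y')) (ts X X' Y Y' q r) = val (\<one> \<otimes> A \<otimes> B) (X \<otimes> Y) (\<sigma> X' Y' \<cdot> (ide C \<one> \<boxtimes> ?t)) (lmult P \<one> (A \<otimes> B) (lunit P) (lmult P A B p s))"
    unfolding t fn_def using h m lunit_closed by (intro cs_val) (simp_all add: hom_iff)
  also have "\<dots> = val (A \<otimes> B) (X \<otimes> Y) ((?t' \<cdot> (ide C (B \<otimes> A) \<boxtimes> \<sigma> X Y)) \<cdot> (\<sigma> A B \<boxtimes> ide C (X \<otimes> Y))) (lmult P A B p s)"
    unfolding e[symmetric] using h m by (simp add: lmult_unit)
  also have "\<dots> = val (B \<otimes> A) (X \<otimes> Y) (?t' \<cdot> (ide C (B \<otimes> A) \<boxtimes> \<sigma> X Y)) (lmult P B A s p)"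
    using val_step[OF _ _ v symm_hom[of A B] m(1)] h by (simp add: lmult_symm)
  also have "\<dots> = val ((B \<otimes> A) \<otimes> \<one>) (X \<otimes> Y) (?t' \<cdot> (ide C (B \<otimes> A) \<boxtimes> \<sigma> X Y)) (lmult P (B \<otimes> A) \<one> (lmult P B A s p) (lunit P))"
    using h m by (simp add: lmult_unit)
  also have "\<dots> = cs (X \<otimes> Y) (Y \<otimes> X) (Y' \<otimes> X') (ts Y Y' X X' r q) (fn (X \<otimes> Y) (\<sigma> X Y))"
    unfolding t fn_def using h m lunit_closed by (intro cs_val[symmetric]) (simp_all add: hom_iff)
  finally show ?case .
next
  case (15 X Y) then show ?case by (simp add: fn_comp[OF symm_hom symm_hom] symm_involutive)
next
  case (16 X Y Z)
  have "ts Y Y (X \<otimes> Z) (Z \<otimes> X) (fn Y (ide C Y)) (fn (X \<otimes> Z) (\<sigma> X Z)) = fn (Y \<otimes> X \<otimes> Z) (ide C Y \<boxtimes> \<sigma> X Z)"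
    "ts (X \<otimes> Y) (Y \<otimes> X) Z Z (fn (X \<otimes> Y) (\<sigma> X Y)) (fn Z (ide C Z)) = fn (X \<otimes> Y \<otimes> Z) (\<sigma> X Y \<boxtimes> ide C Z)"
    using 16 by (simp_all add: fn_tensor[OF ide_hom symm_hom] fn_tensor[OF symm_hom ide_hom])
  moreover have "ide C Y \<boxtimes> \<sigma> X Z \<in> hom C (Y \<otimes> X \<otimes> Z) (Y \<otimes> Z \<otimes> X)" "\<sigma> X Y \<boxtimes> ide C Z \<in> hom C (X \<otimes> Y \<otimes> Z) (Y \<otimes> X \<otimes> Z)"
    using 16 by (simp_all add: hom_iff)
  ultimately show ?case using 16 by (simp add: fn_comp symm_hexagon)
qed

definition F :: "('o, 'a, 'o, 's) func" where
  "F = \<lparr> omap = (\<lambda>X\<in>Obj C. X), amap = (\<lambda>f\<in>Arr C. k (Dom C f, fn (Dom C f) f, Cod C f)) \<rparr>"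

lemma F_simps: "X \<in> Obj C \<Longrightarrow> omap F X = X" "f \<in> hom C X Y \<Longrightarrow> amap F f = k (X, fn X f, Y)"
  by (auto simp: F_def hom_iff)

lemma strict_monoidal_functor_F: "strict_monoidal_functor C S.D F"
proof -
  have "is_functor C S.D F"
  proof (rule is_functorI[OF category_axioms])
    fix X assume X: "X \<in> Obj C"
    show "amap F (ide C X) = ide S.D (omap F X)"
      using F_simps(2)[OF ide_hom[OF X]] X by (simp add: F_simps(1))
  next
    fix X Y f assume f: "f \<in> hom C X Y"
    show "amap F f \<in> hom S.D (omap F X) (omap F Y)"
      using F_simps(2)[OF f] homD[OF f] fn_closed[OF f] by (simp add: F_simps(1) S.hom_D)
  next
    fix X Y Z g f assume g: "g \<in> hom C Y Z" and f: "f \<in> hom C X Y"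
    show "amap F (g \<cdot> f) = amap F g \<cdot>\<^bsub>S.D\<^esub> amap F f"
      using F_simps(2)[OF f] F_simps(2)[OF g] F_simps(2)[OF comp_hom[OF g f]] homD[OF f] homD[OF g] fn_closed[OF f] fn_closed[OF g]
      by (simp add: fn_comp[OF f g])
  qed (simp_all add: F_def)
  moreover have "amap F (f \<boxtimes> g) = amap F f \<boxtimes>\<^bsub>S.D\<^esub> amap F g" if "f \<in> Arr C" "g \<in> Arr C" for f g
  proof -
    note f = arr_hom[OF that(1)] and g = arr_hom[OF that(2)]
    show ?thesis
      using F_simps(2)[OF f] F_simps(2)[OF g] F_simps(2)[OF tarr_closed[OF f g]] that fn_closed[OF f] fn_closed[OF g]
      by (simp add: fn_tensor[OF f g])
  qed
  moreover have "amap F (\<sigma> X Y) = \<sigma>\<^bsub>S.D\<^esub> (omap F X) (omap F Y)" if "X \<in> Obj C" "Y \<in> Obj C" for X Y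
    using F_simps(2)[OF symm_hom[OF that]] that by (simp add: F_simps(1))
  ultimately show ?thesis by (simp add: strict_monoidal_functor_def F_simps(1))
qed

text \<open>A strict monoidal functor preserves duals, and this one is the identity on objects. So
  every object inherits the dual it has in \<open>C\<close>.\<close>

lemma compact_category_D: "compact_category S.D"
proof -
  interpret D: symmetric_monoidal S.D by (rule S.symmetric_monoidal_D)
  show ?thesis
  proof (intro compact_category.intro compact_category_axioms.intro D.symmetric_monoidal_axioms)
    fix X assume "X \<in> Obj S.D"
    then have X: "X \<in> Obj C" by simp
    note Ff = strict_functor[OF strict_monoidal_functor_F]
    note s = functor_obj[OF Ff] functor_arr[OF category_axioms Ff] strict_functor_simps[OF strict_monoidal_functor_F] functor_comp_arr[OF Ff] functor_ide[OF Ff]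
    have "is_dual S.D (omap F X) (omap F (ds X)) (amap F (et X)) (amap F (ep X))"
      unfolding is_dual_def
    proof (intro conjI)
      show "(ide S.D (omap F X) \<boxtimes>\<^bsub>S.D\<^esub> amap F (ep X)) \<cdot>\<^bsub>S.D\<^esub> (amap F (et X) \<boxtimes>\<^bsub>S.D\<^esub> ide S.D (omap F X)) = ide S.D (omap F X)"
        using dual_simps(8)[OF X, THEN arg_cong, of "amap F"] X by (simp add: s del: dual_simps(8) S.D_simps)
      show "(amap F (ep X) \<boxtimes>\<^bsub>S.D\<^esub> ide S.D (omap F (ds X))) \<cdot>\<^bsub>S.D\<^esub> (ide S.D (omap F (ds X)) \<boxtimes>\<^bsub>S.D\<^esub> amap F (et X)) = ide S.D (omap F (ds X))"
        using dual_simps(9)[OF X, THEN arg_cong, of "amap F"] X by (simp add: s del: dual_simps(9) S.D_simps)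
    qed (use X in \<open>simp_all add: hom_iff s del: S.D_simps\<close>)
    then show "\<exists>Y \<eta> \<epsilon>. is_dual S.D X Y \<eta> \<epsilon>" using X by (auto simp: F_simps(1))
  qed
qed

text \<open>The points over \<open>X\<close> are the elements of
  \<open>P (X \<otimes> ds \<one>)\<close>, and the chosen dual of the unit need not be the unit.
  The transpose of the identity of \<open>X\<close> compares \<open>X\<close> with
  \<open>X \<otimes> ds \<one>\<close>; evaluation is its inverse.\<close>

lemma rep_F:
  defines "\<alpha> \<equiv> \<lambda>X\<in>Obj C. \<lambda>p\<in>lset P X. k (\<one>, val X \<one> (ide C X) p, X)"
  shows "monoidal_transformation C P (rep_lax C S.D F id) \<alpha>"
    "X \<in> Obj C \<Longrightarrow> bij_betw (\<alpha> X) (lset P X) (lset (rep_lax C S.D F id) X)"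
proof -
  note R = rep_lax_simps[OF symmetric_monoidal_axioms S.symmetric_monoidal_D strict_monoidal_functor_F, where e = id, simplified]
  have \<alpha>: "\<alpha> X p = k (\<one>, val X \<one> (ide C X) p, X)" if "X \<in> Obj C" "p \<in> lset P X" for X p
    using that by (simp add: \<alpha>_def)
  have vc: "val X \<one> (ide C X) p \<in> Hs \<one> X" if "X \<in> Obj C" "p \<in> lset P X" for X p
    using that by (intro val_closed) (simp_all add: hom_iff)
  have set: "lset (rep_lax C S.D F id) X = {k (\<one>, q, X) |q. q \<in> Hs \<one> X}" if "X \<in> Obj C" for X
    using that by (auto simp: R F_simps S.hom_D)
  show "bij_betw (\<alpha> X) (lset P X) (lset (rep_lax C S.D F id) X)" if X: "X \<in> Obj C" for X
  \<comment> \<open>The inverse decodes the arrow and acts by evaluation. One composite is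
    \<open>can_hat\<close>, the other is the statement that an element is its own canonical
    class.\<close>
  proof (rule bij_betwI[where g = "\<lambda>u. lact P (can \<one> X) (fst (snd (S.dec u)))"])
    have can: "can \<one> X \<in> hom C (X \<otimes> ds \<one>) X" using X by (simp add: hom_iff)
    show "\<alpha> X \<in> lset P X \<rightarrow> lset (rep_lax C S.D F id) X" using X vc by (auto simp: \<alpha> set)
    show "(\<lambda>u. lact P (can \<one> X) (fst (snd (S.dec u)))) \<in> lset (rep_lax C S.D F id) X \<rightarrow> lset P X"
      using X act_closed[OF can] by (auto simp: set Hs_def)
    fix p assume p: "p \<in> lset P X"
    have "lact P (can \<one> X) (val X \<one> (ide C X) p) = lact P (can \<one> X \<cdot> hat X \<one> (ide C X)) p"
      unfolding val_def using can p X hat_hom[of X \<one> "ide C X" X] by (intro act_comp[symmetric]) (simp_all add: hom_iff)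
    also have "\<dots> = p" using can_hat[of X \<one> "ide C X" X] p X by (simp add: act_ide)
    finally show "lact P (can \<one> X) (fst (snd (S.dec (\<alpha> X p)))) = p" using p X by (simp add: \<alpha>)
  next
    fix u assume "u \<in> lset (rep_lax C S.D F id) X"
    then obtain q where q: "u = k (\<one>, q, X)" "q \<in> Hs \<one> X" using X by (auto simp: set)
    have can: "can \<one> X \<in> hom C (X \<otimes> ds \<one>) X" using X by (simp add: hom_iff)
    have "val X \<one> (ide C X) (lact P (can \<one> X) q) = val (X \<otimes> ds \<one>) \<one> (can \<one> X) q"
      using val_step[of X \<one> "ide C X" X "can \<one> X" "X \<otimes> ds \<one>" q] q X can by (simp add: hom_iff Hs_def)
    then show "\<alpha> X (lact P (can \<one> X) (fst (snd (S.dec u)))) = u"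
      using q X val_can[of \<one> X q] act_closed[OF can, of q] by (simp add: \<alpha> Hs_def)
  qed
  show "monoidal_transformation C P (rep_lax C S.D F id) \<alpha>"
    unfolding monoidal_transformation_def
  proof (intro conjI ballI)
    show "\<alpha> \<in> (\<Pi>\<^sub>E X\<in>Obj C. lset P X \<rightarrow>\<^sub>E lset (rep_lax C S.D F id) X)"
      using vc by (auto simp: PiE_iff set \<alpha>) (auto simp: \<alpha>_def)
  next
    fix f p assume f: "f \<in> Arr C" and p: "p \<in> lset P (Dom C f)"
    let ?X = "Dom C f" and ?Y = "Cod C f"
    have o: "?X \<in> Obj C" "?Y \<in> Obj C" using f by simp_all
    have m: "k (\<one>, val ?X \<one> (ide C ?X) p, ?X) \<in> hom S.D \<one> ?X" using o p vc by (simp add: S.hom_D)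
    \<comment> \<open>Composition with the class of \<open>f\<close> turns the identity
      representative into \<open>f\<close>, and \<open>val_step\<close> then moves \<open>f\<close>
      onto the element.\<close>
    have "cs \<one> ?X ?Y (fn ?X f) (val ?X \<one> (ide C ?X) p) = val ?X \<one> f p"
      using cs_val[of ?X \<one> \<one> "ide C ?X" ?X f ?Y p "lunit P"] f o p lunit_closed by (simp add: fn_def lmult_unit hom_iff)
    also have "\<dots> = val ?Y \<one> (ide C ?Y) (lact P f p)"
      using val_step[of ?Y \<one> "ide C ?Y" ?Y f ?X p] f o p by (simp add: hom_iff)
    finally show "\<alpha> ?Y (lact P f p) = lact (rep_lax C S.D F id) f (\<alpha> ?X p)"
      using R(2)[OF arr_hom[OF f], of "k (\<one>, val ?X \<one> (ide C ?X) p, ?X)"] m o p f vc act_closed[OF arr_hom[OF f] p]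
      by (simp add: \<alpha> F_simps(1) F_simps(2)[OF arr_hom[OF f]] fn_closed[OF arr_hom[OF f]])
  next
    show "\<alpha> \<one> (lunit P) = lunit (rep_lax C S.D F id)"
      using lunit_closed by (simp add: \<alpha> R(3)) (simp add: fn_def)
  next
    fix X Y p q assume a: "X \<in> Obj C" "Y \<in> Obj C" "p \<in> lset P X" "q \<in> lset P Y"
    have m: "k (\<one>, val X \<one> (ide C X) p, X) \<in> hom S.D \<one> X" "k (\<one>, val Y \<one> (ide C Y) q, Y) \<in> hom S.D \<one> Y" using a vc by (simp_all add: S.hom_D)
    have "ts \<one> X \<one> Y (val X \<one> (ide C X) p) (val Y \<one> (ide C Y) q) = val (X \<otimes> Y) \<one> (ide C (X \<otimes> Y)) (lmult P X Y p q)"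
      using ts_val[of X Y \<one> \<one> "ide C X" X "ide C Y" Y p q] a by (simp add: hom_iff)
    then show "\<alpha> (X \<otimes> Y) (lmult P X Y p q) = lmult (rep_lax C S.D F id) X Y (\<alpha> X p) (\<alpha> Y q)"
      using R(4)[of X Y "k (\<one>, val X \<one> (ide C X) p, X)" "k (\<one>, val Y \<one> (ide C Y) q, Y)"] m a vc by (simp add: \<alpha> F_simps(1) lmult_closed)
  qed
qed

end

section \<open>The equivalence over compact categories\<close>

theorem compact_equivalence:
  assumes "infinite (UNIV :: 'u set)"
  shows "\<exists>\<Phi>. equivalence_of_fibrations (CompCat :: 'u compcat)
        (grothendieck CompCat Lax_CompCat) (grothendieck_proj CompCat Lax_CompCat)
        CompCat_bo (dom_functor CompCat compcat_bo) \<Phi>"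
proof -
  \<comment> \<open>Lax functors live on the compact category itself and its arrows already are
    elements of the universe, so the passage to \<open>Mo\<close>, to \<open>Mm\<close> and the
    renaming are all trivial.\<close>
  interpret R: smc_indexing "{C :: ('u, 'u) smc. compact_category C}" "\<lambda>C D. {F. strict_monoidal_functor C D F}" func_id "\<lambda>C _ _. func_comp C"
    "\<lambda>C. C" "\<lambda>C G. G" id compcat_bo
  proof (rule smc_indexing.intro; (unfold mem_Collect_eq)?)
    show "category (cat_of_homs {C :: ('u, 'u) smc. compact_category C} (\<lambda>C D. {F. strict_monoidal_functor C D F}) func_id (\<lambda>C _ _. func_comp C))"
      using category_CompCat by (simp add: CompCat_def)
  next
    fix b F d b' F' d' g \<theta>
    assume a: "(b, F, d) \<in> (compcat_bo :: 'u compcat_arrow set)" "(b', F', d') \<in> (compcat_bo :: 'u compcat_arrow set)" "strict_monoidal_functor b b' g"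
      and t: "monoidal_transformation b (rep_lax b d F id) (lax_precomp b g (rep_lax b' d' F' id)) \<theta>"
    show "\<exists>!h. strict_monoidal_functor d d' h \<and> func_comp b h F = func_comp b F' g \<and>
       (\<forall>x\<in>Obj b. \<forall>p\<in>hom d \<one>\<^bsub>d\<^esub> (omap F x). id (amap h p) = \<theta> x (id p))"
      by (rule compact_square_unique[OF _ _ _ _ _ _ a(3) _ t]) (use a in \<open>auto simp: compcat_bo_def CompCat_def compact_category_def\<close>)
  next
    fix C :: "('u, 'u) smc" and P :: "('u, 'u, 'u) lax"
    assume C: "compact_category C" and P: "lax_monoidal C P"
    obtain k :: "'u \<times> 'u \<times> 'u \<Rightarrow> 'u" where k: "inj k" using infinite_UNIV_triples[OF assms] by blast
    interpret lax_on_compact C P k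
      by (intro lax_on_compact.intro lax_on_compact_axioms.intro dualised.intro lax_functor.intro lax_functor_axioms.intro C P k compact_category.axioms(1))
    have "(C, F, S.D) \<in> compcat_bo"
      using C compact_category_D strict_monoidal_functor_F by (auto simp: compcat_bo_def CompCat_def bij_betw_def inj_on_def F_simps)
    then show "\<exists>d F \<alpha>. (C, F, d) \<in> compcat_bo \<and> monoidal_transformation C P (rep_lax C d F id) \<alpha> \<and>
       (\<forall>x\<in>Obj C. bij_betw (\<alpha> x) (lset P x) (lset (rep_lax C d F id) x))"
      using rep_F by blast
  qed (auto simp: compact_category.axioms(1) compcat_bo_def CompCat_def)
  have "R.I = Lax_CompCat" by (simp add: R.I_def Lax_CompCat_def)
  then show ?thesis using R.equivalence by (simp add: CompCat_def)
qed

theorem theoremB: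
  assumes "infinite (UNIV :: 'u set)"
  shows
    "(\<exists>\<Phi>. equivalence_of_fibrations (CompCat :: 'u compcat)
        (grothendieck CompCat Lax_CompCat) (grothendieck_proj CompCat Lax_CompCat)
        CompCat_bo (dom_functor CompCat compcat_bo) \<Phi>) \<and>
     (\<exists>\<Psi>. equivalence_of_fibrations (TrCat :: 'u trcat)
        (grothendieck TrCat Lax_Int_TrCat) (grothendieck_proj TrCat Lax_Int_TrCat)
        TrCat_bo (dom_functor TrCat trcat_bo) \<Psi>)"
  using compact_equivalence[OF assms] traced_equivalence[OF assms] by (rule conjI)

end
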